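(* Assume $R\in\mathbb S^m_{++}$, $Q-S^\top R^{-1}S\in\mathbb S^n_{++}$, $Q+\bar Q-S^\top R^{-1}S\in\mathbb S^n_{++}$, and that the systems $[A+\bar A,\Gamma+\bar\Gamma;B]$ and $[A,C,\Gamma;B,D]$ are $L^2$-stabilizable (defined in the context). For $\mu_0\in\mathcal P_4(\mathbb R^n)$ let $(\bar X,\bar u)$ be the optimal pair of the ergodic mean field control problem (written out in the context) started from an initial state with law $\mu_0$, let $$J_T(\mu_0;\bar u(\cdot))=\mathbb E\Big[\int_0^Tf\big(\bar X(s),\mathbb E[\bar X(s)|\mathcal F_s^0],\bar u(s)\big)ds\Big],$$ and let $U_T(\mu_0)=\inf_{u\in\mathscr U[0,T]}J_T(\mu_0;u(\cdot))$ be the value of the finite-horizon mean field control problem. Then for all $\mu_0\in\mathcal P_4(\mathbb R^n)$ $$0\le J_T(\mu_0;\bar u(\cdot))-U_T(\mu_0)=O(1)\quad(\text{as }T\to\infty).$$ Furthermore, for all $\mu_0\in\mathcal P_4(\mathbb R^n)$, the constant $c_0=2b^\top p+\sigma^\top P\sigma+\gamma^\top\bar\Pi\gamma-\langle\mathcal R(P)\theta^*,\theta^*\rangle$ satisfies $$c_0=\lim_{T\to\infty}\frac1TU_T(\mu_0).$$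
   Context: Notation. $\mathbb S^k,\mathbb S^k_+,\mathbb S^k_{++}$: real symmetric, positive semidefinite, positive definite $k\times k$ matrices; $\mathcal P_4(\mathbb R^n)$: probability measures with finite fourth moment. Fix $n,m\in\mathbb N^+$, $A,\bar A,C,\bar C,\Gamma,\bar\Gamma\in\mathbb R^{n\times n}$, $B,D\in\mathbb R^{n\times m}$, $Q,\bar Q\in\mathbb S^n$, $S\in\mathbb R^{m\times n}$, $R\in\mathbb S^m$, $b,\sigma,\gamma,q\in\mathbb R^n$, $r\in\mathbb R^m$. Probability space. $(\Omega,\mathcal F,\mathbb P)$ is complete and carries independent one-dimensional standard Brownian motions $W,W^0$ and an initial $\sigma$-algebra $\mathcal F_0$, independent of $(W,W^0)$, on which $\mathbb P$ is atomless; $\{\mathcal F_t^0\}$ is the augmented filtration of $W^0$; $\mathbb F$ is the complete right-continuous augmentation of the filtration generated by $W,W^0,\mathcal F_0$. $L^4_{\mathcal F_0}$: $\mathcal F_0$-measurable $\mathbb R^n$-valued $\xi$ with $\mathbb E|\xi|^4<\infty$. $\mathscr U[0,T]$: $\mathbb F$-progressively measurable $u:[0,T]\times\Omega\to\mathbb R^m$ with $\mathbb E\int_0^T|u|^2dt<\infty$. State equation for a control $u$: $X(0)=\xi\in L^4_{\mathcal F_0}$, $\xi\sim\mu_0$, $$dX=\{AX+\bar A\mathbb E[X|\mathcal F_t^0]+Bu+b\}dt+\{CX+\bar C\mathbb E[X|\mathcal F_t^0]+Du+\sigma\}dW+\{\Gamma X+\bar\Gamma\mathbb E[X|\mathcal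 F_t^0]+\gamma\}dW^0.\quad(\ast)$$ Cost: $J_T(\mu_0;u)=\mathbb E\int_0^Tf(X,\mathbb E[X|\mathcal F_t^0],u)dt$, $f(x,\bar x,u)=\langle Qx,x\rangle+2\langle Sx,u\rangle+\langle Ru,u\rangle+2\langle q,x\rangle+2\langle r,u\rangle+\langle\bar Q\bar x,\bar x\rangle$. $L^2$-stabilizability. $[A+\bar A,\Gamma+\bar\Gamma;B]$ is $L^2$-stabilizable if there is $\bar\Theta\in\mathbb R^{m\times n}$ such that for every $y\in\mathbb R^n$ the solution of $dY=(A+\bar A+B\bar\Theta)Y\,dt+(\Gamma+\bar\Gamma)Y\,dW^0$, $Y(0)=y$, satisfies $\mathbb E\int_0^\infty|Y|^2dt<\infty$. $[A,C,\Gamma;B,D]$ is $L^2$-stabilizable if there is $\Theta\in\mathbb R^{m\times n}$ such that for every $\xi\in L^4_{\mathcal F_0}$ the solution of $dX=(A+B\Theta)X\,dt+(C+D\Theta)X\,dW+\Gamma X\,dW^0$, $X(0)=\xi$, satisfies $\mathbb E\int_0^\infty|X|^2dt<\infty$. Stationary coefficients. $\hat A=A+\bar A$, $\hat C=C+\bar C$, $\hat\Gamma=\Gamma+\bar\Gamma$, $\hat Q=Q+\bar Q$; $\mathcal Q(P)=PA+A^\top P+C^\top PC+\Gamma^\top P\Gamma+Q$; $\hat{\mathcal Q}(P,\bar\Pi)=\bar\Pi\hat A+\hat A^\top\bar\Pi+\hat C^\top P\hat C+\hat\Gamma^\top\bar\Pi\hat\Gamma+\hat Q$; $\mathcal S(P)=B^\top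 P+D^\top PC+S$; $\hat{\mathcal S}(P,\bar\Pi)=B^\top\bar\Pi+D^\top P\hat C+S$; $\mathcal R(P)=R+D^\top PD$. Under the hypotheses there is a unique $(P,\bar\Pi,p)\in\mathbb S^n_{++}\times\mathbb S^n_{++}\times\mathbb R^n$ with $\mathcal Q(P)-\mathcal S(P)^\top\mathcal R(P)^{-1}\mathcal S(P)=0$, $\hat{\mathcal Q}(P,\bar\Pi)-\hat{\mathcal S}(P,\bar\Pi)^\top\mathcal R(P)^{-1}\hat{\mathcal S}(P,\bar\Pi)=0$ and $(\hat A+B\bar\Theta^* )^\top p+(\hat C+D\bar\Theta^* )^\top P\sigma+(\bar\Theta^* )^\top r+\bar\Pi b+\hat\Gamma^\top\bar\Pi\gamma+q=0$, where $\Theta^*=-\mathcal R(P)^{-1}\mathcal S(P)$, $\bar\Theta^*=-\mathcal R(P)^{-1}\hat{\mathcal S}(P,\bar\Pi)$; $\theta^*=-\mathcal R(P)^{-1}(B^\top p+D^\top P\sigma+r)$. Ergodic optimal pair. $(\bar X,\bar u)$ is the solution of $(\ast)$ on $[0,\infty)$ with $\bar X(0)=\xi$ under the feedback $\bar u(t)=\Theta^*(\bar X-\mathbb E[\bar X|\mathcal F_t^0])+\bar\Theta^*\mathbb E[\bar X|\mathcal F_t^0]+\theta^*$. *)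

theory Defs
  imports "HOL-Probability.Probability" "HOL-Library.Landau_Symbols"
begin

section \<open>Matrices and coefficients\<close>

definition symmetric_mat :: "real^'k^'k \<Rightarrow> bool" where
  "symmetric_mat N \<longleftrightarrow> transpose N = N"

definition pos_def_mat :: "real^'k^'k \<Rightarrow> bool" where
  "pos_def_mat N \<longleftrightarrow> symmetric_mat N \<and> (\<forall>x. x \<noteq> 0 \<longrightarrow> 0 < (N *v x) \<bullet> x)"

text \<open>The suffix \<open>b\<close> (as in \<open>cAb\<close>) marks the barred coefficients, which act on the conditional
  mean. The fields \<open>cb\<close>, \<open>csig\<close>, \<open>cgam\<close> are the inhomogeneous terms of the drift, of the
  \<open>W\<close>-part and of the \<open>W0\<close>-part; \<open>cq\<close>, \<open>cr\<close> are the linear cost terms.\<close>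

record ('n::finite, 'm::finite) mf_coeffs =
  cA :: "real^'n^'n"
  cAb :: "real^'n^'n"
  cC :: "real^'n^'n"
  cCb :: "real^'n^'n"
  cG :: "real^'n^'n"
  cGb :: "real^'n^'n"
  cB :: "real^'m^'n"
  cD :: "real^'m^'n"
  cQ :: "real^'n^'n"
  cQb :: "real^'n^'n"
  cS :: "real^'n^'m"
  cR :: "real^'m^'m"
  cb :: "real^'n"
  csig :: "real^'n"
  cgam :: "real^'n"
  cq :: "real^'n"
  cr :: "real^'m"

definition symmetric_coeffs :: "('n::finite, 'm::finite) mf_coeffs \<Rightarrow> bool" where
  "symmetric_coeffs K \<longleftrightarrow> symmetric_mat (cQ K) \<and> symmetric_mat (cQb K) \<and> symmetric_mat (cR K)"


section \<open>Probabilistic basis\<close>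

text \<open>Time is a real number, and only times \<open>t \<ge> 0\<close> matter. A filtration is a function into
  \<open>'a measure\<close> of which only the space and the sigma-algebra are used.\<close>

definition brownian_motion :: "'a measure \<Rightarrow> (real \<Rightarrow> 'a \<Rightarrow> real) \<Rightarrow> bool" where
  "brownian_motion M W \<longleftrightarrow>
     (\<forall>t\<ge>0. W t \<in> borel_measurable M) \<and>
     (AE \<omega> in M. W 0 \<omega> = 0) \<and>
     (AE \<omega> in M. continuous_on {0..} (\<lambda>t. W t \<omega>)) \<and>
     (\<forall>s t. 0 \<le> s \<and> s < t \<longrightarrow>
        distributed M lborel (\<lambda>\<omega>. W t \<omega> - W s \<omega>) (normal_density 0 (sqrt (t - s)))) \<and>
     (\<forall>(k::nat) (\<tau>::nat \<Rightarrow> real). 0 \<le> \<tau> 0 \<and> (\<forall>i<k. \<tau> i \<le> \<tau> (Suc i)) \<longrightarrow>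
        prob_space.indep_vars M (\<lambda>_. borel) (\<lambda>i \<omega>. W (\<tau> (Suc i)) \<omega> - W (\<tau> i) \<omega>) {..<k})"

definition path_events :: "'a measure \<Rightarrow> (real \<Rightarrow> 'a \<Rightarrow> real) \<Rightarrow> real set \<Rightarrow> 'a set set" where
  "path_events M W I = {W t -` E \<inter> space M | t E. t \<in> I \<and> E \<in> sets borel}"

definition atomless_on :: "'a measure \<Rightarrow> 'a measure \<Rightarrow> bool" where
  "atomless_on M F \<longleftrightarrow> (\<forall>E \<in> sets F. 0 < measure M E \<longrightarrow>
     (\<exists>E' \<in> sets F. E' \<subseteq> E \<and> 0 < measure M E' \<and> measure M E' < measure M E))"

definition mf_basis ::
  "'a measure \<Rightarrow> 'a measure \<Rightarrow> (real \<Rightarrow> 'a \<Rightarrow> real) \<Rightarrow> (real \<Rightarrow> 'a \<Rightarrow> real) \<Rightarrow> bool" where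
  "mf_basis M F0 W W0 \<longleftrightarrow>
     prob_space M \<and> complete_measure M \<and>
     brownian_motion M W \<and> brownian_motion M W0 \<and>
     subalgebra M F0 \<and> atomless_on M F0 \<and>
     prob_space.indep_sets M
       (\<lambda>i. [sigma_sets (space M) (path_events M W {0..}),
             sigma_sets (space M) (path_events M W0 {0..}),
             sets F0] ! i) {..<3}"

text \<open>The augmented filtration of the common noise. No right limit is taken, because the
  null-augmented filtration of a Brownian motion is already right-continuous.\<close>

definition common_filt :: "'a measure \<Rightarrow> (real \<Rightarrow> 'a \<Rightarrow> real) \<Rightarrow> real \<Rightarrow> 'a measure" where
  "common_filt M W0 t = sigma (space M) (path_events M W0 {0..t} \<union> null_sets M)"

definition full_filt ::
  "'a measure \<Rightarrow> 'a measure \<Rightarrow> (real \<Rightarrow> 'a \<Rightarrow> real) \<Rightarrow> (real \<Rightarrow> 'a \<Rightarrow> real) \<Rightarrow> real \<Rightarrow> 'a measure" where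
  "full_filt M F0 W W0 t = sigma (space M)
     (\<Inter>s\<in>{t<..}. sigma_sets (space M)
        (path_events M W {0..s} \<union> path_events M W0 {0..s} \<union> sets F0 \<union> null_sets M))"

definition progressive ::
  "(real \<Rightarrow> 'a measure) \<Rightarrow> real \<Rightarrow> (real \<Rightarrow> 'a \<Rightarrow> 'b::euclidean_space) \<Rightarrow> bool" where
  "progressive F T H \<longleftrightarrow> (\<forall>t\<in>{0..T}.
     (\<lambda>(s, \<omega>). H s \<omega>) \<in> borel_measurable (restrict_space borel {0..t} \<Otimes>\<^sub>M F t))"

definition energy ::
  "'a measure \<Rightarrow> real set \<Rightarrow> (real \<Rightarrow> 'a \<Rightarrow> 'b::euclidean_space) \<Rightarrow> ennreal" where
  "energy M I H = (\<integral>\<^sup>+\<omega>. (\<integral>\<^sup>+t\<in>I. ennreal ((norm (H t \<omega>))\<^sup>2) \<partial>lborel) \<partial>M)"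

text \<open>The class of admissible controls on \<open>[0,T]\<close> is an instance of the following space.\<close>

definition L2_prog ::
  "'a measure \<Rightarrow> (real \<Rightarrow> 'a measure) \<Rightarrow> real \<Rightarrow> (real \<Rightarrow> 'a \<Rightarrow> 'b::euclidean_space) set" where
  "L2_prog M F T = {H. progressive F T H \<and> energy M {0..T} H < \<infinity>}"


section \<open>Ito integral\<close>

text \<open>A simple process is \<open>\<Sum>k<N. \<eta> k \<cdot> 1 on (\<tau> k, \<tau> (k+1)]\<close> with \<open>\<eta> k\<close> bounded and measurable
  with respect to the sigma-algebra at time \<open>\<tau> k\<close>.\<close>

definition simple_data ::
  "(real \<Rightarrow> 'a measure) \<Rightarrow> real \<Rightarrow> nat \<Rightarrow> (nat \<Rightarrow> real) \<Rightarrow> (nat \<Rightarrow> 'a \<Rightarrow> 'b::euclidean_space) \<Rightarrow> bool" where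
  "simple_data F T N \<tau> \<eta> \<longleftrightarrow>
     0 \<le> \<tau> 0 \<and> \<tau> N \<le> T \<and> (\<forall>k<N. \<tau> k \<le> \<tau> (Suc k)) \<and>
     (\<forall>k<N. \<eta> k \<in> borel_measurable (F (\<tau> k))) \<and>
     (\<exists>c. \<forall>k<N. \<forall>\<omega>\<in>space (F (\<tau> k)). norm (\<eta> k \<omega>) \<le> c)"

definition simple_proc ::
  "nat \<Rightarrow> (nat \<Rightarrow> real) \<Rightarrow> (nat \<Rightarrow> 'a \<Rightarrow> 'b::euclidean_space) \<Rightarrow> real \<Rightarrow> 'a \<Rightarrow> 'b" where
  "simple_proc N \<tau> \<eta> s \<omega> = (\<Sum>k<N. indicator {\<tau> k<..\<tau> (Suc k)} s *\<^sub>R \<eta> k \<omega>)"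

definition simple_integral ::
  "(real \<Rightarrow> 'a \<Rightarrow> real) \<Rightarrow> nat \<Rightarrow> (nat \<Rightarrow> real) \<Rightarrow> (nat \<Rightarrow> 'a \<Rightarrow> 'b::euclidean_space) \<Rightarrow> real \<Rightarrow> 'a \<Rightarrow> 'b" where
  "simple_integral W N \<tau> \<eta> t \<omega> =
     (\<Sum>k<N. (W (min t (\<tau> (Suc k))) \<omega> - W (min t (\<tau> k)) \<omega>) *\<^sub>R \<eta> k \<omega>)"

text \<open>\<open>I\<close> is the (up to indistinguishability unique) continuous adapted version of
  \<open>\<integral> H dW\<close> on \<open>[0,T]\<close>, for a square-integrable progressive \<open>H\<close>: it is the
  \<open>L\<^sup>2\<close>-limit of integrals of simple processes converging to \<open>H\<close>.\<close>

definition is_ito_integral ::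
  "'a measure \<Rightarrow> (real \<Rightarrow> 'a measure) \<Rightarrow> (real \<Rightarrow> 'a \<Rightarrow> real) \<Rightarrow> real \<Rightarrow>
   (real \<Rightarrow> 'a \<Rightarrow> 'b::euclidean_space) \<Rightarrow> (real \<Rightarrow> 'a \<Rightarrow> 'b) \<Rightarrow> bool" where
  "is_ito_integral M F W T H I \<longleftrightarrow>
     H \<in> L2_prog M F T \<and>
     (\<forall>t\<in>{0..T}. I t \<in> borel_measurable (F t)) \<and>
     (AE \<omega> in M. continuous_on {0..T} (\<lambda>t. I t \<omega>)) \<and>
     (\<exists>N \<tau> \<eta>.
        (\<forall>j::nat. simple_data F T (N j) (\<tau> j) (\<eta> j)) \<and>
        (\<lambda>j. energy M {0..T} (\<lambda>s \<omega>. simple_proc (N j) (\<tau> j) (\<eta> j) s \<omega> - H s \<omega>)) \<longlonglongrightarrow> 0 \<and>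
        (\<forall>t\<in>{0..T}. (\<lambda>j. \<integral>\<^sup>+\<omega>. ennreal ((norm
            (simple_integral W (N j) (\<tau> j) (\<eta> j) t \<omega> - I t \<omega>))\<^sup>2) \<partial>M) \<longlonglongrightarrow> 0))"

text \<open>\<open>dX = a dt + c dW + g dW0\<close> on \<open>[0,T]\<close>, \<open>X(0) = \<xi>\<close>.\<close>

definition ito_process ::
  "'a measure \<Rightarrow> 'a measure \<Rightarrow> (real \<Rightarrow> 'a \<Rightarrow> real) \<Rightarrow> (real \<Rightarrow> 'a \<Rightarrow> real) \<Rightarrow> real \<Rightarrow> ('a \<Rightarrow> real^'n) \<Rightarrow>
   (real \<Rightarrow> 'a \<Rightarrow> real^'n) \<Rightarrow> (real \<Rightarrow> 'a \<Rightarrow> real^'n) \<Rightarrow> (real \<Rightarrow> 'a \<Rightarrow> real^'n) \<Rightarrow> (real \<Rightarrow> 'a \<Rightarrow> real^'n) \<Rightarrow> bool" where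
  "ito_process M F0 W W0 T \<xi> a c g X \<longleftrightarrow>
     X \<in> L2_prog M (full_filt M F0 W W0) T \<and>
     a \<in> L2_prog M (full_filt M F0 W W0) T \<and>
     (\<exists>I I0. is_ito_integral M (full_filt M F0 W W0) W T c I \<and>
        is_ito_integral M (full_filt M F0 W W0) W0 T g I0 \<and>
        (AE \<omega> in M. \<forall>t\<in>{0..T}.
           X t \<omega> = \<xi> \<omega> + (LBINT s:{0..t}. a s \<omega>) + I t \<omega> + I0 t \<omega>))"


section \<open>State equation, cost and value\<close>

definition P4 :: "(real^'n) measure set" where
  "P4 = {\<mu>. prob_space \<mu> \<and> sets \<mu> = sets borel \<and> (\<integral>\<^sup>+x. ennreal (norm x ^ 4) \<partial>\<mu>) < \<infinity>}"

definition L4 :: "'a measure \<Rightarrow> 'a measure \<Rightarrow> ('a \<Rightarrow> real^'n) set" where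
  "L4 M F0 = {\<xi>. \<xi> \<in> borel_measurable F0 \<and> (\<integral>\<^sup>+\<omega>. ennreal (norm (\<xi> \<omega>) ^ 4) \<partial>M) < \<infinity>}"

text \<open>\<open>Y\<close> is a version of \<open>t \<mapsto> E[X(t) | common noise up to t]\<close>. Conditional expectations are only
  defined almost surely for each time, so a progressive version is singled out; it is unique
  up to modification, which does not affect the equation or the cost.\<close>

definition cond_mean_process ::
  "'a measure \<Rightarrow> (real \<Rightarrow> 'a \<Rightarrow> real) \<Rightarrow> real \<Rightarrow> (real \<Rightarrow> 'a \<Rightarrow> real^'n) \<Rightarrow> (real \<Rightarrow> 'a \<Rightarrow> real^'n) \<Rightarrow> bool" where
  "cond_mean_process M W0 T X Y \<longleftrightarrow>
     progressive (common_filt M W0) T Y \<and>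
     (\<forall>t\<in>{0..T}. AE \<omega> in M.
        Y t \<omega> = (\<chi> i. real_cond_exp M (common_filt M W0 t) (\<lambda>\<omega>'. X t \<omega>' $ i) \<omega>))"

definition mf_state ::
  "('n::finite, 'm::finite) mf_coeffs \<Rightarrow> 'a measure \<Rightarrow> 'a measure \<Rightarrow> (real \<Rightarrow> 'a \<Rightarrow> real) \<Rightarrow>
   (real \<Rightarrow> 'a \<Rightarrow> real) \<Rightarrow> real \<Rightarrow> ('a \<Rightarrow> real^'n) \<Rightarrow> (real \<Rightarrow> 'a \<Rightarrow> real^'m) \<Rightarrow>
   (real \<Rightarrow> 'a \<Rightarrow> real^'n) \<Rightarrow> (real \<Rightarrow> 'a \<Rightarrow> real^'n) \<Rightarrow> bool" where
  "mf_state K M F0 W W0 T \<xi> u X Y \<longleftrightarrow>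
     cond_mean_process M W0 T X Y \<and>
     ito_process M F0 W W0 T \<xi>
       (\<lambda>t \<omega>. cA K *v X t \<omega> + cAb K *v Y t \<omega> + cB K *v u t \<omega> + cb K)
       (\<lambda>t \<omega>. cC K *v X t \<omega> + cCb K *v Y t \<omega> + cD K *v u t \<omega> + csig K)
       (\<lambda>t \<omega>. cG K *v X t \<omega> + cGb K *v Y t \<omega> + cgam K)
       X"

definition running_cost ::
  "('n::finite, 'm::finite) mf_coeffs \<Rightarrow> real^'n \<Rightarrow> real^'n \<Rightarrow> real^'m \<Rightarrow> real" where
  "running_cost K x y u =
     (cQ K *v x) \<bullet> x + 2 * ((cS K *v x) \<bullet> u) + (cR K *v u) \<bullet> u
     + 2 * (cq K \<bullet> x) + 2 * (cr K \<bullet> u) + (cQb K *v y) \<bullet> y"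

definition total_cost ::
  "('n::finite, 'm::finite) mf_coeffs \<Rightarrow> 'a measure \<Rightarrow> real \<Rightarrow> (real \<Rightarrow> 'a \<Rightarrow> real^'n) \<Rightarrow>
   (real \<Rightarrow> 'a \<Rightarrow> real^'n) \<Rightarrow> (real \<Rightarrow> 'a \<Rightarrow> real^'m) \<Rightarrow> real" where
  "total_cost K M T X Y u =
     (\<integral>\<omega>. (LBINT s:{0..T}. running_cost K (X s \<omega>) (Y s \<omega>) (u s \<omega>)) \<partial>M)"

definition value_fn ::
  "('n::finite, 'm::finite) mf_coeffs \<Rightarrow> 'a measure \<Rightarrow> 'a measure \<Rightarrow> (real \<Rightarrow> 'a \<Rightarrow> real) \<Rightarrow>
   (real \<Rightarrow> 'a \<Rightarrow> real) \<Rightarrow> ('a \<Rightarrow> real^'n) \<Rightarrow> real \<Rightarrow> real" where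
  "value_fn K M F0 W W0 \<xi> T =
     Inf {total_cost K M T X Y u | X Y u.
       u \<in> L2_prog M (full_filt M F0 W W0) T \<and> mf_state K M F0 W W0 T \<xi> u X Y}"


section \<open>Stabilizability\<close>

definition L2_stabilizable_mean ::
  "'a measure \<Rightarrow> 'a measure \<Rightarrow> (real \<Rightarrow> 'a \<Rightarrow> real) \<Rightarrow> (real \<Rightarrow> 'a \<Rightarrow> real) \<Rightarrow>
   real^'n^'n \<Rightarrow> real^'n^'n \<Rightarrow> real^'m^'n \<Rightarrow> bool" where
  "L2_stabilizable_mean M F0 W W0 A G B \<longleftrightarrow>
     (\<exists>\<Theta> :: real^'n^'m. \<forall>y Y.
        (\<forall>T>0. ito_process M F0 W W0 T (\<lambda>_. y)
           (\<lambda>t \<omega>. (A + B ** \<Theta>) *v Y t \<omega>) (\<lambda>_ _. 0) (\<lambda>t \<omega>. G *v Y t \<omega>) Y) \<longrightarrow>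
        energy M {0..} Y < \<infinity>)"

definition L2_stabilizable ::
  "'a measure \<Rightarrow> 'a measure \<Rightarrow> (real \<Rightarrow> 'a \<Rightarrow> real) \<Rightarrow> (real \<Rightarrow> 'a \<Rightarrow> real) \<Rightarrow>
   real^'n^'n \<Rightarrow> real^'n^'n \<Rightarrow> real^'n^'n \<Rightarrow> real^'m^'n \<Rightarrow> real^'m^'n \<Rightarrow> bool" where
  "L2_stabilizable M F0 W W0 A C G B D \<longleftrightarrow>
     (\<exists>\<Theta> :: real^'n^'m. \<forall>\<xi> \<in> L4 M F0. \<forall>X.
        (\<forall>T>0. ito_process M F0 W W0 T \<xi>
           (\<lambda>t \<omega>. (A + B ** \<Theta>) *v X t \<omega>) (\<lambda>t \<omega>. (C + D ** \<Theta>) *v X t \<omega>)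
           (\<lambda>t \<omega>. G *v X t \<omega>) X) \<longrightarrow>
        energy M {0..} X < \<infinity>)"


section \<open>Stationary equations and the ergodic optimal pair\<close>

text \<open>\<open>h\<close> marks hatted quantities, and \<open>\<Lambda>\<close> is the Riccati matrix for the conditional mean,
  usually written as a barred capital Pi (that letter is taken by the dependent product).\<close>

definition hA :: "('n::finite, 'm::finite) mf_coeffs \<Rightarrow> real^'n^'n" where "hA K = cA K + cAb K"
definition hC :: "('n::finite, 'm::finite) mf_coeffs \<Rightarrow> real^'n^'n" where "hC K = cC K + cCb K"
definition hG :: "('n::finite, 'm::finite) mf_coeffs \<Rightarrow> real^'n^'n" where "hG K = cG K + cGb K"
definition hQ :: "('n::finite, 'm::finite) mf_coeffs \<Rightarrow> real^'n^'n" where "hQ K = cQ K + cQb K"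

definition op_Q :: "('n::finite, 'm::finite) mf_coeffs \<Rightarrow> real^'n^'n \<Rightarrow> real^'n^'n" where
  "op_Q K P = P ** cA K + transpose (cA K) ** P + transpose (cC K) ** P ** cC K
     + transpose (cG K) ** P ** cG K + cQ K"

definition op_Qh :: "('n::finite, 'm::finite) mf_coeffs \<Rightarrow> real^'n^'n \<Rightarrow> real^'n^'n \<Rightarrow> real^'n^'n" where
  "op_Qh K P \<Lambda> = \<Lambda> ** hA K + transpose (hA K) ** \<Lambda> + transpose (hC K) ** P ** hC K
     + transpose (hG K) ** \<Lambda> ** hG K + hQ K"

definition op_S :: "('n::finite, 'm::finite) mf_coeffs \<Rightarrow> real^'n^'n \<Rightarrow> real^'n^'m" where
  "op_S K P = transpose (cB K) ** P + transpose (cD K) ** P ** cC K + cS K"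

definition op_Sh :: "('n::finite, 'm::finite) mf_coeffs \<Rightarrow> real^'n^'n \<Rightarrow> real^'n^'n \<Rightarrow> real^'n^'m" where
  "op_Sh K P \<Lambda> = transpose (cB K) ** \<Lambda> + transpose (cD K) ** P ** hC K + cS K"

definition op_R :: "('n::finite, 'm::finite) mf_coeffs \<Rightarrow> real^'n^'n \<Rightarrow> real^'m^'m" where
  "op_R K P = cR K + transpose (cD K) ** P ** cD K"

definition gain :: "('n::finite, 'm::finite) mf_coeffs \<Rightarrow> real^'n^'n \<Rightarrow> real^'n^'m" where
  "gain K P = - (matrix_inv (op_R K P) ** op_S K P)"

definition gain_mean :: "('n::finite, 'm::finite) mf_coeffs \<Rightarrow> real^'n^'n \<Rightarrow> real^'n^'n \<Rightarrow> real^'n^'m" where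
  "gain_mean K P \<Lambda> = - (matrix_inv (op_R K P) ** op_Sh K P \<Lambda>)"

definition offset :: "('n::finite, 'm::finite) mf_coeffs \<Rightarrow> real^'n^'n \<Rightarrow> real^'n \<Rightarrow> real^'m" where
  "offset K P p = - (matrix_inv (op_R K P) *v
     (transpose (cB K) *v p + transpose (cD K) *v (P *v csig K) + cr K))"

definition stationary_solution ::
  "('n::finite, 'm::finite) mf_coeffs \<Rightarrow> real^'n^'n \<Rightarrow> real^'n^'n \<Rightarrow> real^'n \<Rightarrow> bool" where
  "stationary_solution K P \<Lambda> p \<longleftrightarrow>
     pos_def_mat P \<and> pos_def_mat \<Lambda> \<and>
     op_Q K P - transpose (op_S K P) ** matrix_inv (op_R K P) ** op_S K P = 0 \<and>
     op_Qh K P \<Lambda> - transpose (op_Sh K P \<Lambda>) ** matrix_inv (op_R K P) ** op_Sh K P \<Lambda> = 0 \<and>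
     transpose (hA K + cB K ** gain_mean K P \<Lambda>) *v p
       + transpose (hC K + cD K ** gain_mean K P \<Lambda>) *v (P *v csig K)
       + transpose (gain_mean K P \<Lambda>) *v cr K
       + \<Lambda> *v cb K + transpose (hG K) *v (\<Lambda> *v cgam K) + cq K = 0"

definition ergodic_const ::
  "('n::finite, 'm::finite) mf_coeffs \<Rightarrow> real^'n^'n \<Rightarrow> real^'n^'n \<Rightarrow> real^'n \<Rightarrow> real" where
  "ergodic_const K P \<Lambda> p =
     2 * (cb K \<bullet> p) + csig K \<bullet> (P *v csig K) + cgam K \<bullet> (\<Lambda> *v cgam K)
     - (op_R K P *v offset K P p) \<bullet> offset K P p"

text \<open>\<open>Y\<close> is the conditional mean of \<open>X\<close>.\<close>

definition ergodic_optimal_pair ::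
  "('n::finite, 'm::finite) mf_coeffs \<Rightarrow> 'a measure \<Rightarrow> 'a measure \<Rightarrow> (real \<Rightarrow> 'a \<Rightarrow> real) \<Rightarrow>
   (real \<Rightarrow> 'a \<Rightarrow> real) \<Rightarrow> real^'n^'n \<Rightarrow> real^'n^'n \<Rightarrow> real^'n \<Rightarrow> ('a \<Rightarrow> real^'n) \<Rightarrow>
   (real \<Rightarrow> 'a \<Rightarrow> real^'n) \<Rightarrow> (real \<Rightarrow> 'a \<Rightarrow> real^'n) \<Rightarrow> (real \<Rightarrow> 'a \<Rightarrow> real^'m) \<Rightarrow> bool" where
  "ergodic_optimal_pair K M F0 W W0 P \<Lambda> p \<xi> X Y u \<longleftrightarrow>
     (\<forall>t\<ge>0. \<forall>\<omega>\<in>space M.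
        u t \<omega> = gain K P *v (X t \<omega> - Y t \<omega>) + gain_mean K P \<Lambda> *v Y t \<omega> + offset K P p) \<and>
     (\<forall>T>0. mf_state K M F0 W W0 T \<xi> u X Y)"

end

theory Submission
  imports Defs
begin

text \<open>Let \<open>Y\<close> be the conditional mean of \<open>X\<close> given the common noise and \<open>Z = X - Y\<close>. Applying Ito's formula
  for second moments to the potential \<open>E (P Z \<bullet> Z + \<Lambda> Y \<bullet> Y + 2 p \<bullet> Y)\<close> and completing the square with
  the stationary equations gives, for every admissible control, the cost up to \<open>T\<close> as the ergodic constant
  times \<open>T\<close>, plus the initial minus the terminal potential, plus the integral of a quadratic form in the
  deviation from the ergodic feedback. Along the feedback the deviation vanishes and the potential is bounded
  below, which bounds the cost from above. For an arbitrary control the expected running cost dominates a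
  multiple of the potential up to a constant; hence after the last time at which the potential is small
  the running cost exceeds the ergodic constant, and before that time the identity applies. Both
  bounds differ from the ergodic constant times \<open>T\<close> by constants that depend neither on \<open>T\<close> nor on the control.\<close>

section \<open>Square-integrable functions\<close>

text \<open>No pathwise Ito formula is used. Expectations of quadratic forms change additively in
  time, so it is enough to expand over a short interval with an error bounded by a small factor
  times the increment of a fixed function of time (\<open>partition_identity\<close>). For
  \<open>Y\<close> no equation is given; its increments are found by conditioning those of
  \<open>X\<close> on the common noise, which annihilates the \<open>W\<close>-integral and projects
  the \<open>W0\<close>-integral. The independence behind this is organized by \<open>mixed\<close>:
  the past up to \<open>s\<close> together with the entire common noise, still independent of the
  future of \<open>W\<close>. A second obstacle is that \<open>value_fn\<close> is an infimum of a
  set of reals, so that its upper bound requires an admissible pair on every horizon, also where no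
  ergodic pair is given. Such a pair is built by an Euler scheme for the doubled state
  \<open>(X, Y)\<close>: there \<open>Y\<close> follows a closed equation of its own and is
  recognized as the conditional mean only afterwards.\<close>

definition sq_int :: "'a measure => ('a => 'b::euclidean_space) => bool" where
 "sq_int M X \<longleftrightarrow> X \<in> borel_measurable M \<and> integrable M (%w. (norm (X w))^2)"

definition l2 :: "'a measure => ('a => 'b::euclidean_space) => real" where
 "l2 M X = sqrt (\<integral>w. (norm (X w))^2 \<partial>M)"

lemma sq_int_meas [measurable_dest]: "sq_int M X ==> X \<in> borel_measurable M"
 by (simp add: sq_int_def)

lemma sq_int_integrable_sq: "sq_int M X ==> integrable M (%w. (norm (X w))^2)"
 by (simp add: sq_int_def)

lemma l2_sq: "(l2 M X)^2 = (\<integral>w. (norm (X w))^2 \<partial>M)"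
 by (simp add: l2_def)

lemma l2_nonneg [simp]: "0 <= l2 M X"
 by (simp add: l2_def)

lemma l2_le_iff: "0 <= c ==> l2 M X <= c \<longleftrightarrow> (\<integral>w. (norm (X w))^2 \<partial>M) <= c^2"
 by (metis l2_sq l2_nonneg abs_le_square_iff abs_of_nonneg)

lemma sq_intI_nn:
 assumes "X \<in> borel_measurable M" "(\<integral>\<^sup>+w. ennreal ((norm (X w))^2) \<partial>M) < \<infinity>"
 shows "sq_int M X"
 using assms by (auto simp: sq_int_def integrable_iff_bounded)

lemma nn_integral_sq_int:
 assumes "sq_int M X"
 shows "(\<integral>\<^sup>+w. ennreal ((norm (X w))^2) \<partial>M) = ennreal ((l2 M X)^2)"
 using assms by (simp add: sq_int_def l2_sq nn_integral_eq_integral)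

lemma sq_int_bound:
 assumes "sq_int M X" "Y \<in> borel_measurable M" "AE w in M. norm (Y w) <= norm (X w)"
 shows "sq_int M Y"
 unfolding sq_int_def
proof (intro conjI assms Bochner_Integration.integrable_bound[OF sq_int_integrable_sq[OF assms(1)]])
 show "(%w. (norm (Y w))^2) \<in> borel_measurable M" using assms(2) by measurable
 show "AE w in M. norm ((norm (Y w))^2) <= norm ((norm (X w))^2)"
  using assms(3) by eventually_elim (simp add: power_mono)
qed

lemma sq_int_cong_AE:
 assumes "sq_int M X" "Y \<in> borel_measurable M" "AE w in M. Y w = X w"
 shows "sq_int M Y" "l2 M Y = l2 M X" (is ?g2)
proof -
 show "sq_int M Y" by (rule sq_int_bound[OF assms(1,2)]) (use assms(3) in eventually_elim, simp)
 have "(\<integral>w. (norm (Y w))^2 \<partial>M) = (\<integral>w. (norm (X w))^2 \<partial>M)"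
  by (rule integral_cong_AE) (use assms in \<open>auto simp: sq_int_def\<close>)
 then show ?g2 by (simp add: l2_def)
qed

lemma sq_int_mult_norm:
 assumes "sq_int M X" "sq_int M Y"
 shows "integrable M (%w. norm (X w) * norm (Y w))"
proof (rule Bochner_Integration.integrable_bound)
 show "integrable M (%w. (norm (X w))^2 + (norm (Y w))^2)"
  using assms by (auto simp: sq_int_def)
 have [measurable]: "X \<in> borel_measurable M" "Y \<in> borel_measurable M"
  using assms by (auto simp: sq_int_def)
 show "(%w. norm (X w) * norm (Y w)) \<in> borel_measurable M" by measurable
 have "norm a * norm b <= (norm a)^2 + (norm b)^2" for a :: 'b and b :: 'c
  using sum_squares_bound[of "norm a" "norm b"] mult_nonneg_nonneg[OF norm_ge_zero[of a] norm_ge_zero[of b]]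
  unfolding mult.assoc by linarith
 then show "AE w in M. norm (norm (X w) * norm (Y w)) <= norm ((norm (X w))^2 + (norm (Y w))^2)"
  by simp
qed

lemma sq_int_inner:
 assumes "sq_int M X" "sq_int M Y"
 shows "integrable M (%w. X w \<bullet> Y w)"
proof (rule Bochner_Integration.integrable_bound[OF sq_int_mult_norm[OF assms]])
 show "(%w. X w \<bullet> Y w) \<in> borel_measurable M"
  using assms by (auto simp: sq_int_def)
qed (simp add: Cauchy_Schwarz_ineq2)

lemma sq_int_mult:
 fixes X Y :: "'a => real"
 shows "sq_int M X ==> sq_int M Y ==> integrable M (%w. X w * Y w)"
 using sq_int_inner[of M X Y] by simp

lemma sq_int_add:
 assumes "sq_int M X" "sq_int M Y"
 shows "sq_int M (%w. X w + Y w)"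
proof -
 have "integrable M (%w. (norm (X w))^2 + 2 * (X w \<bullet> Y w) + (norm (Y w))^2)"
  using assms sq_int_inner[OF assms] by (auto simp: sq_int_def)
 then show ?thesis
  using assms by (auto simp: sq_int_def power2_norm_eq_inner inner_simps inner_commute algebra_simps)
qed

lemma sq_int_linear:
 assumes "sq_int M X" "bounded_linear L"
 shows "sq_int M (%w. L (X w))"
proof -
 interpret L: bounded_linear L by fact
 obtain C where C: "0 <= C" "!!x. norm (L x) <= norm x * C" using L.nonneg_bounded by auto
 have LX: "(%w. L (X w)) \<in> borel_measurable M"
  using assms by (intro borel_measurable_continuous_onI measurable_compose[of X M borel L borel])
   (auto simp: sq_int_def intro: linear_continuous_on)
 have "integrable M (%w. (norm (X w))^2 * C^2)" using assms by (auto simp: sq_int_def)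
 then have "integrable M (%w. (norm (L (X w)))^2)"
  by (rule Bochner_Integration.integrable_bound)
   (use C LX in \<open>auto simp flip: power_mult_distrib intro!: power_mono\<close>)
 with LX show ?thesis by (simp add: sq_int_def)
qed

lemma sq_int_scaleR: "sq_int M X ==> sq_int M (%w. c *\<^sub>R X w)"
 using sq_int_linear[OF _ bounded_linear_scaleR_right] .

lemma sq_int_uminus: "sq_int M X ==> sq_int M (%w. - X w)"
 using sq_int_scaleR[of M X "-1"] by simp

lemma sq_int_diff:
 "sq_int M X ==> sq_int M Y ==> sq_int M (%w. X w - Y w)"
 using sq_int_add[of M X "%w. - Y w"] by (simp add: sq_int_uminus)

lemma sq_int_zero [simp]: "sq_int M (%_. 0)"
 by (simp add: sq_int_def)

lemma sq_int_sum:
 "(!!i. i \<in> I ==> sq_int M (X i)) ==> sq_int M (%w. \<Sum>i\<in>I. X i w)"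
 by (induction I rule: infinite_finite_induct) (auto intro: sq_int_add)

lemma sq_int_indicator:
 assumes "sq_int M X" "A \<in> sets M"
 shows "sq_int M (%w. indicator A w *\<^sub>R X w)"
 by (rule sq_int_bound[OF assms(1)]) (use assms in \<open>auto simp: indicator_def sq_int_def\<close>)

lemma sq_int_bounded:
 assumes "finite_measure M" "X \<in> borel_measurable M" "!!w. w \<in> space M ==> norm (X w) <= c"
 shows "sq_int M X"
 unfolding sq_int_def
proof (intro conjI assms finite_measure.integrable_const_bound[OF assms(1), where B = "c^2"])
 show "AE w in M. norm ((norm (X w))^2) <= c^2"
  using assms(3) by (auto intro!: AE_I2 power_mono)
qed (use assms(2) in measurable)

lemma sq_int_const: "finite_measure M ==> sq_int M (%_. c)"
 by (rule sq_int_bounded[where c = "norm c"]) auto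

lemma sq_int_integrable:
 assumes "finite_measure M" "sq_int M X"
 shows "integrable M X"
proof -
 have "integrable M (%w. norm (X w) * norm (1::real))"
  by (rule sq_int_mult_norm[OF assms(2) sq_int_const[OF assms(1)]])
 then show ?thesis using assms(2) by (auto simp: sq_int_def intro: Bochner_Integration.integrable_bound)
qed

text \<open>The integral of \<open>(t * norm (X w) - norm (Y w))^2\<close> is a nonnegative
  quadratic polynomial in \<open>t\<close>, so its discriminant is not positive. The value at the
  minimizer \<open>?i / ?a\<close> shows this, unless the leading coefficient vanishes.\<close>

lemma integral_norm_mult_le:
 assumes "sq_int M X" "sq_int M Y"
 shows "(\<integral>w. norm (X w) * norm (Y w) \<partial>M) <= l2 M X * l2 M Y"
proof -
 let ?a = "\<integral>w. (norm (X w))^2 \<partial>M" and ?b = "\<integral>w. (norm (Y w))^2 \<partial>M"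
  and ?i = "\<integral>w. norm (X w) * norm (Y w) \<partial>M"
 have "0 <= t^2 * ?a - 2 * t * ?i + ?b" for t
 proof -
  have "0 <= (\<integral>w. (t * norm (X w) - norm (Y w))^2 \<partial>M)" by simp
  also have "\<dots> = (\<integral>w. t^2 * (norm (X w))^2 - 2 * t * (norm (X w) * norm (Y w)) + (norm (Y w))^2 \<partial>M)"
   by (simp add: power2_eq_square algebra_simps)
  also have "\<dots> = t^2 * ?a - 2 * t * ?i + ?b"
   using assms sq_int_mult_norm[OF assms] by (simp add: sq_int_def)
  finally show ?thesis .
 qed note q = this
 have i0: "0 <= ?i" by simp
 have "?i^2 <= ?a * ?b"
 proof (cases "?a = 0")
  case True
  have "?i = 0"
  proof (rule ccontr)
   assume "?i \<noteq> 0"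
   \<comment> \<open>With \<open>?a = 0\<close> the polynomial is affine, and at this
     \<open>t\<close> its value \<open>?b - 2 * (?b + 1)\<close> would be negative.\<close>
   define t where "t = (?b + 1) / ?i"
   have "t * ?i = ?b + 1" using \<open>?i \<noteq> 0\<close> by (simp add: t_def)
   moreover have "0 <= ?b" by simp
   moreover have "0 <= ?b - 2 * (t * ?i)" using q[of t] True by (simp add: mult.assoc)
   ultimately show False by linarith
  qed
  then show ?thesis using True by simp
 next
  case False
  then have "0 < ?a" by (simp add: order_less_le)
  with q[of "?i / ?a"] show ?thesis by (simp add: field_simps power2_eq_square)
 qed
 then show ?thesis using i0 by (simp add: l2_def real_le_rsqrt flip: real_sqrt_mult)
qed

lemma abs_integral_inner_le:
 assumes "sq_int M X" "sq_int M Y"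
 shows "\<bar>\<integral>w. X w \<bullet> Y w \<partial>M\<bar> <= l2 M X * l2 M Y"
proof -
 have "\<bar>\<integral>w. X w \<bullet> Y w \<partial>M\<bar> <= (\<integral>w. norm (X w) * norm (Y w) \<partial>M)"
  by (rule order_trans[OF integral_abs_bound], rule integral_mono)
   (use sq_int_inner[OF assms] sq_int_mult_norm[OF assms] in \<open>auto simp: Cauchy_Schwarz_ineq2\<close>)
 with integral_norm_mult_le[OF assms] show ?thesis by linarith
qed

lemma integral_norm_sq_add:
 assumes "sq_int M X" "sq_int M Y"
 shows "(\<integral>w. (norm (X w + Y w))^2 \<partial>M) =
  (\<integral>w. (norm (X w))^2 \<partial>M) + 2 * (\<integral>w. X w \<bullet> Y w \<partial>M) + (\<integral>w. (norm (Y w))^2 \<partial>M)"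
proof -
 have "(\<integral>w. (norm (X w + Y w))^2 \<partial>M) =
   (\<integral>w. (norm (X w))^2 + 2 * (X w \<bullet> Y w) + (norm (Y w))^2 \<partial>M)"
  by (rule Bochner_Integration.integral_cong)
   (auto simp: power2_norm_eq_inner inner_simps inner_commute algebra_simps)
 then show ?thesis using assms sq_int_inner[OF assms] by (simp add: sq_int_def)
qed

lemma l2_add_le:
 assumes "sq_int M X" "sq_int M Y"
 shows "l2 M (%w. X w + Y w) <= l2 M X + l2 M Y"
proof -
 have "(l2 M X + l2 M Y)^2 = (l2 M X)^2 + 2 * (l2 M X * l2 M Y) + (l2 M Y)^2"
  by (simp add: power2_eq_square algebra_simps)
 then show ?thesis
  using abs_integral_inner_le[OF assms] integral_norm_sq_add[OF assms]
  by (subst l2_le_iff) (auto simp: l2_sq)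
qed

lemma l2_scaleR: "l2 M (%w. c *\<^sub>R X w) = \<bar>c\<bar> * l2 M X"
 by (simp add: l2_def power_mult_distrib real_sqrt_mult)

lemma l2_uminus: "l2 M (%w. - X w) = l2 M X"
 by (simp add: l2_def)

lemma l2_minus_commute: "l2 M (%w. X w - Y w) = l2 M (%w. Y w - X w)"
 by (simp add: l2_def norm_minus_commute)

lemma l2_diff_le:
 assumes "sq_int M X" "sq_int M Y"
 shows "l2 M (%w. X w - Y w) <= l2 M X + l2 M Y"
 using l2_add_le[OF assms(1) sq_int_uminus[OF assms(2)]] by (simp add: l2_uminus)

lemma l2_triangle:
 assumes "sq_int M X" "sq_int M Y" "sq_int M Z"
 shows "l2 M (%w. X w - Z w) <= l2 M (%w. X w - Y w) + l2 M (%w. Y w - Z w)"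
 using l2_add_le[OF sq_int_diff[OF assms(1,2)] sq_int_diff[OF assms(2,3)]] by simp

lemma l2_diff_abs:
 assumes "sq_int M X" "sq_int M Y"
 shows "\<bar>l2 M X - l2 M Y\<bar> <= l2 M (%w. X w - Y w)"
 using l2_triangle[OF assms sq_int_zero] l2_triangle[OF assms(2,1) sq_int_zero]
 by (simp add: l2_minus_commute[of M Y X])

lemma l2_linear_le:
 assumes "sq_int M X" "!!x. norm (L x) <= C * norm x" "0 <= C" "(%w. L (X w)) \<in> borel_measurable M"
 shows "sq_int M (%w. L (X w))" (is ?g1) "l2 M (%w. L (X w)) <= C * l2 M X" (is ?g2)
proof -
 have "sq_int M (%w. C *\<^sub>R X w)" using assms(1) by (rule sq_int_scaleR)
 then show s: ?g1
  by (rule sq_int_bound) (use assms in auto)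
 have "(\<integral>w. (norm (L (X w)))^2 \<partial>M) <= (\<integral>w. C^2 * (norm (X w))^2 \<partial>M)"
 proof (rule integral_mono)
  show "(norm (L (X w)))^2 <= C^2 * (norm (X w))^2" for w
   unfolding power_mult_distrib[symmetric] by (rule power_mono) (use assms(2) in auto)
 qed (use s assms(1) in \<open>auto simp: sq_int_def\<close>)
 then show ?g2
  using assms(3) by (subst l2_le_iff) (auto simp: power_mult_distrib l2_sq)
qed

lemma l2_sum_le:
 assumes "!!i. i \<in> I ==> sq_int M (X i)"
 shows "l2 M (%w. \<Sum>i\<in>I. X i w) <= (\<Sum>i\<in>I. l2 M (X i))"
 using assms
proof (induction I rule: infinite_finite_induct)
 case (insert i I)
 then show ?case
  using l2_add_le[of M "X i" "%w. \<Sum>i\<in>I. X i w"] sq_int_sum[of I M X] by auto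
qed (auto simp: l2_def)

text \<open>The difference of the two pairings is that of \<open>X j - X'\<close> with
  \<open>Y j\<close> plus that of \<open>X'\<close> with \<open>Y j - Y'\<close>; the norms of
  \<open>Y j\<close> stay bounded because they are close to the norm of \<open>Y'\<close>.\<close>

lemma tendsto_integral_inner_l2:
 assumes "!!j. sq_int M (X j)" "sq_int M X'" "!!j. sq_int M (Y j)" "sq_int M Y'"
  and "(%j. l2 M (%w. X j w - X' w)) \<longlonglongrightarrow> 0" "(%j. l2 M (%w. Y j w - Y' w)) \<longlonglongrightarrow> 0"
 shows "(%j. \<integral>w. X j w \<bullet> Y j w \<partial>M) \<longlonglongrightarrow> (\<integral>w. X' w \<bullet> Y' w \<partial>M)"
proof (rule Lim_null_comparison[where f = "%j. _ j - _" and g = "%j. l2 M (%w. X j w - X' w) *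
   (l2 M (%w. Y j w - Y' w) + l2 M Y') + l2 M X' * l2 M (%w. Y j w - Y' w)", THEN LIM_zero_cancel])
 show "\<forall>\<^sub>F j in sequentially. norm ((\<integral>w. X j w \<bullet> Y j w \<partial>M) - (\<integral>w. X' w \<bullet> Y' w \<partial>M)) <=
   l2 M (%w. X j w - X' w) * (l2 M (%w. Y j w - Y' w) + l2 M Y') + l2 M X' * l2 M (%w. Y j w - Y' w)"
 proof (rule always_eventually, rule allI)
  fix j
  have dx: "sq_int M (%w. X j w - X' w)" and dy: "sq_int M (%w. Y j w - Y' w)"
   using assms by (auto intro: sq_int_diff)
  have "(\<integral>w. X j w \<bullet> Y j w \<partial>M) - (\<integral>w. X' w \<bullet> Y' w \<partial>M) =
    (\<integral>w. (X j w - X' w) \<bullet> Y j w \<partial>M) + (\<integral>w. X' w \<bullet> (Y j w - Y' w) \<partial>M)"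
   using assms dx dy sq_int_inner[OF assms(1) assms(3), of j j] sq_int_inner[OF assms(2,4)]
    sq_int_inner[OF assms(2,3), of j]
   by (simp add: inner_diff_left inner_diff_right)
  moreover have "l2 M (Y j) <= l2 M (%w. Y j w - Y' w) + l2 M Y'"
   using l2_add_le[OF dy assms(4)] by simp
  ultimately show "norm ((\<integral>w. X j w \<bullet> Y j w \<partial>M) - (\<integral>w. X' w \<bullet> Y' w \<partial>M)) <=
   l2 M (%w. X j w - X' w) * (l2 M (%w. Y j w - Y' w) + l2 M Y') + l2 M X' * l2 M (%w. Y j w - Y' w)"
   using abs_integral_inner_le[OF dx assms(3)[of j]] abs_integral_inner_le[OF assms(2) dy]
    mult_left_mono[of "l2 M (Y j)" _ "l2 M (%w. X j w - X' w)"]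
   by (smt (verit) l2_nonneg real_norm_def)
 qed
 show "(%j. l2 M (%w. X j w - X' w) * (l2 M (%w. Y j w - Y' w) + l2 M Y') +
   l2 M X' * l2 M (%w. Y j w - Y' w)) \<longlonglongrightarrow> 0"
  using tendsto_add[OF tendsto_mult[OF assms(5) tendsto_add[OF assms(6) tendsto_const[of "l2 M Y'"]]]
    tendsto_mult[OF tendsto_const[of "l2 M X'"] assms(6)]] by simp
qed

lemma tendsto_integral_sq_l2:
 assumes "!!j. sq_int M (X j)" "sq_int M X'" "(%j. l2 M (%w. X j w - X' w)) \<longlonglongrightarrow> 0"
 shows "(%j. \<integral>w. (norm (X j w))^2 \<partial>M) \<longlonglongrightarrow> (\<integral>w. (norm (X' w))^2 \<partial>M)"
 using tendsto_integral_inner_l2[OF assms(1,2,1,2,3,3)] by (simp add: power2_norm_eq_inner)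

lemma l2_tendsto_0_iff_nn:
 assumes "!!j. sq_int M (X j)"
 shows "(%j. \<integral>\<^sup>+w. ennreal ((norm (X j w))^2) \<partial>M) \<longlonglongrightarrow> 0 \<longleftrightarrow> (%j. l2 M (X j)) \<longlonglongrightarrow> 0"
proof -
 have "(%j. (l2 M (X j))^2) \<longlonglongrightarrow> 0 ==> (%j. l2 M (X j)) \<longlonglongrightarrow> 0"
  using tendsto_real_sqrt[of "%j. (l2 M (X j))^2" 0 sequentially] by simp
 moreover have "(%j. l2 M (X j)) \<longlonglongrightarrow> 0 ==> (%j. (l2 M (X j))^2) \<longlonglongrightarrow> 0"
  using tendsto_power[of "%j. l2 M (X j)" 0 sequentially 2] by simp
 moreover have "((%j. ennreal ((l2 M (X j))^2)) \<longlonglongrightarrow> ennreal 0) \<longleftrightarrow> (%j. (l2 M (X j))^2) \<longlonglongrightarrow> 0"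
  by (rule tendsto_ennreal_iff) auto
 ultimately show ?thesis using nn_integral_sq_int[OF assms] by auto
qed

text \<open>One index at finite distance from the limit is enough to make the limit
  square-integrable; afterwards the extended and the real form of the convergence agree.\<close>

lemma sq_int_limit:
 assumes "!!j::nat. sq_int M (X j)" "X' \<in> borel_measurable M"
  "(%j. \<integral>\<^sup>+w. ennreal ((norm (X j w - X' w))^2) \<partial>M) \<longlonglongrightarrow> 0"
 shows "sq_int M X'" "(%j. l2 M (%w. X j w - X' w)) \<longlonglongrightarrow> 0" (is ?g2)
proof -
 have "\<forall>\<^sub>F j in sequentially. (\<integral>\<^sup>+w. ennreal ((norm (X j w - X' w))^2) \<partial>M) < 1"
  using assms(3) by (rule order_tendstoD) simp
 then obtain j where j: "(\<integral>\<^sup>+w. ennreal ((norm (X j w - X' w))^2) \<partial>M) < 1"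
  by (auto simp: eventually_sequentially)
 have [measurable]: "X j \<in> borel_measurable M" for j using assms(1) by (simp add: sq_int_def)
 have "sq_int M (%w. X j w - X' w)"
  using j assms(2) by (intro sq_intI_nn) (auto simp: less_top[symmetric] intro: less_trans)
 from sq_int_diff[OF assms(1) this, of j] show s: "sq_int M X'" by simp
 show ?g2
  using assms(3) l2_tendsto_0_iff_nn[of M "%j w. X j w - X' w"] s assms(1) by (auto intro: sq_int_diff)
qed

text \<open>Ito integrals are defined through bounded simple processes, whereas the coefficients of
  the Euler scheme are only square-integrable; truncation bridges the two. Dominated convergence
  applies with majorant \<open>(norm (X w))^2\<close>.\<close>

lemma l2_truncate:
 assumes "sq_int M X"
 shows "(%n. l2 M (%w. (if norm (X w) <= real n then X w else 0) - X w)) \<longlonglongrightarrow> 0" (is ?g1)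
  and "sq_int M (%w. if norm (X w) <= c then X w else 0)"
proof -
 have [measurable]: "X \<in> borel_measurable M" using assms by (simp add: sq_int_def)
 show s: "sq_int M (%w. if norm (X w) <= c then X w else 0)" for c
  by (rule sq_int_bound[OF assms]) auto
 have "(%n. \<integral>w. (norm ((if norm (X w) <= real n then X w else 0) - X w))^2 \<partial>M) \<longlonglongrightarrow> (\<integral>w. 0 \<partial>M)"
 proof (rule integral_dominated_convergence[where w = "%w. (norm (X w))^2"])
  show "AE w in M. (%n. (norm ((if norm (X w) <= real n then X w else 0) - X w))^2) \<longlonglongrightarrow> 0"
  proof (rule AE_I2)
   fix w
   have "\<forall>\<^sub>F n in sequentially. (norm ((if norm (X w) <= real n then X w else 0) - X w))^2 = 0"
    using eventually_ge_at_top[of "nat \<lceil>norm (X w)\<rceil>"] by eventually_elim (auto simp: nat_le_iff ceiling_le_iff)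
   then show "(%n. (norm ((if norm (X w) <= real n then X w else 0) - X w))^2) \<longlonglongrightarrow> 0"
    by (rule tendsto_eventually)
  qed
 qed (use assms in \<open>auto simp: sq_int_def\<close>)
 then show ?g1
  unfolding l2_def using tendsto_real_sqrt[of _ 0 sequentially] by simp
qed

section \<open>Conditional means\<close>

text \<open>Conditional expectation in weak form for vector-valued functions. In this form it passes
  through bounded linear maps, sums and \<open>l2\<close>-limits without any choice of
  versions.\<close>

definition is_cm :: "'a measure => 'a measure => ('a => 'b::euclidean_space) => ('a => 'b) => bool" where
 "is_cm M G U V \<longleftrightarrow> sq_int M U \<and> sq_int M V \<and> V \<in> borel_measurable G \<and>
   (\<forall>A\<in>sets G. (\<integral>w. indicator A w *\<^sub>R (U w - V w) \<partial>M) = 0)"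

context prob_space
begin

lemma is_cm_linear:
 assumes "is_cm M G U V" "bounded_linear L" "subalgebra M G"
 shows "is_cm M G (%w. L (U w)) (%w. L (V w))"
proof -
 interpret L: bounded_linear L by fact
 have s: "sq_int M (%w. U w - V w)" using assms by (auto simp: is_cm_def intro: sq_int_diff)
 have LV: "(%w. L (V w)) \<in> borel_measurable G"
  using assms by (intro borel_measurable_continuous_onI measurable_compose[of V G borel L borel])
   (auto simp: is_cm_def intro: linear_continuous_on)
 have "(\<integral>w. indicator A w *\<^sub>R (L (U w) - L (V w)) \<partial>M) = 0" if "A \<in> sets G" for A
 proof -
  have A: "A \<in> sets M" using that assms(3) by (auto simp: subalgebra_def)
  have "integrable M (%w. indicator A w *\<^sub>R (U w - V w))"
   by (rule sq_int_integrable[OF _ sq_int_indicator[OF s A]]) unfold_locales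
  from integral_bounded_linear[OF assms(2) this]
  have "(\<integral>w. indicator A w *\<^sub>R (L (U w) - L (V w)) \<partial>M) = L (\<integral>w. indicator A w *\<^sub>R (U w - V w) \<partial>M)"
   by (simp add: L.scaleR L.diff)
  also have "\<dots> = 0" using assms(1) that by (auto simp: is_cm_def L.zero)
  finally show ?thesis .
 qed
 then show ?thesis using assms(1,2) LV by (auto simp: is_cm_def intro: sq_int_linear)
qed

lemma is_cm_add:
 assumes "is_cm M G U V" "is_cm M G U' V'" "subalgebra M G"
 shows "is_cm M G (%w. U w + U' w) (%w. V w + V' w)"
proof -
 have i: "integrable M (%w. indicator A w *\<^sub>R (U w - V w))" if "is_cm M G U V" "A \<in> sets G" for U V A
  using that assms(3)
  by (intro sq_int_integrable[OF _ sq_int_indicator] sq_int_diff)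
   (auto simp: is_cm_def subalgebra_def intro: finite_measure_axioms)
 have "(\<integral>w. indicator A w *\<^sub>R ((U w + U' w) - (V w + V' w)) \<partial>M) = 0" if A: "A \<in> sets G" for A
 proof -
  have "(\<integral>w. indicator A w *\<^sub>R ((U w + U' w) - (V w + V' w)) \<partial>M) =
    (\<integral>w. indicator A w *\<^sub>R (U w - V w) + indicator A w *\<^sub>R (U' w - V' w) \<partial>M)"
   by (simp add: algebra_simps)
  also have "\<dots> = 0" using i[OF assms(1) A] i[OF assms(2) A] assms A by (simp add: is_cm_def)
  finally show ?thesis .
 qed
 then show ?thesis using assms by (auto simp: is_cm_def intro: sq_int_add)
qed

lemma is_cm_self: "sq_int M U ==> U \<in> borel_measurable G ==> is_cm M G U U"
 by (auto simp: is_cm_def)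

lemma is_cm_diff:
 assumes "is_cm M G U V" "is_cm M G U' V'" "subalgebra M G"
 shows "is_cm M G (%w. U w - U' w) (%w. V w - V' w)"
 using is_cm_add[OF assms(1) is_cm_linear[OF assms(2) bounded_linear_minus[OF bounded_linear_ident] assms(3)] assms(3)]
 by simp

lemma is_cm_sum:
 assumes "!!i. i \<in> I ==> is_cm M G (U i) (V i)" "subalgebra M G"
 shows "is_cm M G (%w. \<Sum>i\<in>I. U i w) (%w. \<Sum>i\<in>I. V i w)"
 using assms(1)
 by (induction I rule: infinite_finite_induct) (auto intro: is_cm_add[OF _ _ assms(2)] is_cm_self)

text \<open>Links the weak form with \<open>real_cond_exp\<close>, in terms of which
  \<open>cond_mean_process\<close> is stated component by component.\<close>

lemma is_cm_AE_real_cond_exp: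
 assumes "is_cm M G U V" "subalgebra M G"
 shows "AE w in M. real_cond_exp M G (%w. U w \<bullet> b) w = V w \<bullet> b"
proof -
 interpret G: finite_measure_subalgebra M G using assms(2) by unfold_locales
 have c: "is_cm M G (%w. U w \<bullet> b) (%w. V w \<bullet> b)"
  using is_cm_linear[OF assms(1) bounded_linear_inner_left assms(2)] .
 then have int: "integrable M (%w. U w \<bullet> b)" "integrable M (%w. V w \<bullet> b)"
  by (auto simp: is_cm_def intro: sq_int_integrable finite_measure_axioms)
 show ?thesis
 proof (rule G.real_cond_exp_charact)
  fix A assume A: "A \<in> sets G"
  then have AM: "A \<in> sets M" using assms(2) by (auto simp: subalgebra_def)
  have "0 = (\<integral>w. indicator A w *\<^sub>R (U w \<bullet> b - V w \<bullet> b) \<partial>M)" using c A by (auto simp: is_cm_def)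
  also have "\<dots> = (\<integral>w. indicator A w *\<^sub>R (U w \<bullet> b) - indicator A w *\<^sub>R (V w \<bullet> b) \<partial>M)"
   by (simp add: algebra_simps)
  also have "\<dots> = (\<integral>w. indicator A w *\<^sub>R (U w \<bullet> b) \<partial>M) - (\<integral>w. indicator A w *\<^sub>R (V w \<bullet> b) \<partial>M)"
   by (rule Bochner_Integration.integral_diff)
    (use integrable_mult_indicator[OF AM int(1)] integrable_mult_indicator[OF AM int(2)] in auto)
  finally show "(LINT w:A|M. U w \<bullet> b) = (LINT w:A|M. V w \<bullet> b)"
   by (simp add: set_lebesgue_integral_def)
 qed (use int c in \<open>auto simp: is_cm_def\<close>)
qed

lemma is_cmI_real_cond_exp:
 assumes "sq_int M U" "V \<in> borel_measurable G" "subalgebra M G"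
  and "!!b. b \<in> Basis ==> AE w in M. V w \<bullet> b = real_cond_exp M G (%w. U w \<bullet> b) w"
 shows "is_cm M G U V"
proof -
 interpret G: finite_measure_subalgebra M G using assms(3) by unfold_locales
 have VM: "V \<in> borel_measurable M" using assms by (auto intro: measurable_from_subalg)
 have Ub: "sq_int M (%w. U w \<bullet> b)" for b
  using sq_int_linear[OF assms(1) bounded_linear_inner_left] .
 have sV: "sq_int M (%w. V w \<bullet> b)" if b: "b \<in> Basis" for b
 proof -
  \<comment> \<open>Jensen's inequality for the square: each coordinate of the conditional mean
    inherits square-integrability from \<open>U\<close>.\<close>
  have "AE w in M. (real_cond_exp M G (%w. U w \<bullet> b) w)^2 <= real_cond_exp M G (%w. (U w \<bullet> b)^2) w"
   and i: "integrable M (%w. (real_cond_exp M G (%w. U w \<bullet> b) w)^2)"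
   using G.real_cond_exp_jensens_inequality[where q = "%x. x^2" and I = UNIV and X = "%w. U w \<bullet> b"]
    G.integrable_convex_cond_exp[where q = "%x. x^2" and I = UNIV and X = "%w. U w \<bullet> b"]
    sq_int_integrable[OF finite_measure_axioms Ub[of b]] Ub[of b] convex_power2
   by (auto simp: sq_int_def)
  have "sq_int M (real_cond_exp M G (%w. U w \<bullet> b))"
   unfolding sq_int_def using i by auto
  then show ?thesis
   by (rule sq_int_cong_AE(1)) (use assms(4)[OF b] VM in auto)
 qed
 have sqV: "sq_int M V"
 proof -
  have "sq_int M (%w. \<Sum>b\<in>Basis. (V w \<bullet> b) *\<^sub>R b)"
   by (intro sq_int_sum sq_int_linear[OF sV bounded_linear_scaleR_left])
  then show ?thesis by (simp add: euclidean_representation)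
 qed
 have "(\<integral>w. indicator A w *\<^sub>R (U w - V w) \<partial>M) = 0" if A: "A \<in> sets G" for A
 proof (rule euclidean_eqI)
  fix b :: 'b assume b: "b \<in> Basis"
  have AM: "A \<in> sets M" using A assms(3) by (auto simp: subalgebra_def)
  have "integrable M (%w. indicator A w *\<^sub>R (U w - V w))"
   by (intro sq_int_integrable[OF finite_measure_axioms] sq_int_indicator sq_int_diff assms sqV AM)
  from integral_bounded_linear[OF bounded_linear_inner_left this, of b]
  have "(\<integral>w. indicator A w *\<^sub>R (U w - V w) \<partial>M) \<bullet> b =
    (\<integral>w. indicator A w *\<^sub>R (U w \<bullet> b) - indicator A w *\<^sub>R (V w \<bullet> b) \<partial>M)"
   by (simp add: inner_diff_left algebra_simps)
  also have "\<dots> = (LINT w:A|M. U w \<bullet> b) - (LINT w:A|M. V w \<bullet> b)"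
   unfolding set_lebesgue_integral_def
   by (rule Bochner_Integration.integral_diff)
    (use integrable_mult_indicator[OF AM sq_int_integrable[OF finite_measure_axioms Ub[of b]]]
     integrable_mult_indicator[OF AM sq_int_integrable[OF finite_measure_axioms sV[OF b]]] in auto)
  also have "(LINT w:A|M. V w \<bullet> b) = (LINT w:A|M. real_cond_exp M G (%w. U w \<bullet> b) w)"
   by (rule set_lebesgue_integral_cong_AE) (use assms(4)[OF b] AM VM in auto)
  also have "\<dots> = (LINT w:A|M. U w \<bullet> b)"
   by (rule G.real_cond_exp_intA[OF _ A, symmetric]) (rule sq_int_integrable[OF finite_measure_axioms Ub])
  finally show "(\<integral>w. indicator A w *\<^sub>R (U w - V w) \<partial>M) \<bullet> b = 0 \<bullet> b" by simp
 qed
 then show ?thesis using assms(1,2) sqV by (auto simp: is_cm_def)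
qed

text \<open>Extends the admissible tests from indicators of sets of \<open>G\<close> to
  square-integrable \<open>G\<close>-measurable functions; in coordinates it is the rule that such a
  factor may be moved inside the conditional expectation.\<close>

lemma is_cm_inner:
 assumes "is_cm M G U V" "subalgebra M G" "sq_int M \<zeta>" "\<zeta> \<in> borel_measurable G"
 shows "(\<integral>w. \<zeta> w \<bullet> U w \<partial>M) = (\<integral>w. \<zeta> w \<bullet> V w \<partial>M)"
proof -
 interpret G: finite_measure_subalgebra M G using assms(2) by unfold_locales
 have sq: "sq_int M U" "sq_int M V" using assms by (auto simp: is_cm_def)
 have c: "sq_int M (%w. X w \<bullet> b)" if "sq_int M X" for X :: "'a => 'b" and b
  using sq_int_linear[OF that bounded_linear_inner_left] .
 have "(\<integral>w. \<zeta> w \<bullet> U w \<partial>M) = (\<Sum>b\<in>Basis. \<integral>w. (\<zeta> w \<bullet> b) * (U w \<bullet> b) \<partial>M)"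
  by (subst euclidean_inner, rule Bochner_Integration.integral_sum) (intro sq_int_mult c assms sq)
 also have "\<dots> = (\<Sum>b\<in>Basis. \<integral>w. (\<zeta> w \<bullet> b) * (V w \<bullet> b) \<partial>M)"
 proof (rule sum.cong[OF refl])
  fix b :: 'b assume "b \<in> Basis"
  have i: "integrable M (%w. (\<zeta> w \<bullet> b) * (U w \<bullet> b))" by (intro sq_int_mult c assms sq)
  have "(\<integral>w. (\<zeta> w \<bullet> b) * (U w \<bullet> b) \<partial>M) =
    (\<integral>w. (\<zeta> w \<bullet> b) * real_cond_exp M G (%w. U w \<bullet> b) w \<partial>M)"
   by (rule G.real_cond_exp_intg(2)[OF i, symmetric]) (use assms(4) sq in \<open>auto simp: sq_int_def\<close>)
  also have "\<dots> = (\<integral>w. (\<zeta> w \<bullet> b) * (V w \<bullet> b) \<partial>M)"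
   by (rule integral_cong_AE)
    (use is_cm_AE_real_cond_exp[OF assms(1,2), of b] sq assms(3) in \<open>auto simp: sq_int_def\<close>)
  finally show "(\<integral>w. (\<zeta> w \<bullet> b) * (U w \<bullet> b) \<partial>M) = (\<integral>w. (\<zeta> w \<bullet> b) * (V w \<bullet> b) \<partial>M)" .
 qed
 also have "\<dots> = (\<integral>w. \<zeta> w \<bullet> V w \<partial>M)"
  by (subst euclidean_inner, rule Bochner_Integration.integral_sum[symmetric]) (intro sq_int_mult c assms sq)
 finally show ?thesis .
qed

text \<open>Testing with \<open>V\<close> itself shows that the squared norm of \<open>V\<close> is
  its pairing with \<open>U\<close>; then Cauchy-Schwarz. Through this contraction, moduli of
  continuity pass from \<open>X\<close> to its conditional mean.\<close>

lemma is_cm_l2_le: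
 assumes "is_cm M G U V" "subalgebra M G"
 shows "l2 M V <= l2 M U"
proof -
 have sq: "sq_int M U" "sq_int M V" "V \<in> borel_measurable G" using assms by (auto simp: is_cm_def)
 have "(l2 M V)^2 = (\<integral>w. V w \<bullet> U w \<partial>M)"
  using is_cm_inner[OF assms sq(2,3)] by (simp add: l2_sq power2_norm_eq_inner)
 also have "\<dots> <= l2 M V * l2 M U" using abs_integral_inner_le[OF sq(2,1)] by linarith
 finally show ?thesis
  by (cases "l2 M V = 0") (auto simp: power2_eq_square order_less_le)
qed

text \<open>For fixed \<open>A\<close> and \<open>b\<close> the pairing with
  \<open>indicator A w *\<^sub>R b\<close> is continuous in \<open>l2\<close>, so it stays zero in
  the limit.\<close>

lemma is_cm_limit:
 assumes "!!j. is_cm M G (U j) (V j)" "subalgebra M G" "sq_int M U'" "sq_int M V'" "V' \<in> borel_measurable G"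
  and "(%j. l2 M (%w. U j w - U' w)) \<longlonglongrightarrow> 0" "(%j. l2 M (%w. V j w - V' w)) \<longlonglongrightarrow> 0"
 shows "is_cm M G U' V'"
proof -
 have sq: "sq_int M (U j)" "sq_int M (V j)" for j using assms by (auto simp: is_cm_def)
 have "(\<integral>w. indicator A w *\<^sub>R (U' w - V' w) \<partial>M) \<bullet> b = 0" if A: "A \<in> sets G" for A b
 proof -
  have AM: "A \<in> sets M" using A assms(2) by (auto simp: subalgebra_def)
  have z: "sq_int M (%w. indicator A w *\<^sub>R b)"
   by (intro sq_int_indicator sq_int_const AM finite_measure_axioms)
  have e: "(\<integral>w. indicator A w *\<^sub>R (X w - Y w) \<partial>M) \<bullet> b =
    (\<integral>w. (indicator A w *\<^sub>R b) \<bullet> X w \<partial>M) - (\<integral>w. (indicator A w *\<^sub>R b) \<bullet> Y w \<partial>M)"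
   if "sq_int M X" "sq_int M Y" for X Y
  proof -
   have "integrable M (%w. indicator A w *\<^sub>R (X w - Y w))"
    by (intro sq_int_integrable[OF finite_measure_axioms] sq_int_indicator sq_int_diff that AM)
   from integral_bounded_linear[OF bounded_linear_inner_left this, of b]
   have "(\<integral>w. indicator A w *\<^sub>R (X w - Y w) \<partial>M) \<bullet> b =
     (\<integral>w. (indicator A w *\<^sub>R b) \<bullet> X w - (indicator A w *\<^sub>R b) \<bullet> Y w \<partial>M)"
    by (simp add: inner_diff_left inner_diff_right inner_commute algebra_simps)
   then show ?thesis using sq_int_inner[OF z that(1)] sq_int_inner[OF z that(2)] by simp
  qed
  have z0: "(%j::nat. l2 M (%w. indicator A w *\<^sub>R b - indicator A w *\<^sub>R b)) \<longlonglongrightarrow> 0"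
   by (simp add: l2_def)
  have "(%j. (\<integral>w. (indicator A w *\<^sub>R b) \<bullet> U j w \<partial>M) - (\<integral>w. (indicator A w *\<^sub>R b) \<bullet> V j w \<partial>M)) \<longlonglongrightarrow>
    (\<integral>w. (indicator A w *\<^sub>R b) \<bullet> U' w \<partial>M) - (\<integral>w. (indicator A w *\<^sub>R b) \<bullet> V' w \<partial>M)"
   by (intro tendsto_diff tendsto_integral_inner_l2 z sq assms z0)
  moreover have "(\<integral>w. (indicator A w *\<^sub>R b) \<bullet> U j w \<partial>M) - (\<integral>w. (indicator A w *\<^sub>R b) \<bullet> V j w \<partial>M) = 0" for j
   using e[OF sq(1) sq(2), of j j] assms(1)[of j] A by (auto simp: is_cm_def)
  ultimately show ?thesis using e[OF assms(3,4)] by (simp add: LIMSEQ_const_iff)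
 qed
 then have "(\<integral>w. indicator A w *\<^sub>R (U' w - V' w) \<partial>M) = 0" if "A \<in> sets G" for A
  using that by (metis inner_eq_zero_iff)
 then show ?thesis using assms by (auto simp: is_cm_def)
qed

end

section \<open>Independence of the noise increments from the past\<close>

lemma path_events_subset_events:
 "(!!t. t \<in> J ==> V t \<in> borel_measurable M) ==> path_events M V J \<subseteq> sets M"
 by (auto simp: path_events_def measurable_sets)

lemma path_events_Pow: "path_events M V J \<subseteq> Pow (space M)"
 by (auto simp: path_events_def)

lemma sigma_path_events_subset:
 assumes "A \<subseteq> Pow (space M)" "!!t. t \<in> J ==> V t \<in> borel_measurable (sigma (space M) A)"
 shows "sigma_sets (space M) (path_events M V J) \<subseteq> sigma_sets (space M) A"
proof (rule sigma_sets_mono, rule subsetI)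
 fix x assume "x \<in> path_events M V J"
 then obtain t E where t: "t \<in> J" "E \<in> sets borel" "x = V t -` E \<inter> space M"
  by (auto simp: path_events_def)
 with measurable_sets[OF assms(2)[OF t(1)] t(2)] show "x \<in> sigma_sets (space M) A"
  using assms(1) by simp
qed

lemma path_events_mono: "J \<subseteq> J' ==> path_events M V J \<subseteq> path_events M V J'"
 by (auto simp: path_events_def)

lemma measurable_path_events:
 assumes "t \<in> J" "path_events M V J \<subseteq> A" "A \<subseteq> Pow (space M)"
 shows "V t \<in> borel_measurable (sigma (space M) A)"
proof (rule measurableI)
 fix E assume E: "E \<in> sets (borel :: real measure)"
 then have "V t -` E \<inter> space M \<in> path_events M V J" using assms(1) by (auto simp: path_events_def)
 then show "V t -` E \<inter> space (sigma (space M) A) \<in> sets (sigma (space M) A)"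
  using assms by (auto simp: space_measure_of)
qed auto

text \<open>Two members of the union lie in a common \<open>A k\<close>, where their intersection
  can be formed.\<close>

lemma Int_stable_directed:
 assumes "!!i. i \<in> I ==> Int_stable (A i)" "!!i j. i \<in> I ==> j \<in> I ==> \<exists>k\<in>I. A i \<union> A j \<subseteq> A k"
 shows "Int_stable (\<Union>i\<in>I. A i)"
proof (rule Int_stableI)
 fix a b assume "a \<in> (\<Union>i\<in>I. A i)" "b \<in> (\<Union>i\<in>I. A i)"
 then obtain i j where ij: "i \<in> I" "j \<in> I" "a \<in> A i" "b \<in> A j" by auto
 from assms(2)[OF ij(1,2)] obtain k where "k \<in> I" "A i \<union> A j \<subseteq> A k" by auto
 with ij assms(1)[of k] have "a \<inter> b \<in> A k" by (auto simp: Int_stable_def)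
 with \<open>k \<in> I\<close> show "a \<inter> b \<in> (\<Union>i\<in>I. A i)" by blast
qed

lemma Int_stable_sigma_sets: "A \<subseteq> Pow \<Omega> ==> Int_stable (sigma_sets \<Omega> A)"
 using sigma_algebra_sigma_sets[of A \<Omega>]
 by (auto simp: Int_stable_def sigma_algebra_def algebra_def ring_of_sets_def semiring_of_sets_def semiring_of_sets_axioms_def)

text \<open>Null sets absorb intersections with events, so they may be added to any generating
  family without losing stability.\<close>

lemma Int_stable_Un_null_sets:
 assumes "Int_stable A" "A \<subseteq> sets M"
 shows "Int_stable (A \<union> null_sets M)"
proof (rule Int_stableI)
 fix a b assume "a \<in> A \<union> null_sets M" "b \<in> A \<union> null_sets M"
 then show "a \<inter> b \<in> A \<union> null_sets M"
  using assms null_set_Int2[of a M b] null_set_Int1[of b M a] null_set_Int2[of b M a]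
  by (auto simp: Int_stable_def Int_commute)
qed

context prob_space
begin

text \<open>All times involved, with 0 and \<open>s\<close> added, are sorted into one grid.
  \<open>brownian_motion\<close> supplies independence of the grid increments; those to the left of
  \<open>s\<close> generate the first family and those to its right the second.\<close>

lemma brownian_indep_finite:
 assumes bm: "brownian_motion M W" and s: "0 <= s"
  and J: "finite J" "J \<subseteq> {0..s}" and J': "finite J'" "J' \<subseteq> {s..}"
 shows "indep_set (sigma_sets (space M) (path_events M (%t w. W t w - W 0 w) J))
          (sigma_sets (space M) (path_events M (%t w. W t w - W s w) J'))"
proof -
 define U where "U = insert 0 (insert s (J \<union> J'))"
 define xs where "xs = sorted_list_of_set U"
 define N where "N = length xs - 1"
 \<comment> \<open>Frozen beyond \<open>N\<close>, so that monotonicity holds for all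
   indices.\<close>
 define \<tau> where "\<tau> i = xs ! (min i N)" for i
 have U: "finite U" "0 \<in> U" "s \<in> U" "U \<subseteq> {0..}" "J \<subseteq> U" "J' \<subseteq> U"
  using J J' s by (auto simp: U_def)
 have xs: "set xs = U" "sorted xs" using U(1) by (auto simp: xs_def)
 have len: "length xs = Suc N" using xs(1) U(2) by (cases xs) (auto simp: N_def)
 have mono: "\<tau> i <= \<tau> j" if "i <= j" for i j
  unfolding \<tau>_def using that len by (intro sorted_nth_mono[OF xs(2)]) auto
 have \<tau>U: "\<tau> i \<in> U" for i unfolding \<tau>_def xs(1)[symmetric] using len by (intro nth_mem) auto
 have surj: "\<exists>k\<le>N. u = \<tau> k" if "u \<in> U" for u
 proof -
  from that obtain k where "k < length xs" "xs ! k = u" unfolding xs(1)[symmetric] by (auto simp: in_set_conv_nth)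
  then show ?thesis using len by (intro exI[of _ k]) (auto simp: \<tau>_def min_def)
 qed
 obtain m where m: "m <= N" "\<tau> m = s" using surj[OF U(3)] by auto
 have \<tau>0: "\<tau> 0 = 0"
 proof -
  obtain k where "0 = \<tau> k" using surj[OF U(2)] by auto
  then have "\<tau> 0 <= 0" using mono[of 0 k] by simp
  then show ?thesis using \<tau>U[of 0] U(4) by auto
 qed
 define \<Delta> where "\<Delta> i = (%w. W (\<tau> (Suc i)) w - W (\<tau> i) w)" for i
 define E where "E i = {\<Delta> i -` A \<inter> space M | A. A \<in> sets borel}" for i
 have "indep_vars (%_. borel) \<Delta> {..<N}"
  using bm mono \<tau>0 unfolding brownian_motion_def \<Delta>_def by (auto dest!: spec[of _ N] spec[of _ \<tau>])
 then have ind: "indep_sets E {..<N}" unfolding indep_vars_def2 E_def by (rule conjunct2)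
 have EP: "E i \<subseteq> Pow (space M)" for i by (auto simp: E_def)
 have meas: "\<Delta> i \<in> borel_measurable (sigma (space M) (\<Union>i\<in>I. E i))" if "i \<in> I" for i I
 proof (rule measurableI)
  fix A :: "real set" assume "A \<in> sets borel"
  then have "\<Delta> i -` A \<inter> space M \<in> (\<Union>i\<in>I. E i)" using that by (auto simp: E_def)
  moreover have "(\<Union>i\<in>I. E i) \<subseteq> Pow (space M)" using EP by blast
  ultimately show "\<Delta> i -` A \<inter> space (sigma (space M) (\<Union>i\<in>I. E i)) \<in> sets (sigma (space M) (\<Union>i\<in>I. E i))"
   by (simp add: space_measure_of sigma_sets.Basic)
 qed auto
 \<comment> \<open>Increments with index below \<open>m\<close> lie before \<open>s\<close>, the
   others after it; each block is merged into one sigma-algebra.\<close>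
 define I where "I = case_bool {..<m} {m..<N}"
 have "indep_sets (%j. sigma_sets (space M) (\<Union>i\<in>I j. E i)) UNIV"
 proof (rule indep_sets_collect_sigma)
  have "(\<Union>j\<in>UNIV. I j) = {..<N}" using m by (auto simp: I_def UNIV_bool)
  then show "indep_sets E (\<Union>j\<in>UNIV. I j)" using ind by simp
  show "Int_stable (E i)" for i
  proof (rule Int_stableI)
   fix a b assume "a \<in> E i" "b \<in> E i"
   then obtain A B where "A \<in> sets borel" "B \<in> sets borel" "a = \<Delta> i -` A \<inter> space M" "b = \<Delta> i -` B \<inter> space M"
    by (auto simp: E_def)
   then show "a \<inter> b \<in> E i" by (auto simp: E_def intro!: exI[of _ "A \<inter> B"])
  qed
  show "disjoint_family_on I UNIV" by (auto simp: disjoint_family_on_def I_def split: bool.splits)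
 qed
 then have ind2: "indep_set (sigma_sets (space M) (\<Union>i\<in>{..<m}. E i)) (sigma_sets (space M) (\<Union>i\<in>{m..<N}. E i))"
  unfolding indep_set_def I_def
  by (rule indep_sets_mono_sets) (auto split: bool.splits)
 have tele: "W (\<tau> k) w - W (\<tau> j) w = (\<Sum>i=j..<k. \<Delta> i w)" if "j <= k" for j k w
  using sum_Suc_diff'[OF that, of "%i. W (\<tau> i) w"] by (simp add: \<Delta>_def)
 have sub1: "sigma_sets (space M) (path_events M (%t w. W t w - W 0 w) J) \<subseteq> sigma_sets (space M) (\<Union>i\<in>{..<m}. E i)"
 proof (rule sigma_path_events_subset)
  fix t assume t: "t \<in> J"
  then obtain k where k: "k <= N" "t = \<tau> k" using U(5) surj by blast
  \<comment> \<open>An index beyond \<open>m\<close> is possible only for \<open>t = s\<close>, and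
    then \<open>m\<close> itself serves.\<close>
  have "\<exists>k\<le>m. t = \<tau> k"
  proof (cases "k <= m")
   case False
   then have "s <= t" using mono[of m k] m k by auto
   then show ?thesis using t J(2) m by (intro exI[of _ m]) auto
  qed (use k in auto)
  then obtain k where k: "k <= m" "t = \<tau> k" by auto
  have "(%w. W t w - W 0 w) = (%w. \<Sum>i=0..<k. \<Delta> i w)" using tele[of 0 k] k \<tau>0 by simp
  then show "(%w. W t w - W 0 w) \<in> borel_measurable (sigma (space M) (\<Union>i\<in>{..<m}. E i))"
   using k by (auto intro!: borel_measurable_sum meas)
 qed (use EP in auto)
 have sub2: "sigma_sets (space M) (path_events M (%t w. W t w - W s w) J') \<subseteq> sigma_sets (space M) (\<Union>i\<in>{m..<N}. E i)"
 proof (rule sigma_path_events_subset)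
  fix t assume t: "t \<in> J'"
  then obtain k where k: "k <= N" "t = \<tau> k" using U(6) surj by blast
  have "\<exists>k\<le>N. m <= k \<and> t = \<tau> k"
  proof (cases "m <= k")
   case False
   then have "t <= s" using mono[of k m] m k by auto
   then show ?thesis using t J'(2) m by (intro exI[of _ m]) auto
  qed (use k in auto)
  then obtain k where k: "k <= N" "m <= k" "t = \<tau> k" by auto
  have "(%w. W t w - W s w) = (%w. \<Sum>i=m..<k. \<Delta> i w)" using tele[of m k] k m by simp
  then show "(%w. W t w - W s w) \<in> borel_measurable (sigma (space M) (\<Union>i\<in>{m..<N}. E i))"
   using k by (auto intro!: borel_measurable_sum meas)
 qed (use EP in auto)
 show ?thesis
  using ind2 sub1 sub2 unfolding indep_sets2_eq by blast
qed

text \<open>The sigma-algebras generated by finitely many times form a directed family whose union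
  is stable under intersection and generates, so independence extends from finite sets of times. The
  past is expressed by increments from time 0 because \<open>W 0\<close> vanishes only almost
  surely.\<close>

lemma brownian_indep_past_future:
 assumes bm: "brownian_motion M W" and s: "0 <= s"
 shows "indep_set (sigma_sets (space M) (path_events M (%t w. W t w - W 0 w) {0..s}))
          (sigma_sets (space M) (path_events M (%t w. W t w - W s w) {s..}))"
proof -
 define \<A> where "\<A> V T = (\<Union>J\<in>{J. finite J \<and> J \<subseteq> T}. sigma_sets (space M) (path_events M V J))"
  for V :: "real => 'a => real" and T
 have st: "Int_stable (\<A> V T)" for V T
  unfolding \<A>_def
 proof (rule Int_stable_directed)
  fix J J' assume *: "J \<in> {J. finite J \<and> J \<subseteq> T}" "J' \<in> {J. finite J \<and> J \<subseteq> T}"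
  show "\<exists>K\<in>{J. finite J \<and> J \<subseteq> T}. sigma_sets (space M) (path_events M V J) \<union>
    sigma_sets (space M) (path_events M V J') \<subseteq> sigma_sets (space M) (path_events M V K)"
   using * by (intro bexI[of _ "J \<union> J'"] Un_least sigma_sets_mono' path_events_mono) auto
 qed (auto intro!: Int_stable_sigma_sets path_events_Pow)
 have gen: "sigma_sets (space M) (path_events M V T) \<subseteq> sigma_sets (space M) (\<A> V T)" for V T
 proof (rule sigma_sets_mono, rule subsetI)
  fix x assume "x \<in> path_events M V T"
  then obtain t where "t \<in> T" "x \<in> path_events M V {t}" unfolding path_events_def by blast
  then have "x \<in> \<A> V T" unfolding \<A>_def by (intro UN_I[of "{t}"] sigma_sets.Basic) auto
  then show "x \<in> sigma_sets (space M) (\<A> V T)" ..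
 qed
 have "indep_set (\<A> (%t w. W t w - W 0 w) {0..s}) (\<A> (%t w. W t w - W s w) {s..})"
 proof (rule indep_setI)
  note fin = brownian_indep_finite[OF bm s, unfolded indep_sets2_eq]
  show "\<A> (%t w. W t w - W 0 w) {0..s} \<subseteq> events"
   unfolding \<A>_def by (rule UN_least) (use fin[of _ "{}"] in simp)
  show "\<A> (%t w. W t w - W s w) {s..} \<subseteq> events"
   unfolding \<A>_def by (rule UN_least) (use fin[of "{}"] in simp)
  fix a b assume "a \<in> \<A> (%t w. W t w - W 0 w) {0..s}" "b \<in> \<A> (%t w. W t w - W s w) {s..}"
  then obtain J J' where J: "finite J" "J \<subseteq> {0..s}" "a \<in> sigma_sets (space M) (path_events M (%t w. W t w - W 0 w) J)"
   "finite J'" "J' \<subseteq> {s..}" "b \<in> sigma_sets (space M) (path_events M (%t w. W t w - W s w) J')"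
   unfolding \<A>_def by blast
  show "prob (a \<inter> b) = prob a * prob b"
   using fin[OF J(1,2,4,5)] J(3,6) by simp
 qed
 from indep_set_sigma_sets[OF this st st]
 show ?thesis using gen[of "%t w. W t w - W 0 w" "{0..s}"] gen[of "%t w. W t w - W s w" "{s..}"]
  unfolding indep_sets2_eq by blast
qed

text \<open>The monotone class argument with one event kept fixed; it is applied to one factor after
  another.\<close>

lemma indep_set_Int_right:
 assumes "!!a. a \<in> A ==> prob (a \<inter> b) = prob a * prob b" "Int_stable A" "A \<subseteq> events" "b \<in> events"
  and "a \<in> sigma_sets (space M) A"
 shows "prob (a \<inter> b) = prob a * prob b"
proof -
 have "indep_set A {b}" using assms by (auto simp: indep_sets2_eq)
 from indep_set_sigma_sets[OF this assms(2)]
 have "indep_set (sigma_sets (space M) A) (sigma_sets (space M) {b})" by (auto simp: Int_stable_def)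
 then show ?thesis using assms(5) by (auto simp: indep_sets2_eq)
qed

text \<open>By completeness, the part of a preimage inside the exceptional set is itself a null set,
  hence belongs to \<open>G\<close>.\<close>

lemma measurable_AE_eq_complete:
 fixes f :: "'a => 'c::topological_space"
 assumes c: "complete_measure M" and G: "subalgebra M G" "null_sets M \<subseteq> sets G"
  and g: "g \<in> borel_measurable G" and eq: "AE w in M. f w = g w"
 shows "f \<in> borel_measurable G"
proof (rule measurableI)
 obtain N where N: "!!w. w \<in> space M - N ==> f w = g w" "N \<in> null_sets M"
  using AE_E3[OF eq] by metis
 fix E :: "'c set" assume E: "E \<in> sets borel"
 have sp: "space G = space M" using G by (simp add: subalgebra_def)
 have "f -` E \<inter> space M \<inter> N \<in> null_sets M"
  using null_sets_subset[of N M "f -` E \<inter> space M \<inter> N"] N(2) complete_measure.complete[OF c, of _ N] by auto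
 moreover have "N \<in> sets G" using N G by auto
 moreover have "f -` E \<inter> space G = (g -` E \<inter> space G - N) \<union> (f -` E \<inter> space M \<inter> N)"
  using N(1) sp by auto
 ultimately show "f -` E \<inter> space G \<in> sets G"
  using measurable_sets[OF g E] G(2) by auto
qed auto

lemma measurable_AE_limit_complete:
 fixes f :: "nat => 'a => 'c::euclidean_space"
 assumes c: "complete_measure M" and G: "subalgebra M G" "null_sets M \<subseteq> sets G"
  and f: "!!n. f n \<in> borel_measurable G" and lim: "AE w in M. (%n. f n w) \<longlonglongrightarrow> g w"
 shows "g \<in> borel_measurable G"
proof -
 obtain N where N: "!!w. w \<in> space M - N ==> (%n. f n w) \<longlonglongrightarrow> g w" "N \<in> null_sets M"
  using AE_E3[OF lim] by metis
 have sp: "space G = space M" using G by (simp add: subalgebra_def)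
 have [measurable]: "N \<in> sets G" "!!n. f n \<in> borel_measurable G" using N G f by auto
 have m: "(%w. if w \<in> N then 0 else g w) \<in> borel_measurable G"
 proof (rule borel_measurable_LIMSEQ_metric)
  show "(%w. if w \<in> N then 0 else f n w) \<in> borel_measurable G" for n by measurable
  show "(%n. if w \<in> N then 0 else f n w) \<longlonglongrightarrow> (if w \<in> N then 0 else g w)" if "w \<in> space G" for w
   using N(1)[of w] that sp by auto
 qed
 have "AE w in M. g w = (if w \<in> N then 0 else g w)"
  using AE_not_in[OF N(2)] by eventually_elim auto
 then show ?thesis by (rule measurable_AE_eq_complete[OF c G m])
qed

end

section \<open>Filtrations of the two noises and independence of the past from the future\<close>

locale mean_field_basis =
 fixes M F0 :: "'a measure" and W W0 :: "real => 'a => real"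
 assumes basis: "mf_basis M F0 W W0"

sublocale mean_field_basis \<subseteq> prob_space M
 using basis by (simp add: mf_basis_def)

text \<open>Only increments that start strictly after \<open>s\<close> generate: an event of the
  right-continuous \<open>full_filt\<close> at \<open>s\<close> is contained in the raw past of
  every later time, but not visibly in that of \<open>s\<close>. The null sets let the increment
  from \<open>s\<close> itself be recovered as an almost sure limit.\<close>

definition future :: "'a measure => (real => 'a => real) => real => 'a measure" where
 "future M W s = sigma (space M) ((\<Union>r\<in>{s<..}.
   sigma_sets (space M) (path_events M (%t w. W t w - W r w) {r..})) \<union> null_sets M)"

lemma full_filt_swap: "full_filt M F0 W0 W = full_filt M F0 W W0"
 by (simp add: full_filt_def Un_commute Un_left_commute fun_eq_iff)

text \<open>Exchanging the noises allows every result on \<open>W\<close> to be reused for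
  \<open>W0\<close> through a second interpretation of the locale.\<close>

lemma mf_basis_swap: "mf_basis M F0 W W0 ==> mf_basis M F0 W0 W"
proof -
 assume b: "mf_basis M F0 W W0"
 then interpret prob_space M by (simp add: mf_basis_def)
 let ?A = "sigma_sets (space M) (path_events M W {0..})"
 let ?B = "sigma_sets (space M) (path_events M W0 {0..})"
 have i: "indep_sets ((!) [?A, ?B, sets F0]) {..<3}"
  using b by (simp add: mf_basis_def)
 have "indep_sets ((!) [?B, ?A, sets F0]) {..<3}"
 proof (rule indep_setsI)
  fix i :: nat assume "i \<in> {..<3}"
  then have "i = 0 \<or> i = 1 \<or> i = 2" by auto
  then show "[?B, ?A, sets F0] ! i \<subseteq> events"
   using i by (auto simp: indep_sets_def numeral_3_eq_3 lessThan_Suc)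
 next
  fix X and J :: "nat set"
  assume J: "J \<noteq> {}" "J \<subseteq> {..<3}" "finite J" and X: "\<forall>j\<in>J. X j \<in> [?B, ?A, sets F0] ! j"
  define p :: "nat => nat" where "p = id(0 := 1, 1 := 0)"
  have inj: "inj p" by (auto simp: p_def inj_def)
  have pp: "p (p j) = j" for j by (auto simp: p_def)
  have "\<forall>j\<in>p ` J. X (p j) \<in> [?A, ?B, sets F0] ! j"
  proof
   fix j assume "j \<in> p ` J"
   then have j: "p j \<in> J" using pp by auto
   then have "p j = 0 \<or> p j = 1 \<or> p j = 2" using J(2) by auto
   then show "X (p j) \<in> [?A, ?B, sets F0] ! j" using X[rule_format, OF j] by (auto simp: p_def split: if_splits)
  qed
  moreover have "p ` J \<subseteq> {..<3}" using J(2) by (auto simp: p_def)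
  ultimately have "prob (\<Inter>j\<in>p ` J. X (p j)) = (\<Prod>j\<in>p ` J. prob (X (p j)))"
   using J by (intro indep_setsD[OF i]) auto
  then show "prob (\<Inter>j\<in>J. X j) = (\<Prod>j\<in>J. prob (X j))"
   using inj by (simp add: prod.reindex inj_on_def inj_def pp)
 qed
 then show ?thesis using b by (simp add: mf_basis_def)
qed

context mean_field_basis
begin

abbreviation "F \<equiv> full_filt M F0 W W0"
abbreviation "H \<equiv> common_filt M W0"

lemma swap: "mean_field_basis M F0 W0 W"
 using basis mf_basis_swap by unfold_locales

lemma complete: "complete_measure M" and bm: "brownian_motion M W" and bm0: "brownian_motion M W0"
 and subF0: "subalgebra M F0"
 using basis by (auto simp: mf_basis_def)

lemma W_meas: "0 <= t ==> W t \<in> borel_measurable M" "0 <= t ==> W0 t \<in> borel_measurable M"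
 using bm bm0 by (auto simp: brownian_motion_def)

lemma W_zero: "AE w in M. W 0 w = 0"
 using bm by (auto simp: brownian_motion_def)

abbreviation "past s \<equiv> path_events M W {0..s} \<union> path_events M W0 {0..s} \<union> sets F0 \<union> null_sets M"

lemma past_events: "past s \<subseteq> events"
 using path_events_subset_events[of "{0..s}" W] path_events_subset_events[of "{0..s}" W0] W_meas subF0
 by (auto simp: subalgebra_def)

lemma past_Pow: "past s \<subseteq> Pow (space M)"
 using past_events sets.space_closed by blast

text \<open>The intersection in \<open>full_filt\<close> is already a sigma-algebra, so generating
  one from it adds nothing.\<close>

lemma sets_F: "sets (F t) = (\<Inter>s\<in>{t<..}. sigma_sets (space M) (past s))"
proof -
 have P: "(\<Inter>s\<in>{t<..}. sigma_sets (space M) (past s)) \<subseteq> Pow (space M)"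
 proof
  fix x assume "x \<in> (\<Inter>s\<in>{t<..}. sigma_sets (space M) (past s))"
  then have "x \<in> sigma_sets (space M) (past (t + 1))" by (rule INT_D) simp
  then show "x \<in> Pow (space M)" using sigma_sets_into_sp[OF past_Pow] by blast
 qed
 have "sigma_sets (space M) (\<Inter>s\<in>{t<..}. sigma_sets (space M) (past s)) \<subseteq> sigma_sets (space M) (past s)"
  if "s > t" for s
  using that by (intro sigma_sets_mono) auto
 then show ?thesis
  unfolding full_filt_def using P by (subst sets_measure_of) auto
qed

lemma space_F [simp]: "space (F t) = space M"
 by (simp add: full_filt_def space_measure_of_conv)

lemma space_H [simp]: "space (H t) = space M"
 by (simp add: common_filt_def space_measure_of_conv)

lemma H_Pow: "path_events M W0 {0..t} \<union> null_sets M \<subseteq> Pow (space M)"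
 using past_Pow[of t] by auto

lemma sets_H: "sets (H t) = sigma_sets (space M) (path_events M W0 {0..t} \<union> null_sets M)"
 unfolding common_filt_def using H_Pow by (rule sets_measure_of)

lemma subalg_F: "subalgebra M (F t)"
proof -
 have "sigma_sets (space M) (past (t + 1)) \<subseteq> events"
  by (rule sets.sigma_sets_subset[OF past_events])
 then have "sets (F t) \<subseteq> events" unfolding sets_F by (auto dest!: bspec[of _ _ "t + 1"])
 then show ?thesis by (simp add: subalgebra_def)
qed

lemma H_le_F: "sets (H s) \<subseteq> sets (F s)"
 unfolding sets_H sets_F
proof (intro INF_greatest)
 fix r assume "r \<in> {s<..}"
 then show "sigma_sets (space M) (path_events M W0 {0..s} \<union> null_sets M) \<subseteq> sigma_sets (space M) (past r)"
  using path_events_mono[of "{0..s}" "{0..r}" M W0] by (intro sigma_sets_mono') auto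
qed

lemma F_mono: "s <= t ==> sets (F s) \<subseteq> sets (F t)"
 unfolding sets_F by auto

lemma H_mono: "s <= t ==> sets (H s) \<subseteq> sets (H t)"
 unfolding sets_H using path_events_mono[of "{0..s}" "{0..t}" M W0] by (intro sigma_sets_mono') auto

lemma subalg_H: "subalgebra M (H t)"
 using H_le_F[of t] subalg_F[of t] by (auto simp: subalgebra_def)

lemma subalgebra_F_mono: "s <= t ==> subalgebra (F t) (F s)"
 using F_mono by (auto simp: subalgebra_def)

lemma subalgebra_H_mono: "s <= t ==> subalgebra (H t) (H s)"
 using H_mono by (auto simp: subalgebra_def)

lemma subalgebra_F_H: "subalgebra (F t) (H t)"
 using H_le_F by (auto simp: subalgebra_def)

lemma F0_le_F: "sets F0 \<subseteq> sets (F s)"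
 unfolding sets_F by (auto intro: sigma_sets.Basic)

lemma null_le_H: "null_sets M \<subseteq> sets (H s)"
 unfolding sets_H by auto

lemma null_le_F: "null_sets M \<subseteq> sets (F s)"
 using null_le_H H_le_F by blast

lemma meas_F_mono: "f \<in> borel_measurable (F s) ==> s <= t ==> f \<in> borel_measurable (F t)"
 using measurable_from_subalg[OF subalgebra_F_mono] .

lemma meas_H_mono: "f \<in> borel_measurable (H s) ==> s <= t ==> f \<in> borel_measurable (H t)"
 using measurable_from_subalg[OF subalgebra_H_mono] .

lemma meas_H_F: "f \<in> borel_measurable (H s) ==> f \<in> borel_measurable (F s)"
 using measurable_from_subalg[OF subalgebra_F_H] .

lemma meas_F_M: "f \<in> borel_measurable (F s) ==> f \<in> borel_measurable M"
 using measurable_from_subalg[OF subalg_F] .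

lemma W0_meas_H: "0 <= s ==> s <= t ==> W0 s \<in> borel_measurable (H t)"
 unfolding common_filt_def using H_Pow by (intro measurable_path_events[where J = "{0..t}"]) auto

lemma W0_meas_F: "0 <= s ==> s <= t ==> W0 s \<in> borel_measurable (F t)"
 using W0_meas_H meas_H_F by blast

lemma W_meas_F: "0 <= s ==> s <= t ==> W s \<in> borel_measurable (F t)"
 using mean_field_basis.W0_meas_F[OF swap, of s t] by (simp add: full_filt_swap)

lemma indep3:
 assumes "A \<in> sigma_sets (space M) (path_events M W {0..})" "B \<in> sigma_sets (space M) (path_events M W0 {0..})"
  "C \<in> sets F0"
 shows "prob (A \<inter> B \<inter> C) = prob A * prob B * prob C"
proof -
 have "indep_sets ((!) [sigma_sets (space M) (path_events M W {0..}), sigma_sets (space M) (path_events M W0 {0..}),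
   sets F0]) {..<3}"
  using basis by (simp add: mf_basis_def)
 from indep_setsD[OF this, of "{..<3}" "%i. [A, B, C] ! i"] assms
 show ?thesis by (simp add: numeral_3_eq_3 lessThan_Suc Int_ac mult_ac)
qed

lemma increment_events_subset:
 assumes "0 <= r"
 shows "sigma_sets (space M) (path_events M (%t w. W t w - W r w) {r..}) \<subseteq> sigma_sets (space M) (path_events M W {0..})"
  "sigma_sets (space M) (path_events M (%t w. W t w - W 0 w) {0..r}) \<subseteq> sigma_sets (space M) (path_events M W {0..})"
 using assms
 by (intro sigma_path_events_subset path_events_Pow borel_measurable_diff
   measurable_path_events[where J = "{0..}"]; auto)+

lemma events_W: "sigma_sets (space M) (path_events M W {0..}) \<subseteq> events"
 by (intro sets.sigma_sets_subset path_events_subset_events W_meas) auto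

text \<open>Up to null sets the raw past is generated by intersections of a past event of
  \<open>W\<close>, a past event of \<open>W0\<close> and an initial event. On these the formula
  follows from the independence of the three sources and, for each noise, of past and
  future.\<close>

lemma indep_past_increments:
 assumes r: "0 <= r" and E: "E \<in> sigma_sets (space M) (past r)"
  and K: "K \<in> sigma_sets (space M) (path_events M (%t w. W t w - W r w) {r..})"
  and K0: "K0 \<in> sigma_sets (space M) (path_events M (%t w. W0 t w - W0 r w) {r..})"
 shows "prob (E \<inter> (K \<inter> K0)) = prob E * prob K * prob K0"
proof -
 interpret sw: mean_field_basis M F0 W0 W by (rule swap)
 let ?\<A> = "sigma_sets (space M) (path_events M (%t w. W t w - W 0 w) {0..r})"
 let ?\<B> = "sigma_sets (space M) (path_events M (%t w. W0 t w - W0 0 w) {0..r})"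
 let ?W = "sigma_sets (space M) (path_events M W {0..})" and ?WO = "sigma_sets (space M) (path_events M W0 {0..})"
 define RR where "RR = {A \<inter> B \<inter> C | A B C. A \<in> ?\<A> \<and> B \<in> ?\<B> \<and> C \<in> sets F0}"
 interpret AA: sigma_algebra "space M" ?\<A> by (rule sigma_algebra_sigma_sets) (rule path_events_Pow)
 interpret BB: sigma_algebra "space M" ?\<B> by (rule sigma_algebra_sigma_sets) (rule path_events_Pow)
 interpret WW: sigma_algebra "space M" ?W by (rule sigma_algebra_sigma_sets) (rule path_events_Pow)
 interpret WW0: sigma_algebra "space M" ?WO by (rule sigma_algebra_sigma_sets) (rule path_events_Pow)
 have sp: "space M \<in> sets F0" using subF0 sets.top[of F0] by (simp add: subalgebra_def)
 have Ksub: "K \<in> ?W" "K0 \<in> ?WO" using K K0 increment_events_subset(1)[OF r] sw.increment_events_subset(1)[OF r] by auto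
 have Kev: "K \<in> events" "K0 \<in> events" using Ksub events_W sw.events_W by auto
 have PK: "prob (K \<inter> K0) = prob K * prob K0"
  using indep3[OF Ksub sp] Kev by (simp add: prob_space Int_absorb2 sets.sets_into_space)
 have RR_ev: "RR \<subseteq> events"
 proof
  fix x assume "x \<in> RR"
  then obtain A B C where x: "A \<in> ?\<A>" "B \<in> ?\<B>" "C \<in> sets F0" "x = A \<inter> B \<inter> C"
   unfolding RR_def by blast
  have "A \<in> events" using x(1) increment_events_subset(2)[OF r] events_W by blast
  moreover have "B \<in> events" using x(2) sw.increment_events_subset(2)[OF r] sw.events_W by blast
  moreover have "C \<in> events" using x(3) subF0 by (auto simp: subalgebra_def)
  ultimately show "x \<in> events" using x(4) by simp
 qed
 have prod: "prob (x \<inter> (K \<inter> K0)) = prob x * prob (K \<inter> K0)" if "x \<in> RR \<union> null_sets M" for x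
 proof (cases "x \<in> null_sets M")
  case True
  then have "x \<inter> (K \<inter> K0) \<in> null_sets M" using Kev by (intro null_set_Int2) auto
  then show ?thesis using True by (simp add: null_sets_def measure_def)
 next
  case False
  with that obtain A B C where x: "x = A \<inter> B \<inter> C" "A \<in> ?\<A>" "B \<in> ?\<B>" "C \<in> sets F0" by (auto simp: RR_def)
  have AW: "A \<in> ?W" "B \<in> ?WO"
   using x increment_events_subset(2)[OF r] sw.increment_events_subset(2)[OF r] by auto
  \<comment> \<open>Grouped by source, so that \<open>indep3\<close> separates the noises before
    past and future are separated within each of them.\<close>
  have "x \<inter> (K \<inter> K0) = (A \<inter> K) \<inter> (B \<inter> K0) \<inter> C" using x by auto
  then have "prob (x \<inter> (K \<inter> K0)) = prob (A \<inter> K) * prob (B \<inter> K0) * prob C"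
   using indep3[of "A \<inter> K" "B \<inter> K0" C] AW Ksub x by auto
  also have "prob (A \<inter> K) = prob A * prob K"
   using brownian_indep_past_future[OF bm r] x(2) K by (auto simp: indep_sets2_eq)
  also have "prob (B \<inter> K0) = prob B * prob K0"
   using brownian_indep_past_future[OF bm0 r] x(3) K0 by (auto simp: indep_sets2_eq)
  also have "prob A * prob K * (prob B * prob K0) * prob C = prob x * prob (K \<inter> K0)"
   using indep3[OF AW x(4)] x(1) PK by simp
  finally show ?thesis .
 qed
 have stable: "Int_stable (RR \<union> null_sets M)"
 proof (rule Int_stable_Un_null_sets[OF Int_stableI RR_ev])
  fix a b assume "a \<in> RR" "b \<in> RR"
  then obtain A B C A' B' C' where ab: "A \<in> ?\<A>" "B \<in> ?\<B>" "C \<in> sets F0" "a = A \<inter> B \<inter> C"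
   "A' \<in> ?\<A>" "B' \<in> ?\<B>" "C' \<in> sets F0" "b = A' \<inter> B' \<inter> C'" unfolding RR_def by blast
  have "a \<inter> b = (A \<inter> A') \<inter> (B \<inter> B') \<inter> (C \<inter> C')" using ab by blast
  moreover have "A \<inter> A' \<in> ?\<A>" "B \<inter> B' \<in> ?\<B>" "C \<inter> C' \<in> sets F0"
   using AA.Int BB.Int sets.Int ab by blast+
  ultimately show "a \<inter> b \<in> RR" unfolding RR_def by blast
 qed
 let ?S = "sigma (space M) (RR \<union> null_sets M)"
 have RP: "RR \<union> null_sets M \<subseteq> Pow (space M)" using RR_ev sets.space_closed by blast
 have setsS: "sets ?S = sigma_sets (space M) (RR \<union> null_sets M)" using RP by (rule sets_measure_of)
 have subS: "subalgebra M ?S"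
  unfolding subalgebra_def setsS using sets.sigma_sets_subset[of "RR \<union> null_sets M" M] RR_ev
  by (auto simp: space_measure_of_conv)
 have nullS: "null_sets M \<subseteq> sets ?S" unfolding setsS by auto
 have incl: "?\<A> \<subseteq> RR" "?\<B> \<subseteq> RR" "sets F0 \<subseteq> RR"
 proof -
  have I: "A \<inter> B \<inter> C \<in> RR" if "A \<in> ?\<A>" "B \<in> ?\<B>" "C \<in> sets F0" for A B C
   using that unfolding RR_def by blast
  show "?\<A> \<subseteq> RR"
  proof
   fix A assume "A \<in> ?\<A>"
   with I[OF this BB.top sp] AA.sets_into_space show "A \<in> RR" by (simp add: Int_absorb2)
  qed
  show "?\<B> \<subseteq> RR"
  proof
   fix A assume "A \<in> ?\<B>"
   with I[OF AA.top this sp] BB.sets_into_space[of A] show "A \<in> RR" by (simp add: Int_absorb1 Int_absorb2)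
  qed
  show "sets F0 \<subseteq> RR"
  proof
   fix A assume A: "A \<in> sets F0"
   then have "A \<subseteq> space M" using sets.sets_into_space[of A F0] subF0 by (simp add: subalgebra_def)
   with I[OF AA.top BB.top A] show "A \<in> RR" by (simp add: Int_absorb1)
  qed
 qed
 \<comment> \<open>Off a null set the value of a noise is its increment from time 0, and the null
   sets belong to the generator.\<close>
 have Wm: "V t \<in> borel_measurable ?S"
  if "t \<in> {0..r}" "sigma_sets (space M) (path_events M (%t w. V t w - V 0 w) {0..r}) \<subseteq> RR" "AE w in M. V 0 w = 0"
  for t and V :: "real => 'a => real"
 proof (rule measurable_AE_eq_complete[OF complete subS nullS])
  have "path_events M (%t w. V t w - V 0 w) {0..r} \<subseteq> RR \<union> null_sets M"
   using that(2) sigma_sets.Basic by blast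
  with that(1) RP show "(%w. V t w - V 0 w) \<in> borel_measurable ?S"
   by (intro measurable_path_events[where V = "%t w. V t w - V 0 w"])
  show "AE w in M. V t w = V t w - V 0 w" using that(3) by eventually_elim simp
 qed
 have "past r \<subseteq> sigma_sets (space M) (RR \<union> null_sets M)"
 proof -
  have "sigma_sets (space M) (path_events M W {0..r}) \<subseteq> sigma_sets (space M) (RR \<union> null_sets M)"
   by (rule sigma_path_events_subset[OF RP Wm[OF _ incl(1) W_zero]])
  moreover have "sigma_sets (space M) (path_events M W0 {0..r}) \<subseteq> sigma_sets (space M) (RR \<union> null_sets M)"
   by (rule sigma_path_events_subset[OF RP Wm[OF _ incl(2) sw.W_zero]])
  moreover have "sets F0 \<union> null_sets M \<subseteq> sigma_sets (space M) (RR \<union> null_sets M)"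
   using incl(3) sigma_sets_superset_generator[of "RR \<union> null_sets M" "space M"] by blast
  ultimately show ?thesis
   using sigma_sets_superset_generator[of "path_events M W {0..r}" "space M"]
    sigma_sets_superset_generator[of "path_events M W0 {0..r}" "space M"] by (simp add: Un_least subset_trans[of "path_events M _ _"])
 qed
 from sigma_sets_mono[OF this] E have "E \<in> sigma_sets (space M) (RR \<union> null_sets M)" by (rule subsetD)
 have RN: "RR \<union> null_sets M \<subseteq> events" using RR_ev by (simp add: null_sets_def subset_iff)
 have "prob (E \<inter> (K \<inter> K0)) = prob E * prob (K \<inter> K0)"
  by (rule indep_set_Int_right[OF prod stable RN sets.Int[OF Kev] \<open>E \<in> sigma_sets (space M) (RR \<union> null_sets M)\<close>])
 then show ?thesis using PK by simp
qed

end

context prob_space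
begin

lemma is_cmI:
 assumes "sq_int M U" "sq_int M V" "V \<in> borel_measurable G" "subalgebra M G"
  and "!!A b. A \<in> sets G ==> (\<integral>w. indicator A w * ((U w - V w) \<bullet> b) \<partial>M) = 0"
 shows "is_cm M G U V"
proof -
 have "(\<integral>w. indicator A w *\<^sub>R (U w - V w) \<partial>M) = 0" if A: "A \<in> sets G" for A
 proof -
  have AM: "A \<in> sets M" using A assms(4) by (auto simp: subalgebra_def)
  have "integrable M (%w. indicator A w *\<^sub>R (U w - V w))"
   by (intro sq_int_integrable[OF finite_measure_axioms] sq_int_indicator sq_int_diff assms(1,2) AM)
  from integral_bounded_linear[OF bounded_linear_inner_left this]
  have "(\<integral>w. indicator A w *\<^sub>R (U w - V w) \<partial>M) \<bullet> b = 0" for b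
   using assms(5)[OF A, of b] by simp
  then show ?thesis using inner_eq_zero_iff by blast
 qed
 then show ?thesis using assms(1-3) by (simp add: is_cm_def)
qed

end

context mean_field_basis
begin

abbreviation "incr_alg V r \<equiv> sigma_sets (space M) (path_events M (%t w. V t w - V r w) {r..})"
abbreviation "future_gen V s \<equiv> (\<Union>r\<in>{s<..}. incr_alg V r) \<union> null_sets M"

lemma incr_alg_antimono:
 fixes V :: "real => 'a => real"
 assumes "r <= r'"
 shows "incr_alg V r' \<subseteq> incr_alg V r"
proof -
 have "(%w. V t w - V r' w) \<in> borel_measurable (sigma (space M) (path_events M (%t w. V t w - V r w) {r..}))"
  if "t \<in> {r'..}" for t
 proof -
  have "(%w. V u w - V r w) \<in> borel_measurable (sigma (space M) (path_events M (%t w. V t w - V r w) {r..}))"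
   if "u \<in> {r..}" for u
   using measurable_path_events[where V = "%t w. V t w - V r w", OF that order_refl path_events_Pow] .
  from borel_measurable_diff[OF this[of t] this[of r']] that assms show ?thesis by simp
 qed
 then show ?thesis by (rule sigma_path_events_subset[OF path_events_Pow])
qed

lemma incr_alg_events: "0 <= r ==> incr_alg W r \<subseteq> events"
 using increment_events_subset(1)[of r] events_W by (rule subset_trans)

lemma future_gen_W:
 assumes "0 <= s"
 shows "future_gen W s \<subseteq> events" (is ?g1) "Int_stable (future_gen W s)" (is ?g2)
proof -
 have e: "incr_alg W r \<subseteq> events" if "r \<in> {s<..}" for r
  using incr_alg_events[of r] that assms by auto
 show ?g1
  by (rule Un_least[OF UN_least[OF e]]) (auto simp: null_sets_def)
 show ?g2
 proof (rule Int_stable_Un_null_sets)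
  show "(\<Union>r\<in>{s<..}. incr_alg W r) \<subseteq> events" using e by (rule UN_least)
  show "Int_stable (\<Union>r\<in>{s<..}. incr_alg W r)"
  proof (rule Int_stable_directed)
   fix i j assume "i \<in> {s<..}" "j \<in> {s<..}"
   then show "\<exists>k\<in>{s<..}. incr_alg W i \<union> incr_alg W j \<subseteq> incr_alg W k"
    by (intro bexI[of _ "min i j"] Un_least incr_alg_antimono) auto
  qed (intro Int_stable_sigma_sets path_events_Pow)
 qed
qed

lemma sets_future:
 assumes "0 <= s"
 shows "sets (future M W s) = sigma_sets (space M) (future_gen W s)"
 unfolding future_def
 by (rule sets_measure_of) (use future_gen_W(1)[OF assms] sets.space_closed in blast)

lemma space_future [simp]: "space (future M V s) = space M"
 by (simp add: future_def space_measure_of_conv)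

lemma subalg_future: "0 <= s ==> subalgebra M (future M W s)"
 using sets.sigma_sets_subset[OF future_gen_W(1)] by (simp add: subalgebra_def sets_future)

lemma space_in_future_gen: "space M \<in> future_gen V s"
 by (intro UnI1 UN_I[of "s + 1"] sigma_sets_top) auto

text \<open>The increments behind \<open>K\<close> and \<open>K0\<close> start at times after
  \<open>s\<close>. At the smaller of these times \<open>E\<close> already belongs to the raw past,
  so the preceding result applies there.\<close>

lemma indep_gen:
 assumes s: "0 <= s" and E: "E \<in> sets (F s)" and K: "K \<in> future_gen W s" and K0: "K0 \<in> future_gen W0 s"
 shows "prob (E \<inter> (K \<inter> K0)) = prob E * prob K * prob K0"
proof -
 interpret sw: mean_field_basis M F0 W0 W by (rule swap)
 have ev: "E \<in> events" "K \<in> events" "K0 \<in> events"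
  using subalg_F[of s] E K K0 future_gen_W(1)[OF s] sw.future_gen_W(1)[OF s] by (auto simp: subalgebra_def)
 show ?thesis
 proof (cases "K \<in> null_sets M \<or> K0 \<in> null_sets M")
  case True
  then have "E \<inter> (K \<inter> K0) \<in> null_sets M"
  proof
   assume "K \<in> null_sets M"
   then show ?thesis using ev by (intro null_set_Int1 null_set_Int2)
  next
   assume "K0 \<in> null_sets M"
   then show ?thesis using ev by (intro null_set_Int1)
  qed
  then show ?thesis using True by (auto simp: null_sets_def measure_def)
 next
  case False
  then obtain r r' where r: "s < r" "K \<in> incr_alg W r" "s < r'" "K0 \<in> incr_alg W0 r'"
   using K K0 by blast
  let ?r = "min r r'"
  have "K \<in> incr_alg W ?r" "K0 \<in> incr_alg W0 ?r"
   using incr_alg_antimono[of ?r r W] incr_alg_antimono[of ?r r' W0] r(2,4) by auto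
  moreover have "E \<in> sigma_sets (space M) (past ?r)" using E r(1,3) unfolding sets_F by auto
  ultimately show ?thesis using s r(1,3) by (intro indep_past_increments[of ?r]) auto
 qed
qed

text \<open>One factor at a time is enlarged from its generating family to the full sigma-algebra.
  Together the claims make the past, the future of \<open>W0\<close> and the future of
  \<open>W\<close> mutually independent.\<close>

lemma indep_F_future:
 assumes s: "0 <= s" and E: "E \<in> sets (F s)" and K: "K \<in> sets (future M W s)" and K0: "K0 \<in> sets (future M W0 s)"
 shows "prob (E \<inter> K0 \<inter> K) = prob (E \<inter> K0) * prob K" (is ?g1) "prob (E \<inter> K0) = prob E * prob K0" (is ?g2)
proof -
 interpret sw: mean_field_basis M F0 W0 W by (rule swap)
 have ev: "E \<in> events" using subalg_F[of s] E by (auto simp: subalgebra_def)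
 have Esp: "E \<inter> space M = E" using sets.sets_into_space[OF ev] by blast
 have sp: "L \<in> events ==> L \<inter> space M = L" "L \<in> events ==> space M \<inter> L = L" for L
  using sets.sets_into_space[of L M] by blast+
 have g0: "future_gen W0 s \<subseteq> events" and g: "future_gen W s \<subseteq> events"
  using future_gen_W(1)[OF s] sw.future_gen_W(1)[OF s] by blast+
 have 1: "prob (L \<inter> E) = prob L * prob E" if "L \<in> future_gen W0 s" for L
 proof -
  have "L \<in> events" using g0 that by (rule subsetD)
  then have "prob (E \<inter> L) = prob E * prob L"
   using indep_gen[OF s E space_in_future_gen that] sp(2)[of L] by (simp add: prob_space)
  then show ?thesis by (simp add: Int_commute mult.commute)
 qed
 have 2: "prob (L \<inter> E) = prob L * prob E" if "L \<in> sets (future M W0 s)" for L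
  by (rule indep_set_Int_right[OF 1 sw.future_gen_W(2)[OF s] g0 ev])
   (use that sw.sets_future[OF s] in auto)
 show *: ?g2 using 2[OF K0] by (simp add: Int_commute mult.commute)
 have b1: "prob (L \<inter> E) = prob L * prob E" if "L \<in> future_gen W s" for L
 proof -
  have "L \<in> events" using g that by (rule subsetD)
  then have "prob (E \<inter> L) = prob E * prob L"
   using indep_gen[OF s E that space_in_future_gen] sp(1)[of L] by (simp add: prob_space)
  then show ?thesis by (simp add: Int_commute mult.commute)
 qed
 have b2: "prob (L \<inter> E) = prob L * prob E" if "L \<in> sets (future M W s)" for L
  by (rule indep_set_Int_right[OF b1 future_gen_W(2)[OF s] g ev])
   (use that sets_future[OF s] in auto)
 have 3: "prob (L \<inter> (E \<inter> L0)) = prob L * prob (E \<inter> L0)" if L: "L \<in> sets (future M W s)" "L0 \<in> future_gen W0 s" for L L0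
 proof (rule indep_set_Int_right[OF _ future_gen_W(2)[OF s] g])
  show "L \<in> sigma_sets (space M) (future_gen W s)" using L sets_future[OF s] by auto
  have "L0 \<in> events" using L(2) g0 by auto
  then show "E \<inter> L0 \<in> events" using ev by auto
  fix a assume a: "a \<in> future_gen W s"
  have "prob (a \<inter> (E \<inter> L0)) = prob (E \<inter> (a \<inter> L0))" by (simp add: Int_ac)
  also have "\<dots> = prob a * prob (E \<inter> L0)"
   using indep_gen[OF s E a L(2)] 1[OF L(2)] by (simp add: Int_commute mult_ac)
  finally show "prob (a \<inter> (E \<inter> L0)) = prob a * prob (E \<inter> L0)" .
 qed
 have Kev: "K \<in> events" using K subalg_future[OF s] by (auto simp: subalgebra_def)
 have "prob (K0 \<inter> (E \<inter> K)) = prob K0 * prob (E \<inter> K)"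
 proof (rule indep_set_Int_right[OF _ sw.future_gen_W(2)[OF s] g0])
  show "K0 \<in> sigma_sets (space M) (future_gen W0 s)" using K0 sw.sets_future[OF s] by auto
  show "E \<inter> K \<in> events" using ev Kev by auto
  fix a assume a: "a \<in> future_gen W0 s"
  have "prob (a \<inter> (E \<inter> K)) = prob (K \<inter> (E \<inter> a))" by (simp add: Int_ac)
  also have "\<dots> = prob a * prob (E \<inter> K)"
   using 3[OF K a] 1[OF a] b2[OF K] by (simp add: Int_commute mult_ac)
  finally show "prob (a \<inter> (E \<inter> K)) = prob a * prob (E \<inter> K)" .
 qed
 then show ?g1
  using * b2[OF K] by (simp add: Int_ac mult_ac)
qed

lemma W_cont: "AE w in M. continuous_on {0..} (%t. W t w)"
 using bm by (simp add: brownian_motion_def)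

lemma future_meas:
 assumes s: "0 <= s" "s <= t"
 shows "(%w. W t w - W s w) \<in> borel_measurable (future M W s)"
proof (cases "s = t")
 case False
 \<comment> \<open>Times in \<open>{s<..t}\<close> decreasing to \<open>s\<close>. By continuity of
   the paths, the increment from \<open>s\<close> is the almost sure limit of increments from
   \<open>r n\<close>, whose events are among the generators.\<close>
 define r where "r n = s + (t - s) / (real n + 2)" for n :: nat
 have r: "s < r n" "r n <= t" for n
 proof -
  show "s < r n" using False s by (simp add: r_def)
  have "(t - s) / (real n + 2) <= (t - s) / 1" using s by (intro divide_left_mono) auto
  then show "r n <= t" by (simp add: r_def)
 qed
 have rlim: "r \<longlonglongrightarrow> s"
 proof -
  have "(%n. s + (t - s) * (1 / (real n + 2))) \<longlonglongrightarrow> s + (t - s) * 0"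
   using LIMSEQ_ignore_initial_segment[OF lim_1_over_n, of 2] by (intro tendsto_intros) (simp add: add.commute)
  moreover have "(%n. s + (t - s) * (1 / (real n + 2))) = r" by (simp add: r_def fun_eq_iff)
  ultimately show ?thesis by simp
 qed
 show ?thesis
 proof (rule measurable_AE_limit_complete[OF complete subalg_future[OF s(1)]])
  show "null_sets M \<subseteq> sets (future M W s)"
   unfolding sets_future[OF s(1)] by (rule subset_trans[OF _ sigma_sets_superset_generator]) simp
  show "(%w. W t w - W (r n) w) \<in> borel_measurable (future M W s)" for n
  proof (rule measurableI)
   fix A :: "real set" assume "A \<in> sets borel"
   then have "(%w. W t w - W (r n) w) -` A \<inter> space M \<in> path_events M (%t w. W t w - W (r n) w) {r n..}"
    unfolding path_events_def using r(2)[of n] by auto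
   then have "(%w. W t w - W (r n) w) -` A \<inter> space M \<in> future_gen W s"
    by (intro UnI1 UN_I[of "r n"] sigma_sets.Basic) (use r in auto)
   then show "(%w. W t w - W (r n) w) -` A \<inter> space (future M W s) \<in> sets (future M W s)"
    unfolding sets_future[OF s(1)] by (simp add: sigma_sets.Basic)
  qed auto
  show "AE w in M. (%n. W t w - W (r n) w) \<longlonglongrightarrow> W t w - W s w"
   using W_cont
  proof eventually_elim
   case (elim w)
   have "(%n. W (r n) w) \<longlonglongrightarrow> W s w"
    by (rule continuous_on_tendsto_compose[OF elim rlim])
     (use s r(1) in \<open>auto intro!: always_eventually less_imp_le order_trans[OF s(1)]\<close>)
   then show ?case by (intro tendsto_intros)
  qed
 qed
qed simp

text \<open>The past at \<open>s\<close> enlarged by the whole common noise. It contains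
  \<open>H t\<close> for every \<open>t\<close> and is nevertheless independent of the future of
  \<open>W\<close>, which is the reason why integrals against \<open>W\<close> have conditional mean
  zero.\<close>

definition mixed :: "real => 'a measure" where
 "mixed s = sigma (space M) {E \<inter> K0 | E K0. E \<in> sets (F s) \<and> K0 \<in> sets (future M W0 s)}"

lemma mixed_gen:
 assumes "0 <= s"
 shows "{E \<inter> K0 | E K0. E \<in> sets (F s) \<and> K0 \<in> sets (future M W0 s)} \<subseteq> events" (is ?g1)
  "Int_stable {E \<inter> K0 | E K0. E \<in> sets (F s) \<and> K0 \<in> sets (future M W0 s)}" (is ?g2)
  "sets (mixed s) = sigma_sets (space M) {E \<inter> K0 | E K0. E \<in> sets (F s) \<and> K0 \<in> sets (future M W0 s)}" (is ?g3)
proof -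
 interpret sw: mean_field_basis M F0 W0 W by (rule swap)
 show ev: ?g1
  using subalg_F[of s] sw.subalg_future[OF assms] by (auto simp: subalgebra_def)
 show ?g2
 proof (rule Int_stableI)
  fix a b assume "a \<in> {E \<inter> K0 | E K0. E \<in> sets (F s) \<and> K0 \<in> sets (future M W0 s)}"
   "b \<in> {E \<inter> K0 | E K0. E \<in> sets (F s) \<and> K0 \<in> sets (future M W0 s)}"
  then obtain E K E' K' where *: "E \<in> sets (F s)" "K \<in> sets (future M W0 s)" "a = E \<inter> K"
   "E' \<in> sets (F s)" "K' \<in> sets (future M W0 s)" "b = E' \<inter> K'" by blast
  then have "a \<inter> b = (E \<inter> E') \<inter> (K \<inter> K')" by blast
  with sets.Int[OF *(1,4)] sets.Int[OF *(2,5)]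
  show "a \<inter> b \<in> {E \<inter> K0 | E K0. E \<in> sets (F s) \<and> K0 \<in> sets (future M W0 s)}" by blast
 qed
 show ?g3
  unfolding mixed_def by (rule sets_measure_of) (use ev sets.space_closed in blast)
qed

lemma subalg_mixed: "0 <= s ==> subalgebra M (mixed s)"
 using sets.sigma_sets_subset[OF mixed_gen(1)]
 by (simp add: subalgebra_def mixed_gen(3)) (simp add: mixed_def space_measure_of_conv)

lemma space_mixed [simp]: "space (mixed s) = space M"
 by (simp add: mixed_def space_measure_of_conv)

lemma F_le_mixed: "0 <= s ==> sets (F s) \<subseteq> sets (mixed s)"
proof
 fix E assume s: "0 <= s" and E: "E \<in> sets (F s)"
 then have "E = E \<inter> space (future M W0 s)" using sets.sets_into_space[OF E] by auto
 with E have "E \<in> {E \<inter> K0 | E K0. E \<in> sets (F s) \<and> K0 \<in> sets (future M W0 s)}"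
  using sets.top[of "future M W0 s"] by blast
 then show "E \<in> sets (mixed s)" unfolding mixed_gen(3)[OF s] by (rule sigma_sets.Basic)
qed

lemma future_le_mixed: "0 <= s ==> sets (future M W0 s) \<subseteq> sets (mixed s)"
proof
 fix E assume s: "0 <= s" and E: "E \<in> sets (future M W0 s)"
 then have "E = space (F s) \<inter> E" using sets.sets_into_space[OF E] by auto
 with E have "E \<in> {E \<inter> K0 | E K0. E \<in> sets (F s) \<and> K0 \<in> sets (future M W0 s)}"
  using sets.top[of "F s"] by blast
 then show "E \<in> sets (mixed s)" unfolding mixed_gen(3)[OF s] by (rule sigma_sets.Basic)
qed

lemma meas_F_mixed: "0 <= s ==> f \<in> borel_measurable (F s) ==> f \<in> borel_measurable (mixed s)"
 by (rule measurable_from_subalg[of "mixed s" "F s"]) (simp_all add: subalgebra_def F_le_mixed)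

lemma meas_mixed_M: "0 <= s ==> f \<in> borel_measurable (mixed s) ==> f \<in> borel_measurable M"
 using measurable_from_subalg[OF subalg_mixed] .

text \<open>A value of \<open>W0\<close> after \<open>s\<close> is its value at \<open>s\<close>,
  which belongs to the past, plus an increment from the future.\<close>

lemma H_le_mixed:
 assumes s: "0 <= s"
 shows "sets (H t) \<subseteq> sets (mixed s)"
proof -
 interpret sw: mean_field_basis M F0 W0 W by (rule swap)
 have W0m: "W0 u \<in> borel_measurable (mixed s)" if "0 <= u" for u
 proof (cases "u <= s")
  case True
  then show ?thesis using W0_meas_F that by (intro meas_F_mixed s) auto
 next
  case False
  have "(%w. W0 u w - W0 s w) \<in> borel_measurable (mixed s)"
   using sw.future_meas[OF s, of u] False future_le_mixed[OF s]
    measurable_from_subalg[of "mixed s" "future M W0 s"] by (simp add: subalgebra_def)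
  moreover have "W0 s \<in> borel_measurable (mixed s)" using W0_meas_F[OF s order_refl] by (rule meas_F_mixed[OF s])
  ultimately have "(%w. (W0 u w - W0 s w) + W0 s w) \<in> borel_measurable (mixed s)" by (rule borel_measurable_add)
  then show ?thesis by simp
 qed
 have "path_events M W0 {0..t} \<subseteq> sets (mixed s)"
  using path_events_subset_events[of "{0..t}" W0 "mixed s"] W0m by (simp add: path_events_def)
 moreover have "null_sets M \<subseteq> sets (mixed s)" using null_le_F F_le_mixed[OF s] by blast
 ultimately show ?thesis
  unfolding sets_H using sets.sigma_sets_subset[of "path_events M W0 {0..t} \<union> null_sets M" "mixed s"] by simp
qed

lemma meas_H_mixed: "0 <= s ==> f \<in> borel_measurable (H t) ==> f \<in> borel_measurable (mixed s)"
 by (rule measurable_from_subalg[of "mixed s" "H t"]) (simp_all add: subalgebra_def H_le_mixed)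

lemma indep_var_mixed_future:
 fixes \<zeta> \<kappa> :: "'a => real"
 assumes s: "0 <= s" and z: "\<zeta> \<in> borel_measurable (mixed s)" and k: "\<kappa> \<in> borel_measurable (future M W s)"
 shows "indep_var borel \<zeta> borel \<kappa>"
proof -
 have ind: "indep_set (sets (mixed s)) (sets (future M W s))"
 proof (rule indep_setI)
  show "sets (mixed s) \<subseteq> events" "sets (future M W s) \<subseteq> events"
   using subalg_mixed[OF s] subalg_future[OF s] by (auto simp: subalgebra_def)
  fix a b assume a: "a \<in> sets (mixed s)" and b: "b \<in> sets (future M W s)"
  show "prob (a \<inter> b) = prob a * prob b"
  proof (rule indep_set_Int_right[OF _ mixed_gen(2,1)[OF s]])
   show "b \<in> events" using b subalg_future[OF s] by (auto simp: subalgebra_def)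
   show "a \<in> sigma_sets (space M) {E \<inter> K0 | E K0. E \<in> sets (F s) \<and> K0 \<in> sets (future M W0 s)}"
    using a mixed_gen(3)[OF s] by simp
   fix c assume "c \<in> {E \<inter> K0 | E K0. E \<in> sets (F s) \<and> K0 \<in> sets (future M W0 s)}"
   then obtain E K0 where "E \<in> sets (F s)" "K0 \<in> sets (future M W0 s)" "c = E \<inter> K0" by blast
   then show "prob (c \<inter> b) = prob c * prob b" using indep_F_future(1)[OF s _ b] by simp
  qed
 qed
 have sub: "sigma_sets (space M) {f -` A \<inter> space M | A. A \<in> sets borel} \<subseteq> sets G"
  if "f \<in> borel_measurable G" "space G = space M" for f :: "'a => real" and G
 proof -
  have "{f -` A \<inter> space M | A. A \<in> sets borel} \<subseteq> sets G" using measurable_sets[OF that(1)] that(2) by auto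
  from sets.sigma_sets_subset[OF this] that(2) show ?thesis by simp
 qed
 have zM: "\<zeta> \<in> borel_measurable M" by (rule meas_mixed_M[OF s z])
 have kM: "\<kappa> \<in> borel_measurable M" by (rule measurable_from_subalg[OF subalg_future[OF s] k])
 have "indep_set (sigma_sets (space M) {\<zeta> -` A \<inter> space M | A. A \<in> sets borel})
   (sigma_sets (space M) {\<kappa> -` A \<inter> space M | A. A \<in> sets borel})"
 proof (rule indep_setI)
  note z' = sub[OF z space_mixed] and k' = sub[OF k space_future]
  show "sigma_sets (space M) {\<zeta> -` A \<inter> space M | A. A \<in> sets borel} \<subseteq> events"
   by (rule subset_trans[OF z' indep_setD_ev1[OF ind]])
  show "sigma_sets (space M) {\<kappa> -` A \<inter> space M | A. A \<in> sets borel} \<subseteq> events"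
   by (rule subset_trans[OF k' indep_setD_ev2[OF ind]])
  show "prob (a \<inter> b) = prob a * prob b"
   if "a \<in> sigma_sets (space M) {\<zeta> -` A \<inter> space M | A. A \<in> sets borel}"
    "b \<in> sigma_sets (space M) {\<kappa> -` A \<inter> space M | A. A \<in> sets borel}" for a b
   by (rule indep_setD[OF ind subsetD[OF z' that(1)] subsetD[OF k' that(2)]])
 qed
 then show ?thesis using zM kM by (simp add: indep_var_eq)
qed

section \<open>Moments of noise increments and conditional means of their products\<close>

lemma increment_moments:
 assumes "0 <= s" "s <= t"
 shows "sq_int M (%w. W t w - W s w)" "(\<integral>w. (W t w - W s w) \<partial>M) = 0"
  "(\<integral>w. (W t w - W s w)^2 \<partial>M) = t - s"
proof -
 have m: "(%w. W t w - W s w) \<in> borel_measurable M" using W_meas(1) assms by auto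
 have "sq_int M (%w. W t w - W s w) \<and> (\<integral>w. (W t w - W s w) \<partial>M) = 0 \<and> (\<integral>w. (W t w - W s w)^2 \<partial>M) = t - s"
 proof (cases "s = t")
  case False
  with assms have lt: "s < t" by simp
  define \<sigma> where "\<sigma> = sqrt (t - s)"
  have \<sigma>: "0 < \<sigma>" "\<sigma>^2 = t - s" using lt by (auto simp: \<sigma>_def)
  have d: "distributed M lborel (%w. W t w - W s w) (normal_density 0 \<sigma>)"
   using bm assms(1) lt by (simp add: brownian_motion_def \<sigma>_def)
  have "integrable lborel (%x. normal_density 0 \<sigma> x * x^2)"
   using integrable_normal_moment[OF \<sigma>(1), of 0 2] by simp
  then have "integrable M (%w. (W t w - W s w)^2)"
   using distributed_integrable[OF d, of "%x. x^2"] by (simp add: normal_density_nonneg)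
  moreover have "(\<integral>w. (W t w - W s w)^2 \<partial>M) = t - s"
   using distributed_integral[OF d, of "%x. x^2"] integral_normal_moment_even[OF \<sigma>(1), of 0 1] \<sigma>(2)
   by (simp add: normal_density_nonneg)
  moreover have "(\<integral>w. (W t w - W s w) \<partial>M) = 0"
   using distributed_integral[OF d, of "%x. x"] integral_normal_moment_nz_1[OF \<sigma>(1), of 0]
   by (simp add: normal_density_nonneg)
  ultimately show ?thesis using m by (simp add: sq_int_def)
 qed simp
 then show "sq_int M (%w. W t w - W s w)" "(\<integral>w. (W t w - W s w) \<partial>M) = 0"
  "(\<integral>w. (W t w - W s w)^2 \<partial>M) = t - s" by blast+
qed

lemma increment_mult:
 fixes \<zeta> :: "'a => real"
 assumes s: "0 <= s" "s <= t" and z: "integrable M \<zeta>" "\<zeta> \<in> borel_measurable (mixed s)"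
 shows "integrable M (%w. \<zeta> w * (W t w - W s w))" (is ?g1) "(\<integral>w. \<zeta> w * (W t w - W s w) \<partial>M) = 0" (is ?g2)
  "integrable M (%w. \<zeta> w * (W t w - W s w)^2)" (is ?g3)
  "(\<integral>w. \<zeta> w * (W t w - W s w)^2 \<partial>M) = (t - s) * (\<integral>w. \<zeta> w \<partial>M)" (is ?g4)
proof -
 note k = future_meas[OF s]
 have k2: "(%w. (W t w - W s w)^2) \<in> borel_measurable (future M W s)" using k by measurable
 have i: "integrable M (%w. W t w - W s w)" "integrable M (%w. (W t w - W s w)^2)"
  using increment_moments(1)[OF s] by (auto intro: sq_int_integrable finite_measure_axioms simp: sq_int_def)
 note a = indep_var_mixed_future[OF s(1) z(2) k] and b = indep_var_mixed_future[OF s(1) z(2) k2]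
 show ?g1 by (rule indep_var_integrable[OF a z(1) i(1)])
 show ?g2
  using indep_var_lebesgue_integral[OF a z(1) i(1)] increment_moments(2)[OF s] by simp
 show ?g3 by (rule indep_var_integrable[OF b z(1) i(2)])
 show ?g4
  using indep_var_lebesgue_integral[OF b z(1) i(2)] increment_moments(3)[OF s] by simp
qed

lemma increment_scaleR:
 fixes \<zeta> :: "'a => 'b::euclidean_space"
 assumes s: "0 <= s" "s <= t" and z: "sq_int M \<zeta>" "\<zeta> \<in> borel_measurable (F s)"
 shows "sq_int M (%w. (W t w - W s w) *\<^sub>R \<zeta> w)" (is ?g1)
  "(l2 M (%w. (W t w - W s w) *\<^sub>R \<zeta> w))^2 = (t - s) * (l2 M \<zeta>)^2" (is ?g2)
proof -
 have [measurable]: "\<zeta> \<in> borel_measurable (mixed s)" by (rule meas_F_mixed[OF s(1) z(2)])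
 have m: "(%w. (norm (\<zeta> w))^2) \<in> borel_measurable (mixed s)" by measurable
 note inc = increment_mult(3,4)[OF s sq_int_integrable_sq[OF z(1)] m]
 have m: "(%w. (W t w - W s w) *\<^sub>R \<zeta> w) \<in> borel_measurable M"
  using W_meas(1) s z(1) by (intro borel_measurable_scaleR borel_measurable_diff) (auto simp: sq_int_def)
 with inc(1) show ?g1
  by (simp add: sq_int_def power_mult_distrib mult.commute)
 show ?g2
  using inc(2) by (simp add: l2_sq power_mult_distrib mult.commute)
qed

lemma increment_orthogonal:
 assumes s: "0 <= s" "s <= t" and z: "sq_int M \<zeta>" "\<zeta> \<in> borel_measurable (F s)"
  and e: "sq_int M \<eta>" "\<eta> \<in> borel_measurable (mixed s)"
 shows "(\<integral>w. \<eta> w \<bullet> ((W t w - W s w) *\<^sub>R \<zeta> w) \<partial>M) = 0"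
proof -
 have "(%w. \<eta> w \<bullet> \<zeta> w) \<in> borel_measurable (mixed s)"
  using e(2) meas_F_mixed[OF s(1) z(2)] by (rule borel_measurable_inner)
 from increment_mult(2)[OF s sq_int_inner[OF e(1) z(1)] this] show ?thesis
  by (simp add: mult.commute)
qed

text \<open>Events of \<open>H r\<close> belong to \<open>mixed s\<close> for every
  \<open>r\<close>, also beyond \<open>t\<close>, so their indicators are orthogonal to the
  increment of \<open>W\<close> times a coefficient known at \<open>s\<close>.\<close>

lemma is_cm_increment_0:
 assumes s: "0 <= s" "s <= t" and z: "sq_int M \<zeta>" "\<zeta> \<in> borel_measurable (F s)"
 shows "is_cm M (H r) (%w. (W t w - W s w) *\<^sub>R \<zeta> w) (%_. 0)"
proof (rule is_cmI[OF increment_scaleR(1)[OF assms] sq_int_zero _ subalg_H])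
 fix A b assume A: "A \<in> sets (H r)"
 then have AM: "A \<in> sets M" and Am: "A \<in> sets (mixed s)" using subalg_H H_le_mixed[OF s(1)] by (auto simp: subalgebra_def)
 have "(\<integral>w. (indicator A w *\<^sub>R b) \<bullet> ((W t w - W s w) *\<^sub>R \<zeta> w) \<partial>M) = 0"
 proof (rule increment_orthogonal[OF assms])
  show "sq_int M (%w. indicator A w *\<^sub>R b)" by (intro sq_int_indicator sq_int_const finite_measure_axioms AM)
  show "(%w. indicator A w *\<^sub>R b) \<in> borel_measurable (mixed s)" using Am by measurable
 qed
 then show "(\<integral>w. indicator A w * (((W t w - W s w) *\<^sub>R \<zeta> w - 0) \<bullet> b) \<partial>M) = 0"
  by (simp add: inner_commute mult_ac)
qed simp

text \<open>\<open>H t\<close> is generated by \<open>H s\<close> and the later increments of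
  \<open>W0\<close>, and the latter are independent of everything known at \<open>s\<close>. Common
  noise observed after \<open>s\<close> therefore adds no information about
  \<open>\<eta>\<close>.\<close>

lemma is_cm_H_mono:
 assumes s: "0 <= s" "s <= t" and e: "is_cm M (H s) \<eta> y" "\<eta> \<in> borel_measurable (F s)"
 shows "is_cm M (H t) \<eta> y"
proof -
 interpret sw: mean_field_basis M F0 W0 W by (rule swap)
 have sq: "sq_int M \<eta>" "sq_int M y" "y \<in> borel_measurable (H s)" using e by (auto simp: is_cm_def)
 define R where "R = {K1 \<inter> K2 | K1 K2. K1 \<in> sets (H s) \<and> K2 \<in> sets (future M W0 s)}"
 have Hev: "sets (H s) \<subseteq> events" and Fev: "sets (future M W0 s) \<subseteq> events"
  using subalg_H sw.subalg_future[OF s(1)] by (auto simp: subalgebra_def)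
 have Rev: "R \<subseteq> events" unfolding R_def using Hev Fev by auto
 then have RP: "R \<subseteq> Pow (space M)" using sets.space_closed by blast
 have Rst: "Int_stable R"
 proof (rule Int_stableI)
  fix a b assume "a \<in> R" "b \<in> R"
  then obtain E K E' K' where *: "E \<in> sets (H s)" "K \<in> sets (future M W0 s)" "a = E \<inter> K"
   "E' \<in> sets (H s)" "K' \<in> sets (future M W0 s)" "b = E' \<inter> K'" unfolding R_def by blast
  then have "a \<inter> b = (E \<inter> E') \<inter> (K \<inter> K')" by blast
  with sets.Int[OF *(1,4)] sets.Int[OF *(2,5)] show "a \<inter> b \<in> R" unfolding R_def by blast
 qed
 let ?S = "sigma (space M) R"
 have setsS: "sets ?S = sigma_sets (space M) R" by (rule sets_measure_of[OF RP])
 have HS: "sets (H s) \<subseteq> sets ?S"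
 proof
  fix E assume E: "E \<in> sets (H s)"
  then have "E = E \<inter> space (future M W0 s)" using sets.sets_into_space[OF E] by auto
  with E have "E \<in> R" unfolding R_def using sets.top[of "future M W0 s"] by blast
  then show "E \<in> sets ?S" unfolding setsS by (rule sigma_sets.Basic)
 qed
 have FS: "sets (future M W0 s) \<subseteq> sets ?S"
 proof
  fix E assume E: "E \<in> sets (future M W0 s)"
  then have "E = space (H s) \<inter> E" using sets.sets_into_space[OF E] by auto
  with E have "E \<in> R" unfolding R_def using sets.top[of "H s"] by blast
  then show "E \<in> sets ?S" unfolding setsS by (rule sigma_sets.Basic)
 qed
 have W0S: "W0 u \<in> borel_measurable ?S" if "0 <= u" for u
 proof (cases "u <= s")
  case True
  then show ?thesis
   by (intro measurable_from_subalg[of ?S "H s"] W0_meas_H that) (simp_all add: HS subalgebra_def space_measure_of_conv)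
 next
  case False
  have "(%w. W0 u w - W0 s w) \<in> borel_measurable ?S" "W0 s \<in> borel_measurable ?S"
   using measurable_from_subalg[of ?S "H s"] W0_meas_H[OF s(1) order_refl] HS
    measurable_from_subalg[of ?S "future M W0 s"] sw.future_meas[OF s(1), of u] FS False
   by (simp_all add: subalgebra_def space_measure_of_conv)
  from borel_measurable_add[OF this] show ?thesis by simp
 qed
 have sub: "sets (H t) \<subseteq> sigma_sets (space M) R"
 proof -
  have "path_events M W0 {0..t} \<subseteq> sets ?S"
   using path_events_subset_events[of "{0..t}" W0 ?S] W0S by (simp add: path_events_def space_measure_of_conv)
  moreover have "null_sets M \<subseteq> sets ?S" using null_le_H HS by blast
  ultimately show ?thesis
   unfolding sets_H setsS[symmetric]
   using sets.sigma_sets_subset[of "path_events M W0 {0..t} \<union> null_sets M" ?S] by (simp add: space_measure_of_conv)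
 qed
 show ?thesis
 proof (rule is_cmI[OF sq(1,2) meas_H_mono[OF sq(3) s(2)] subalg_H])
  fix A b assume "A \<in> sets (H t)"
  then have A: "A \<in> sigma_sets (space M) R" using sub by auto
  define f where "f w = (\<eta> w - y w) \<bullet> b" for w
  have sf: "sq_int M f" unfolding f_def
   using sq_int_linear[OF sq_int_diff[OF sq(1,2)] bounded_linear_inner_left] .
  have fF: "f \<in> borel_measurable (F s)" unfolding f_def
   using e(2) meas_H_F[OF sq(3)] by measurable
  have int: "set_integrable M B f" if "B \<in> sets M" for B
   unfolding set_integrable_def
   by (rule integrable_mult_indicator[OF that sq_int_integrable[OF finite_measure_axioms sf]])
  have Rsub: "sigma_sets (space M) R \<subseteq> events" by (rule sets.sigma_sets_subset[OF Rev])
  have base: "(LINT w:B|M. f w) = 0" if "B \<in> R" for B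
  proof -
   from that obtain K1 K2 where K: "K1 \<in> sets (H s)" "K2 \<in> sets (future M W0 s)" "B = K1 \<inter> K2"
    unfolding R_def by blast
   have K1F: "K1 \<in> sets (F s)" by (rule subsetD[OF H_le_F K(1)])
   have K1M: "K1 \<in> sets M" "K2 \<in> sets M" by (rule subsetD[OF Hev K(1)], rule subsetD[OF Fev K(2)])
   have z: "(%w. indicator K1 w * f w) \<in> borel_measurable (F s)" using K1F fF by measurable
   have k: "(indicator K2 :: 'a => real) \<in> borel_measurable (future M W0 s)" using K(2) by measurable
   \<comment> \<open>Read with the noises exchanged: a variable of \<open>F s\<close> is independent
     of the future of \<open>W0\<close>.\<close>
   have ind: "indep_var borel (%w. indicator K1 w * f w) borel (indicator K2 :: 'a => real)"
    using sw.meas_F_mixed[OF s(1), of "%w. indicator K1 w * f w"] z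
    by (intro sw.indep_var_mixed_future[OF s(1) _ k]) (simp add: full_filt_swap)
   have i1: "integrable M (%w. indicator K1 w * f w)"
    using int[OF K1M(1)] by (simp add: set_integrable_def)
   have i2: "integrable M (indicator K2 :: 'a => real)" by (rule integrable_real_indicator[OF K1M(2)]) (simp add: less_top[symmetric])
   have "(\<integral>w. indicator K1 w * f w * indicator K2 w \<partial>M) = (\<integral>w. indicator K1 w * f w \<partial>M) * prob K2"
    using indep_var_lebesgue_integral[OF ind i1 i2] K1M(2) by simp
   also have "(\<integral>w. indicator K1 w * f w \<partial>M) = 0"
   proof -
    have "integrable M (%w. indicator K1 w *\<^sub>R (\<eta> w - y w))"
     by (intro sq_int_integrable[OF finite_measure_axioms] sq_int_indicator sq_int_diff sq(1,2) K1M)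
    from integral_bounded_linear[OF bounded_linear_inner_left this, of b]
    show ?thesis using e(1) K(1) by (simp add: is_cm_def f_def)
   qed
   finally show ?thesis
    using K(3) by (simp add: set_lebesgue_integral_def indicator_inter_arith mult_ac)
  qed
  have "(LINT w:A|M. f w) = 0"
  \<comment> \<open>The sets over which \<open>f\<close> integrates to zero are closed under
    disjoint unions and, because the whole space lies in \<open>R\<close>, under
    complements.\<close>
  proof (rule sigma_sets_induct_disjoint[OF Rst RP A])
   fix B assume B: "B \<in> sigma_sets (space M) R" "(LINT w:B|M. f w) = 0"
   have BM: "B \<in> sets M" using B Rsub by blast
   have "space M \<in> R" unfolding R_def
    using sets.top[of "H s"] sets.top[of "future M W0 s"] by (auto intro!: exI[of _ "space M"])
   then have "0 = (LINT w:B \<union> (space M - B)|M. f w)"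
    using base[of "space M"] sets.sets_into_space[OF BM] by (simp add: Un_absorb1)
   also have "\<dots> = (LINT w:B|M. f w) + (LINT w:(space M - B)|M. f w)"
    by (rule set_integral_Un) (use int BM in auto)
   finally show "(LINT w:(space M - B)|M. f w) = 0" using B by simp
  next
   fix B :: "nat => 'a set"
   assume B: "disjoint_family B" "range B \<subseteq> sigma_sets (space M) R" "!!i. (LINT w:B i|M. f w) = 0"
   have BM: "B i \<in> sets M" for i using B(2) Rsub by blast
   have "(LINT w:(\<Union>i. B i)|M. f w) = (\<Sum>i. (LINT w:B i|M. f w))"
    by (rule lebesgue_integral_countable_add)
     (use B(1) BM int in \<open>auto simp: disjoint_family_on_def\<close>)
   then show "(LINT w:(\<Union>i. B i)|M. f w) = 0" using B(3) by simp
  qed (use base in \<open>auto simp: set_lebesgue_integral_def\<close>)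
  then show "(\<integral>w. indicator A w * ((\<eta> w - y w) \<bullet> b) \<partial>M) = 0"
   by (simp add: set_lebesgue_integral_def f_def)
 qed
qed

text \<open>The increment is known in \<open>H t\<close> and can be taken out. Since it is
  unbounded, it is moved onto the test function \<open>\<zeta>\<close>, which is still
  square-integrable, and \<open>is_cm_inner\<close> is applied to \<open>\<eta>\<close>.\<close>

lemma is_cm_increment_W0:
 fixes \<eta> y :: "'a => 'b::euclidean_space"
 assumes s: "0 <= s" "s <= r" "r <= t" and e: "is_cm M (H s) \<eta> y" "\<eta> \<in> borel_measurable (F s)"
 shows "is_cm M (H t) (%w. (W0 r w - W0 s w) *\<^sub>R \<eta> w) (%w. (W0 r w - W0 s w) *\<^sub>R y w)"
proof -
 interpret sw: mean_field_basis M F0 W0 W by (rule swap)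
 have sq: "sq_int M \<eta>" "sq_int M y" "y \<in> borel_measurable (H s)" using e by (auto simp: is_cm_def)
 have c: "is_cm M (H t) \<eta> y" by (rule is_cm_H_mono[OF s(1) order_trans[OF s(2,3)] e])
 have yF: "y \<in> borel_measurable (F s)" by (rule meas_H_F[OF sq(3)])
 have W0H: "(%w. W0 r w - W0 s w) \<in> borel_measurable (H t)"
  using W0_meas_H[of r t] W0_meas_H[of s t] s by simp
 have s1: "sq_int M (%w. (W0 r w - W0 s w) *\<^sub>R \<eta> w)" "sq_int M (%w. (W0 r w - W0 s w) *\<^sub>R y w)"
  using sw.increment_scaleR(1)[OF s(1,2) sq(1)] sw.increment_scaleR(1)[OF s(1,2) sq(2)] e(2) yF
  by (auto simp: full_filt_swap)
 show ?thesis
 proof (rule is_cmI[OF s1 _ subalg_H])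
  show "(%w. (W0 r w - W0 s w) *\<^sub>R y w) \<in> borel_measurable (H t)"
   using W0H meas_H_mono[OF sq(3) order_trans[OF s(2,3)]] by (rule borel_measurable_scaleR)
  fix A and b :: 'b assume A: "A \<in> sets (H t)"
  then have AM: "A \<in> sets M" using subalg_H by (auto simp: subalgebra_def)
  define \<zeta> :: "'a => 'b" where "\<zeta> w = indicator A w *\<^sub>R ((W0 r w - W0 s w) *\<^sub>R b)" for w
  have z: "sq_int M \<zeta>" unfolding \<zeta>_def
   by (intro sq_int_indicator AM sq_int_linear[OF sw.increment_moments(1)[OF s(1,2)] bounded_linear_scaleR_left])
  have zH: "\<zeta> \<in> borel_measurable (H t)" unfolding \<zeta>_def using A W0H by measurable
  have "(\<integral>w. \<zeta> w \<bullet> \<eta> w - \<zeta> w \<bullet> y w \<partial>M) = 0"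
   using is_cm_inner[OF c subalg_H z zH] sq_int_inner[OF z sq(1)] sq_int_inner[OF z sq(2)] by simp
  moreover have "\<zeta> w \<bullet> \<eta> w - \<zeta> w \<bullet> y w =
    indicator A w * (((W0 r w - W0 s w) *\<^sub>R \<eta> w - (W0 r w - W0 s w) *\<^sub>R y w) \<bullet> b)" for w
   by (simp add: \<zeta>_def inner_diff_left inner_commute algebra_simps)
  ultimately show "(\<integral>w. indicator A w * (((W0 r w - W0 s w) *\<^sub>R \<eta> w - (W0 r w - W0 s w) *\<^sub>R y w) \<bullet> b) \<partial>M) = 0"
   by simp
 qed
qed

end

section \<open>Square-integrable processes\<close>

text \<open>The process on \<open>{s<..t}\<close> as a function on the product space, zero
  elsewhere, so that Fubini's theorem and the \<open>l2\<close>-lemmas apply without restricted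
  measures. Half-open intervals let consecutive pieces add up exactly.\<close>

definition cut :: "real => real => (real => 'a => 'b::euclidean_space) => real \<times> 'a => 'b" where
 "cut s t Z = (%(r, w). indicator {s<..t} r *\<^sub>R Z r w)"

definition l2proc :: "'a measure => real => (real => 'a => 'b::euclidean_space) => bool" where
 "l2proc M T Z \<longleftrightarrow> sq_int (lborel \<Otimes>\<^sub>M M) (cut 0 T Z)"

context prob_space
begin

lemma pair_lborel: "pair_sigma_finite lborel M"
 by (intro pair_sigma_finite.intro sigma_finite_lborel sigma_finite_measure_axioms)

lemma cut_sq_int:
 assumes "l2proc M T Z" "0 <= s" "t <= T"
 shows "sq_int (lborel \<Otimes>\<^sub>M M) (cut s t Z)"
proof -
 have m: "{s<..t} \<times> space M \<in> sets (lborel \<Otimes>\<^sub>M M)" by measurable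
 have "sq_int (lborel \<Otimes>\<^sub>M M) (%x. indicator ({s<..t} \<times> space M) x *\<^sub>R cut 0 T Z x)"
  using assms(1) m by (intro sq_int_indicator) (auto simp: l2proc_def)
 moreover have "cut s t Z x = indicator ({s<..t} \<times> space M) x *\<^sub>R cut 0 T Z x" if "x \<in> space (lborel \<Otimes>\<^sub>M M)" for x
  using assms that by (auto simp: cut_def indicator_def space_pair_measure)
 ultimately show ?thesis
  unfolding sq_int_def by (simp cong: measurable_cong Bochner_Integration.integrable_cong)
qed

lemma l2proc_add: "l2proc M T Z ==> l2proc M T Z' ==> l2proc M T (%t w. Z t w + Z' t w)"
 unfolding l2proc_def using sq_int_add[of "lborel \<Otimes>\<^sub>M M" "cut 0 T Z" "cut 0 T Z'"]
 by (simp add: cut_def case_prod_beta' scaleR_add_right)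

lemma l2proc_linear:
 assumes "l2proc M T Z" "bounded_linear L"
 shows "l2proc M T (%t w. L (Z t w))"
proof -
 interpret L: bounded_linear L by fact
 show ?thesis
  using sq_int_linear[OF assms(1)[unfolded l2proc_def] assms(2)]
  by (simp add: l2proc_def cut_def case_prod_beta' L.scaleR)
qed

lemma l2proc_diff: "l2proc M T Z ==> l2proc M T Z' ==> l2proc M T (%t w. Z t w - Z' t w)"
 unfolding l2proc_def using sq_int_diff[of "lborel \<Otimes>\<^sub>M M" "cut 0 T Z" "cut 0 T Z'"]
 by (simp add: cut_def case_prod_beta' scaleR_diff_right)

lemma integral_time_const:
 fixes f :: "'a => real"
 assumes "integrable M f" "s <= t"
 shows "integrable (lborel \<Otimes>\<^sub>M M) (%x. indicator {s<..t} (fst x) * f (snd x))" (is ?g1)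
  "(\<integral>x. indicator {s<..t} (fst x) * f (snd x) \<partial>(lborel \<Otimes>\<^sub>M M)) = (t - s) * (\<integral>w. f w \<partial>M)" (is ?g2)
proof -
 interpret P: pair_sigma_finite lborel M by (rule pair_lborel)
 have [measurable]: "f \<in> borel_measurable M" using assms by auto
 have i: "integrable lborel (indicator {s<..t} :: real => real)"
  by (rule integrable_real_indicator) (use assms(2) in auto)
 show int: ?g1
 proof (rule P.Fubini_integrable)
  show "integrable lborel (%x. \<integral>y. norm (indicator {s<..t} (fst (x, y)) * f (snd (x, y))) \<partial>M)"
   using i by (simp add: abs_mult)
  show "AE x in lborel. integrable M (%y. indicator {s<..t} (fst (x, y)) * f (snd (x, y)))"
   using assms by simp
 qed measurable
 have "(\<integral>x. indicator {s<..t} (fst x) * f (snd x) \<partial>(lborel \<Otimes>\<^sub>M M)) =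
   (\<integral>r. (\<integral>w. indicator {s<..t} r * f w \<partial>M) \<partial>lborel)"
  using P.integral_fst'[OF int] by simp
 also have "\<dots> = (t - s) * (\<integral>w. f w \<partial>M)" using assms(2) by simp
 finally show ?g2 .
qed

lemma cut_const:
 assumes "sq_int M \<zeta>" "s <= t"
 shows "sq_int (lborel \<Otimes>\<^sub>M M) (cut s t (%_. \<zeta>))"
proof -
 have [measurable]: "\<zeta> \<in> borel_measurable M" using assms by (simp add: sq_int_def)
 have m: "cut s t (%_. \<zeta>) \<in> borel_measurable (lborel \<Otimes>\<^sub>M M)" unfolding cut_def by measurable
 have "(norm (cut s t (%_. \<zeta>) x))^2 = indicator {s<..t} (fst x) * (norm (\<zeta> (snd x)))^2" for x
  by (simp add: cut_def case_prod_beta' power_mult_distrib indicator_def)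
 with m integral_time_const(1)[OF sq_int_integrable_sq[OF assms(1)] assms(2)]
 show ?thesis by (simp add: sq_int_def)
qed

lemma l2proc_const: "sq_int M \<zeta> ==> 0 <= T ==> l2proc M T (%_. \<zeta>)"
 unfolding l2proc_def by (rule cut_const)

lemma time_integral_inner:
 assumes Z: "l2proc M T Z" "l2proc M T Z'" and st: "0 <= s" "t <= T"
 shows "set_integrable lborel {s<..t} (%r. \<integral>w. Z r w \<bullet> Z' r w \<partial>M)" (is ?g1)
  "(\<integral>x. cut s t Z x \<bullet> cut s t Z' x \<partial>(lborel \<Otimes>\<^sub>M M)) = (LBINT r:{s<..t}. \<integral>w. Z r w \<bullet> Z' r w \<partial>M)" (is ?g2)
proof -
 interpret P: pair_sigma_finite lborel M by (rule pair_lborel)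
 have i: "integrable (lborel \<Otimes>\<^sub>M M) (%x. cut s t Z x \<bullet> cut s t Z' x)"
  by (intro sq_int_inner cut_sq_int[OF Z(1) st] cut_sq_int[OF Z(2) st])
 have e: "(\<integral>w. cut s t Z (r, w) \<bullet> cut s t Z' (r, w) \<partial>M) = indicator {s<..t} r *\<^sub>R (\<integral>w. Z r w \<bullet> Z' r w \<partial>M)" for r
  by (simp add: cut_def indicator_def)
 show ?g1
  using P.integrable_fst'[OF i] by (simp add: e set_integrable_def)
 show ?g2
  using P.integral_fst'[OF i] by (simp add: e set_lebesgue_integral_def)
qed

lemma time_integral_sq:
 assumes Z: "l2proc M T Z" and st: "0 <= s" "t <= T"
 shows "set_integrable lborel {s<..t} (%r. \<integral>w. (norm (Z r w))^2 \<partial>M)"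
  "(\<integral>x. (norm (cut s t Z x))^2 \<partial>(lborel \<Otimes>\<^sub>M M)) = (LBINT r:{s<..t}. \<integral>w. (norm (Z r w))^2 \<partial>M)"
 using time_integral_inner[OF Z Z st] by (simp_all add: power2_norm_eq_inner)

lemma l2proc_AE:
 assumes Z: "l2proc M T Z"
 shows "AE r in lborel. r \<in> {0<..T} --> sq_int M (Z r)"
proof -
 interpret P: pair_sigma_finite lborel M by (rule pair_lborel)
 have i: "integrable (lborel \<Otimes>\<^sub>M M) (%x. (norm (cut 0 T Z x))^2)"
  and m: "cut 0 T Z \<in> borel_measurable (lborel \<Otimes>\<^sub>M M)"
  using Z by (auto simp: l2proc_def sq_int_def)
 show ?thesis
  using P.AE_integrable_fst'[OF i]
 proof eventually_elim
  case (elim r)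
  show ?case
  proof
   assume r: "r \<in> {0<..T}"
   have "(%w. cut 0 T Z (r, w)) \<in> borel_measurable M"
    by (rule measurable_compose[OF measurable_Pair1' m]) simp
   then show "sq_int M (Z r)" using elim r by (simp add: cut_def sq_int_def)
  qed
 qed
qed

lemma nn_cut_le_energy:
 fixes G :: "real => 'a => 'b::euclidean_space"
 assumes m: "cut s t G \<in> borel_measurable (lborel \<Otimes>\<^sub>M M)" and st: "0 <= s" "t <= T"
 shows "(\<integral>\<^sup>+x. ennreal ((norm (cut s t G x))^2) \<partial>(lborel \<Otimes>\<^sub>M M)) <= energy M {0..T} G"
proof -
 interpret P: pair_sigma_finite lborel M by (rule pair_lborel)
 have "(\<integral>\<^sup>+x. ennreal ((norm (cut s t G x))^2) \<partial>(lborel \<Otimes>\<^sub>M M)) =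
   (\<integral>\<^sup>+w. (\<integral>\<^sup>+r. ennreal ((norm (cut s t G (r, w)))^2) \<partial>lborel) \<partial>M)"
  by (rule P.nn_integral_snd[symmetric]) (use m in measurable)
 also have "\<dots> <= energy M {0..T} G"
  unfolding energy_def using st
  by (intro nn_integral_mono) (auto simp: cut_def indicator_def)
 finally show ?thesis .
qed

text \<open>Progressivity at the single time \<open>T\<close> is joint measurability on the strip,
  and extension by zero carries it to the whole product. For negative \<open>T\<close> the cut is
  identically zero.\<close>

lemma progressive_cut:
 assumes p: "progressive G T Z" and G: "subalgebra M (G T)" and st: "0 <= s" "t <= T"
 shows "cut s t Z \<in> borel_measurable (lborel \<Otimes>\<^sub>M M)"
proof (cases "0 <= T")
 case True
 have m: "(%(r, w). Z r w) \<in> borel_measurable (restrict_space borel {0..T} \<Otimes>\<^sub>M G T)"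
  using p True by (auto simp: progressive_def)
 have "(%x. x) \<in> measurable (restrict_space (lborel \<Otimes>\<^sub>M M) {x. fst x \<in> {0..T}}) (restrict_space borel {0..T} \<Otimes>\<^sub>M G T)"
 proof (subst measurable_pair_iff, intro conjI)
  show "fst \<circ> (%x. x) \<in> restrict_space (lborel \<Otimes>\<^sub>M M) {x. fst x \<in> {0..T}} \<rightarrow>\<^sub>M restrict_space borel {0..T}"
   by (rule measurable_restrict_space2) (auto simp: space_restrict_space intro!: measurable_restrict_space1)
  have "snd \<in> lborel \<Otimes>\<^sub>M M \<rightarrow>\<^sub>M G T"
  proof (rule measurable_compose[OF measurable_snd])
   show "(%x. x) \<in> M \<rightarrow>\<^sub>M G T" using G by (auto simp: subalgebra_def measurable_def)
  qed
  then show "snd \<circ> (%x. x) \<in> restrict_space (lborel \<Otimes>\<^sub>M M) {x. fst x \<in> {0..T}} \<rightarrow>\<^sub>M G T"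
   by (auto simp: comp_def intro: measurable_restrict_space1)
 qed
 from measurable_compose[OF this m]
 have 1: "(%(r, w). Z r w) \<in> borel_measurable (restrict_space (lborel \<Otimes>\<^sub>M M) {x. fst x \<in> {0..T}})" by simp
 have "{x. fst x \<in> {0..T}} \<inter> space (lborel \<Otimes>\<^sub>M M) = {x \<in> space (lborel \<Otimes>\<^sub>M M). fst x \<in> {0..T}}" by auto
 also have "\<dots> \<in> sets (lborel \<Otimes>\<^sub>M M)" by measurable
 finally have "(%x. indicator {x. fst x \<in> {0..T}} x *\<^sub>R (%(r, w). Z r w) x) \<in> borel_measurable (lborel \<Otimes>\<^sub>M M)"
  using 1 by (subst borel_measurable_restrict_space_iff[symmetric])
 then have "(%x. indicator {s<..t} (fst x) *\<^sub>R (indicator {x. fst x \<in> {0..T}} x *\<^sub>R (%(r, w). Z r w) x)) \<in> borel_measurable (lborel \<Otimes>\<^sub>M M)"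
  by (rule borel_measurable_scaleR[rotated]) measurable
 also have "(%x. indicator {s<..t} (fst x) *\<^sub>R (indicator {x. fst x \<in> {0..T}} x *\<^sub>R (%(r, w). Z r w) x)) = cut s t Z"
  using st by (auto simp: cut_def fun_eq_iff indicator_def)
 finally show ?thesis .
next
 case False
 then have "cut s t Z = (%_. 0)" using st by (auto simp: cut_def fun_eq_iff)
 then show ?thesis by simp
qed

lemma L2_prog_l2proc:
 assumes "Z \<in> L2_prog M G T" "subalgebra M (G T)"
 shows "l2proc M T Z"
 unfolding l2proc_def
proof (rule sq_intI_nn)
 show m: "cut 0 T Z \<in> borel_measurable (lborel \<Otimes>\<^sub>M M)"
  by (rule progressive_cut[where G = G and T = T]) (use assms in \<open>auto simp: L2_prog_def\<close>)
 show "(\<integral>\<^sup>+x. ennreal ((norm (cut 0 T Z x))^2) \<partial>(lborel \<Otimes>\<^sub>M M)) < \<infinity>"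
  using nn_cut_le_energy[OF m order_refl order_refl] assms(1) by (auto simp: L2_prog_def)
qed

lemma sq_int_orthogonal_sum:
 fixes D :: "nat => 'a => 'b::euclidean_space"
 assumes "!!k. k < N ==> sq_int M (D k)" "!!j k. j < k ==> k < N ==> (\<integral>w. D j w \<bullet> D k w \<partial>M) = 0"
 shows "(\<integral>w. (norm (\<Sum>k<N. D k w))^2 \<partial>M) = (\<Sum>k<N. \<integral>w. (norm (D k w))^2 \<partial>M)"
 using assms
proof (induction N)
 case (Suc N)
 have "(\<integral>w. (\<Sum>k<N. D k w) \<bullet> D N w \<partial>M) = (\<Sum>k<N. \<integral>w. D k w \<bullet> D N w \<partial>M)"
  unfolding inner_sum_left
  by (rule Bochner_Integration.integral_sum) (use Suc.prems in \<open>auto intro!: sq_int_inner\<close>)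
 also have "\<dots> = 0" using Suc.prems by simp
 finally have o: "(\<integral>w. (\<Sum>k<N. D k w) \<bullet> D N w \<partial>M) = 0" .
 have "(\<integral>w. (norm ((\<Sum>k<N. D k w) + D N w))^2 \<partial>M) =
   (\<integral>w. (norm (\<Sum>k<N. D k w))^2 \<partial>M) + (\<integral>w. (norm (D N w))^2 \<partial>M)"
  using integral_norm_sq_add[OF sq_int_sum[of "{..<N}" M D], of "D N"] Suc.prems o by simp
 then show ?case using Suc by simp
qed simp

end

section \<open>Stochastic integrals\<close>

text \<open>Projection of a time onto the interval from \<open>s\<close> to \<open>t\<close>. The
  increment of a simple integral over that interval is the integral along the projected
  partition.\<close>

definition clamp_time :: "real => real => real => real" where
 "clamp_time s t x = max s (min t x)"

lemma clamp_time_range: "s <= t ==> s <= clamp_time s t x" "s <= t ==> clamp_time s t x <= t"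
 by (auto simp: clamp_time_def)

lemma clamp_time_mono: "x <= y ==> clamp_time s t x <= clamp_time s t y"
 by (auto simp: clamp_time_def)

lemma simple_integral_increment:
 assumes "s <= t"
 shows "simple_integral W N \<tau> \<eta> t w - simple_integral W N \<tau> \<eta> s w =
  (\<Sum>k<N. (W (clamp_time s t (\<tau> (Suc k))) w - W (clamp_time s t (\<tau> k)) w) *\<^sub>R \<eta> k w)"
proof -
 \<comment> \<open>Wherever \<open>x\<close> lies, stopping at \<open>t\<close> and at
   \<open>s\<close> differs by the increment from \<open>s\<close> to the projection of
   \<open>x\<close>.\<close>
 have "W (min t x) w - W (min s x) w = W (clamp_time s t x) w - W s w" for x
  using assms by (cases "x <= s"; cases "x <= t") (auto simp: clamp_time_def min_def max_def)
 note * = this[of "\<tau> (Suc _)"] this[of "\<tau> _"]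
 have "(W (min t (\<tau> (Suc k))) w - W (min t (\<tau> k)) w) - (W (min s (\<tau> (Suc k))) w - W (min s (\<tau> k)) w) =
   W (clamp_time s t (\<tau> (Suc k))) w - W (clamp_time s t (\<tau> k)) w" for k
  using *(1)[of k] *(2)[of k] by linarith
 then show ?thesis
  by (simp add: simple_integral_def sum_subtractf[symmetric] scaleR_diff_left[symmetric])
qed

lemma cut_simple_proc:
 assumes "s <= t"
 shows "cut s t (simple_proc N \<tau> \<eta>) (r, w) =
  (\<Sum>k<N. indicator {clamp_time s t (\<tau> k)<..clamp_time s t (\<tau> (Suc k))} r *\<^sub>R \<eta> k w)"
proof -
 have "indicator {s<..t} r * indicator {a<..b} r = (indicator {clamp_time s t a<..clamp_time s t b} r :: real)" for a b
  using assms by (auto simp: indicator_def clamp_time_def)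
 then have "indicator {s<..t} r *\<^sub>R (indicator {\<tau> k<..\<tau> (Suc k)} r *\<^sub>R \<eta> k w) =
   (indicator {clamp_time s t (\<tau> k)<..clamp_time s t (\<tau> (Suc k))} r :: real) *\<^sub>R \<eta> k w" for k
  by (simp only: scaleR_scaleR)
 then show ?thesis unfolding cut_def simple_proc_def scaleR_sum_right prod.case by (intro sum.cong refl)
qed

context mean_field_basis
begin

lemma swF: "full_filt M F0 W0 W = F"
 by (rule full_filt_swap)

text \<open>In contrast to \<open>simple_data\<close> the coefficients are only square-integrable,
  as the Euler scheme produces them, and no horizon is fixed.\<close>

definition sq_data :: "nat => (nat => real) => (nat => 'a => 'b::euclidean_space) => bool" where
 "sq_data N \<tau> \<eta> \<longleftrightarrow> 0 <= \<tau> 0 \<and> (\<forall>k<N. \<tau> k <= \<tau> (Suc k)) \<and>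
   (\<forall>k<N. sq_int M (\<eta> k) \<and> \<eta> k \<in> borel_measurable (F (\<tau> k)))"

lemma simple_data_sq_data:
 assumes "simple_data F T N \<tau> \<eta>"
 shows "sq_data N \<tau> \<eta>"
proof -
 from assms obtain c where c: "\<forall>k<N. \<forall>w\<in>space (F (\<tau> k)). norm (\<eta> k w) <= c"
  unfolding simple_data_def by blast
 have "sq_int M (\<eta> k)" if "k < N" for k
  by (rule sq_int_bounded[where c = c, OF finite_measure_axioms meas_F_M]) (use assms that c in \<open>auto simp: simple_data_def\<close>)
 then show ?thesis using assms by (auto simp: simple_data_def sq_data_def)
qed

lemma sq_data_tau_mono:
 assumes "sq_data N \<tau> \<eta>" "i <= j" "j <= N"
 shows "\<tau> i <= \<tau> j"
proof -
 have "\<tau> i <= \<tau> j" using assms(2,3)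
 proof (induction j rule: dec_induct)
  case (step j)
  then show ?case using assms(1) by (auto simp: sq_data_def intro: order_trans)
 qed simp
 then show ?thesis .
qed

text \<open>The increment over \<open>[s,t]\<close> of one summand of a simple integral; it vanishes unless
 \<open>\<eta> k\<close> is known at its left end point.\<close>

definition piece :: "(real => 'a => real) => real => real => (nat => real) => (nat => 'a => 'b::euclidean_space) => nat => 'a => 'b" where
 "piece V s t \<tau> \<eta> k w = (V (clamp_time s t (\<tau> (Suc k))) w - V (clamp_time s t (\<tau> k)) w) *\<^sub>R \<eta> k w"

lemma piece_cases:
 assumes d: "sq_data N \<tau> \<eta>" and st: "0 <= s" "s <= t" and k: "k < N"
 obtains "piece V s t \<tau> \<eta> k = (%_. 0)" "clamp_time s t (\<tau> (Suc k)) = clamp_time s t (\<tau> k)"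
 | "\<eta> k \<in> borel_measurable (F (clamp_time s t (\<tau> k)))"
proof (cases "\<tau> k <= t")
 case True
 then have "\<tau> k <= clamp_time s t (\<tau> k)" by (simp add: clamp_time_def)
 moreover have "\<eta> k \<in> borel_measurable (F (\<tau> k))" using d k by (simp add: sq_data_def)
 ultimately show ?thesis using that(2) meas_F_mono by blast
next
 case False
 moreover have "\<tau> k <= \<tau> (Suc k)" using d k by (simp add: sq_data_def)
 ultimately have "clamp_time s t (\<tau> (Suc k)) = clamp_time s t (\<tau> k)" by (simp add: clamp_time_def)
 then show ?thesis using that(1) by (simp add: piece_def fun_eq_iff)
qed

lemma clamp_step:
 assumes d: "sq_data N \<tau> \<eta>" and st: "0 <= s" "s <= t" and k: "k < N"
 shows "0 <= clamp_time s t (\<tau> k)" "clamp_time s t (\<tau> k) <= clamp_time s t (\<tau> (Suc k))"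
 using d k st clamp_time_range(1)[OF st(2), of "\<tau> k"] by (auto simp: sq_data_def intro!: clamp_time_mono)

lemma piece_props:
 assumes d: "sq_data N \<tau> \<eta>" and st: "0 <= s" "s <= t" and k: "k < N"
 shows "sq_int M (piece W s t \<tau> \<eta> k)"
  "(\<integral>w. (norm (piece W s t \<tau> \<eta> k w))^2 \<partial>M) =
    (clamp_time s t (\<tau> (Suc k)) - clamp_time s t (\<tau> k)) * (\<integral>w. (norm (\<eta> k w))^2 \<partial>M)"
  "piece W s t \<tau> \<eta> k \<in> borel_measurable (F (clamp_time s t (\<tau> (Suc k))))"
  "is_cm M (H r) (piece W s t \<tau> \<eta> k) (%_. 0)"
proof -
 note c = clamp_step[OF assms]
 have z: "sq_int M (\<eta> k)" using d k by (simp add: sq_data_def)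
 have "sq_int M (piece W s t \<tau> \<eta> k) \<and> (\<integral>w. (norm (piece W s t \<tau> \<eta> k w))^2 \<partial>M) =
    (clamp_time s t (\<tau> (Suc k)) - clamp_time s t (\<tau> k)) * (\<integral>w. (norm (\<eta> k w))^2 \<partial>M) \<and>
  piece W s t \<tau> \<eta> k \<in> borel_measurable (F (clamp_time s t (\<tau> (Suc k)))) \<and>
  is_cm M (H r) (piece W s t \<tau> \<eta> k) (%_. 0)"
 proof (cases rule: piece_cases[OF assms, of W])
  case 1
  then show ?thesis by (simp add: is_cm_def)
 next
  case 2
  have "(%w. W (clamp_time s t (\<tau> (Suc k))) w - W (clamp_time s t (\<tau> k)) w) \<in> borel_measurable (F (clamp_time s t (\<tau> (Suc k))))"
   using W_meas_F c by (intro borel_measurable_diff) auto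
  then have "piece W s t \<tau> \<eta> k \<in> borel_measurable (F (clamp_time s t (\<tau> (Suc k))))"
   unfolding piece_def using meas_F_mono[OF 2 c(2)] by (rule borel_measurable_scaleR)
  then show ?thesis
   using increment_scaleR[OF c z 2] is_cm_increment_0[OF c z 2, of r]
   by (simp add: piece_def[abs_def] l2_sq)
 qed
 then show "sq_int M (piece W s t \<tau> \<eta> k)"
  "(\<integral>w. (norm (piece W s t \<tau> \<eta> k w))^2 \<partial>M) =
    (clamp_time s t (\<tau> (Suc k)) - clamp_time s t (\<tau> k)) * (\<integral>w. (norm (\<eta> k w))^2 \<partial>M)"
  "piece W s t \<tau> \<eta> k \<in> borel_measurable (F (clamp_time s t (\<tau> (Suc k))))"
  "is_cm M (H r) (piece W s t \<tau> \<eta> k) (%_. 0)" by blast+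
qed

lemma piece_orthogonal:
 assumes d: "sq_data N \<tau> \<eta>" and st: "0 <= s" "s <= t" and k: "k < N"
  and x: "sq_int M \<xi>" "\<xi> \<in> borel_measurable (mixed (clamp_time s t (\<tau> k)))"
 shows "(\<integral>w. \<xi> w \<bullet> piece W s t \<tau> \<eta> k w \<partial>M) = 0"
proof (cases rule: piece_cases[OF d st k, of W])
 case 2
 have "sq_int M (\<eta> k)" using d k by (simp add: sq_data_def)
 from increment_orthogonal[OF clamp_step[OF d st k] this 2 x] show ?thesis by (simp add: piece_def)
qed simp

lemma simple_increment_eq:
 assumes "s <= t"
 shows "simple_integral W N \<tau> \<eta> t w - simple_integral W N \<tau> \<eta> s w = (\<Sum>k<N. piece W s t \<tau> \<eta> k w)"
 using simple_integral_increment[OF assms] by (simp add: piece_def)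

text \<open>Of two pieces the earlier is known when the later starts, so distinct pieces are
  orthogonal and second moments add. The last claim is the covariation with the driving noise,
  weighted by a vector known at \<open>s\<close>.\<close>

lemma simple_increment:
 assumes d: "sq_data N \<tau> \<eta>" and st: "0 <= s" "s <= t"
 defines "S \<equiv> %w. simple_integral W N \<tau> \<eta> t w - simple_integral W N \<tau> \<eta> s w"
 shows "sq_int M S" "is_cm M (H r) S (%_. 0)" (is ?g2) "S \<in> borel_measurable (F t)" (is ?g3)
  "(l2 M S)^2 = (\<Sum>k<N. (clamp_time s t (\<tau> (Suc k)) - clamp_time s t (\<tau> k)) * (l2 M (\<eta> k))^2)" (is ?g4)
  "[|sq_int M \<zeta>; \<zeta> \<in> borel_measurable (F s)|] ==> (\<integral>w. \<zeta> w \<bullet> S w \<partial>M) = 0"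
  "[|sq_int M \<zeta>; \<zeta> \<in> borel_measurable (F s)|] ==> (\<integral>w. S w \<bullet> ((W t w - W s w) *\<^sub>R \<zeta> w) \<partial>M) =
    (\<Sum>k<N. (clamp_time s t (\<tau> (Suc k)) - clamp_time s t (\<tau> k)) * (\<integral>w. \<eta> k w \<bullet> \<zeta> w \<partial>M))"
proof -
 have S: "S = (%w. \<Sum>k<N. piece W s t \<tau> \<eta> k w)" by (simp add: S_def simple_increment_eq[OF st(2)])
 note pp = piece_props[OF d st]
 show "sq_int M S" unfolding S by (rule sq_int_sum) (use pp(1) in auto)
 show ?g2
  using is_cm_sum[of "{..<N}" "H r" "piece W s t \<tau> \<eta>" "%_ _. 0"] pp(4) subalg_H by (simp add: S)
 show ?g3 unfolding S
  using pp(3) clamp_time_range(2)[OF st(2)] meas_F_mono by (intro borel_measurable_sum) blast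
 have orth: "(\<integral>w. piece W s t \<tau> \<eta> j w \<bullet> piece W s t \<tau> \<eta> k w \<partial>M) = 0" if "j < k" "k < N" for j k
 proof (rule piece_orthogonal[OF d st that(2)])
  have "clamp_time s t (\<tau> (Suc j)) <= clamp_time s t (\<tau> k)"
   using sq_data_tau_mono[OF d, of "Suc j" k] that by (intro clamp_time_mono) auto
  then show "piece W s t \<tau> \<eta> j \<in> borel_measurable (mixed (clamp_time s t (\<tau> k)))"
   using pp(3)[of j] that clamp_step(1)[OF d st that(2)] by (intro meas_F_mixed) (auto intro: meas_F_mono)
  show "sq_int M (piece W s t \<tau> \<eta> j)" using pp(1)[of j] that by auto
 qed
 show ?g4
  unfolding l2_sq S using sq_int_orthogonal_sum[of N "piece W s t \<tau> \<eta>"] pp(1,2) orth by simp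
 { assume z: "sq_int M \<zeta>" "\<zeta> \<in> borel_measurable (F s)"
  have zk: "\<zeta> \<in> borel_measurable (F (clamp_time s t (\<tau> k)))" for k
   by (rule meas_F_mono[OF z(2) clamp_time_range(1)[OF st(2)]])
  have "(\<integral>w. \<zeta> w \<bullet> S w \<partial>M) = (\<Sum>k<N. \<integral>w. \<zeta> w \<bullet> piece W s t \<tau> \<eta> k w \<partial>M)"
   unfolding S inner_sum_right
   by (rule Bochner_Integration.integral_sum) (use pp(1) z in \<open>auto intro!: sq_int_inner\<close>)
  also have "\<dots> = 0"
   using piece_orthogonal[OF d st _ z(1) meas_F_mixed[OF clamp_step(1)[OF d st] zk]] by simp
  finally show "(\<integral>w. \<zeta> w \<bullet> S w \<partial>M) = 0" .
  have t1: "(\<integral>w. piece W s t \<tau> \<eta> k w \<bullet> ((W t w - W s w) *\<^sub>R \<zeta> w) \<partial>M) =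
    (clamp_time s t (\<tau> (Suc k)) - clamp_time s t (\<tau> k)) * (\<integral>w. \<eta> k w \<bullet> \<zeta> w \<partial>M)" if k: "k < N" for k
  proof (cases rule: piece_cases[OF d st k, of W])
   case 2
   let ?a = "clamp_time s t (\<tau> k)" and ?b = "clamp_time s t (\<tau> (Suc k))"
   have ab: "0 <= ?a" "s <= ?a" "?a <= ?b" "?b <= t" "0 <= ?b"
    using clamp_step[OF d st k] clamp_time_range[OF st(2)] by auto
   have e: "sq_int M (\<eta> k)" using d k by (simp add: sq_data_def)
   define p where "p = piece W s t \<tau> \<eta> k"
   have p: "sq_int M p" "p \<in> borel_measurable (F ?b)" using pp[OF k] by (simp_all add: p_def)
   have zb: "\<zeta> \<in> borel_measurable (F ?b)" by (rule meas_F_mono[OF z(2)]) (use ab in auto)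
   have q1: "sq_int M (%w. (W t w - W ?b w) *\<^sub>R \<zeta> w)" by (rule increment_scaleR(1)[OF ab(5,4) z(1) zb])
   have q2: "sq_int M (%w. (W ?b w - W ?a w) *\<^sub>R \<zeta> w)" by (rule increment_scaleR(1)[OF ab(1,3) z(1) zk])
   have q3: "sq_int M (%w. (W ?a w - W s w) *\<^sub>R \<zeta> w)" by (rule increment_scaleR(1)[OF st(1) ab(2) z])
   have i1: "(\<integral>w. p w \<bullet> ((W t w - W ?b w) *\<^sub>R \<zeta> w) \<partial>M) = 0"
    by (rule increment_orthogonal[OF ab(5,4) z(1) zb p(1) meas_F_mixed[OF ab(5) p(2)]])
   have i3: "(\<integral>w. p w \<bullet> ((W ?a w - W s w) *\<^sub>R \<zeta> w) \<partial>M) = 0"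
   proof -
    have "(%w. (W ?a w - W s w) *\<^sub>R \<zeta> w) \<in> borel_measurable (F ?a)"
     using W_meas_F[of ?a ?a] W_meas_F[of s ?a] zk ab st
     by (intro borel_measurable_scaleR borel_measurable_diff) auto
    from piece_orthogonal[OF d st k q3 meas_F_mixed[OF ab(1) this]] show ?thesis
     by (simp add: p_def inner_commute)
   qed
   have i2: "(\<integral>w. p w \<bullet> ((W ?b w - W ?a w) *\<^sub>R \<zeta> w) \<partial>M) = (?b - ?a) * (\<integral>w. \<eta> k w \<bullet> \<zeta> w \<partial>M)"
   proof -
    have "(%w. \<eta> k w \<bullet> \<zeta> w) \<in> borel_measurable (mixed ?a)"
     using meas_F_mixed[OF ab(1) 2] meas_F_mixed[OF ab(1) zk] by (rule borel_measurable_inner)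
    from increment_mult(4)[OF ab(1,3) sq_int_inner[OF e z(1)] this]
    show ?thesis by (simp add: p_def piece_def power2_eq_square mult_ac)
   qed
   \<comment> \<open>The noise increment is split at both ends of the piece; only the middle part,
     over the interval of the piece itself, correlates with it.\<close>
   have "p w \<bullet> ((W t w - W s w) *\<^sub>R \<zeta> w) = p w \<bullet> ((W t w - W ?b w) *\<^sub>R \<zeta> w) +
     p w \<bullet> ((W ?b w - W ?a w) *\<^sub>R \<zeta> w) + p w \<bullet> ((W ?a w - W s w) *\<^sub>R \<zeta> w)" for w
    by (simp add: algebra_simps)
   then have "(\<integral>w. p w \<bullet> ((W t w - W s w) *\<^sub>R \<zeta> w) \<partial>M) = (?b - ?a) * (\<integral>w. \<eta> k w \<bullet> \<zeta> w \<partial>M)"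
    using sq_int_inner[OF p(1) q1] sq_int_inner[OF p(1) q2] sq_int_inner[OF p(1) q3] i1 i2 i3 by simp
   then show ?thesis by (simp add: p_def)
  qed simp
  have q: "sq_int M (%w. (W t w - W s w) *\<^sub>R \<zeta> w)" by (rule increment_scaleR(1)[OF st z])
  have "(\<integral>w. S w \<bullet> ((W t w - W s w) *\<^sub>R \<zeta> w) \<partial>M) =
    (\<Sum>k<N. \<integral>w. piece W s t \<tau> \<eta> k w \<bullet> ((W t w - W s w) *\<^sub>R \<zeta> w) \<partial>M)"
   unfolding S inner_sum_left
   by (rule Bochner_Integration.integral_sum, rule sq_int_inner[OF pp(1) q]) simp
  then show "(\<integral>w. S w \<bullet> ((W t w - W s w) *\<^sub>R \<zeta> w) \<partial>M) =
    (\<Sum>k<N. (clamp_time s t (\<tau> (Suc k)) - clamp_time s t (\<tau> k)) * (\<integral>w. \<eta> k w \<bullet> \<zeta> w \<partial>M))"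
   using t1 by simp }
qed

text \<open>The piece that starts first is known in the mixed sigma-algebra at the start of the
  other one: its coefficient is past, and its noise is contained entirely. The other piece is driven
  by the remaining noise and is orthogonal to it. The second case exchanges the noises.\<close>

lemma piece_cross:
 assumes d: "sq_data N \<tau> \<eta>" and d': "sq_data N' \<tau>' \<eta>'" and st: "0 <= s" "s <= t" and k: "k < N" "l < N'"
 shows "(\<integral>w. piece W s t \<tau> \<eta> k w \<bullet> piece W0 s t \<tau>' \<eta>' l w \<partial>M) = 0"
proof -
 interpret sw: mean_field_basis M F0 W0 W by (rule swap)
 have d0: "sw.sq_data N \<tau> \<eta>" "sw.sq_data N' \<tau>' \<eta>'"
  using d d' by (simp_all add: sq_data_def sw.sq_data_def swF)
 have swm: "f \<in> borel_measurable (F r) ==> 0 <= a ==> r <= a ==> f \<in> borel_measurable (sw.mixed a)" for f :: "'a => 'b" and r a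
  using sw.meas_F_mixed[of a f, unfolded swF, OF _ meas_F_mono[of f r a]] by blast
 note c = clamp_step[OF d st k(1)] and c' = clamp_step[OF d' st k(2)]
 show ?thesis
 proof (cases "clamp_time s t (\<tau>' l) <= clamp_time s t (\<tau> k)")
  case True
  have "piece W0 s t \<tau>' \<eta>' l \<in> borel_measurable (mixed (clamp_time s t (\<tau> k)))"
  proof (cases rule: piece_cases[OF d' st k(2), of W0])
   case 2
   have "(%w. W0 (clamp_time s t (\<tau>' (Suc l))) w - W0 (clamp_time s t (\<tau>' l)) w)
     \<in> borel_measurable (H (clamp_time s t (\<tau>' (Suc l))))"
    using c' W0_meas_H by (intro borel_measurable_diff) auto
   from meas_H_mixed[OF c(1) this] meas_F_mixed[OF c(1) meas_F_mono[OF 2 True]]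
   show ?thesis unfolding piece_def by (rule borel_measurable_scaleR)
  qed simp
  from piece_orthogonal[OF d st k(1) _ this] sw.piece_props(1)[OF d0(2) st k(2)]
  show ?thesis by (simp add: inner_commute sw.piece_def[abs_def] piece_def[abs_def])
 next
  case False
  then have le: "clamp_time s t (\<tau> k) <= clamp_time s t (\<tau>' l)" by simp
  have "piece W s t \<tau> \<eta> k \<in> borel_measurable (sw.mixed (clamp_time s t (\<tau>' l)))"
  proof (cases rule: piece_cases[OF d st k(1), of W])
   case 2
   have "(%w. W (clamp_time s t (\<tau> (Suc k))) w - W (clamp_time s t (\<tau> k)) w)
     \<in> borel_measurable (common_filt M W (clamp_time s t (\<tau> (Suc k))))"
    using c sw.W0_meas_H by (intro borel_measurable_diff) auto
   from sw.meas_H_mixed[OF c'(1) this] swm[OF 2 c'(1) le]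
   show ?thesis unfolding piece_def by (rule borel_measurable_scaleR)
  qed simp
  from sw.piece_orthogonal[OF d0(2) st k(2) piece_props(1)[OF d st k(1)] this]
  show ?thesis by (simp add: sw.piece_def[abs_def] piece_def[abs_def])
 qed
qed

lemma simple_cross:
 assumes d: "sq_data N \<tau> \<eta>" and d': "sq_data N' \<tau>' \<eta>'" and st: "0 <= s" "s <= t"
 shows "(\<integral>w. (simple_integral W N \<tau> \<eta> t w - simple_integral W N \<tau> \<eta> s w) \<bullet>
   (simple_integral W0 N' \<tau>' \<eta>' t w - simple_integral W0 N' \<tau>' \<eta>' s w) \<partial>M) = 0"
proof -
 interpret sw: mean_field_basis M F0 W0 W by (rule swap)
 have d0: "sw.sq_data N' \<tau>' \<eta>'"
  using d' by (simp add: sq_data_def sw.sq_data_def swF)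
 have p0: "sq_int M (piece W0 s t \<tau>' \<eta>' l)" if "l < N'" for l
  using sw.piece_props(1)[OF d0 st that] by (simp add: sw.piece_def[abs_def] piece_def[abs_def])
 have "(\<integral>w. (\<Sum>k<N. piece W s t \<tau> \<eta> k w) \<bullet> (\<Sum>l<N'. piece W0 s t \<tau>' \<eta>' l w) \<partial>M) =
   (\<Sum>k<N. \<integral>w. piece W s t \<tau> \<eta> k w \<bullet> (\<Sum>l<N'. piece W0 s t \<tau>' \<eta>' l w) \<partial>M)"
  unfolding inner_sum_left
  by (rule Bochner_Integration.integral_sum) (use piece_props(1)[OF d st] p0 in \<open>auto intro!: sq_int_inner sq_int_sum\<close>)
 also have "\<dots> = (\<Sum>k<N. \<Sum>l<N'. \<integral>w. piece W s t \<tau> \<eta> k w \<bullet> piece W0 s t \<tau>' \<eta>' l w \<partial>M)"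
  unfolding inner_sum_right
  by (intro sum.cong refl Bochner_Integration.integral_sum) (use piece_props(1)[OF d st] p0 in \<open>auto intro!: sq_int_inner\<close>)
 also have "\<dots> = 0" using piece_cross[OF d d' st] by simp
 finally show ?thesis
  by (simp add: simple_increment_eq[OF st(2)] sw.simple_increment_eq[OF st(2)] sw.piece_def[abs_def] piece_def[abs_def])
qed

text \<open>The right-hand sides coincide with those in \<open>simple_increment\<close>; the
  comparison is the Ito isometry for simple processes, in quadratic and in covariation form.\<close>

lemma cut_simple_integral_sq:
 assumes d: "sq_data N \<tau> \<eta>" and st: "0 <= s" "s <= t"
 shows "sq_int (lborel \<Otimes>\<^sub>M M) (cut s t (simple_proc N \<tau> \<eta>))" (is ?g1)
  "(\<integral>x. (norm (cut s t (simple_proc N \<tau> \<eta>) x))^2 \<partial>(lborel \<Otimes>\<^sub>M M)) =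
   (\<Sum>k<N. (clamp_time s t (\<tau> (Suc k)) - clamp_time s t (\<tau> k)) * (l2 M (\<eta> k))^2)"
  "sq_int M \<zeta> ==> (\<integral>x. cut s t (simple_proc N \<tau> \<eta>) x \<bullet> cut s t (%_. \<zeta>) x \<partial>(lborel \<Otimes>\<^sub>M M)) =
   (\<Sum>k<N. (clamp_time s t (\<tau> (Suc k)) - clamp_time s t (\<tau> k)) * (\<integral>w. \<eta> k w \<bullet> \<zeta> w \<partial>M))"
proof -
 let ?a = "%k. clamp_time s t (\<tau> k)"
 let ?c = "%k. cut (?a k) (?a (Suc k)) (%_. \<eta> k)"
 have e: "sq_int M (\<eta> k)" if "k < N" for k using d that by (simp add: sq_data_def)
 have c: "sq_int (lborel \<Otimes>\<^sub>M M) (?c k)" if "k < N" for k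
  by (rule cut_const[OF e[OF that] clamp_step(2)[OF d st that]])
 have eq: "cut s t (simple_proc N \<tau> \<eta>) = (%x. \<Sum>k<N. ?c k x)"
  using cut_simple_proc[OF st(2)] by (auto simp: fun_eq_iff cut_def)
 show ?g1
  unfolding eq by (rule sq_int_sum) (use c in auto)
 have disj: "indicator {?a j<..?a (Suc j)} r * indicator {?a k<..?a (Suc k)} r = (0::real)"
  if "j < k" "k < N" for j k r
 proof -
  have "?a (Suc j) <= ?a k" using sq_data_tau_mono[OF d, of "Suc j" k] that by (intro clamp_time_mono) auto
  then show ?thesis by (auto simp: indicator_def)
 qed
 have "(norm (\<Sum>k<N. ?c k x))^2 = (\<Sum>k<N. (norm (?c k x))^2)" for x
 proof -
  have "n <= N ==> (norm (\<Sum>k<n. ?c k x))^2 = (\<Sum>k<n. (norm (?c k x))^2)" for n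
  proof (induction n)
   case (Suc n)
   have "?c j x \<bullet> ?c n x = 0" if "j < n" for j
    using disj[OF that, of "fst x"] Suc.prems by (auto simp: cut_def case_prod_beta')
   then have "(\<Sum>k<n. ?c k x) \<bullet> ?c n x = 0" by (simp add: inner_sum_left)
   then show ?case using Suc by (simp add: power2_norm_eq_inner inner_add_left inner_add_right inner_commute)
  qed simp
  then show ?thesis by simp
 qed
 then have "(\<integral>x. (norm (cut s t (simple_proc N \<tau> \<eta>) x))^2 \<partial>(lborel \<Otimes>\<^sub>M M)) =
   (\<Sum>k<N. \<integral>x. (norm (?c k x))^2 \<partial>(lborel \<Otimes>\<^sub>M M))"
  unfolding eq using c by (simp add: sq_int_def)
 also have "\<dots> = (\<Sum>k<N. (?a (Suc k) - ?a k) * (l2 M (\<eta> k))^2)"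
 proof (rule sum.cong[OF refl])
  fix k assume "k \<in> {..<N}" then have k: "k < N" by simp
  have "(norm (?c k x))^2 = indicator {?a k<..?a (Suc k)} (fst x) * (norm (\<eta> k (snd x)))^2" for x
   by (simp add: cut_def case_prod_beta' power_mult_distrib indicator_def)
  then show "(\<integral>x. (norm (?c k x))^2 \<partial>(lborel \<Otimes>\<^sub>M M)) = (?a (Suc k) - ?a k) * (l2 M (\<eta> k))^2"
   using integral_time_const(2)[OF sq_int_integrable_sq[OF e[OF k]] clamp_step(2)[OF d st k]] by (simp add: l2_sq)
 qed
 finally show "(\<integral>x. (norm (cut s t (simple_proc N \<tau> \<eta>) x))^2 \<partial>(lborel \<Otimes>\<^sub>M M)) =
   (\<Sum>k<N. (?a (Suc k) - ?a k) * (l2 M (\<eta> k))^2)" .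
 assume z: "sq_int M \<zeta>"
 have zc: "sq_int (lborel \<Otimes>\<^sub>M M) (cut s t (%_. \<zeta>))" by (rule cut_const[OF z st(2)])
 have "(\<integral>x. cut s t (simple_proc N \<tau> \<eta>) x \<bullet> cut s t (%_. \<zeta>) x \<partial>(lborel \<Otimes>\<^sub>M M)) =
   (\<Sum>k<N. \<integral>x. ?c k x \<bullet> cut s t (%_. \<zeta>) x \<partial>(lborel \<Otimes>\<^sub>M M))"
  unfolding eq inner_sum_left
  by (rule Bochner_Integration.integral_sum) (use c zc in \<open>auto intro!: sq_int_inner\<close>)
 also have "\<dots> = (\<Sum>k<N. (?a (Suc k) - ?a k) * (\<integral>w. \<eta> k w \<bullet> \<zeta> w \<partial>M))"
 proof (rule sum.cong[OF refl])
  fix k assume "k \<in> {..<N}" then have k: "k < N" by simp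
  have "s <= ?a k" "?a (Suc k) <= t" using clamp_time_range[OF st(2)] by auto
  then have "?c k x \<bullet> cut s t (%_. \<zeta>) x = indicator {?a k<..?a (Suc k)} (fst x) * (\<eta> k (snd x) \<bullet> \<zeta> (snd x))" for x
   by (auto simp: cut_def case_prod_beta' indicator_def)
  then show "(\<integral>x. ?c k x \<bullet> cut s t (%_. \<zeta>) x \<partial>(lborel \<Otimes>\<^sub>M M)) = (?a (Suc k) - ?a k) * (\<integral>w. \<eta> k w \<bullet> \<zeta> w \<partial>M)"
   using integral_time_const(2)[OF sq_int_inner[OF e[OF k] z] clamp_step(2)[OF d st k]] by simp
 qed
 finally show "(\<integral>x. cut s t (simple_proc N \<tau> \<eta>) x \<bullet> cut s t (%_. \<zeta>) x \<partial>(lborel \<Otimes>\<^sub>M M)) =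
   (\<Sum>k<N. (?a (Suc k) - ?a k) * (\<integral>w. \<eta> k w \<bullet> \<zeta> w \<partial>M))" .
qed

end

section \<open>From simple processes to square-integrable integrands\<close>

lemma tendsto_0_power2_iff:
 fixes f :: "nat => real"
 assumes "!!j. 0 <= f j"
 shows "(%j. (f j)^2) \<longlonglongrightarrow> 0 \<longleftrightarrow> f \<longlonglongrightarrow> 0"
proof
 assume "(%j. (f j)^2) \<longlonglongrightarrow> 0"
 then have "(%j. sqrt ((f j)^2)) \<longlonglongrightarrow> sqrt 0" by (rule tendsto_real_sqrt)
 then show "f \<longlonglongrightarrow> 0" using assms by simp
next
 assume "f \<longlonglongrightarrow> 0"
 then show "(%j. (f j)^2) \<longlonglongrightarrow> 0" using tendsto_power[of f 0 sequentially 2] by simp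
qed

context mean_field_basis
begin

lemma simple_integral_0: "sq_data N \<tau> \<eta> ==> simple_integral V N \<tau> \<eta> 0 w = 0"
proof -
 assume d: "sq_data N \<tau> \<eta>"
 have "0 <= \<tau> k" if "k <= N" for k
  using sq_data_tau_mono[OF d, of 0 k] d that by (auto simp: sq_data_def)
 then have "min 0 (\<tau> k) = 0" if "k <= N" for k using that by (simp add: min_def)
 then show ?thesis by (simp add: simple_integral_def)
qed

lemma cut_diff: "cut s t Z x - cut s t Z' x = cut s t (%r w. Z r w - Z' r w) x"
 by (simp add: cut_def case_prod_beta' scaleR_diff_right)

text \<open>Keeps of an Ito integral its approximating simple integrals, with convergence at every
  time and on every subinterval. The coefficients may be unbounded, and \<open>V\<close> may be
  either noise.\<close>

definition ito_approx ::
 "(real => 'a => real) => real => (real => 'a => 'b::euclidean_space) => (real => 'a => 'b) =>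
  (nat => nat) => (nat => nat => real) => (nat => nat => 'a => 'b) => bool" where
 "ito_approx V T Z I N \<tau> \<eta> \<longleftrightarrow> l2proc M T Z \<and> (\<forall>j. sq_data (N j) (\<tau> j) (\<eta> j)) \<and>
  (\<forall>t\<in>{0..T}. sq_int M (I t) \<and> (\<forall>j. sq_int M (simple_integral V (N j) (\<tau> j) (\<eta> j) t)) \<and>
    (%j. l2 M (%w. simple_integral V (N j) (\<tau> j) (\<eta> j) t w - I t w)) \<longlonglongrightarrow> 0) \<and>
  (\<forall>s t. 0 <= s --> t <= T -->
    (%j. l2 (lborel \<Otimes>\<^sub>M M) (%x. cut s t (simple_proc (N j) (\<tau> j) (\<eta> j)) x - cut s t Z x)) \<longlonglongrightarrow> 0)"

lemma ito_integral_approx: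
 assumes "is_ito_integral M F W T Z I"
 obtains N \<tau> \<eta> where "ito_approx W T Z I N \<tau> \<eta>"
proof -
 from assms obtain N \<tau> \<eta> where d: "!!j. simple_data F T (N j) (\<tau> j) (\<eta> j)"
  and e: "(%j. energy M {0..T} (%s w. simple_proc (N j) (\<tau> j) (\<eta> j) s w - Z s w)) \<longlonglongrightarrow> 0"
  and l: "!!t. t \<in> {0..T} ==> (%j. \<integral>\<^sup>+w. ennreal ((norm (simple_integral W (N j) (\<tau> j) (\<eta> j) t w - I t w))^2) \<partial>M) \<longlonglongrightarrow> 0"
  unfolding is_ito_integral_def by blast
 have Z: "l2proc M T Z" using assms subalg_F by (auto simp: is_ito_integral_def intro: L2_prog_l2proc)
 have sd: "sq_data (N j) (\<tau> j) (\<eta> j)" for j by (rule simple_data_sq_data[OF d])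
 have si: "sq_int M (simple_integral W (N j) (\<tau> j) (\<eta> j) t)" if "0 <= t" for j t
  using simple_increment(1)[OF sd[of j] order_refl that] by (simp add: simple_integral_0[OF sd[of j]])
 have I: "sq_int M (I t)" "(%j. l2 M (%w. simple_integral W (N j) (\<tau> j) (\<eta> j) t w - I t w)) \<longlonglongrightarrow> 0"
  if t: "t \<in> {0..T}" for t
 proof -
  have m: "I t \<in> borel_measurable M" using assms t by (auto simp: is_ito_integral_def intro: meas_F_M)
  show "sq_int M (I t)" "(%j. l2 M (%w. simple_integral W (N j) (\<tau> j) (\<eta> j) t w - I t w)) \<longlonglongrightarrow> 0"
   using sq_int_limit[OF si m l[OF t]] t by auto
 qed
 have c: "(%j. l2 (lborel \<Otimes>\<^sub>M M) (%x. cut s t (simple_proc (N j) (\<tau> j) (\<eta> j)) x - cut s t Z x)) \<longlonglongrightarrow> 0"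
  if st: "0 <= s" "t <= T" for s t
 proof (cases "s <= t")
  case True
  have sq: "sq_int (lborel \<Otimes>\<^sub>M M) (%x. cut s t (simple_proc (N j) (\<tau> j) (\<eta> j)) x - cut s t Z x)" for j
   by (intro sq_int_diff cut_simple_integral_sq(1)[OF sd st(1) True] cut_sq_int[OF Z st])
  have "(%j. \<integral>\<^sup>+x. ennreal ((norm (cut s t (simple_proc (N j) (\<tau> j) (\<eta> j)) x - cut s t Z x))^2) \<partial>(lborel \<Otimes>\<^sub>M M)) \<longlonglongrightarrow> 0"
  proof (rule tendsto_sandwich[OF _ _ tendsto_const e])
   have "(\<integral>\<^sup>+x. ennreal ((norm (cut s t (simple_proc (N j) (\<tau> j) (\<eta> j)) x - cut s t Z x))^2) \<partial>(lborel \<Otimes>\<^sub>M M))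
     <= energy M {0..T} (%s w. simple_proc (N j) (\<tau> j) (\<eta> j) s w - Z s w)" for j
    using sq[of j] unfolding cut_diff by (intro nn_cut_le_energy st) (simp add: sq_int_def)
   then show "\<forall>\<^sub>F j in sequentially. (\<integral>\<^sup>+x. ennreal ((norm (cut s t (simple_proc (N j) (\<tau> j) (\<eta> j)) x - cut s t Z x))^2) \<partial>(lborel \<Otimes>\<^sub>M M))
     <= energy M {0..T} (%s w. simple_proc (N j) (\<tau> j) (\<eta> j) s w - Z s w)" by simp
  qed simp
  then show ?thesis using l2_tendsto_0_iff_nn[OF sq] by simp
 next
  case False
  then have "cut s t Z' = (%_. 0)" for Z' :: "real => 'a => 'b" by (auto simp: cut_def fun_eq_iff)
  then show ?thesis by (simp add: l2_def)
 qed
 show ?thesis using that[of N \<tau> \<eta>] Z sd I si c unfolding ito_approx_def by simp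
qed

lemma ito_approx_increment:
 assumes a: "ito_approx V T Z I N \<tau> \<eta>" and st: "s \<in> {0..T}" "t \<in> {0..T}"
 shows "sq_int M (%w. I t w - I s w)"
  "sq_int M (%w. simple_integral V (N j) (\<tau> j) (\<eta> j) t w - simple_integral V (N j) (\<tau> j) (\<eta> j) s w)"
  "(%j. l2 M (%w. (simple_integral V (N j) (\<tau> j) (\<eta> j) t w - simple_integral V (N j) (\<tau> j) (\<eta> j) s w) - (I t w - I s w))) \<longlonglongrightarrow> 0"
proof -
 let ?S = "%j. simple_integral V (N j) (\<tau> j) (\<eta> j)"
 have sq: "sq_int M (?S j r)" "sq_int M (I r)" "(%j. l2 M (%w. ?S j r w - I r w)) \<longlonglongrightarrow> 0" if "r \<in> {0..T}" for j r
  using a that by (auto simp: ito_approx_def)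
 show "sq_int M (%w. I t w - I s w)" "sq_int M (%w. ?S j t w - ?S j s w)"
  using sq st by (auto intro: sq_int_diff)
 show "(%j. l2 M (%w. (?S j t w - ?S j s w) - (I t w - I s w))) \<longlonglongrightarrow> 0"
 proof (rule tendsto_sandwich[OF _ _ tendsto_const])
  show "(%j. l2 M (%w. ?S j t w - I t w) + l2 M (%w. ?S j s w - I s w)) \<longlonglongrightarrow> 0"
   using tendsto_add[OF sq(3)[OF st(2)] sq(3)[OF st(1)]] by simp
  have "l2 M (%w. (?S j t w - ?S j s w) - (I t w - I s w)) <=
    l2 M (%w. ?S j t w - I t w) + l2 M (%w. ?S j s w - I s w)" for j
   using l2_diff_le[OF sq_int_diff[OF sq(1,2)[OF st(2)]] sq_int_diff[OF sq(1,2)[OF st(1)]], of j j]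
   by (simp add: algebra_simps)
  then show "\<forall>\<^sub>F j in sequentially. l2 M (%w. (?S j t w - ?S j s w) - (I t w - I s w)) <=
    l2 M (%w. ?S j t w - I t w) + l2 M (%w. ?S j s w - I s w)" by simp
 qed simp
qed

text \<open>Each claim holds for the approximants and is continuous in \<open>l2\<close>. For the
  isometry and the covariation, one numerical sequence is written in two ways, converging to an
  expectation at one side and to a time integral at the other.\<close>

lemma ito_increment:
 assumes a: "ito_approx W T Z I N \<tau> \<eta>" and st: "0 <= s" "s <= t" "t <= T"
 shows "sq_int M (%w. I t w - I s w)" (is ?g1)
  "is_cm M (H r) (%w. I t w - I s w) (%_. 0)" (is ?g2)
  "(l2 M (%w. I t w - I s w))^2 = (LBINT r:{s<..t}. \<integral>w. (norm (Z r w))^2 \<partial>M)" (is ?g3)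
  "[|sq_int M \<zeta>; \<zeta> \<in> borel_measurable (F s)|] ==> (\<integral>w. \<zeta> w \<bullet> (I t w - I s w) \<partial>M) = 0"
  "[|sq_int M \<zeta>; \<zeta> \<in> borel_measurable (F s)|] ==>
    (\<integral>w. (I t w - I s w) \<bullet> ((W t w - W s w) *\<^sub>R \<zeta> w) \<partial>M) = (LBINT r:{s<..t}. \<integral>w. Z r w \<bullet> \<zeta> w \<partial>M)"
proof -
 have st': "s \<in> {0..T}" "t \<in> {0..T}" using st by auto
 let ?S = "%j. simple_integral W (N j) (\<tau> j) (\<eta> j)"
 let ?P = "lborel \<Otimes>\<^sub>M M"
 have d: "sq_data (N j) (\<tau> j) (\<eta> j)" for j using a by (auto simp: ito_approx_def)
 have Z: "l2proc M T Z" using a by (auto simp: ito_approx_def)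
 have cl: "(%j. l2 ?P (%x. cut s t (simple_proc (N j) (\<tau> j) (\<eta> j)) x - cut s t Z x)) \<longlonglongrightarrow> 0"
  using a st by (auto simp: ito_approx_def)
 note inc = ito_approx_increment[OF a st']
 note cs = cut_simple_integral_sq[OF d st(1,2)]
 have cZ: "sq_int ?P (cut s t Z)" by (rule cut_sq_int[OF Z st(1,3)])
 show ?g1 by (rule inc(1))
 show ?g2
  by (rule is_cm_limit[OF simple_increment(2)[OF d st(1,2)] subalg_H inc(1) _ _ inc(3)]) (auto simp: l2_def)
 have "(%j. \<integral>x. (norm (cut s t (simple_proc (N j) (\<tau> j) (\<eta> j)) x))^2 \<partial>?P) \<longlonglongrightarrow> (\<integral>x. (norm (cut s t Z x))^2 \<partial>?P)"
  by (rule tendsto_integral_sq_l2[OF cs(1) cZ cl])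
 moreover have "(%j. \<integral>w. (norm (?S j t w - ?S j s w))^2 \<partial>M) \<longlonglongrightarrow> (\<integral>w. (norm (I t w - I s w))^2 \<partial>M)"
  by (rule tendsto_integral_sq_l2[OF inc(2,1,3)])
 moreover have "(\<integral>x. (norm (cut s t (simple_proc (N j) (\<tau> j) (\<eta> j)) x))^2 \<partial>?P) = (\<integral>w. (norm (?S j t w - ?S j s w))^2 \<partial>M)" for j
  using cs(2)[of j] simple_increment(4)[OF d st(1,2), of j] by (simp add: l2_sq)
 ultimately have "(\<integral>w. (norm (I t w - I s w))^2 \<partial>M) = (\<integral>x. (norm (cut s t Z x))^2 \<partial>?P)"
  using LIMSEQ_unique by auto
 then show ?g3
  using time_integral_sq(2)[OF Z st(1,3)] by (simp add: l2_sq)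
 assume z: "sq_int M \<zeta>" "\<zeta> \<in> borel_measurable (F s)"
 have "(%j. \<integral>w. \<zeta> w \<bullet> (?S j t w - ?S j s w) \<partial>M) \<longlonglongrightarrow> (\<integral>w. \<zeta> w \<bullet> (I t w - I s w) \<partial>M)"
  by (rule tendsto_integral_inner_l2[OF z(1) z(1) inc(2,1) _ inc(3)]) (simp add: l2_def)
 then show "(\<integral>w. \<zeta> w \<bullet> (I t w - I s w) \<partial>M) = 0"
  using simple_increment(5)[OF d st(1,2) z] by (simp add: LIMSEQ_const_iff)
 let ?\<xi> = "%w. (W t w - W s w) *\<^sub>R \<zeta> w"
 have x: "sq_int M ?\<xi>" by (rule increment_scaleR(1)[OF st(1,2) z])
 have "(%j. \<integral>w. (?S j t w - ?S j s w) \<bullet> ?\<xi> w \<partial>M) \<longlonglongrightarrow> (\<integral>w. (I t w - I s w) \<bullet> ?\<xi> w \<partial>M)"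
  by (rule tendsto_integral_inner_l2[OF inc(2,1) x x inc(3)]) (simp add: l2_def)
 moreover have zc: "sq_int ?P (cut s t (%_. \<zeta>))" by (rule cut_const[OF z(1) st(2)])
 have "(%j. \<integral>x. cut s t (simple_proc (N j) (\<tau> j) (\<eta> j)) x \<bullet> cut s t (%_. \<zeta>) x \<partial>?P) \<longlonglongrightarrow> (\<integral>x. cut s t Z x \<bullet> cut s t (%_. \<zeta>) x \<partial>?P)"
  by (rule tendsto_integral_inner_l2[OF cs(1) cZ zc zc cl]) (simp add: l2_def)
 moreover have "(\<integral>w. (?S j t w - ?S j s w) \<bullet> ?\<xi> w \<partial>M) = (\<integral>x. cut s t (simple_proc (N j) (\<tau> j) (\<eta> j)) x \<bullet> cut s t (%_. \<zeta>) x \<partial>?P)" for j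
  using cs(3)[OF z(1), of j] simple_increment(6)[OF d st(1,2) z, of j] by simp
 ultimately have "(\<integral>w. (I t w - I s w) \<bullet> ?\<xi> w \<partial>M) = (\<integral>x. cut s t Z x \<bullet> cut s t (%_. \<zeta>) x \<partial>?P)"
  using LIMSEQ_unique by auto
 then show "(\<integral>w. (I t w - I s w) \<bullet> ?\<xi> w \<partial>M) = (LBINT r:{s<..t}. \<integral>w. Z r w \<bullet> \<zeta> w \<partial>M)"
  using time_integral_inner(2)[OF Z l2proc_const[OF z(1)] st(1,3)] st by simp
qed

lemma ito_cross:
 assumes a: "ito_approx W T Z I N \<tau> \<eta>" and a0: "ito_approx W0 T Z' I' N' \<tau>' \<eta>'" and st: "0 <= s" "s <= t" "t <= T"
 shows "(\<integral>w. (I t w - I s w) \<bullet> (I' t w - I' s w) \<partial>M) = 0"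
proof -
 have st': "s \<in> {0..T}" "t \<in> {0..T}" using st by auto
 have d: "sq_data (N j) (\<tau> j) (\<eta> j)" "sq_data (N' j) (\<tau>' j) (\<eta>' j)" for j
  using a a0 by (auto simp: ito_approx_def)
 note i = ito_approx_increment[OF a st'] and i' = ito_approx_increment[OF a0 st']
 from tendsto_integral_inner_l2[OF i(2,1) i'(2,1) i(3) i'(3)]
 show ?thesis using simple_cross[OF d st(1,2)] by (simp add: LIMSEQ_const_iff)
qed

lemma ito_zero:
 assumes a: "ito_approx W T Z I N \<tau> \<eta>" and T: "0 <= T"
 shows "AE w in M. I 0 w = 0"
proof -
 have d: "sq_data (N j) (\<tau> j) (\<eta> j)" for j using a by (auto simp: ito_approx_def)
 have s: "sq_int M (I 0)" "(%j. l2 M (%w. simple_integral W (N j) (\<tau> j) (\<eta> j) 0 w - I 0 w)) \<longlonglongrightarrow> 0"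
  using a T by (auto simp: ito_approx_def)
 then have "l2 M (I 0) = 0"
  by (simp add: simple_integral_0[OF d] l2_uminus LIMSEQ_const_iff)
 then have "(\<integral>w. (norm (I 0 w))^2 \<partial>M) = 0" using l2_sq[of M "I 0"] by simp
 then have "AE w in M. (norm (I 0 w))^2 = 0"
  using integral_nonneg_eq_0_iff_AE[of M "%w. (norm (I 0 w))^2"] sq_int_integrable_sq[OF s(1)] by simp
 then show ?thesis by eventually_elim simp
qed

end

section \<open>Pathwise time integrals\<close>

context prob_space
begin

definition drift :: "(real => 'a => 'b::euclidean_space) => real => real => 'a => 'b" where
 "drift a s t w = (LBINT r:{s<..t}. a r w)"

lemma drift_eq: "drift a s t w = (\<integral>r. cut s t a (r, w) \<partial>lborel)"
 by (simp add: drift_def set_lebesgue_integral_def cut_def)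

lemma cut_integrable:
 assumes a: "l2proc M T a" and st: "0 <= s" "s <= t" "t <= T"
 shows "integrable (lborel \<Otimes>\<^sub>M M) (cut s t a)"
proof -
 have one: "sq_int (lborel \<Otimes>\<^sub>M M) (cut s t (%_ _. 1::real))"
  by (rule cut_const[OF sq_int_const[OF finite_measure_axioms] st(2)])
 have c: "sq_int (lborel \<Otimes>\<^sub>M M) (cut s t a)" by (rule cut_sq_int[OF a st(1,3)])
 show ?thesis
 proof (rule Bochner_Integration.integrable_bound[OF sq_int_mult_norm[OF c one]])
  show "cut s t a \<in> borel_measurable (lborel \<Otimes>\<^sub>M M)" using c by (simp add: sq_int_def)
  show "AE x in lborel \<Otimes>\<^sub>M M. norm (cut s t a x) <= norm (norm (cut s t a x) * norm (cut s t (%_ _. 1::real) x))"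
   by (auto simp: cut_def indicator_def)
 qed
qed

lemma drift_AE_integrable:
 assumes a: "l2proc M T a" and st: "0 <= s" "s <= t" "t <= T"
 shows "AE w in M. set_integrable lborel {s<..t} (%r. a r w)"
proof -
 interpret P: pair_sigma_finite lborel M by (rule pair_lborel)
 have "integrable (lborel \<Otimes>\<^sub>M M) (case_prod (%r w. indicator {s<..t} r *\<^sub>R a r w))"
  using cut_integrable[OF assms] by (simp add: cut_def)
 from P.AE_integrable_snd[OF this] show ?thesis by (simp add: set_integrable_def)
qed

text \<open>Cauchy-Schwarz in time along each path yields the factor \<open>t - s\<close>, by which
  the squared drift is negligible over short intervals. The pairing with \<open>\<zeta>\<close> is
  Fubini's theorem.\<close>

lemma drift_props:
 assumes a: "l2proc M T a" and st: "0 <= s" "s <= t" "t <= T"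
 shows "sq_int M (drift a s t)" (is ?g1)
  "(l2 M (drift a s t))^2 <= (t - s) * (LBINT r:{s<..t}. \<integral>w. (norm (a r w))^2 \<partial>M)" (is ?g2)
  "sq_int M \<zeta> ==> (\<integral>w. \<zeta> w \<bullet> drift a s t w \<partial>M) = (LBINT r:{s<..t}. \<integral>w. \<zeta> w \<bullet> a r w \<partial>M)"
proof -
 interpret P: pair_sigma_finite lborel M by (rule pair_lborel)
 have c: "sq_int (lborel \<Otimes>\<^sub>M M) (cut s t a)" by (rule cut_sq_int[OF a st(1,3)])
 have ci: "integrable (lborel \<Otimes>\<^sub>M M) (case_prod (%r w. indicator {s<..t} r *\<^sub>R a r w))"
  using cut_integrable[OF a st] by (simp add: cut_def)
 have c2: "integrable (lborel \<Otimes>\<^sub>M M) (case_prod (%r w. (norm (cut s t a (r, w)))^2))"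
  using c by (simp add: sq_int_def case_prod_beta')
 have m: "drift a s t \<in> borel_measurable M"
  using P.integrable_snd[OF ci] by (simp add: drift_def[abs_def] set_lebesgue_integral_def)
 have cm: "cut s t a \<in> borel_measurable (lborel \<Otimes>\<^sub>M M)" using c by (simp add: sq_int_def)
 have bound: "AE w in M. (norm (drift a s t w))^2 <= (t - s) * (\<integral>r. (norm (cut s t a (r, w)))^2 \<partial>lborel)"
  using P.AE_integrable_snd[OF c2] AE_space
 proof eventually_elim
  case (elim w)
  have "(%r. cut s t a (r, w)) \<in> borel_measurable lborel"
   by (rule measurable_compose[OF measurable_Pair2'[OF elim(2)] cm])
  then have f: "sq_int lborel (%r. cut s t a (r, w))" using elim(1) by (simp add: sq_int_def)
  have one: "sq_int lborel (indicator {s<..t} :: real => real)"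
   using st by (simp add: sq_int_def power2_eq_square indicator_inter_arith[symmetric])
  have l1: "l2 lborel (indicator {s<..t} :: real => real) = sqrt (t - s)"
   using st by (simp add: l2_def power2_eq_square indicator_inter_arith[symmetric])
  have "norm (drift a s t w) <= (\<integral>r. norm (cut s t a (r, w)) \<partial>lborel)"
   unfolding drift_eq by (rule integral_norm_bound)
  also have "\<dots> = (\<integral>r. norm (cut s t a (r, w)) * norm (indicator {s<..t} r :: real) \<partial>lborel)"
   by (rule Bochner_Integration.integral_cong) (auto simp: cut_def indicator_def)
  also have "\<dots> <= l2 lborel (%r. cut s t a (r, w)) * sqrt (t - s)"
   using integral_norm_mult_le[OF f one] l1 by simp
  finally have "(norm (drift a s t w))^2 <= (l2 lborel (%r. cut s t a (r, w)) * sqrt (t - s))^2"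
   by (rule power_mono) simp
  then show ?case using st by (simp add: power_mult_distrib l2_sq mult.commute)
 qed
 have i: "integrable M (%w. (t - s) * (\<integral>r. (norm (cut s t a (r, w)))^2 \<partial>lborel))"
  using P.integrable_snd[OF c2] by simp
 have "integrable M (%w. (norm (drift a s t w))^2)"
  by (rule Bochner_Integration.integrable_bound[OF i])
   (use m bound st in \<open>auto elim!: eventually_mono simp: abs_mult\<close>)
 with m show sd: ?g1 by (simp add: sq_int_def)
 have "(l2 M (drift a s t))^2 <= (\<integral>w. (t - s) * (\<integral>r. (norm (cut s t a (r, w)))^2 \<partial>lborel) \<partial>M)"
  unfolding l2_sq by (rule integral_mono_AE) (use sd i bound in \<open>auto simp: sq_int_def\<close>)
 also have "\<dots> = (t - s) * (\<integral>x. (norm (cut s t a x))^2 \<partial>(lborel \<Otimes>\<^sub>M M))"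
  using P.integral_snd[OF c2] by (simp add: case_prod_beta')
 finally show ?g2
  using time_integral_sq(2)[OF a st(1,3)] by simp
 assume z: "sq_int M \<zeta>"
 have zP: "l2proc M T (%_. \<zeta>)" using st by (intro l2proc_const z) auto
 have pi: "integrable (lborel \<Otimes>\<^sub>M M) (case_prod (%r w. cut s t (%_. \<zeta>) (r, w) \<bullet> cut s t a (r, w)))"
  using sq_int_inner[OF cut_sq_int[OF zP st(1,3)] c] by (simp add: case_prod_beta')
 have "(\<integral>w. \<zeta> w \<bullet> drift a s t w \<partial>M) = (\<integral>w. (\<integral>r. cut s t (%_. \<zeta>) (r, w) \<bullet> cut s t a (r, w) \<partial>lborel) \<partial>M)"
 proof (rule integral_cong_AE)
  show "(%w. \<zeta> w \<bullet> drift a s t w) \<in> borel_measurable M" using z m by (auto simp: sq_int_def)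
  show "(%w. \<integral>r. cut s t (%_. \<zeta>) (r, w) \<bullet> cut s t a (r, w) \<partial>lborel) \<in> borel_measurable M"
   using P.integrable_snd[OF pi] by simp
  show "AE w in M. \<zeta> w \<bullet> drift a s t w = (\<integral>r. cut s t (%_. \<zeta>) (r, w) \<bullet> cut s t a (r, w) \<partial>lborel)"
   using P.AE_integrable_snd[OF ci]
  proof eventually_elim
   case (elim w)
   then have "integrable lborel (%r. cut s t a (r, w))" by (simp add: cut_def)
   then have "\<zeta> w \<bullet> drift a s t w = (\<integral>r. \<zeta> w \<bullet> cut s t a (r, w) \<partial>lborel)"
    unfolding drift_eq by simp
   also have "\<dots> = (\<integral>r. cut s t (%_. \<zeta>) (r, w) \<bullet> cut s t a (r, w) \<partial>lborel)"
    by (rule Bochner_Integration.integral_cong) (auto simp: cut_def indicator_def)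
   finally show ?case .
  qed
 qed
 also have "\<dots> = (\<integral>x. cut s t (%_. \<zeta>) x \<bullet> cut s t a x \<partial>(lborel \<Otimes>\<^sub>M M))"
  using P.integral_snd[OF pi] by (simp add: case_prod_beta')
 finally show "(\<integral>w. \<zeta> w \<bullet> drift a s t w \<partial>M) = (LBINT r:{s<..t}. \<integral>w. \<zeta> w \<bullet> a r w \<partial>M)"
  using time_integral_inner(2)[OF zP a st(1,3)] by simp
qed

end

section \<open>Additive functions of intervals\<close>

text \<open>Over a fine uniform partition the local errors sum to at most
  \<open>\<epsilon> * (G T - G 0)\<close>, and \<open>\<epsilon>\<close> is arbitrary. This takes
  the place of the limit over partitions in the proof of Ito's formula.\<close>

lemma partition_identity:
 fixes \<Phi> \<Psi> G :: "real => real"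
 assumes T: "0 <= T"
  and loc: "!!\<epsilon>. 0 < \<epsilon> ==> \<exists>d>0. \<forall>s t. 0 <= s --> s <= t --> t <= T --> t - s < d -->
    \<bar>\<Phi> t - \<Phi> s - (\<Psi> t - \<Psi> s)\<bar> <= \<epsilon> * (G t - G s)"
 shows "\<Phi> T - \<Phi> 0 = \<Psi> T - \<Psi> 0"
proof -
 have b: "\<bar>\<Phi> T - \<Phi> 0 - (\<Psi> T - \<Psi> 0)\<bar> <= \<epsilon> * (G T - G 0)" if e: "0 < \<epsilon>" for \<epsilon>
 proof -
  from loc[OF e] obtain d where d: "0 < d" "!!s t. 0 <= s ==> s <= t ==> t <= T ==> t - s < d ==>
    \<bar>\<Phi> t - \<Phi> s - (\<Psi> t - \<Psi> s)\<bar> <= \<epsilon> * (G t - G s)" by blast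
  obtain n :: nat where n: "T / d < real n" using reals_Archimedean2 by blast
  then have n0: "0 < n" using T d(1) by (cases n) (auto simp: field_simps not_less)
  have step: "T / real n < d" using n n0 d(1) by (simp add: field_simps)
  define u where "u k = real k * T / real n" for k :: nat
  have "\<bar>\<Phi> (u k) - \<Phi> 0 - (\<Psi> (u k) - \<Psi> 0)\<bar> <= \<epsilon> * (G (u k) - G 0)" if "k <= n" for k
   using that
  proof (induction k)
   case (Suc k)
   have "real (Suc k) * T / real n <= real n * T / real n"
    using Suc.prems T by (intro divide_right_mono mult_right_mono) auto
   then have "u (Suc k) <= T" using n0 by (simp add: u_def)
   moreover have "u (Suc k) - u k = T / real n" by (simp add: u_def diff_divide_distrib[symmetric] algebra_simps)
   moreover have "0 <= u k" "0 <= T / real n" using T by (auto simp: u_def)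
   ultimately have "\<bar>\<Phi> (u (Suc k)) - \<Phi> (u k) - (\<Psi> (u (Suc k)) - \<Psi> (u k))\<bar> <= \<epsilon> * (G (u (Suc k)) - G (u k))"
    using step by (intro d(2)) auto
   then show ?case using Suc by (auto simp: right_diff_distrib)
  qed (simp add: u_def)
  from this[of n] show ?thesis using n0 by (simp add: u_def)
 qed
 have "\<bar>\<Phi> T - \<Phi> 0 - (\<Psi> T - \<Psi> 0)\<bar> <= 0 + e" if e: "0 < e" for e
 proof -
  \<comment> \<open>The added 1 keeps the divisor positive when \<open>G\<close> has the same value
    at both ends.\<close>
  define K where "K = \<bar>G T - G 0\<bar> + 1"
  have K: "0 < K" "G T - G 0 <= K" by (auto simp: K_def)
  have "\<bar>\<Phi> T - \<Phi> 0 - (\<Psi> T - \<Psi> 0)\<bar> <= (e / K) * (G T - G 0)" using e K by (intro b) auto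
  also have "\<dots> <= (e / K) * K" using e K by (intro mult_left_mono) auto
  finally show ?thesis using K by simp
 qed
 then have "\<bar>\<Phi> T - \<Phi> 0 - (\<Psi> T - \<Psi> 0)\<bar> <= 0" by (rule field_le_epsilon)
 then show ?thesis by simp
qed

lemma set_integral_Ioc_split:
 fixes f :: "real => 'b::euclidean_space"
 assumes "set_integrable lborel {a<..c} f" "a <= b" "b <= c"
 shows "(LBINT r:{a<..c}. f r) = (LBINT r:{a<..b}. f r) + (LBINT r:{b<..c}. f r)"
proof -
 have i: "set_integrable lborel {a<..b} f" "set_integrable lborel {b<..c} f"
  using assms by (auto intro: set_integrable_subset)
 have "{a<..c} = {a<..b} \<union> {b<..c}" using assms by auto
 then show ?thesis using set_integral_Un[OF _ i] by auto
qed

lemma continuous_on_set_integral_Ioc: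
 fixes f :: "real => real"
 assumes "set_integrable lborel {0<..T} f"
 shows "continuous_on {0..T} (%t. LBINT r:{0<..t}. f r)"
proof -
 define g where "g r = indicator {0<..T} r *\<^sub>R f r" for r
 have g: "set_integrable lborel {0..T} g"
  using assms integrable_mult_indicator[of "{0..T}" lborel g] by (simp add: set_integrable_def g_def[abs_def])
 have "continuous_on {0..T} (%t. integral {0..t} g)"
  by (rule indefinite_integral_continuous_1) (rule set_borel_integral_eq_integral(1)[OF g])
 moreover have "integral {0..t} g = (LBINT r:{0<..t}. f r)" if "t \<in> {0..T}" for t
 proof -
  have "set_integrable lborel {0..t} g" using g that by (auto intro: set_integrable_subset)
  then have "integral {0..t} g = (LBINT r:{0..t}. g r)" by (simp add: set_borel_integral_eq_integral(2))
  also have "\<dots> = (LBINT r:{0<..t}. f r)"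
   unfolding set_lebesgue_integral_def
   by (rule Bochner_Integration.integral_cong) (use that in \<open>auto simp: g_def indicator_def\<close>)
  finally show ?thesis .
 qed
 ultimately show ?thesis by (rule continuous_on_eq) auto
qed

text \<open>Absolute continuity of the integral, read off from uniform continuity of the primitive
  on a compact interval.\<close>

lemma set_integral_Ioc_modulus:
 fixes f :: "real => real"
 assumes f: "set_integrable lborel {0<..T} f" and e: "0 < \<epsilon>"
 shows "\<exists>d>0. \<forall>s t. 0 <= s --> s <= t --> t <= T --> t - s < d --> \<bar>LBINT r:{s<..t}. f r\<bar> < \<epsilon>"
proof -
 have "uniformly_continuous_on {0..T} (%t. LBINT r:{0<..t}. f r)"
  by (rule compact_uniformly_continuous[OF continuous_on_set_integral_Ioc[OF f]]) simp
 then obtain d where d: "0 < d" "!!x y. x \<in> {0..T} ==> y \<in> {0..T} ==> dist y x < d ==>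
   dist (LBINT r:{0<..y}. f r) (LBINT r:{0<..x}. f r) < \<epsilon>"
  using e unfolding uniformly_continuous_on_def by metis
 show ?thesis
 proof (intro exI conjI allI impI)
  fix s t :: real assume st: "0 <= s" "s <= t" "t <= T" "t - s < d"
  have "set_integrable lborel {0<..t} f" using f st by (auto intro: set_integrable_subset)
  from set_integral_Ioc_split[OF this st(1,2)] d(2)[of s t] st
  show "\<bar>LBINT r:{s<..t}. f r\<bar> < \<epsilon>" by (auto simp: dist_real_def)
 qed (rule d(1))
qed

section \<open>Second moments of Ito processes and of their conditional means\<close>

lemma abs_set_integral_le:
 fixes f h :: "real => real"
 assumes "set_integrable lborel A f" "set_integrable lborel A h" "AE r in lborel. r \<in> A --> \<bar>f r\<bar> <= h r"
 shows "\<bar>LBINT r:A. f r\<bar> <= (LBINT r:A. h r)"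
proof -
 have "\<bar>LBINT r:A. f r\<bar> <= (\<integral>r. \<bar>indicator A r *\<^sub>R f r\<bar> \<partial>lborel)"
  unfolding set_lebesgue_integral_def by (rule integral_abs_bound)
 also have "\<dots> <= (LBINT r:A. h r)"
  unfolding set_lebesgue_integral_def
 proof (rule integral_mono_AE)
  show "AE r in lborel. \<bar>indicator A r *\<^sub>R f r\<bar> <= indicator A r *\<^sub>R h r"
   using assms(3) by eventually_elim (auto simp: indicator_def)
 qed (use assms(1,2) in \<open>auto simp: set_integrable_def\<close>)
 finally show ?thesis .
qed

lemma two_mult_le_add:
 fixes d u v :: real
 assumes "d^2 <= u * v" "0 <= u" "0 <= v"
 shows "2 * d <= u + v"
proof (rule power2_le_imp_le)
 have "4 * (u * v) <= (u + v)^2" using zero_le_power2[of "u - v"] by (simp add: power2_eq_square algebra_simps)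
 then show "(2 * d)^2 <= (u + v)^2" using assms(1) by (simp add: power_mult_distrib)
qed (use assms in simp)

lemma set_integrable_const_Ioc: "set_integrable lborel {s<..t::real} (%_. c::real)"
proof (cases "s <= t")
 case True
 then have "integrable lborel (indicator {s<..t} :: real => real)"
  by (intro integrable_real_indicator) auto
 then show ?thesis by (simp add: set_integrable_def)
qed (simp add: set_integrable_def)

lemma set_integral_const_Ioc: "s <= t ==> (LBINT r:{s<..t::real}. (c::real)) = (t - s) * c"
 by (simp add: set_lebesgue_integral_def)

text \<open>An Ito process in the form that second moments see: increments are decomposed up to a
  null set that may depend on \<open>s\<close> and \<open>t\<close>, and the integrals are given
  through approximants. The state space is an arbitrary Euclidean space so that affine images are
  again instances.\<close>

locale ito_sys = mean_field_basis M F0 W W0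
 for M F0 :: "'a measure" and W W0 :: "real => 'a => real" +
 fixes T :: real and X a c g I I0 :: "real => 'a => 'b::euclidean_space"
 assumes T: "0 <= T" and aP: "l2proc M T a" and XP: "l2proc M T X"
  and X: "!!t. t \<in> {0..T} ==> sq_int M (X t)" "!!t. t \<in> {0..T} ==> X t \<in> borel_measurable (F t)"
  and I: "\<exists>N \<tau> \<eta>. ito_approx W T c I N \<tau> \<eta>" and I0: "\<exists>N \<tau> \<eta>. ito_approx W0 T g I0 N \<tau> \<eta>"
  and dyn: "!!s t. 0 <= s ==> s <= t ==> t <= T ==>
    AE w in M. X t w - X s w = drift a s t w + ((I t w - I s w) + (I0 t w - I0 s w))"
begin

abbreviation mart :: "real => real => 'a => 'b" where
 "mart s t \<equiv> %w. (I t w - I s w) + (I0 t w - I0 s w)"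

abbreviation msq :: "(real => 'a => 'b) => real => real" where
 "msq Z r \<equiv> \<integral>w. (norm (Z r w))^2 \<partial>M"

lemma cP: "l2proc M T c" and gP: "l2proc M T g"
 using I I0 by (auto simp: ito_approx_def)

lemma I0_swap:
 obtains N \<tau> \<eta> where "mean_field_basis.ito_approx M F0 W0 W W0 T g I0 N \<tau> \<eta>"
proof -
 interpret sw: mean_field_basis M F0 W0 W by (rule swap)
 obtain N \<tau> \<eta> where "ito_approx W0 T g I0 N \<tau> \<eta>" using I0 by blast
 then have "sw.ito_approx W0 T g I0 N \<tau> \<eta>"
  by (simp add: ito_approx_def sw.ito_approx_def sq_data_def sw.sq_data_def swF)
 then show ?thesis by (rule that)
qed

text \<open>The integrals against the two noises are orthogonal by \<open>ito_cross\<close>, so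
  their mean squares add; for the one against \<open>W0\<close> the results are taken from the
  exchanged basis.\<close>

lemma mart:
 assumes st: "0 <= s" "s <= t" "t <= T"
 shows "sq_int M (mart s t)" (is ?g1) "(l2 M (mart s t))^2 = (LBINT r:{s<..t}. msq c r + msq g r)" (is ?g2)
  "[|sq_int M \<zeta>; \<zeta> \<in> borel_measurable (F s)|] ==> (\<integral>w. \<zeta> w \<bullet> mart s t w \<partial>M) = 0"
proof -
 interpret sw: mean_field_basis M F0 W0 W by (rule swap)
 obtain N \<tau> \<eta> where i: "ito_approx W T c I N \<tau> \<eta>" using I by blast
 obtain N' \<tau>' \<eta>' where i0: "ito_approx W0 T g I0 N' \<tau>' \<eta>'" using I0 by blast
 then have i0': "sw.ito_approx W0 T g I0 N' \<tau>' \<eta>'"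
  by (simp add: ito_approx_def sw.ito_approx_def sq_data_def sw.sq_data_def swF)
 note a = ito_increment[OF i st] and b = sw.ito_increment[OF i0' st, unfolded swF]
 show ?g1 by (rule sq_int_add[OF a(1) b(1)])
 show ?g2
  using integral_norm_sq_add[OF a(1) b(1)] ito_cross[OF i i0 st] a(3) b(3)
   set_integral_add(2)[OF time_integral_sq(1)[OF cP st(1,3)] time_integral_sq(1)[OF gP st(1,3)]]
  by (simp add: l2_sq)
 assume z: "sq_int M \<zeta>" "\<zeta> \<in> borel_measurable (F s)"
 show "(\<integral>w. \<zeta> w \<bullet> mart s t w \<partial>M) = 0"
  using a(4)[OF z] b(4)[OF z] sq_int_inner[OF z(1) a(1)] sq_int_inner[OF z(1) b(1)]
  by (simp add: inner_add_right)
qed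

lemma increment_inner:
 assumes st: "0 <= s" "s <= t" "t <= T" and z: "sq_int M \<zeta>" "\<zeta> \<in> borel_measurable (F s)"
 shows "(\<integral>w. \<zeta> w \<bullet> (X t w - X s w) \<partial>M) = (LBINT r:{s<..t}. \<integral>w. \<zeta> w \<bullet> a r w \<partial>M)"
proof -
 have st': "s \<in> {0..T}" "t \<in> {0..T}" using st by auto
 note m = mart[OF st] and d = drift_props[OF aP st]
 have "(\<integral>w. \<zeta> w \<bullet> (X t w - X s w) \<partial>M) = (\<integral>w. \<zeta> w \<bullet> drift a s t w + \<zeta> w \<bullet> mart s t w \<partial>M)"
 proof (rule integral_cong_AE)
  show "AE w in M. \<zeta> w \<bullet> (X t w - X s w) = \<zeta> w \<bullet> drift a s t w + \<zeta> w \<bullet> mart s t w"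
   using dyn[OF st] by eventually_elim (simp only: inner_add_right)
  show "(%w. \<zeta> w \<bullet> (X t w - X s w)) \<in> borel_measurable M"
   using z(1) X(1)[OF st'(1)] X(1)[OF st'(2)] by (auto simp: sq_int_def)
  show "(%w. \<zeta> w \<bullet> drift a s t w + \<zeta> w \<bullet> mart s t w) \<in> borel_measurable M"
   using Bochner_Integration.integrable_add[OF sq_int_inner[OF z(1) d(1)] sq_int_inner[OF z(1) m(1)]]
   by (rule borel_measurable_integrable)
 qed
 also have "\<dots> = (LBINT r:{s<..t}. \<integral>w. \<zeta> w \<bullet> a r w \<partial>M)"
  using sq_int_inner[OF z(1) d(1)] sq_int_inner[OF z(1) m(1)] m(3)[OF z] d(3)[OF z(1)] by simp
 finally show ?thesis .
qed

lemma increment_sq: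
 assumes st: "0 <= s" "s <= t" "t <= T"
 shows "(\<integral>w. (norm (X t w - X s w))^2 \<partial>M) = (\<integral>w. (norm (drift a s t w + mart s t w))^2 \<partial>M)"
proof (rule integral_cong_AE)
 have st': "s \<in> {0..T}" "t \<in> {0..T}" using st by auto
 show "AE w in M. (norm (X t w - X s w))^2 = (norm (drift a s t w + mart s t w))^2"
  using dyn[OF st] by eventually_elim simp
 show "(%w. (norm (X t w - X s w))^2) \<in> borel_measurable M"
  using sq_int_diff[OF X(1)[OF st'(2)] X(1)[OF st'(1)]] by (auto simp: sq_int_def)
 show "(%w. (norm (drift a s t w + mart s t w))^2) \<in> borel_measurable M"
  using sq_int_add[OF drift_props(1)[OF aP st] mart(1)[OF st]] by (auto simp: sq_int_def)
qed

lemma increment_l2_le: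
 assumes st: "0 <= s" "s <= t" "t <= T"
 shows "l2 M (%w. X t w - X s w) <= l2 M (drift a s t) + l2 M (mart s t)"
 using l2_add_le[OF drift_props(1)[OF aP st] mart(1)[OF st]] increment_sq[OF st] by (simp add: l2_def)

text \<open>Freezing \<open>Z\<close> at \<open>s\<close> costs at most \<open>\<delta>\<close>
  times the time integral of \<open>l2 M (a r)\<close>, and \<open>l2 M (a r) <= 1 + msq a r\<close>
  turns this into an additive function of the interval.\<close>

lemma cross_integral_le:
 assumes st: "0 <= s" "s <= t" "t <= T" and Z: "l2proc M T Z" "!!r. r \<in> {s..t} ==> sq_int M (Z r)"
  and d: "0 <= \<delta>" "!!r. r \<in> {s..t} ==> l2 M (%w. Z r w - Z s w) <= \<delta>"
 shows "\<bar>(LBINT r:{s<..t}. \<integral>w. Z s w \<bullet> a r w \<partial>M) - (LBINT r:{s<..t}. \<integral>w. Z r w \<bullet> a r w \<partial>M)\<bar>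
  <= \<delta> * ((t - s) + (LBINT r:{s<..t}. msq a r))"
proof -
 have Zs: "sq_int M (Z s)" using Z(2)[of s] st by simp
 have i: "set_integrable lborel {s<..t} (%r. \<integral>w. Z s w \<bullet> a r w \<partial>M)"
  "set_integrable lborel {s<..t} (%r. \<integral>w. Z r w \<bullet> a r w \<partial>M)"
  using time_integral_inner(1)[OF l2proc_const[OF Zs T] aP st(1,3)] time_integral_inner(1)[OF Z(1) aP st(1,3)] .
 have ie: "set_integrable lborel {s<..t} (%r. 1 + msq a r)"
  by (intro set_integral_add(1) set_integrable_const_Ioc time_integral_sq(1)[OF aP st(1,3)])
 have "\<bar>LBINT r:{s<..t}. (\<integral>w. Z s w \<bullet> a r w \<partial>M) - (\<integral>w. Z r w \<bullet> a r w \<partial>M)\<bar> <= (LBINT r:{s<..t}. \<delta> * (1 + msq a r))"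
 proof (rule abs_set_integral_le)
  show "AE r in lborel. r \<in> {s<..t} --> \<bar>(\<integral>w. Z s w \<bullet> a r w \<partial>M) - (\<integral>w. Z r w \<bullet> a r w \<partial>M)\<bar> <= \<delta> * (1 + msq a r)"
   using l2proc_AE[OF aP]
  proof eventually_elim
   case (elim r)
   show ?case
   proof
    assume r: "r \<in> {s<..t}"
    then have ar: "sq_int M (a r)" using elim st by auto
    have Zr: "sq_int M (Z r)" using Z(2)[of r] r by simp
    have "\<bar>(\<integral>w. Z s w \<bullet> a r w \<partial>M) - (\<integral>w. Z r w \<bullet> a r w \<partial>M)\<bar> = \<bar>\<integral>w. (Z s w - Z r w) \<bullet> a r w \<partial>M\<bar>"
     using sq_int_inner[OF Zs ar] sq_int_inner[OF Zr ar] by (simp add: inner_diff_left)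
    also have "\<dots> <= l2 M (%w. Z s w - Z r w) * l2 M (a r)"
     by (rule abs_integral_inner_le[OF sq_int_diff[OF Zs Zr] ar])
    also have "\<dots> <= \<delta> * l2 M (a r)"
     using d(2)[of r] r l2_minus_commute[of M "Z s" "Z r"] by (intro mult_right_mono) auto
    also have "\<dots> <= \<delta> * (1 + msq a r)"
    proof (rule mult_left_mono[OF _ d(1)])
     show "l2 M (a r) <= 1 + msq a r"
      using two_mult_le_add[of "l2 M (a r)" 1 "msq a r"] l2_nonneg[of M "a r"] l2_sq[of M "a r"]
       zero_le_power2[of "l2 M (a r)"] by linarith
    qed
    finally show "\<bar>(\<integral>w. Z s w \<bullet> a r w \<partial>M) - (\<integral>w. Z r w \<bullet> a r w \<partial>M)\<bar> <= \<delta> * (1 + msq a r)" .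
   qed
  qed
 qed (use i ie in \<open>auto intro: set_integral_diff\<close>)
 also have "(LBINT r:{s<..t}. \<delta> * (1 + msq a r)) = \<delta> * ((t - s) + (LBINT r:{s<..t}. msq a r))"
  using set_integral_add(2)[OF set_integrable_const_Ioc[of s t 1] time_integral_sq(1)[OF aP st(1,3)]] st
  by (simp add: set_integral_const_Ioc)
 finally show ?thesis using set_integral_diff(2)[OF i] by simp
qed

lemma msq_a_nonneg: "0 <= (LBINT r:{s<..t}. msq a r)"
 unfolding set_lebesgue_integral_def by (rule Bochner_Integration.integral_nonneg) (simp add: indicator_def)

text \<open>The square is expanded around \<open>X s\<close>. The martingale part drops out of the
  linear term, and by the isometry its mean square is the integral over \<open>c\<close> and
  \<open>g\<close>. The rest, namely the freezing of \<open>X\<close>, the squared drift and the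
  product of drift and martingale part, is a small factor times
  \<open>(t - s) + (LBINT r:{s<..t}. msq a r)\<close>.\<close>

lemma X_step:
 assumes st: "0 <= s" "s <= t" "t <= T" and d: "0 <= \<delta>" "!!r. r \<in> {s..t} ==> l2 M (%w. X r w - X s w) <= \<delta>"
 shows "\<bar>msq X t - msq X s - (LBINT r:{s<..t}. 2 * (\<integral>w. X r w \<bullet> a r w \<partial>M) + (msq c r + msq g r))\<bar>
  <= (2 * \<delta> + (t - s) + l2 M (mart s t)) * ((t - s) + (LBINT r:{s<..t}. msq a r))"
proof -
 have st': "s \<in> {0..T}" "t \<in> {0..T}" using st by auto
 have Xr: "sq_int M (X r)" if "r \<in> {s..t}" for r using X(1) that st by auto
 let ?u = "LBINT r:{s<..t}. msq a r" and ?D = "l2 M (drift a s t)" and ?m = "l2 M (mart s t)"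
 have u: "0 <= ?u" by (rule msq_a_nonneg)
 note D = drift_props[OF aP st] and m = mart[OF st]
 note cr = cross_integral_le[OF st XP Xr d]
 have "msq X t = msq X s + 2 * (\<integral>w. X s w \<bullet> (X t w - X s w) \<partial>M) + (\<integral>w. (norm (X t w - X s w))^2 \<partial>M)"
  using integral_norm_sq_add[OF X(1)[OF st'(1)] sq_int_diff[OF X(1)[OF st'(2)] X(1)[OF st'(1)]]] by simp
 also have "\<dots> = msq X s + 2 * (LBINT r:{s<..t}. \<integral>w. X s w \<bullet> a r w \<partial>M) +
   (?D^2 + 2 * (\<integral>w. drift a s t w \<bullet> mart s t w \<partial>M) + ?m^2)"
  using increment_inner[OF st X(1)[OF st'(1)] X(2)[OF st'(1)]] increment_sq[OF st] integral_norm_sq_add[OF D(1) m(1)]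
  by (simp add: l2_sq)
 finally have e1: "msq X t = \<dots>" .
 have e2: "(LBINT r:{s<..t}. 2 * (\<integral>w. X r w \<bullet> a r w \<partial>M) + (msq c r + msq g r)) =
   2 * (LBINT r:{s<..t}. (\<integral>w. X r w \<bullet> a r w \<partial>M)) + ?m^2"
  unfolding m(2)
  using set_integral_add(2)[OF set_integrable_mult_right[of 2, OF time_integral_inner(1)[OF XP aP st(1,3)]]
    set_integral_add(1)[OF time_integral_sq(1)[OF cP st(1,3)] time_integral_sq(1)[OF gP st(1,3)]]] by simp
 have b1: "?D^2 <= (t - s) * ?u" by (rule D(2))
 have b2: "\<bar>2 * (\<integral>w. drift a s t w \<bullet> mart s t w \<partial>M)\<bar> <= ?m * ((t - s) + ?u)"
 proof -
  have "\<bar>2 * (\<integral>w. drift a s t w \<bullet> mart s t w \<partial>M)\<bar> <= 2 * (?D * ?m)"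
   using abs_integral_inner_le[OF D(1) m(1)] by (simp add: abs_mult)
  also have "\<dots> = ?m * (2 * ?D)" by simp
  also have "\<dots> <= ?m * ((t - s) + ?u)"
   using two_mult_le_add[OF b1] st u by (intro mult_left_mono) auto
  finally show ?thesis .
 qed
 have b3: "(t - s) * ?u <= (t - s) * ((t - s) + ?u)" using st by (intro mult_left_mono) auto
 have "(2 * \<delta> + (t - s) + ?m) * ((t - s) + ?u) =
   2 * (\<delta> * ((t - s) + ?u)) + (t - s) * ((t - s) + ?u) + ?m * ((t - s) + ?u)"
  by (simp only: distrib_right mult.assoc)
 then show ?thesis
  unfolding e1 e2 using cr b1 b2 b3 zero_le_power2[of ?D] by linarith
qed

lemma modulus:
 assumes e: "0 < \<epsilon>"
 shows "\<exists>d>0. \<forall>s t. 0 <= s --> s <= t --> t <= T --> t - s < d -->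
  l2 M (%w. X t w - X s w) <= \<epsilon> \<and> l2 M (mart s t) <= \<epsilon> \<and> l2 M (drift a s t) <= \<epsilon> \<and>
  (LBINT r:{s<..t}. msq a r) <= \<epsilon>^2"
proof -
 \<comment> \<open>One half of \<open>\<epsilon>\<close> goes to the martingale part and one to the
   drift; the bound 1 on the length of the interval absorbs the factor \<open>t - s\<close> from
   \<open>drift_props\<close>.\<close>
 let ?e = "(\<epsilon> / 2)^2"
 have e2: "0 < ?e" using e by simp
 have i: "set_integrable lborel {0<..T} (%r. msq c r + msq g r)"
  by (intro set_integral_add(1) time_integral_sq(1)[OF cP] time_integral_sq(1)[OF gP]) auto
 have ia: "set_integrable lborel {0<..T} (%r. msq a r)"
  by (rule time_integral_sq(1)[OF aP]) auto
 obtain d1 where d1: "0 < d1" "!!s t. 0 <= s ==> s <= t ==> t <= T ==> t - s < d1 ==> \<bar>LBINT r:{s<..t}. msq c r + msq g r\<bar> < ?e"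
  using set_integral_Ioc_modulus[OF i e2] by blast
 obtain d2 where d2: "0 < d2" "!!s t. 0 <= s ==> s <= t ==> t <= T ==> t - s < d2 ==> \<bar>LBINT r:{s<..t}. msq a r\<bar> < ?e"
  using set_integral_Ioc_modulus[OF ia e2] by blast
 have "?e <= \<epsilon>^2" using e by (simp add: power_divide)
 have main: "l2 M (%w. X t w - X s w) <= \<epsilon> \<and> l2 M (mart s t) <= \<epsilon> \<and> l2 M (drift a s t) <= \<epsilon> \<and>
  (LBINT r:{s<..t}. msq a r) <= \<epsilon>^2"
  if st: "0 <= s" "s <= t" "t <= T" "t - s < min 1 (min d1 d2)" for s t
 proof -
  have u: "(LBINT r:{s<..t}. msq a r) < ?e" using d2(2)[OF st(1-3)] st(4) by auto
  have "(l2 M (mart s t))^2 <= ?e" using d1(2)[OF st(1-3)] st(4) mart(2)[OF st(1-3)] by auto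
  then have m: "l2 M (mart s t) <= \<epsilon> / 2" by (rule power2_le_imp_le) (use e in simp)
  have "(l2 M (drift a s t))^2 <= (t - s) * (LBINT r:{s<..t}. msq a r)" by (rule drift_props(2)[OF aP st(1-3)])
  also have "\<dots> <= 1 * ?e" using st u msq_a_nonneg by (intro mult_mono) auto
  finally have "(l2 M (drift a s t))^2 <= ?e" by simp
  then have "l2 M (drift a s t) <= \<epsilon> / 2" by (rule power2_le_imp_le) (use e in simp)
  then show ?thesis using m u \<open>?e <= \<epsilon>^2\<close> increment_l2_le[OF st(1-3)] e by linarith
 qed
 show ?thesis by (rule exI[of _ "min 1 (min d1 d2)"]) (use d1(1) d2(1) main in simp)
qed

lemma Ioc_split:
 fixes f :: "real => real"
 assumes "set_integrable lborel {0<..T} f" "0 <= s" "s <= t" "t <= T"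
 shows "(LBINT r:{0<..t}. f r) - (LBINT r:{0<..s}. f r) = (LBINT r:{s<..t}. f r)"
proof -
 have "set_integrable lborel {0<..t} f" using assms by (auto intro: set_integrable_subset)
 from set_integral_Ioc_split[OF this assms(2,3)] show ?thesis by simp
qed

lemma identity_from_steps:
 fixes f :: "real => real"
 assumes t: "t \<in> {0..T}" and f: "set_integrable lborel {0<..T} f"
  and step: "!!\<epsilon>. 0 < \<epsilon> ==> \<exists>d>0. \<forall>s t. 0 <= s --> s <= t --> t <= T --> t - s < d -->
    \<bar>\<Phi> t - \<Phi> s - (LBINT r:{s<..t}. f r)\<bar> <= \<epsilon> * ((t - s) + (LBINT r:{s<..t}. msq a r))"
 shows "\<Phi> t - \<Phi> 0 = (LBINT r:{0<..t}. f r)"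
proof -
 have ia: "set_integrable lborel {0<..T} (%r. msq a r)" by (rule time_integral_sq(1)[OF aP]) auto
 define \<Psi> where "\<Psi> t = (LBINT r:{0<..t}. f r)" for t
 define G where "G t = t + (LBINT r:{0<..t}. msq a r)" for t
 have "\<Phi> t - \<Phi> 0 = \<Psi> t - \<Psi> 0"
 proof (rule partition_identity)
  show "0 <= t" using t by simp
  fix \<epsilon> :: real assume e: "0 < \<epsilon>"
  obtain d where d: "0 < d" "!!s t. 0 <= s ==> s <= t ==> t <= T ==> t - s < d ==>
    \<bar>\<Phi> t - \<Phi> s - (LBINT r:{s<..t}. f r)\<bar> <= \<epsilon> * ((t - s) + (LBINT r:{s<..t}. msq a r))" using step[OF e] by blast
  show "\<exists>d>0. \<forall>s t'. 0 <= s --> s <= t' --> t' <= t --> t' - s < d -->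
    \<bar>\<Phi> t' - \<Phi> s - (\<Psi> t' - \<Psi> s)\<bar> <= \<epsilon> * (G t' - G s)"
  proof (intro exI[of _ d] conjI allI impI d(1))
   fix s t' assume st: "0 <= s" "s <= t'" "t' <= t" "t' - s < d"
   then have "t' <= T" using t by simp
   have "\<Psi> t' - \<Psi> s = (LBINT r:{s<..t'}. f r)" unfolding \<Psi>_def by (rule Ioc_split[OF f st(1,2) \<open>t' <= T\<close>])
   moreover have "G t' - G s = (t' - s) + (LBINT r:{s<..t'}. msq a r)"
    unfolding G_def using Ioc_split[OF ia st(1,2) \<open>t' <= T\<close>] by simp
   ultimately show "\<bar>\<Phi> t' - \<Phi> s - (\<Psi> t' - \<Psi> s)\<bar> <= \<epsilon> * (G t' - G s)"
    using d(2)[OF st(1,2) \<open>t' <= T\<close> st(4)] by simp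
  qed
 qed
 then show ?thesis by (simp add: \<Psi>_def set_lebesgue_integral_def)
qed

theorem X_identity:
 assumes t: "t \<in> {0..T}"
 shows "msq X t - msq X 0 = (LBINT r:{0<..t}. 2 * (\<integral>w. X r w \<bullet> a r w \<partial>M) + (msq c r + msq g r))"
proof (rule identity_from_steps[OF t])
 show "set_integrable lborel {0<..T} (%r. 2 * (\<integral>w. X r w \<bullet> a r w \<partial>M) + (msq c r + msq g r))"
  by (intro set_integral_add(1) set_integrable_mult_right time_integral_inner(1)[OF XP aP] time_integral_sq(1)[OF cP]
   time_integral_sq(1)[OF gP]) auto
 fix \<epsilon> :: real assume e: "0 < \<epsilon>"
 \<comment> \<open>The modulus counts twice in \<open>X_step\<close>, the step length and the
   martingale part once each, hence quarters.\<close>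
 then have e4: "0 < \<epsilon> / 4" by simp
 obtain d where d: "0 < d" "!!s t. 0 <= s ==> s <= t ==> t <= T ==> t - s < d ==>
   l2 M (%w. X t w - X s w) <= \<epsilon> / 4 \<and> l2 M (mart s t) <= \<epsilon> / 4"
  using modulus[OF e4] by blast
 show "\<exists>d>0. \<forall>s t. 0 <= s --> s <= t --> t <= T --> t - s < d -->
   \<bar>msq X t - msq X s - (LBINT r:{s<..t}. 2 * (\<integral>w. X r w \<bullet> a r w \<partial>M) + (msq c r + msq g r))\<bar>
   <= \<epsilon> * ((t - s) + (LBINT r:{s<..t}. msq a r))"
 proof (intro exI[of _ "min d (\<epsilon> / 4)"] conjI allI impI)
  show "0 < min d (\<epsilon> / 4)" using d(1) e by simp
  fix s t assume st: "0 <= s" "s <= t" "t <= T" "t - s < min d (\<epsilon> / 4)"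
  have l: "l2 M (%w. X r w - X s w) <= \<epsilon> / 4" if "r \<in> {s..t}" for r
   using d(2)[of s r] that st by auto
  have m: "l2 M (mart s t) <= \<epsilon> / 4" using d(2)[OF st(1-3)] st(4) by simp
  have "\<bar>msq X t - msq X s - (LBINT r:{s<..t}. 2 * (\<integral>w. X r w \<bullet> a r w \<partial>M) + (msq c r + msq g r))\<bar>
   <= (2 * (\<epsilon> / 4) + (t - s) + l2 M (mart s t)) * ((t - s) + (LBINT r:{s<..t}. msq a r))"
   by (rule X_step[OF st(1-3) _ l]) (use e in auto)
  also have "\<dots> <= \<epsilon> * ((t - s) + (LBINT r:{s<..t}. msq a r))"
   using m st msq_a_nonneg[of s t] by (intro mult_right_mono) auto
  finally show "\<bar>msq X t - msq X s - (LBINT r:{s<..t}. 2 * (\<integral>w. X r w \<bullet> a r w \<partial>M) + (msq c r + msq g r))\<bar>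
   <= \<epsilon> * ((t - s) + (LBINT r:{s<..t}. msq a r))" .
 qed
qed

end

text \<open>\<open>gh\<close> is the conditional mean of \<open>g\<close>, and \<open>Y\<close> is
  expected to have \<open>gh\<close> as its only diffusion coefficient. Continuity of
  \<open>g\<close> in \<open>l2\<close> serves to compare its integral against \<open>W0\<close>
  with the coefficient frozen at the left end. The drift \<open>a\<close> appears only paired with
  \<open>Y\<close>, so its own conditional mean gets no name.\<close>

locale cm_sys = ito_sys +
 fixes Y gh :: "real => 'a => 'b" and C :: real
 assumes Y: "!!t. t \<in> {0..T} ==> is_cm M (H t) (X t) (Y t)" and YP: "l2proc M T Y"
  and gF: "!!t. t \<in> {0..T} ==> g t \<in> borel_measurable (F t)"
  and gh: "!!t. t \<in> {0..T} ==> is_cm M (H t) (g t) (gh t)" and ghP: "l2proc M T gh"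
  and g_bound: "!!t. t \<in> {0..T} ==> l2 M (gh t) <= C"
  and g_modulus: "!!\<epsilon>. 0 < \<epsilon> ==> \<exists>d>0. \<forall>s t. 0 <= s --> s <= t --> t <= T --> t - s < d -->
    l2 M (%w. g t w - g s w) <= \<epsilon>"
begin

lemma C0: "0 <= C"
 using order_trans[OF l2_nonneg g_bound[of 0]] T by simp

lemma cm_increment:
 assumes st: "0 <= s" "s <= t" "t <= T"
 shows "is_cm M (H t) (%w. X t w - X s w) (%w. Y t w - Y s w)" (is ?g1)
  "is_cm M (H t) (%w. g t w - g s w) (%w. gh t w - gh s w)" (is ?g2)
proof -
 have st': "s \<in> {0..T}" "t \<in> {0..T}" using st by auto
 show ?g1
  by (intro is_cm_diff Y st' subalg_H is_cm_H_mono[OF st(1,2)] X(2))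
 show ?g2
  by (intro is_cm_diff gh st' subalg_H is_cm_H_mono[OF st(1,2)] gF)
qed

text \<open>After expansion of the square, the isometry and the covariation with the noise combine
  into the time integral of the mean square of \<open>g r - g s\<close>.\<close>

lemma W0_remainder:
 assumes st: "0 <= s" "s <= t" "t <= T" and d: "0 <= \<delta>" "!!r. r \<in> {s..t} ==> l2 M (%w. g r w - g s w) <= \<delta>"
 shows "l2 M (%w. (I0 t w - I0 s w) - (W0 t w - W0 s w) *\<^sub>R g s w) <= sqrt (t - s) * \<delta>" (is ?g1)
  "sq_int M (%w. I0 t w - I0 s w)" (is ?g2)
proof -
 interpret sw: mean_field_basis M F0 W0 W by (rule swap)
 have s': "s \<in> {0..T}" using st by auto
 obtain N \<tau> \<eta> where i: "sw.ito_approx W0 T g I0 N \<tau> \<eta>" by (rule I0_swap)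
 have gs: "sq_int M (g s)" "g s \<in> borel_measurable (F s)" using gh[OF s'] gF[OF s'] by (auto simp: is_cm_def)
 have gr: "sq_int M (g r)" if "r \<in> {s..t}" for r using gh[of r] that st by (auto simp: is_cm_def)
 note b = sw.ito_increment[OF i st, unfolded swF]
 note w = sw.increment_scaleR[OF st(1,2) gs(1), unfolded swF, OF gs(2)]
 show ?g2 by (rule b(1))
 have P: "l2proc M T (%_. g s)" by (rule l2proc_const[OF gs(1) T])
 have i1: "set_integrable lborel {s<..t} (msq g)" by (rule time_integral_sq(1)[OF gP st(1,3)])
 have i2: "set_integrable lborel {s<..t} (%r. \<integral>w. g r w \<bullet> g s w \<partial>M)" by (rule time_integral_inner(1)[OF gP P st(1,3)])
 have "(l2 M (%w. (I0 t w - I0 s w) - (W0 t w - W0 s w) *\<^sub>R g s w))^2 =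
   (l2 M (%w. I0 t w - I0 s w))^2 - 2 * (\<integral>w. (I0 t w - I0 s w) \<bullet> ((W0 t w - W0 s w) *\<^sub>R g s w) \<partial>M)
   + (l2 M (%w. (W0 t w - W0 s w) *\<^sub>R g s w))^2"
  using integral_norm_sq_add[OF b(1) sq_int_uminus[OF w(1)]] by (simp add: l2_sq)
 also have "\<dots> = (LBINT r:{s<..t}. msq g r) - 2 * (LBINT r:{s<..t}. \<integral>w. g r w \<bullet> g s w \<partial>M) + (t - s) * msq g s"
  using b(3) b(5)[OF gs] w(2) by (simp add: l2_sq)
 also have "\<dots> = (LBINT r:{s<..t}. msq g r - 2 * (\<integral>w. g r w \<bullet> g s w \<partial>M) + msq g s)"
  using set_integral_add(2)[OF set_integral_diff(1)[OF i1 set_integrable_mult_right[of 2, OF i2]] set_integrable_const_Ioc[of s t "msq g s"]]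
   set_integral_diff(2)[OF i1 set_integrable_mult_right[of 2, OF i2]] st
  by (simp add: set_integral_const_Ioc)
 also have "\<dots> <= (LBINT r:{s<..t}. \<delta>^2)"
 proof (rule order_trans[OF abs_ge_self abs_set_integral_le])
  show "set_integrable lborel {s<..t} (%r. msq g r - 2 * (\<integral>w. g r w \<bullet> g s w \<partial>M) + msq g s)"
   by (intro set_integral_add(1) set_integral_diff(1) i1 set_integrable_mult_right i2 set_integrable_const_Ioc)
  have "\<bar>msq g r - 2 * (\<integral>w. g r w \<bullet> g s w \<partial>M) + msq g s\<bar> <= \<delta>^2" if r: "r \<in> {s<..t}" for r
  proof -
   have r': "r \<in> {s..t}" using r by auto
   have "msq g r - 2 * (\<integral>w. g r w \<bullet> g s w \<partial>M) + msq g s = (l2 M (%w. g r w - g s w))^2"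
    using integral_norm_sq_add[OF gr[OF r'] sq_int_uminus[OF gs(1)]] by (simp add: l2_sq)
   moreover have "(l2 M (%w. g r w - g s w))^2 <= \<delta>^2" by (rule power_mono[OF d(2)[OF r'] l2_nonneg])
   ultimately show ?thesis by simp
  qed
  then show "AE r in lborel. r \<in> {s<..t} --> \<bar>msq g r - 2 * (\<integral>w. g r w \<bullet> g s w \<partial>M) + msq g s\<bar> <= \<delta>^2" by simp
 qed (rule set_integrable_const_Ioc)
 also have "\<dots> = (sqrt (t - s) * \<delta>)^2" using st by (simp add: set_integral_const_Ioc power_mult_distrib)
 finally show ?g1
  by (rule power2_le_imp_le) (use d st in simp)
qed

lemma Y_step:
 assumes st: "0 <= s" "s <= t" "t <= T" and d: "0 <= \<delta>"
  "!!r. r \<in> {s..t} ==> l2 M (%w. X r w - X s w) <= \<delta>" "!!r. r \<in> {s..t} ==> l2 M (%w. g r w - g s w) <= \<delta>"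
  and u: "(LBINT r:{s<..t}. msq a r) <= \<delta>^2"
 shows "\<bar>msq Y t - msq Y s - (LBINT r:{s<..t}. 2 * (\<integral>w. Y r w \<bullet> a r w \<partial>M) + msq gh r)\<bar>
  <= (2 * \<delta> + (4 * \<delta>^2 + 4 * C * \<delta> + 2 * C * \<delta>)) * ((t - s) + (LBINT r:{s<..t}. msq a r))"
proof -
 have st': "s \<in> {0..T}" "t \<in> {0..T}" using st by auto
 let ?u = "LBINT r:{s<..t}. msq a r"
 have u0: "0 <= ?u" by (rule msq_a_nonneg)
 have Ysq: "sq_int M (Y r)" "Y r \<in> borel_measurable (H r)" if "r \<in> {0..T}" for r
  using Y[OF that] by (auto simp: is_cm_def)
 have ghsq: "sq_int M (gh r)" "gh r \<in> borel_measurable (H r)" if "r \<in> {0..T}" for r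
  using gh[OF that] by (auto simp: is_cm_def)
 have in_T: "r \<in> {0..T}" if "r \<in> {s..t}" for r using that st by auto
 have Ymod: "l2 M (%w. Y r w - Y s w) <= \<delta>" if r: "r \<in> {s..t}" for r
  using is_cm_l2_le[OF cm_increment(1)[of s r] subalg_H] d(2)[OF r] r st by auto
 have ghmod: "l2 M (%w. gh r w - gh s w) <= \<delta>" if r: "r \<in> {s..t}" for r
  using is_cm_l2_le[OF cm_increment(2)[of s r] subalg_H] d(3)[OF r] r st by auto
 note cr = cross_integral_le[OF st YP Ysq(1)[OF in_T] d(1) Ymod]
 have in1: "(\<integral>w. Y s w \<bullet> (Y t w - Y s w) \<partial>M) = (LBINT r:{s<..t}. \<integral>w. Y s w \<bullet> a r w \<partial>M)"
 proof -
  have "(\<integral>w. Y s w \<bullet> (X t w - X s w) \<partial>M) = (\<integral>w. Y s w \<bullet> (Y t w - Y s w) \<partial>M)"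
   by (rule is_cm_inner[OF cm_increment(1)[OF st] subalg_H Ysq(1)[OF st'(1)] meas_H_mono[OF Ysq(2)[OF st'(1)] st(2)]])
  then show ?thesis using increment_inner[OF st Ysq(1)[OF st'(1)] meas_H_F[OF Ysq(2)[OF st'(1)]]] by simp
 qed
 let ?G = "%w. (W0 t w - W0 s w) *\<^sub>R gh s w" and ?g = "%w. (W0 t w - W0 s w) *\<^sub>R g s w"
 let ?h = "sqrt (t - s)"
 have gcm: "is_cm M (H t) ?g ?G" by (rule is_cm_increment_W0[OF st(1,2) order_refl gh[OF st'(1)] gF[OF st'(1)]])
 have Gsq: "sq_int M ?G" "sq_int M ?g" using gcm by (auto simp: is_cm_def)
 have Gl2: "(l2 M ?G)^2 = (t - s) * msq gh s"
 proof -
  interpret sw: mean_field_basis M F0 W0 W by (rule swap)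
  show ?thesis
   using sw.increment_scaleR(2)[OF st(1,2) ghsq(1)[OF st'(1)], unfolded swF, OF meas_H_F[OF ghsq(2)[OF st'(1)]]]
   by (simp add: l2_sq)
 qed
 obtain N \<tau> \<eta> where i: "ito_approx W T c I N \<tau> \<eta>" using I by blast
 note b = ito_increment[OF i st]
 define V where "V w = (Y t w - Y s w) - ?G w" for w
 have "is_cm M (H t) (%w. ((X t w - X s w) - (I t w - I s w)) - ?g w) (%w. ((Y t w - Y s w) - 0) - ?G w)"
  by (intro is_cm_diff cm_increment(1)[OF st] b(2) gcm subalg_H)
 then have Vcm: "is_cm M (H t) (%w. ((X t w - X s w) - (I t w - I s w)) - ?g w) V"
  by (simp add: V_def[abs_def])
 then have Vsq: "sq_int M V" by (simp add: is_cm_def)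
 note rem = W0_remainder[OF st d(1,3)] and D = drift_props[OF aP st]
 have Vl2: "l2 M V <= ?h * (2 * \<delta>)"
 proof -
  have "l2 M V <= l2 M (%w. ((X t w - X s w) - (I t w - I s w)) - ?g w)" by (rule is_cm_l2_le[OF Vcm subalg_H])
  also have "\<dots> = l2 M (%w. drift a s t w + ((I0 t w - I0 s w) - ?g w))"
  proof (rule sq_int_cong_AE(2)[OF sq_int_add[OF D(1) sq_int_diff[OF rem(2) Gsq(2)]]])
   show "(%w. ((X t w - X s w) - (I t w - I s w)) - ?g w) \<in> borel_measurable M"
    using Vcm by (simp add: is_cm_def sq_int_def)
   show "AE w in M. ((X t w - X s w) - (I t w - I s w)) - ?g w = drift a s t w + ((I0 t w - I0 s w) - ?g w)"
    using dyn[OF st] by eventually_elim simp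
  qed
  also have "\<dots> <= l2 M (drift a s t) + l2 M (%w. (I0 t w - I0 s w) - ?g w)"
   by (rule l2_add_le[OF D(1) sq_int_diff[OF rem(2) Gsq(2)]])
  also have "l2 M (drift a s t) <= ?h * \<delta>"
  proof (rule power2_le_imp_le)
   have "(l2 M (drift a s t))^2 <= (t - s) * ?u" by (rule D(2))
   also have "\<dots> <= (t - s) * \<delta>^2" using st u by (intro mult_left_mono) auto
   finally show "(l2 M (drift a s t))^2 <= (?h * \<delta>)^2" using st by (simp add: power_mult_distrib)
  qed (use d st in simp)
  finally show ?thesis using rem(1) by (simp add: algebra_simps)
 qed
 have Gle: "l2 M ?G <= ?h * C"
 proof (rule power2_le_imp_le)
  have "msq gh s <= C^2" using power_mono[OF g_bound[OF st'(1)] l2_nonneg, of 2] by (simp add: l2_sq)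
  then show "(l2 M ?G)^2 <= (?h * C)^2" unfolding Gl2 using st by (simp add: power_mult_distrib mult_left_mono)
 qed (use C0 st in simp)
 have "(\<integral>w. (norm (Y t w - Y s w))^2 \<partial>M) = (l2 M ?G)^2 + 2 * (\<integral>w. ?G w \<bullet> V w \<partial>M) + (l2 M V)^2"
  using integral_norm_sq_add[OF Gsq(1) Vsq] by (simp add: V_def l2_sq)
 moreover have "\<bar>2 * (\<integral>w. ?G w \<bullet> V w \<partial>M)\<bar> <= (t - s) * (4 * C * \<delta>)"
 proof -
  have "\<bar>\<integral>w. ?G w \<bullet> V w \<partial>M\<bar> <= l2 M ?G * l2 M V" by (rule abs_integral_inner_le[OF Gsq(1) Vsq])
  also have "\<dots> <= (?h * C) * (?h * (2 * \<delta>))" using Gle Vl2 C0 st by (intro mult_mono) auto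
  also have "\<dots> = ?h^2 * (2 * C * \<delta>)" by (simp add: power2_eq_square)
  also have "\<dots> = (t - s) * (2 * C * \<delta>)" using st by simp
  finally have "\<bar>\<integral>w. ?G w \<bullet> V w \<partial>M\<bar> <= (t - s) * (2 * C * \<delta>)" .
  moreover have "2 * ((t - s) * (2 * C * \<delta>)) = (t - s) * (4 * C * \<delta>)" by simp
  ultimately show ?thesis unfolding abs_mult abs_numeral by linarith
 qed
 moreover have "(l2 M V)^2 <= (t - s) * (4 * \<delta>^2)"
  using power_mono[OF Vl2 l2_nonneg, of 2] st by (simp add: power_mult_distrib)
 ultimately have e3: "\<bar>(\<integral>w. (norm (Y t w - Y s w))^2 \<partial>M) - (t - s) * msq gh s\<bar> <= (t - s) * (4 * \<delta>^2 + 4 * C * \<delta>)"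
  unfolding Gl2 distrib_left using zero_le_power2[of "l2 M V"] by linarith
 have igh: "set_integrable lborel {s<..t} (msq gh)" by (rule time_integral_sq(1)[OF ghP st(1,3)])
 \<comment> \<open>Passes from \<open>gh\<close> frozen at \<open>s\<close> to \<open>gh\<close> at
   \<open>r\<close>: a difference of squares is the sum of the norms, at most \<open>2 * C\<close>,
   times their difference, at most \<open>\<delta>\<close>.\<close>
 have e4: "\<bar>(LBINT r:{s<..t}. msq gh s) - (LBINT r:{s<..t}. msq gh r)\<bar> <= (t - s) * (2 * C * \<delta>)"
 proof -
  have "\<bar>LBINT r:{s<..t}. msq gh s - msq gh r\<bar> <= (LBINT r:{s<..t}. 2 * C * \<delta>)"
  proof (rule abs_set_integral_le)
   have "\<bar>msq gh s - msq gh r\<bar> <= 2 * C * \<delta>" if r: "r \<in> {s<..t}" for r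
   proof -
    have r': "r \<in> {s..t}" "r \<in> {0..T}" using r st by auto
    have "\<bar>msq gh s - msq gh r\<bar> = \<bar>l2 M (gh s) + l2 M (gh r)\<bar> * \<bar>l2 M (gh s) - l2 M (gh r)\<bar>"
     unfolding l2_sq[symmetric] abs_mult[symmetric] by (simp add: power2_eq_square algebra_simps)
    also have "\<dots> <= (2 * C) * \<delta>"
    proof (rule mult_mono)
     show "\<bar>l2 M (gh s) + l2 M (gh r)\<bar> <= 2 * C"
      using g_bound[OF st'(1)] g_bound[OF r'(2)] l2_nonneg[of M "gh s"] l2_nonneg[of M "gh r"] by linarith
     show "\<bar>l2 M (gh s) - l2 M (gh r)\<bar> <= \<delta>"
      using l2_diff_abs[OF ghsq(1)[OF r'(2)] ghsq(1)[OF st'(1)]] ghmod[OF r'(1)] by linarith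
    qed (use C0 in auto)
    finally show ?thesis .
   qed
   then show "AE r in lborel. r \<in> {s<..t} --> \<bar>msq gh s - msq gh r\<bar> <= 2 * C * \<delta>" by simp
  qed (intro set_integral_diff(1) set_integrable_const_Ioc igh)+
  then show ?thesis
   using set_integral_diff(2)[OF set_integrable_const_Ioc[of s t "msq gh s"] igh] st by (simp add: set_integral_const_Ioc mult_ac)
 qed
 have e1: "msq Y t = msq Y s + 2 * (LBINT r:{s<..t}. \<integral>w. Y s w \<bullet> a r w \<partial>M) + (\<integral>w. (norm (Y t w - Y s w))^2 \<partial>M)"
  using integral_norm_sq_add[OF Ysq(1)[OF st'(1)] sq_int_diff[OF Ysq(1)[OF st'(2)] Ysq(1)[OF st'(1)]]] in1 by simp
 have e2: "(LBINT r:{s<..t}. 2 * (\<integral>w. Y r w \<bullet> a r w \<partial>M) + msq gh r) =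
   2 * (LBINT r:{s<..t}. (\<integral>w. Y r w \<bullet> a r w \<partial>M)) + (LBINT r:{s<..t}. msq gh r)"
  using set_integral_add(2)[OF set_integrable_mult_right[of 2, OF time_integral_inner(1)[OF YP aP st(1,3)]] igh] by simp
 have e5: "(LBINT r:{s<..t}. msq gh s) = (t - s) * msq gh s" using st by (simp add: set_integral_const_Ioc)
 let ?k = "4 * \<delta>^2 + 4 * C * \<delta> + 2 * C * \<delta>"
 have k: "0 <= ?k" using C0 d(1) by simp
 have "(t - s) * (4 * \<delta>^2 + 4 * C * \<delta>) + (t - s) * (2 * C * \<delta>) = (t - s) * ?k" by (simp only: distrib_left)
 moreover have "(t - s) * ?k <= ?k * ((t - s) + ?u)" using mult_left_mono[OF _ k, of "t - s" "(t - s) + ?u"] u0 by (simp add: mult.commute)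
 moreover have "(2 * \<delta> + ?k) * ((t - s) + ?u) = 2 * (\<delta> * ((t - s) + ?u)) + ?k * ((t - s) + ?u)"
  by (simp only: distrib_right mult.assoc)
 ultimately show ?thesis
  unfolding e1 e2 using cr e3 e4 unfolding e5 by linarith
qed

theorem Y_identity:
 assumes t: "t \<in> {0..T}"
 shows "msq Y t - msq Y 0 = (LBINT r:{0<..t}. 2 * (\<integral>w. Y r w \<bullet> a r w \<partial>M) + msq gh r)"
proof (rule identity_from_steps[OF t])
 show "set_integrable lborel {0<..T} (%r. 2 * (\<integral>w. Y r w \<bullet> a r w \<partial>M) + msq gh r)"
  by (intro set_integral_add(1) set_integrable_mult_right time_integral_inner(1)[OF YP aP] time_integral_sq(1)[OF ghP]) auto
 fix \<epsilon> :: real assume e: "0 < \<epsilon>"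
 \<comment> \<open>The cap at 1 gives \<open>\<delta>^2 <= \<delta>\<close>; then the coefficients
   in \<open>Y_step\<close> sum to \<open>2 + 4\<close> and \<open>4 * C + 2 * C\<close>, that is to
   \<open>6 + 6 * C\<close>.\<close>
 define \<delta> where "\<delta> = min 1 (\<epsilon> / (6 + 6 * C))"
 have d: "0 < \<delta>" "\<delta> <= 1" using e C0 by (auto simp: \<delta>_def)
 have de: "\<delta> * (6 + 6 * C) <= \<epsilon>"
 proof -
  have "\<delta> * (6 + 6 * C) <= \<epsilon> / (6 + 6 * C) * (6 + 6 * C)" using C0 by (intro mult_right_mono) (auto simp: \<delta>_def)
  then show ?thesis using C0 by simp
 qed
 have k: "2 * \<delta> + (4 * \<delta>^2 + 4 * C * \<delta> + 2 * C * \<delta>) <= \<epsilon>"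
 proof -
  have "\<delta>^2 <= \<delta>" using d by (simp add: power2_eq_square mult_left_le)
  then show ?thesis using de by (simp add: algebra_simps)
 qed
 obtain d1 where d1: "0 < d1" "!!s t. 0 <= s ==> s <= t ==> t <= T ==> t - s < d1 ==>
   l2 M (%w. X t w - X s w) <= \<delta> \<and> (LBINT r:{s<..t}. msq a r) <= \<delta>^2"
  using modulus[OF d(1)] by blast
 obtain d2 where d2: "0 < d2" "!!s t. 0 <= s ==> s <= t ==> t <= T ==> t - s < d2 ==>
   l2 M (%w. g t w - g s w) <= \<delta>"
  using g_modulus[OF d(1)] by blast
 show "\<exists>d>0. \<forall>s t. 0 <= s --> s <= t --> t <= T --> t - s < d -->
   \<bar>msq Y t - msq Y s - (LBINT r:{s<..t}. 2 * (\<integral>w. Y r w \<bullet> a r w \<partial>M) + msq gh r)\<bar>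
   <= \<epsilon> * ((t - s) + (LBINT r:{s<..t}. msq a r))"
 proof (intro exI[of _ "min d1 d2"] conjI allI impI)
  show "0 < min d1 d2" using d1(1) d2(1) by simp
  fix s t assume st: "0 <= s" "s <= t" "t <= T" "t - s < min d1 d2"
  have l1: "l2 M (%w. X r w - X s w) <= \<delta>" if "r \<in> {s..t}" for r
   using d1(2)[of s r] that st by auto
  have l2: "l2 M (%w. g r w - g s w) <= \<delta>" if "r \<in> {s..t}" for r
   using d2(2)[of s r] that st by auto
  have u: "(LBINT r:{s<..t}. msq a r) <= \<delta>^2" using d1(2)[OF st(1-3)] st(4) by simp
  have "\<bar>msq Y t - msq Y s - (LBINT r:{s<..t}. 2 * (\<integral>w. Y r w \<bullet> a r w \<partial>M) + msq gh r)\<bar>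
   <= (2 * \<delta> + (4 * \<delta>^2 + 4 * C * \<delta> + 2 * C * \<delta>)) * ((t - s) + (LBINT r:{s<..t}. msq a r))"
   by (rule Y_step[OF st(1-3) _ l1 l2 u]) (use d in auto)
  also have "\<dots> <= \<epsilon> * ((t - s) + (LBINT r:{s<..t}. msq a r))"
   using k st msq_a_nonneg[of s t] by (intro mult_right_mono) auto
  finally show "\<bar>msq Y t - msq Y s - (LBINT r:{s<..t}. 2 * (\<integral>w. Y r w \<bullet> a r w \<partial>M) + msq gh r)\<bar>
   <= \<epsilon> * ((t - s) + (LBINT r:{s<..t}. msq a r))" .
 qed
qed

end

section \<open>The Euler scheme\<close>

text \<open>Lipschitz continuity and linear growth with a common constant, in the squared form in
  which they enter second-moment recursions.\<close>

definition sq_lip :: "real => ('b::euclidean_space => 'b) => bool" where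
 "sq_lip \<kappa> f \<longleftrightarrow> (\<forall>x y. (norm (f x - f y))^2 <= \<kappa> * (norm (x - y))^2) \<and> (\<forall>x. (norm (f x))^2 <= \<kappa> * (1 + (norm x)^2))"

lemma sq_lip_norm:
 assumes "sq_lip \<kappa> f" "0 <= \<kappa>"
 shows "norm (f x - f y) <= sqrt \<kappa> * norm (x - y)"
proof (rule power2_le_imp_le)
 have "(norm (f x - f y))^2 <= \<kappa> * (norm (x - y))^2" using assms(1) unfolding sq_lip_def by blast
 then show "(norm (f x - f y))^2 <= (sqrt \<kappa> * norm (x - y))^2" using assms(2) by (simp add: power_mult_distrib)
qed (use assms(2) in simp)

lemma sq_lip_continuous:
 assumes "sq_lip \<kappa> f" "0 <= \<kappa>"
 shows "continuous_on A f"
proof (rule continuous_on_subset[OF uniformly_continuous_imp_continuous[OF lipschitz_on_uniformly_continuous]])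
 show "(sqrt \<kappa>)-lipschitz_on UNIV f"
  using sq_lip_norm[OF assms] assms by (auto intro!: lipschitz_onI simp: dist_norm)
qed simp

lemma sq_lip_meas:
 assumes "sq_lip \<kappa> f" "0 <= \<kappa>" "u \<in> borel_measurable G"
 shows "(%w. f (u w)) \<in> borel_measurable G"
 using borel_measurable_continuous_onI[OF sq_lip_continuous[OF assms(1,2)]] measurable_compose[OF assms(3)] by blast

context mean_field_basis
begin

lemma sq_lip_sq_int:
 assumes f: "sq_lip \<kappa> f" "0 <= \<kappa>" and u: "sq_int M u"
 shows "sq_int M (%w. f (u w))" (is ?g1) "(\<integral>w. (norm (f (u w)))^2 \<partial>M) <= \<kappa> * (1 + (\<integral>w. (norm (u w))^2 \<partial>M))" (is ?g2)
proof -
 have i: "integrable M (%w. \<kappa> * (1 + (norm (u w))^2))" using u by (auto simp: sq_int_def)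
 have m: "(%w. f (u w)) \<in> borel_measurable M" using u by (intro sq_lip_meas[OF f]) (simp add: sq_int_def)
 have "integrable M (%w. (norm (f (u w)))^2)"
 proof (rule Bochner_Integration.integrable_bound[OF i])
  show "AE w in M. norm ((norm (f (u w)))^2) <= norm (\<kappa> * (1 + (norm (u w))^2))"
   using f by (auto simp: sq_lip_def abs_mult)
 qed (use m in measurable)
 with m show s: ?g1 by (simp add: sq_int_def)
 have "(\<integral>w. (norm (f (u w)))^2 \<partial>M) <= (\<integral>w. \<kappa> * (1 + (norm (u w))^2) \<partial>M)"
  by (rule integral_mono) (use s i f in \<open>auto simp: sq_int_def sq_lip_def\<close>)
 also have "\<dots> = \<kappa> * (1 + (\<integral>w. (norm (u w))^2 \<partial>M))"
  using u by (simp add: sq_int_def prob_space)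
 finally show ?g2 .
qed

lemma sq_lip_diff:
 assumes f: "sq_lip \<kappa> f" "0 <= \<kappa>" and u: "sq_int M u" "sq_int M v"
 shows "sq_int M (%w. f (u w) - f (v w))" (is ?g1)
  "(\<integral>w. (norm (f (u w) - f (v w)))^2 \<partial>M) <= \<kappa> * (\<integral>w. (norm (u w - v w))^2 \<partial>M)" (is ?g2)
proof -
 show s: ?g1 by (intro sq_int_diff sq_lip_sq_int[OF f] u)
 have "(\<integral>w. (norm (f (u w) - f (v w)))^2 \<partial>M) <= (\<integral>w. \<kappa> * (norm (u w - v w))^2 \<partial>M)"
  by (rule integral_mono) (use s f sq_int_diff[OF u] in \<open>auto simp: sq_int_def sq_lip_def\<close>)
 then show ?g2 by simp
qed

text \<open>Both noise terms are orthogonal to the known part and to each other, so a cross term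
  arises only between \<open>u\<close> and the drift; it is split by \<open>2 * d <= u + v\<close>
  for \<open>d^2 <= u * v\<close>.\<close>

lemma euler_step:
 fixes u p q r :: "'a => 'b::euclidean_space"
 assumes st: "0 <= s" "s <= t"
  and sq: "sq_int M u" "sq_int M p" "sq_int M q" "sq_int M r"
  and F: "u \<in> borel_measurable (F s)" "p \<in> borel_measurable (F s)" "q \<in> borel_measurable (F s)" "r \<in> borel_measurable (F s)"
 defines "N \<equiv> %w. u w + (t - s) *\<^sub>R p w + (W t w - W s w) *\<^sub>R q w + (W0 t w - W0 s w) *\<^sub>R r w"
 shows "sq_int M N" "N \<in> borel_measurable (F t)" (is ?g2)
  "(\<integral>w. (norm (N w))^2 \<partial>M) <= (\<integral>w. (norm (u w))^2 \<partial>M) + (t - s) * ((\<integral>w. (norm (u w))^2 \<partial>M) + (1 + (t - s)) * (\<integral>w. (norm (p w))^2 \<partial>M)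
    + (\<integral>w. (norm (q w))^2 \<partial>M) + (\<integral>w. (norm (r w))^2 \<partial>M))"
proof -
 interpret sw: mean_field_basis M F0 W0 W by (rule swap)
 let ?E = "%v. \<integral>w. (norm (v w))^2 \<partial>M"
 let ?u = "%w. u w + (t - s) *\<^sub>R p w" and ?q = "%w. (W t w - W s w) *\<^sub>R q w" and ?r = "%w. (W0 t w - W0 s w) *\<^sub>R r w"
 have su: "sq_int M ?u" by (intro sq_int_add sq_int_scaleR sq)
 have uF: "?u \<in> borel_measurable (F s)" using F by measurable
 note q = increment_scaleR[OF st sq(3) F(3)]
 note r = sw.increment_scaleR[OF st sq(4), unfolded swF, OF F(4)]
 show "sq_int M N" unfolding N_def by (intro sq_int_add[OF sq_int_add[OF su q(1)] r(1)])
 have WF: "(%w. W t w - W s w) \<in> borel_measurable (F t)" "(%w. W0 t w - W0 s w) \<in> borel_measurable (F t)"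
  using W_meas_F W0_meas_F st by (auto intro!: borel_measurable_diff)
 show ?g2
  unfolding N_def using WF F[THEN meas_F_mono[OF _ st(2)]] by measurable
 have rmix: "?r \<in> borel_measurable (mixed s)"
 proof -
  have "(%w. W0 t w - W0 s w) \<in> borel_measurable (H t)" using W0_meas_H st by (auto intro!: borel_measurable_diff)
  from borel_measurable_scaleR[OF meas_H_mixed[OF st(1) this] meas_F_mixed[OF st(1) F(4)]] show ?thesis .
 qed
 have o1: "(\<integral>w. ?u w \<bullet> ?q w \<partial>M) = 0" by (rule increment_orthogonal[OF st sq(3) F(3) su meas_F_mixed[OF st(1) uF]])
 have o2: "(\<integral>w. ?u w \<bullet> ?r w \<partial>M) = 0"
  by (rule sw.increment_orthogonal[OF st sq(4) _ su sw.meas_F_mixed[OF st(1)], unfolded swF, OF F(4) uF])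
 have o3: "(\<integral>w. ?r w \<bullet> ?q w \<partial>M) = 0" by (rule increment_orthogonal[OF st sq(3) F(3) r(1) rmix])
 have o4: "(\<integral>w. (?u w + ?q w) \<bullet> ?r w \<partial>M) = 0"
 proof -
  have "(\<integral>w. ?q w \<bullet> ?r w \<partial>M) = 0" by (subst inner_commute) (rule o3)
  then show ?thesis
   using Bochner_Integration.integral_add[OF sq_int_inner[OF su r(1)] sq_int_inner[OF q(1) r(1)]] o2
   by (simp only: inner_add_left)
 qed
 have "?E N = ?E (%w. ?u w + ?q w) + (t - s) * ?E r"
  unfolding N_def using integral_norm_sq_add[OF sq_int_add[OF su q(1)] r(1)] o4 r(2) by (simp add: l2_sq)
 also have "?E (%w. ?u w + ?q w) = ?E ?u + (t - s) * ?E q"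
  using integral_norm_sq_add[OF su q(1)] o1 q(2) by (simp add: l2_sq)
 also have "?E ?u <= ?E u + (t - s) * (?E u + ?E p) + (t - s)^2 * ?E p"
 proof -
  have "?E ?u = ?E u + 2 * (\<integral>w. u w \<bullet> ((t - s) *\<^sub>R p w) \<partial>M) + ?E (%w. (t - s) *\<^sub>R p w)"
   by (rule integral_norm_sq_add[OF sq(1) sq_int_scaleR[OF sq(2)]])
  also have "\<dots> = ?E u + (t - s) * (2 * (\<integral>w. u w \<bullet> p w \<partial>M)) + (t - s)^2 * ?E p"
   by (simp add: power_mult_distrib)
  also have "2 * (\<integral>w. u w \<bullet> p w \<partial>M) <= ?E u + ?E p"
   using abs_integral_inner_le[OF sq(1,2)] two_mult_le_add[of "l2 M u * l2 M p" "?E u" "?E p"]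
   by (simp add: power_mult_distrib l2_sq)
  finally show ?thesis using st by (simp add: mult_left_mono)
 qed
 finally show "?E N <= ?E u + (t - s) * (?E u + (1 + (t - s)) * ?E p + ?E q + ?E r)"
  by (simp add: algebra_simps power2_eq_square)
qed

end

locale euler_scheme = mean_field_basis M F0 W W0
 for M F0 :: "'a measure" and W W0 :: "real => 'a => real" +
 fixes T \<kappa> :: real and fa fc fg :: "'b::euclidean_space => 'b" and x0 :: "'a => 'b"
 assumes T: "0 < T" and \<kappa>_ge: "1 <= \<kappa>" and lip: "sq_lip \<kappa> fa" "sq_lip \<kappa> fc" "sq_lip \<kappa> fg"
  and x0: "sq_int M x0" "x0 \<in> borel_measurable (F 0)"
begin

lemma \<kappa>: "0 <= \<kappa>"
 using \<kappa>_ge by simp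

text \<open>Refinement by the factor 4: mean-square errors are of the order of the step, so
  successive levels differ in \<open>l2\<close> by a multiple of \<open>(1 / 2) ^ n\<close>.\<close>

definition tm :: "nat => nat => real" where "tm n k = real k * (T / 4 ^ n)"

fun node :: "nat => nat => 'a => 'b" where
 "node n 0 = x0"
| "node n (Suc k) = (%w. node n k w + (tm n (Suc k) - tm n k) *\<^sub>R fa (node n k w)
   + (W (tm n (Suc k)) w - W (tm n k) w) *\<^sub>R fc (node n k w)
   + (W0 (tm n (Suc k)) w - W0 (tm n k) w) *\<^sub>R fg (node n k w))"

abbreviation Esq :: "('a => 'b) => real" where "Esq v \<equiv> \<integral>w. (norm (v w))^2 \<partial>M"

lemma tm_simps: "tm n 0 = 0" "tm n (4 ^ n) = T" "tm (Suc n) (4 * k) = tm n k" "tm n (Suc k) - tm n k = T / 4 ^ n"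
 by (simp_all add: tm_def field_simps)

lemma tm_mono: "i <= j ==> tm n i <= tm n j"
 unfolding tm_def by (rule mult_right_mono) (use T in auto)

lemma tm_nonneg: "0 <= tm n k"
 using tm_mono[of 0 k n] by (simp add: tm_simps)

lemma tm_le: "k <= 4 ^ n ==> tm n k <= T"
 using tm_mono[of k "4 ^ n" n] by (simp add: tm_simps)

lemma step_le: "T / 4 ^ n <= T"
 using T by (simp add: field_simps)

lemma node_props: "sq_int M (node n k) \<and> node n k \<in> borel_measurable (F (tm n k))"
proof (induction k)
 case 0
 then show ?case using x0 by (simp add: tm_simps)
next
 case (Suc k)
 then have n: "sq_int M (node n k)" "node n k \<in> borel_measurable (F (tm n k))" by auto
 have le: "tm n k <= tm n (Suc k)" by (rule tm_mono) simp
 note e = euler_step[OF tm_nonneg le n(1) sq_lip_sq_int(1)[OF lip(1) \<kappa> n(1)] sq_lip_sq_int(1)[OF lip(2) \<kappa> n(1)]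
   sq_lip_sq_int(1)[OF lip(3) \<kappa> n(1)] n(2) sq_lip_meas[OF lip(1) \<kappa> n(2)] sq_lip_meas[OF lip(2) \<kappa> n(2)] sq_lip_meas[OF lip(3) \<kappa> n(2)]]
 from e(1,2) show ?case by simp
qed

lemmas node_sq = node_props[THEN conjunct1] and node_F = node_props[THEN conjunct2]

text \<open>Growth rate of \<open>1 + Esq (node n k)\<close> per unit of time: 1 from the cross term
  in \<open>euler_step\<close>, \<open>(1 + T) * \<kappa>\<close> from the drift and
  \<open>\<kappa>\<close> from each noise.\<close>

definition K1 :: real where "K1 = 1 + \<kappa> * (3 + T)"
definition K2 :: real where "K2 = exp (K1 * T) * (1 + Esq x0)"

lemma K1_nonneg: "0 <= K1" and K2_nonneg: "0 <= K2"
 using T \<kappa> by (auto simp: K1_def K2_def)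

lemma one_plus_power_le:
 assumes "0 <= K" "k <= 4 ^ n"
 shows "(1 + T / 4 ^ n * K) ^ k <= exp (K * T)"
proof -
 have "(1 + T / 4 ^ n * K) ^ k <= (exp (T / 4 ^ n * K)) ^ k"
  using T assms by (intro power_mono exp_ge_add_one_self) simp
 also have "\<dots> = exp (real k * (T / 4 ^ n * K))" by (rule exp_of_nat_mult[symmetric])
 also have "\<dots> <= exp (K * T)"
  using mult_right_mono[OF tm_le[OF assms(2)] assms(1)] by (simp add: tm_def mult_ac)
 finally show ?thesis .
qed

text \<open>A discrete Gronwall inequality; the accumulated factor is bounded by an exponential
  uniformly in the level.\<close>

lemma node_moment:
 assumes "k <= 4 ^ n"
 shows "1 + Esq (node n k) <= K2"
proof -
 let ?h = "T / 4 ^ n"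
 have h: "0 <= ?h" "?h <= T" using T step_le by auto
 have "1 + Esq (node n k) <= (1 + ?h * K1) ^ k * (1 + Esq x0)"
 proof (induction k)
  case (Suc k)
  let ?m = "1 + Esq (node n k)"
  have m0: "0 <= Esq (node n k)" by simp
  note f = sq_lip_sq_int[OF lip(1) \<kappa> node_sq] sq_lip_sq_int[OF lip(2) \<kappa> node_sq] sq_lip_sq_int[OF lip(3) \<kappa> node_sq]
  note e = euler_step(3)[OF tm_nonneg tm_mono node_sq f(1,3,5) node_F sq_lip_meas[OF lip(1) \<kappa> node_F]
    sq_lip_meas[OF lip(2) \<kappa> node_F] sq_lip_meas[OF lip(3) \<kappa> node_F]]
  have "Esq (node n (Suc k)) <= Esq (node n k) + ?h * (Esq (node n k) + (1 + ?h) * Esq (%w. fa (node n k w))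
    + Esq (%w. fc (node n k w)) + Esq (%w. fg (node n k w)))"
   using e[of k "Suc k" n] by (simp add: tm_simps(4))
  also have "\<dots> <= Esq (node n k) + ?h * (?m + (1 + T) * (\<kappa> * ?m) + \<kappa> * ?m + \<kappa> * ?m)"
   using h f(2,4,6)[of n k] m0 \<kappa> by (intro add_mono mult_left_mono mult_mono) auto
  also have "\<dots> = Esq (node n k) + ?h * K1 * ?m" by (simp add: K1_def algebra_simps)
  finally have "1 + Esq (node n (Suc k)) <= (1 + ?h * K1) * ?m" by (simp add: algebra_simps)
  also have "\<dots> <= (1 + ?h * K1) * ((1 + ?h * K1) ^ k * (1 + Esq x0))"
   using Suc h K1_nonneg by (intro mult_left_mono) auto
  finally show ?case by simp
 qed simp
 also have "\<dots> <= K2" unfolding K2_def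
  using one_plus_power_le[OF K1_nonneg assms] by (intro mult_right_mono) auto
 finally show ?thesis .
qed

text \<open>The level-\<open>n\<close> scheme evaluated on the finer grid of level \<open>n + 1\<close>.\<close>

definition coarse :: "nat => nat => 'a => 'b" where
 "coarse n j = (%w. node n (j div 4) w + (tm (Suc n) j - tm n (j div 4)) *\<^sub>R fa (node n (j div 4) w)
   + (W (tm (Suc n) j) w - W (tm n (j div 4)) w) *\<^sub>R fc (node n (j div 4) w)
   + (W0 (tm (Suc n) j) w - W0 (tm n (j div 4)) w) *\<^sub>R fg (node n (j div 4) w))"

text \<open>At multiples of 4 the coarse index jumps, and the formula persists because the
  interpolation arrives there at the next coarse node. On the fine grid the coarse level thus also
  follows an Euler recursion, with frozen coefficients.\<close>

lemma coarse_Suc: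
 "coarse n (Suc j) w = coarse n j w + (tm (Suc n) (Suc j) - tm (Suc n) j) *\<^sub>R fa (node n (j div 4) w)
   + (W (tm (Suc n) (Suc j)) w - W (tm (Suc n) j) w) *\<^sub>R fc (node n (j div 4) w)
   + (W0 (tm (Suc n) (Suc j)) w - W0 (tm (Suc n) j) w) *\<^sub>R fg (node n (j div 4) w)"
proof (cases "Suc j mod 4 = 0")
 case True
 define k where "k = j div 4"
 have j: "Suc j = 4 * Suc k" using True unfolding k_def by presburger
 then have d: "Suc j div 4 = Suc k" "tm (Suc n) (Suc j) = tm n (Suc k)" using tm_simps(3)[of n "Suc k"] by simp_all
 show ?thesis
  unfolding coarse_def d k_def[symmetric] by (simp add: algebra_simps)
next
 case False
 then have d: "Suc j div 4 = j div 4" by presburger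
 show ?thesis unfolding coarse_def d by (simp add: algebra_simps)
qed

lemma tm_div_le: "tm n (j div 4) <= tm (Suc n) j" (is ?g1) "tm (Suc n) j - tm n (j div 4) <= T / 4 ^ n" (is ?g2)
proof -
 have "4 * (j div 4) <= j" by simp
 then show ?g1 using tm_mono[of "4 * (j div 4)" j "Suc n"] by (simp add: tm_simps(3))
 have "j <= 4 * Suc (j div 4)" by presburger
 then have "tm (Suc n) j <= tm n (Suc (j div 4))" using tm_mono[of j "4 * Suc (j div 4)" "Suc n"] by (simp only: tm_simps(3))
 then show ?g2 using tm_simps(4)[of n "j div 4"] by linarith
qed

lemma coarse_props:
 assumes j: "j <= 4 ^ Suc n"
 shows "sq_int M (coarse n j)" "coarse n j \<in> borel_measurable (F (tm (Suc n) j))"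
  "Esq (%w. coarse n j w - node n (j div 4) w) <= T / 4 ^ n * (K1 * K2)"
proof -
 let ?k = "j div 4"
 note f = sq_lip_sq_int[OF lip(1) \<kappa> node_sq[of n ?k]] sq_lip_sq_int[OF lip(2) \<kappa> node_sq[of n ?k]] sq_lip_sq_int[OF lip(3) \<kappa> node_sq[of n ?k]]
 note m = sq_lip_meas[OF lip(1) \<kappa> node_F[of n ?k]] sq_lip_meas[OF lip(2) \<kappa> node_F[of n ?k]] sq_lip_meas[OF lip(3) \<kappa> node_F[of n ?k]]
 note e = euler_step[OF tm_nonneg tm_div_le(1) node_sq f(1,3,5) node_F m]
 show "sq_int M (coarse n j)" "coarse n j \<in> borel_measurable (F (tm (Suc n) j))"
  using e(1,2) by (simp_all add: coarse_def)
 have k: "?k <= 4 ^ n" using j by simp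
 let ?d = "tm (Suc n) j - tm n ?k"
 have d: "0 <= ?d" "?d <= T / 4 ^ n" "?d <= T" using tm_div_le[of n j] step_le[of n] by linarith+
 \<comment> \<open>A single Euler step started from 0 with the coefficients of the coarse
   node.\<close>
 have "Esq (%w. coarse n j w - node n ?k w) <=
   ?d * ((1 + ?d) * Esq (%w. fa (node n ?k w)) + Esq (%w. fc (node n ?k w)) + Esq (%w. fg (node n ?k w)))"
  using euler_step(3)[OF tm_nonneg tm_div_le(1) sq_int_zero f(1,3,5) borel_measurable_const m]
  by (simp add: coarse_def algebra_simps)
 also have "\<dots> <= T / 4 ^ n * ((1 + T) * (\<kappa> * K2) + \<kappa> * K2 + \<kappa> * K2)"
  using d T f(2,4,6) node_moment[OF k] \<kappa> mult_left_mono[OF node_moment[OF k] \<kappa>]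
  by (intro mult_mono add_mono) (auto intro!: add_nonneg_nonneg mult_nonneg_nonneg)
 also have "\<dots> <= T / 4 ^ n * (K1 * K2)"
  using T K2_nonneg by (intro mult_left_mono) (auto simp: K1_def algebra_simps)
 finally show "Esq (%w. coarse n j w - node n ?k w) <= T / 4 ^ n * (K1 * K2)" .
qed

definition K3 :: real where "K3 = 1 + 2 * (\<kappa> * (3 + T))"
definition K4 :: real where "K4 = 2 * (\<kappa> * (3 + T)) * (K1 * K2)"
definition K5 :: real where "K5 = 2 * (T * K4 * exp (K3 * T)) + 2 * (K1 * K2)"

lemma K_nonneg: "0 <= K3" "0 <= K4" "0 <= K5"
 using T \<kappa> K1_nonneg K2_nonneg by (auto simp: K3_def K4_def K5_def)

lemma Esq_split:
 assumes "sq_int M x" "sq_int M y" "sq_int M z"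
 shows "Esq (%w. x w - z w) <= 2 * Esq (%w. x w - y w) + 2 * Esq (%w. y w - z w)"
proof -
 have "(norm (x w - z w))^2 <= 2 * (norm (x w - y w))^2 + 2 * (norm (y w - z w))^2" for w
  using norm_triangle_ineq[of "x w - y w" "y w - z w"] power_mono[of "norm (x w - z w)" "norm (x w - y w) + norm (y w - z w)" 2]
   sum_squares_bound[of "norm (x w - y w)" "norm (y w - z w)"]
  by (simp add: power2_sum)
 then have "Esq (%w. x w - z w) <= (\<integral>w. 2 * (norm (x w - y w))^2 + 2 * (norm (y w - z w))^2 \<partial>M)"
  using sq_int_diff[OF assms(1,3)] sq_int_diff[OF assms(1,2)] sq_int_diff[OF assms(2,3)]
  by (intro integral_mono) (auto simp: sq_int_def)
 then show ?thesis
  using sq_int_diff[OF assms(1,2)] sq_int_diff[OF assms(2,3)] by (simp add: sq_int_def)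
qed

text \<open>Fine nodes and coarse interpolation are driven by the same noise increments. Their
  difference is therefore an Euler step as well, whose coefficients are differences controlled by
  \<open>sq_lip\<close>.\<close>

lemma level_difference:
 assumes j: "j <= 4 ^ Suc n"
 shows "Esq (%w. node (Suc n) j w - node n (j div 4) w) <= T / 4 ^ n * K5"
proof -
 let ?h = "T / 4 ^ n" and ?h' = "T / 4 ^ Suc n"
 have h: "0 <= ?h" "0 <= ?h'" "?h' <= T" using T step_le[of "Suc n"] by auto
 let ?d = "%j. Esq (%w. node (Suc n) j w - coarse n j w)"
 let ?e = "%j. Esq (%w. node (Suc n) j w - node n (j div 4) w)"
 have ed: "?e j <= 2 * ?d j + 2 * (?h * (K1 * K2))" if "j <= 4 ^ Suc n" for j
  using Esq_split[OF node_sq coarse_props(1)[OF that] node_sq, of "Suc n" j n "j div 4"] coarse_props(3)[OF that] by linarith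
 \<comment> \<open>The growth factor is allowed to multiply all \<open>j\<close> sources in full;
   this cruder Gronwall bound closes directly under induction.\<close>
 have "?d j <= real j * (?h' * (K4 * ?h)) * (1 + ?h' * K3) ^ j" if "j <= 4 ^ Suc n" for j
  using that
 proof (induction j)
  case 0
  then show ?case by (simp add: coarse_def tm_simps)
 next
  case (Suc j)
  then have j: "j <= 4 ^ Suc n" by simp
  let ?x = "node (Suc n) j" and ?z = "node n (j div 4)"
  have zF: "?z \<in> borel_measurable (F (tm (Suc n) j))" by (rule meas_F_mono[OF node_F tm_div_le(1)])
  note c = coarse_props[OF j]
  note df = sq_lip_diff[OF lip(1) \<kappa> node_sq[of "Suc n" j] node_sq[of n "j div 4"]]
   sq_lip_diff[OF lip(2) \<kappa> node_sq[of "Suc n" j] node_sq[of n "j div 4"]]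
   sq_lip_diff[OF lip(3) \<kappa> node_sq[of "Suc n" j] node_sq[of n "j div 4"]]
  have mf: "(%w. f (?x w) - f (?z w)) \<in> borel_measurable (F (tm (Suc n) j))" if "sq_lip \<kappa> f" for f
   using sq_lip_meas[OF that \<kappa> node_F] sq_lip_meas[OF that \<kappa> zF] by (rule borel_measurable_diff)
  have mu: "(%w. ?x w - coarse n j w) \<in> borel_measurable (F (tm (Suc n) j))"
   using node_F c(2) by (rule borel_measurable_diff)
  have eq: "node (Suc n) (Suc j) w - coarse n (Suc j) w = (?x w - coarse n j w)
    + (tm (Suc n) (Suc j) - tm (Suc n) j) *\<^sub>R (fa (?x w) - fa (?z w))
    + (W (tm (Suc n) (Suc j)) w - W (tm (Suc n) j) w) *\<^sub>R (fc (?x w) - fc (?z w))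
    + (W0 (tm (Suc n) (Suc j)) w - W0 (tm (Suc n) j) w) *\<^sub>R (fg (?x w) - fg (?z w))" for w
   unfolding coarse_Suc node.simps by (simp only: scaleR_diff_right) simp
  have "?d (Suc j) <= ?d j + ?h' * (?d j + (1 + ?h') * Esq (%w. fa (?x w) - fa (?z w))
    + Esq (%w. fc (?x w) - fc (?z w)) + Esq (%w. fg (?x w) - fg (?z w)))"
   using euler_step(3)[OF tm_nonneg tm_mono sq_int_diff[OF node_sq c(1)] df(1,3,5) mu mf[OF lip(1)] mf[OF lip(2)] mf[OF lip(3)], of "Suc j"]
   unfolding eq tm_simps(4) by simp
  also have "\<dots> <= ?d j + ?h' * (?d j + (1 + T) * (\<kappa> * ?e j) + \<kappa> * ?e j + \<kappa> * ?e j)"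
   using h df(2,4,6) \<kappa> T by (intro add_mono mult_left_mono mult_mono order_refl) auto
  also have "\<dots> = ?d j + ?h' * (?d j + \<kappa> * (3 + T) * ?e j)" by (simp add: algebra_simps)
  also have "\<dots> <= ?d j + ?h' * (?d j + \<kappa> * (3 + T) * (2 * ?d j + 2 * (?h * (K1 * K2))))"
   using h \<kappa> T ed[OF j] by (intro add_mono mult_left_mono order_refl) auto
  also have "\<dots> = (1 + ?h' * K3) * ?d j + ?h' * (K4 * ?h)"
  proof -
   have "D + h * (D + k * (2 * D + 2 * (u * v))) = (1 + h * (1 + 2 * k)) * D + h * (2 * k * v * u)" for D h k u v :: real
    by (simp add: algebra_simps)
   then show ?thesis unfolding K3_def K4_def .
  qed
  also have "\<dots> <= (1 + ?h' * K3) * (real j * (?h' * (K4 * ?h)) * (1 + ?h' * K3) ^ j) + ?h' * (K4 * ?h) * (1 + ?h' * K3) ^ Suc j"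
  proof (intro add_mono mult_left_mono)
   have "1 <= (1 + ?h' * K3) ^ Suc j" using h K_nonneg by (intro one_le_power) auto
   from mult_left_mono[OF this, of "?h' * (K4 * ?h)"] show "?h' * (K4 * ?h) <= ?h' * (K4 * ?h) * (1 + ?h' * K3) ^ Suc j"
    using h K_nonneg by simp
  qed (use Suc.IH[OF j] h K_nonneg in auto)
  also have "\<dots> = real (Suc j) * (?h' * (K4 * ?h)) * (1 + ?h' * K3) ^ Suc j"
  proof -
   have "a * (r * b * a ^ j) + b * a ^ Suc j = (r + 1) * b * a ^ Suc j" for a b r :: real
    by (simp add: algebra_simps)
   then show ?thesis by (simp only: of_nat_Suc add.commute[of 1])
  qed
  finally show ?case .
 qed
 from this[OF j] have "?d j <= (tm (Suc n) j * (K4 * ?h)) * (1 + ?h' * K3) ^ j" by (simp add: tm_def mult_ac)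
 also have "\<dots> <= (T * (K4 * ?h)) * exp (K3 * T)"
  using tm_le[OF j] one_plus_power_le[OF K_nonneg(1) j] K_nonneg h T
  by (intro mult_mono) auto
 finally have "?d j <= ?h * (T * K4 * exp (K3 * T))" by (simp add: mult_ac)
 moreover have "?h * K5 = 2 * (?h * (T * K4 * exp (K3 * T))) + 2 * (?h * (K1 * K2))"
  unfolding K5_def by (simp only: distrib_left mult.left_commute[of _ 2])
 ultimately show ?thesis using ed[OF j] by linarith
qed

definition K6 :: real where "K6 = sqrt (T * K5)"

lemma level_difference_l2:
 assumes j: "j <= 4 ^ Suc n"
 shows "l2 M (%w. node (Suc n) j w - node n (j div 4) w) <= K6 * (1 / 2) ^ n"
proof (rule power2_le_imp_le)
 have "((1 / 2) ^ n)^2 = (1 / 4 :: real) ^ n" by (simp add: power2_eq_square power_mult_distrib[symmetric])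
 then show "(l2 M (%w. node (Suc n) j w - node n (j div 4) w))^2 <= (K6 * (1 / 2) ^ n)^2"
  using level_difference[OF j] T K_nonneg by (simp add: l2_sq K6_def power_mult_distrib power_divide)
 show "0 <= K6 * (1 / 2) ^ n" using T K_nonneg by (simp add: K6_def)
qed

end

section \<open>Uniform convergence of the Euler scheme\<close>

text \<open>Geometric steps give a tail bound at each level, and Fatou's lemma carries it to the
  almost sure limit, which thereby is also the \<open>l2\<close>-limit with the same rate.\<close>

lemma l2_geometric_limit:
 fixes f :: "nat => 'a => 'b::euclidean_space"
 assumes f: "!!n. sq_int N (f n)" and g: "g \<in> borel_measurable N" and lim: "AE x in N. (%n. f n x) \<longlonglongrightarrow> g x"
  and step: "!!n. l2 N (%x. f (Suc n) x - f n x) <= K * (1 / 2) ^ n" and K: "0 <= K"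
 shows "sq_int N g" "l2 N (%x. f n x - g x) <= 2 * K * (1 / 2) ^ n" "(%n. l2 N (%x. f n x - g x)) \<longlonglongrightarrow> 0" (is ?g3)
proof -
 have [measurable]: "f n \<in> borel_measurable N" "g \<in> borel_measurable N" for n using f g by (auto simp: sq_int_def)
 have tail: "l2 N (%x. f (n + m) x - f n x) <= 2 * K * (1 / 2) ^ n" for n m
 proof -
  \<comment> \<open>The subtracted term is the unspent part of the geometric series; it makes the
    induction on \<open>m\<close> close.\<close>
  have "l2 N (%x. f (n + m) x - f n x) <= 2 * K * (1 / 2) ^ n - 2 * K * (1 / 2) ^ (n + m)"
  proof (induction m)
   case (Suc m)
   have "l2 N (%x. f (n + Suc m) x - f n x) <= l2 N (%x. f (Suc (n + m)) x - f (n + m) x) + l2 N (%x. f (n + m) x - f n x)"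
    using l2_triangle[OF f f f, of "Suc (n + m)" n "n + m"] by simp
   then show ?case using Suc step[of "n + m"] by (simp add: power_add)
  qed (simp add: l2_def)
  moreover have "0 <= 2 * K * (1 / 2) ^ (n + m)" using K by simp
  ultimately show ?thesis by linarith
 qed
 have nn: "(\<integral>\<^sup>+x. ennreal ((norm (f n x - g x))^2) \<partial>N) <= ennreal ((2 * K * (1 / 2) ^ n)^2)" for n
 proof -
  have "(\<integral>\<^sup>+x. ennreal ((norm (f n x - g x))^2) \<partial>N) = (\<integral>\<^sup>+x. liminf (%m. ennreal ((norm (f (n + m) x - f n x))^2)) \<partial>N)"
  proof (rule nn_integral_cong_AE)
   show "AE x in N. ennreal ((norm (f n x - g x))^2) = liminf (%m. ennreal ((norm (f (n + m) x - f n x))^2))"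
    using lim
   proof eventually_elim
    case (elim x)
    have "(%m. f (n + m) x) \<longlonglongrightarrow> g x" using LIMSEQ_ignore_initial_segment[OF elim, of n] by (simp add: add.commute)
    then have "(%m. ennreal ((norm (f (n + m) x - f n x))^2)) \<longlonglongrightarrow> ennreal ((norm (g x - f n x))^2)"
     by (intro tendsto_intros)
    from lim_imp_Liminf[OF trivial_limit_sequentially this] show ?case by (simp add: norm_minus_commute[of "g x"])
   qed
  qed
  also have "\<dots> <= liminf (%m. \<integral>\<^sup>+x. ennreal ((norm (f (n + m) x - f n x))^2) \<partial>N)"
   by (rule nn_integral_liminf) simp
  also have "\<dots> <= liminf (%m. ennreal ((2 * K * (1 / 2) ^ n)^2))"
  proof (rule Liminf_mono, rule always_eventually, rule allI)
   fix m
   have "sq_int N (%x. f (n + m) x - f n x)" by (intro sq_int_diff f)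
   then show "(\<integral>\<^sup>+x. ennreal ((norm (f (n + m) x - f n x))^2) \<partial>N) <= ennreal ((2 * K * (1 / 2) ^ n)^2)"
    using tail[of n m] by (simp add: nn_integral_sq_int ennreal_leI power_mono)
  qed
  also have "\<dots> = ennreal ((2 * K * (1 / 2) ^ n)^2)" by (simp add: Liminf_const)
  finally show ?thesis .
 qed
 have d: "sq_int N (%x. f n x - g x)" for n
  by (rule sq_intI_nn) (use nn[of n] in \<open>auto intro: le_less_trans\<close>)
 from sq_int_diff[OF f d, of 0 0] show "sq_int N g" by simp
 show l: "l2 N (%x. f n x - g x) <= 2 * K * (1 / 2) ^ n" for n
 proof (rule power2_le_imp_le)
  show "(l2 N (%x. f n x - g x))^2 <= (2 * K * (1 / 2) ^ n)^2"
   using nn[of n] nn_integral_sq_int[OF d[of n]] by (simp add: ennreal_le_iff)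
 qed (use K in simp)
 have u: "(%n. 2 * K * (1 / 2 :: real) ^ n) \<longlonglongrightarrow> 0" by (rule tendsto_mult_right_zero) (rule LIMSEQ_realpow_zero, simp_all)
 show ?g3
  by (rule tendsto_sandwich[OF _ _ tendsto_const u]) (simp_all add: l)
qed

text \<open>The Weierstrass test for the telescoping series. The starting level \<open>n0\<close> is
  left free because on a given path the bound holds only from some path-dependent level on.\<close>

lemma uniform_limit_geometric:
 fixes f :: "nat => 'x => 'b::euclidean_space"
 assumes "!!n t. n0 <= n ==> t \<in> A ==> norm (f (Suc n) t - f n t) <= (3 / 4) ^ n"
 shows "uniform_limit A f (%t. lim (%n. f n t)) sequentially"
proof -
 define D where "D n t = f (Suc n) t - f n t" for n t
 have ul: "uniform_limit A (%n t. \<Sum>i<n. D i t) (%t. suminf (%i. D i t)) sequentially"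
 proof (rule Weierstrass_m_test_ev)
  show "\<forall>\<^sub>F n in sequentially. \<forall>t\<in>A. norm (D n t) <= (3 / 4) ^ n"
   using eventually_ge_at_top[of n0] by eventually_elim (auto simp: D_def assms)
  show "summable (%n. (3 / 4 :: real) ^ n)" by (rule summable_geometric) simp
 qed
 have tele: "(\<Sum>i<n. D i t) = f n t - f 0 t" for n t
  unfolding D_def by (rule sum_lessThan_telescope)
 have u: "uniform_limit A f (%t. suminf (%i. D i t) + f 0 t) sequentially"
  using uniform_limit_add[OF ul uniform_limit_const[where c = "f 0"]] by (simp add: tele)
 have "lim (%n. f n t) = suminf (%i. D i t) + f 0 t" if "t \<in> A" for t
  by (rule limI) (rule tendsto_uniform_limitI[OF u that])
 then show ?thesis using u by (simp cong: uniform_limit_cong')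
qed

lemma continuous_on_simple_integral:
 assumes "continuous_on {0..} (%t. V t w)" "!!k. k <= N ==> 0 <= \<tau> k"
 shows "continuous_on {0..} (%t. simple_integral V N \<tau> \<eta> t w)"
proof -
 have "continuous_on {0..} (%t. V (min t (\<tau> k)) w)" if "k <= N" for k
  by (rule continuous_on_compose2[OF assms(1)]) (use assms(2)[OF that] in \<open>auto intro!: continuous_intros\<close>)
 then show ?thesis unfolding simple_integral_def by (intro continuous_intros) auto
qed

section \<open>A maximal inequality for simple integrals\<close>

context mean_field_basis
begin

lemma sq_data_tau_nonneg: "sq_data N \<tau> \<eta> ==> k <= N ==> 0 <= \<tau> k"
 using sq_data_tau_mono[of N \<tau> \<eta> 0 k] by (auto simp: sq_data_def)

lemma simple_integral_props:
 assumes d: "sq_data N \<tau> \<eta>" and t: "0 <= t"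
 shows "sq_int M (simple_integral W N \<tau> \<eta> t)" "simple_integral W N \<tau> \<eta> t \<in> borel_measurable (F t)"
 using simple_increment(1,3)[OF d order_refl t] by (simp_all add: simple_integral_0[OF d])

text \<open>Doob's argument by first exceedance. On \<open>A k\<close> the increment after
  \<open>u k\<close> is orthogonal to the value at \<open>u k\<close>, so the terminal mean square
  over \<open>A k\<close> is at least \<open>l^2\<close> times its probability. The events
  \<open>A k\<close> are disjoint, and the contributions add up to at most the whole second
  moment.\<close>

lemma maximal_inequality_grid:
 fixes \<eta> :: "nat => 'a => 'b::euclidean_space" and u :: "nat => real"
 assumes d: "sq_data N \<tau> \<eta>" and u: "0 <= u 0" "!!i j. i <= j ==> u i <= u j" "u K = T" and l: "0 < l"
 shows "{w \<in> space M. \<exists>k\<le>K. l < norm (simple_integral W N \<tau> \<eta> (u k) w)} \<in> sets M" (is ?g1)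
  "prob {w \<in> space M. \<exists>k\<le>K. l < norm (simple_integral W N \<tau> \<eta> (u k) w)} <= (l2 M (simple_integral W N \<tau> \<eta> T))^2 / l^2" (is ?g2)
proof -
 define S where "S t = simple_integral W N \<tau> \<eta> t" for t
 have u0: "0 <= u k" for k using u(1) u(2)[of 0 k] by simp
 have S: "sq_int M (S t)" "S t \<in> borel_measurable (F t)" if "0 <= t" for t
  using simple_integral_props[OF d that] by (simp_all add: S_def)
 define A where "A k = {w \<in> space M. l < norm (S (u k) w) \<and> (\<forall>i<k. norm (S (u i) w) <= l)}" for k
 have AF: "A k \<in> sets (F (u k))" for k
 proof -
  have Sm: "S (u i) \<in> borel_measurable (F (u k))" if "i <= k" for i
   by (rule meas_F_mono[OF S(2)[OF u0] u(2)[OF that]])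
  note [measurable] = Sm[OF order_refl]
  have "A k = {w \<in> space (F (u k)). l < norm (S (u k) w)} \<inter> {w \<in> space (F (u k)). \<forall>i\<in>{..<k}. norm (S (u i) w) <= l}"
   by (auto simp: A_def)
  also have "\<dots> \<in> sets (F (u k))"
  proof (rule sets.Int)
   show "{w \<in> space (F (u k)). l < norm (S (u k) w)} \<in> sets (F (u k))" by measurable
   have le: "{w \<in> space (F (u k)). norm (S (u i) w) <= l} \<in> sets (F (u k))" if "i \<in> {..<k}" for i
   proof -
    have [measurable]: "S (u i) \<in> borel_measurable (F (u k))" by (rule Sm) (use that in simp)
    show ?thesis by measurable
   qed
   show "{w \<in> space (F (u k)). \<forall>i\<in>{..<k}. norm (S (u i) w) <= l} \<in> sets (F (u k))"
    by (rule sets.sets_Collect_finite_All[OF le]) simp_all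
  qed
  finally show ?thesis .
 qed
 then have AM: "A k \<in> sets M" for k using subalg_F by (auto simp: subalgebra_def)
 have disj: "disjoint_family_on A {..K}"
  unfolding disjoint_family_on_def
 proof (intro ballI impI)
  fix i j :: nat assume "i \<noteq> j"
  then show "A i \<inter> A j = {}"
  proof (induction i j rule: linorder_wlog)
   case (le i j)
   then have "i < j" by simp
   then show ?case unfolding A_def by (auto simp: not_less dest!: spec[of _ i])
  qed (simp add: Int_commute)
 qed
 have un: "{w \<in> space M. \<exists>k\<le>K. l < norm (S (u k) w)} = (\<Union>k\<in>{..K}. A k)"
 proof (intro set_eqI iffI)
  fix w assume "w \<in> {w \<in> space M. \<exists>k\<le>K. l < norm (S (u k) w)}"
  then obtain k where k: "w \<in> space M" "k <= K" "l < norm (S (u k) w)" by auto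
  define m where "m = (LEAST k. l < norm (S (u k) w))"
  have "l < norm (S (u m) w)" unfolding m_def using k(3) by (rule LeastI)
  moreover have "norm (S (u i) w) <= l" if "i < m" for i using not_less_Least[of i] that unfolding m_def by (meson not_less)
  moreover have "m <= K" using Least_le[of "%k. l < norm (S (u k) w)" k] k unfolding m_def by linarith
  ultimately show "w \<in> (\<Union>k\<in>{..K}. A k)" using k(1) by (auto simp: A_def)
 qed (auto simp: A_def)
 show ?g1
  using un AM by (simp add: S_def)
 have T: "0 <= T" using u0[of K] u(3) by simp
 have ST: "sq_int M (S T)" by (rule S(1)[OF T])
 have iT: "integrable M (%w. indicator (A k) w * (norm (S T w))^2)" for k
  using integrable_mult_indicator[OF AM[of k] sq_int_integrable_sq[OF ST]] by simp
 have key: "l^2 * prob (A k) <= (\<integral>w. indicator (A k) w * (norm (S T w))^2 \<partial>M)" if k: "k <= K" for k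
 proof -
  have uk: "u k <= T" using u(2)[OF k] u(3) by simp
  note Sk = S[OF u0[of k]]
  define \<zeta> where "\<zeta> w = indicator (A k) w *\<^sub>R S (u k) w" for w
  have z: "sq_int M \<zeta>" "\<zeta> \<in> borel_measurable (F (u k))"
   unfolding \<zeta>_def using sq_int_indicator[OF Sk(1) AM] AF[of k] Sk(2) by (auto intro!: borel_measurable_scaleR)
  have orth: "(\<integral>w. \<zeta> w \<bullet> (S T w - S (u k) w) \<partial>M) = 0"
   using simple_increment(5)[OF d u0 uk z] by (simp add: S_def)
  have i1: "integrable M (%w. \<zeta> w \<bullet> (S T w - S (u k) w))" by (intro sq_int_inner z sq_int_diff ST Sk)
  have "l^2 * prob (A k) = (\<integral>w. indicator (A k) w * l^2 + 2 * (\<zeta> w \<bullet> (S T w - S (u k) w)) \<partial>M)"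
   using orth i1 AM[of k] by (simp add: less_top[symmetric])
  also have "\<dots> <= (\<integral>w. indicator (A k) w * (norm (S T w))^2 \<partial>M)"
  proof (rule integral_mono[OF _ iT])
   show "integrable M (%w. indicator (A k) w * l^2 + 2 * (\<zeta> w \<bullet> (S T w - S (u k) w)))"
    using i1 AM[of k] by (auto simp: less_top[symmetric])
   fix w assume "w \<in> space M"
   show "indicator (A k) w * l^2 + 2 * (\<zeta> w \<bullet> (S T w - S (u k) w)) <= indicator (A k) w * (norm (S T w))^2"
   proof (cases "w \<in> A k")
    case True
    have "(norm (S T w))^2 = (norm (S (u k) w))^2 + 2 * (S (u k) w \<bullet> (S T w - S (u k) w)) + (norm (S T w - S (u k) w))^2"
     by (simp add: power2_norm_eq_inner inner_diff_left inner_diff_right inner_commute)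
    moreover have "l^2 <= (norm (S (u k) w))^2" using True l by (intro power_mono) (auto simp: A_def)
    ultimately show ?thesis using True by (simp add: \<zeta>_def add_increasing2)
   qed (simp add: \<zeta>_def)
  qed
  finally show ?thesis .
 qed
 have "l^2 * prob (\<Union>k\<in>{..K}. A k) = (\<Sum>k\<le>K. l^2 * prob (A k))"
  using finite_measure_finite_Union[OF finite_atMost image_subsetI[OF AM] disj] by (simp add: sum_distrib_left)
 also have "\<dots> <= (\<Sum>k\<le>K. \<integral>w. indicator (A k) w * (norm (S T w))^2 \<partial>M)" by (intro sum_mono key) simp
 also have "\<dots> = (\<integral>w. (\<Sum>k\<le>K. indicator (A k) w) * (norm (S T w))^2 \<partial>M)"
  unfolding sum_distrib_right by (rule Bochner_Integration.integral_sum[symmetric]) (rule iT)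
 also have "\<dots> <= (\<integral>w. (norm (S T w))^2 \<partial>M)"
 proof (rule integral_mono[OF _ sq_int_integrable_sq[OF ST]])
  show "integrable M (%w. (\<Sum>k\<le>K. indicator (A k) w) * (norm (S T w))^2)"
   unfolding sum_distrib_right by (rule Bochner_Integration.integrable_sum) (rule iT)
  fix w
  have "(\<Sum>k\<le>K. indicator (A k) w) = (indicator (\<Union>k\<in>{..K}. A k) w :: real)"
   by (rule indicator_UN_disjoint[OF finite_atMost disj, symmetric])
  then show "(\<Sum>k\<le>K. indicator (A k) w) * (norm (S T w))^2 <= (norm (S T w))^2"
   by (simp add: indicator_def)
 qed
 finally have "l^2 * prob (\<Union>k\<in>{..K}. A k) <= (l2 M (S T))^2" by (simp add: l2_sq)
 then show ?g2
  using l un by (simp add: S_def field_simps)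
qed

text \<open>The exceedance events of the dyadic grids increase, with a uniform bound on their
  probabilities, and path continuity extends the estimate to all times. An exceptional event stands
  in for a supremum over uncountably many times.\<close>

lemma maximal_inequality:
 fixes \<eta> :: "nat => 'a => 'b::euclidean_space"
 assumes d: "sq_data N \<tau> \<eta>" and T: "0 < T" and l: "0 < l"
 obtains B where "B \<in> sets M" "prob B <= (l2 M (simple_integral W N \<tau> \<eta> T))^2 / l^2"
  "!!w t. w \<in> space M - B ==> continuous_on {0..} (%t. W t w) ==> t \<in> {0..T} ==> norm (simple_integral W N \<tau> \<eta> t w) <= l"
proof -
 let ?S = "simple_integral W N \<tau> \<eta>"
 define u where "u m k = real k * T / 2 ^ m" for m k :: nat
 define B where "B m = {w \<in> space M. \<exists>k\<le>2 ^ m. l < norm (?S (u m k) w)}" for m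
 have u: "0 <= u m 0" "!!i j. i <= j ==> u m i <= u m j" "u m (2 ^ m) = T" for m
  using T by (auto simp: u_def intro!: divide_right_mono mult_right_mono)
 note mx = maximal_inequality_grid[OF d u l]
 have BM: "B m \<in> sets M" for m unfolding B_def by (rule mx(1))
 have Bp: "prob (B m) <= (l2 M (?S T))^2 / l^2" for m unfolding B_def by (rule mx(2))
 have inc: "incseq B"
 proof (rule incseq_SucI, rule subsetI)
  fix m w assume "w \<in> B m"
  then obtain k where "w \<in> space M" "k <= 2 ^ m" "l < norm (?S (u m k) w)" by (auto simp: B_def)
  moreover have "u (Suc m) (2 * k) = u m k" by (simp add: u_def)
  ultimately show "w \<in> B (Suc m)" unfolding B_def by (auto intro!: exI[of _ "2 * k"])
 qed
 have "(%m. prob (B m)) \<longlonglongrightarrow> prob (\<Union>m. B m)"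
  by (rule finite_Lim_measure_incseq) (use BM inc in auto)
 then have "prob (\<Union>m. B m) <= (l2 M (?S T))^2 / l^2"
  by (rule LIMSEQ_le_const2) (use Bp in auto)
 moreover have "norm (?S t w) <= l" if w: "w \<in> space M - (\<Union>m. B m)" "continuous_on {0..} (%t. W t w)" and t: "t \<in> {0..T}" for w t
 proof -
  \<comment> \<open>\<open>u m (k m)\<close> is the last dyadic time of level \<open>m\<close> that
    is not after \<open>t\<close>.\<close>
  define k where "k m = nat \<lfloor>t * 2 ^ m / T\<rfloor>" for m
  have q: "0 <= t * 2 ^ m / T" "t * 2 ^ m / T <= 2 ^ m" for m using t T by (auto simp: field_simps)
  have kr: "real (k m) <= t * 2 ^ m / T" "t * 2 ^ m / T < real (k m) + 1" for m
   using q(1)[of m] unfolding k_def by linarith+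
  have k: "k m <= 2 ^ m" for m
  proof -
   have "real (k m) <= 2 ^ m" using kr(1)[of m] q(2)[of m] by linarith
   then have "real (k m) <= real (2 ^ m)" by (simp only: of_nat_power of_nat_numeral)
   then show ?thesis by (simp only: of_nat_le_iff)
  qed
  have ub: "u m (k m) <= t" "t - T * (1 / 2) ^ m <= u m (k m)" "0 <= u m (k m)" for m
  proof -
   show "u m (k m) <= t" using kr(1)[of m] T by (simp add: u_def field_simps)
   have "t * 2 ^ m < (real (k m) + 1) * T" using kr(2)[of m] T by (simp add: field_simps)
   then have "t * 2 ^ m / 2 ^ m <= (real (k m) + 1) * T / 2 ^ m" by (intro divide_right_mono) auto
   then show "t - T * (1 / 2) ^ m <= u m (k m)"
    by (simp add: u_def distrib_right add_divide_distrib power_one_over)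
   show "0 <= u m (k m)" using T by (simp add: u_def)
  qed
  have "(%m. t - T * (1 / 2) ^ m) \<longlonglongrightarrow> t - T * 0" by (intro tendsto_intros LIMSEQ_realpow_zero) auto
  then have low: "(%m. t - T * (1 / 2) ^ m) \<longlonglongrightarrow> t" by simp
  have lim: "(%m. u m (k m)) \<longlonglongrightarrow> t"
   by (rule tendsto_sandwich[OF _ _ low tendsto_const]) (simp_all add: ub)
  have cont: "continuous_on {0..} (%t. ?S t w)"
   by (rule continuous_on_simple_integral[where V = W, OF w(2) sq_data_tau_nonneg[OF d]])
  have "(%m. ?S (u m (k m)) w) \<longlonglongrightarrow> ?S t w"
   by (rule continuous_on_tendsto_compose[OF cont lim]) (use t ub in auto)
  then have "(%m. norm (?S (u m (k m)) w)) \<longlonglongrightarrow> norm (?S t w)" by (rule tendsto_norm)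
  moreover have "norm (?S (u m (k m)) w) <= l" for m
  proof -
   have "w \<in> space M" "w \<notin> B m" using w(1) by auto
   then show ?thesis using k[of m] unfolding B_def by (auto simp: not_less)
  qed
  ultimately show ?thesis by (intro LIMSEQ_le_const2) auto
 qed
 moreover have "(\<Union>m. B m) \<in> sets M" using BM by auto
 ultimately show ?thesis using that by blast
qed

lemma eventually_small_AE:
 assumes B: "!!n. B n \<in> sets M" "!!n. prob (B n) <= K * (4 / 9) ^ n"
 shows "AE w in M. \<exists>n0. \<forall>n\<ge>n0. w \<in> space M - B n"
proof -
 have "AE w in M. eventually (%n. w \<in> space M - B n) sequentially"
 proof (rule borel_cantelli_AE1)
  show "summable (%n. prob (B n))"
  proof (rule summable_comparison_test')
   show "summable (%n. K * (4 / 9 :: real) ^ n)" by (intro summable_mult summable_geometric) simp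
   show "norm (prob (B n)) <= K * (4 / 9) ^ n" if "0 <= n" for n using B(2)[of n] by simp
  qed
 qed (use B in \<open>auto simp: less_top[symmetric]\<close>)
 then show ?thesis by (simp add: eventually_sequentially)
qed

text \<open>Here the threshold ratio \<open>3 / 4\<close> is decided: it lies between the
  \<open>l2\<close>-ratio \<open>1 / 2\<close> and 1, so the thresholds are summable and the
  Chebyshev bounds still decay like \<open>(4 / 9) ^ n\<close>.\<close>

lemma geometric_square: "(K * (1 / 2) ^ n)^2 / ((3 / 4) ^ n)^2 = K^2 * (4 / 9 :: real) ^ n"
 by (simp add: power2_eq_square power_divide field_simps flip: power_mult_distrib)

lemma simple_integrals_uniformly_small:
 fixes \<eta> :: "nat => nat => 'a => 'b::euclidean_space"
 assumes d: "!!n. sq_data (N n) (\<tau> n) (\<eta> n)" and T: "0 < T"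
  and b: "!!n. l2 M (simple_integral W (N n) (\<tau> n) (\<eta> n) T) <= K * (1 / 2) ^ n"
 shows "AE w in M. \<exists>n0. \<forall>n\<ge>n0. \<forall>t\<in>{0..T}. norm (simple_integral W (N n) (\<tau> n) (\<eta> n) t w) <= (3 / 4) ^ n"
proof -
 have "\<exists>B. B \<in> sets M \<and> prob B <= K^2 * (4 / 9) ^ n \<and>
  (\<forall>w t. w \<in> space M - B --> continuous_on {0..} (%t. W t w) --> t \<in> {0..T} -->
   norm (simple_integral W (N n) (\<tau> n) (\<eta> n) t w) <= (3 / 4) ^ n)" for n
 proof -
  have p: "(0::real) < (3 / 4) ^ n" by simp
  obtain B where B: "B \<in> sets M" "prob B <= (l2 M (simple_integral W (N n) (\<tau> n) (\<eta> n) T))^2 / ((3 / 4) ^ n)^2"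
   "!!w t. w \<in> space M - B ==> continuous_on {0..} (%t. W t w) ==> t \<in> {0..T} ==>
    norm (simple_integral W (N n) (\<tau> n) (\<eta> n) t w) <= (3 / 4) ^ n"
   using maximal_inequality[OF d[of n] T p] by metis
  have "(l2 M (simple_integral W (N n) (\<tau> n) (\<eta> n) T))^2 / ((3 / 4) ^ n)^2 <= (K * (1 / 2) ^ n)^2 / ((3 / 4) ^ n)^2"
   by (intro divide_right_mono power_mono b) auto
  then have "prob B <= K^2 * (4 / 9) ^ n" using B(2) unfolding geometric_square by linarith
  then show ?thesis using B(1,3) by blast
 qed
 then obtain B where B: "!!n. B n \<in> sets M" "!!n. prob (B n) <= K^2 * (4 / 9) ^ n"
  "!!n w t. w \<in> space M - B n ==> continuous_on {0..} (%t. W t w) ==> t \<in> {0..T} ==>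
   norm (simple_integral W (N n) (\<tau> n) (\<eta> n) t w) <= (3 / 4) ^ n"
  by metis
 show ?thesis
  using eventually_small_AE[OF B(1,2)] W_cont
 proof eventually_elim
  case (elim w)
  then obtain n0 where "!!n. n \<ge> n0 ==> w \<in> space M - B n" by blast
  then show ?case using B(3) elim(2) by blast
 qed
qed

end

section \<open>Euler interpolations and their uniform convergence on almost every path\<close>

context euler_scheme
begin

definition SI :: "(real => 'a => real) => ('b => 'b) => nat => real => 'a => 'b" where
 "SI V f n = simple_integral V (4 ^ n) (tm n) (%k w. f (node n k w))"

definition dn :: "('b => 'b) => nat => nat => 'a => 'b" where
 "dn f n j w = f (node (Suc n) j w) - f (node n (j div 4) w)"

text \<open>With time itself as integrator, the drift is a simple integral too and shares the
  algebra of the noise terms.\<close>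

abbreviation clock :: "real => 'a => real" where "clock \<equiv> %t _. t"

lemma tm_sq_data:
 assumes "!!k. k < 4 ^ n ==> sq_int M (\<eta> k)" "!!k. k < 4 ^ n ==> \<eta> k \<in> borel_measurable (F (tm n k))"
 shows "sq_data (4 ^ n) (tm n) \<eta>"
 using assms tm_nonneg tm_mono by (simp add: sq_data_def)

lemma node_data: "sq_lip \<kappa> f ==> sq_data (4 ^ n) (tm n) (%k w. f (node n k w))"
 by (rule tm_sq_data) (simp_all add: sq_lip_sq_int(1)[OF _ \<kappa> node_sq] sq_lip_meas[OF _ \<kappa> node_F])

lemma dn_props:
 assumes f: "sq_lip \<kappa> f" and j: "j <= 4 ^ Suc n"
 shows "sq_int M (dn f n j)" (is ?g1) "dn f n j \<in> borel_measurable (F (tm (Suc n) j))" (is ?g2) "l2 M (dn f n j) <= sqrt \<kappa> * K6 * (1 / 2) ^ n" (is ?g3)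
proof -
 note d = sq_lip_diff[OF f \<kappa> node_sq[of "Suc n" j] node_sq[of n "j div 4"]]
 show ?g1 using d(1) by (simp add: dn_def[abs_def])
 show ?g2
  unfolding dn_def
  using sq_lip_meas[OF f \<kappa> node_F] sq_lip_meas[OF f \<kappa> meas_F_mono[OF node_F tm_div_le(1)]] by (rule borel_measurable_diff)
 have K6: "0 <= K6" using T K_nonneg by (simp add: K6_def)
 show ?g3
 proof (rule power2_le_imp_le)
  have "(l2 M (dn f n j))^2 <= \<kappa> * (l2 M (%w. node (Suc n) j w - node n (j div 4) w))^2"
   using d(2) by (simp add: l2_sq dn_def)
  also have "\<dots> <= \<kappa> * (K6 * (1 / 2) ^ n)^2"
   using \<kappa> level_difference_l2[OF j] by (intro mult_left_mono power_mono) auto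
  also have "\<dots> = (sqrt \<kappa> * K6 * (1 / 2) ^ n)^2" using \<kappa> by (simp add: power_mult_distrib)
  finally show "(l2 M (dn f n j))^2 <= (sqrt \<kappa> * K6 * (1 / 2) ^ n)^2" .
 qed (use \<kappa> K6 in simp)
qed

lemma dn_data: "sq_lip \<kappa> f ==> sq_data (4 ^ Suc n) (tm (Suc n)) (dn f n)"
 by (rule tm_sq_data) (simp_all add: dn_props)

text \<open>Every coarse interval consists of four fine ones, over which the increments of the
  integrator telescope. The difference of two levels is then a single simple integral on the fine
  grid, for any \<open>V\<close>.\<close>

lemma SI_diff: "SI V f (Suc n) t w - SI V f n t w = simple_integral V (4 ^ Suc n) (tm (Suc n)) (dn f n) t w"
proof -
 let ?v = "%j. V (min t (tm (Suc n) j)) w"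
 have "(\<Sum>j<4 ^ Suc n. (?v (Suc j) - ?v j) *\<^sub>R f (node n (j div 4) w)) =
   (\<Sum>k<4 ^ n. \<Sum>j\<in>{k * 4..<k * 4 + 4}. (?v (Suc j) - ?v j) *\<^sub>R f (node n (j div 4) w))"
  using sum.nat_group[of "%j. (?v (Suc j) - ?v j) *\<^sub>R f (node n (j div 4) w)" 4 "4 ^ n"] by (simp add: mult.commute)
 also have "\<dots> = (\<Sum>k<4 ^ n. (V (min t (tm n (Suc k))) w - V (min t (tm n k)) w) *\<^sub>R f (node n k w))"
 proof (rule sum.cong[OF refl])
  fix k assume "k \<in> {..<4 ^ n :: nat}"
  have "(\<Sum>j\<in>{k * 4..<k * 4 + 4}. (?v (Suc j) - ?v j) *\<^sub>R f (node n (j div 4) w)) =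
    (\<Sum>j\<in>{k * 4..<k * 4 + 4}. (?v (Suc j) - ?v j) *\<^sub>R f (node n k w))"
  proof (rule sum.cong[OF refl])
   fix j assume "j \<in> {k * 4..<k * 4 + 4}"
   then have "j div 4 = k" by auto
   then show "(?v (Suc j) - ?v j) *\<^sub>R f (node n (j div 4) w) = (?v (Suc j) - ?v j) *\<^sub>R f (node n k w)" by simp
  qed
  also have "\<dots> = (\<Sum>j\<in>{k * 4..<k * 4 + 4}. ?v (Suc j) - ?v j) *\<^sub>R f (node n k w)" by (simp only: scaleR_sum_left)
  also have "(\<Sum>j\<in>{k * 4..<k * 4 + 4}. ?v (Suc j) - ?v j) = ?v (k * 4 + 4) - ?v (k * 4)"
   by (rule sum_Suc_diff') simp
  also have "?v (k * 4 + 4) = V (min t (tm n (Suc k))) w" using tm_simps(3)[of n "Suc k"] by (simp add: algebra_simps)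
  also have "?v (k * 4) = V (min t (tm n k)) w" using tm_simps(3)[of n k] by (simp add: mult.commute)
  finally show "(\<Sum>j\<in>{k * 4..<k * 4 + 4}. (?v (Suc j) - ?v j) *\<^sub>R f (node n (j div 4) w)) =
    (V (min t (tm n (Suc k))) w - V (min t (tm n k)) w) *\<^sub>R f (node n k w)" .
 qed
 finally have "SI V f n t w = (\<Sum>j<4 ^ Suc n. (?v (Suc j) - ?v j) *\<^sub>R f (node n (j div 4) w))"
  by (simp add: SI_def simple_integral_def)
 then show ?thesis
  by (simp add: SI_def simple_integral_def dn_def scaleR_diff_right sum_subtractf)
qed

text \<open>The factor \<open>1 + T\<close> dominates both \<open>sqrt T\<close>, which the isometry
  produces, and \<open>T\<close>, which the time integral produces.\<close>

definition K7 :: real where "K7 = (1 + T) * (sqrt \<kappa> * K6)"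

lemma K7_nonneg: "0 <= K7" and sqrtT_le: "sqrt T <= 1 + T" (is ?g2)
proof -
 show "0 <= K7" using T \<kappa> K_nonneg by (simp add: K7_def K6_def)
 show ?g2 using T by (intro real_le_lsqrt) (auto simp: power2_eq_square algebra_simps)
qed

text \<open>By the isometry both norms are given by the same sum. Each coefficient has size
  \<open>(1 / 2) ^ n\<close>, and the interval lengths telescope to at most
  \<open>T\<close>.\<close>

lemma cut_dn_le:
 assumes f: "sq_lip \<kappa> f" and t: "0 <= t" "t <= T"
 shows "l2 M (simple_integral W (4 ^ Suc n) (tm (Suc n)) (dn f n) t) <= K7 * (1 / 2) ^ n" (is ?g1)
  "l2 (lborel \<Otimes>\<^sub>M M) (cut 0 t (simple_proc (4 ^ Suc n) (tm (Suc n)) (dn f n))) <= K7 * (1 / 2) ^ n" (is ?g2)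
proof -
 let ?c = "%k. clamp_time 0 t (tm (Suc n) k)"
 let ?k = "sqrt \<kappa> * K6 * (1 / 2) ^ n"
 have c: "?c k <= ?c (Suc k)" for k by (intro clamp_time_mono tm_mono) simp
 have "(\<Sum>k<4 ^ Suc n. (?c (Suc k) - ?c k) * (l2 M (dn f n k))^2) <= (\<Sum>k<4 ^ Suc n. (?c (Suc k) - ?c k) * ?k^2)"
  using c dn_props(3)[OF f] by (intro sum_mono mult_left_mono power_mono) auto
 also have "\<dots> = (\<Sum>k<4 ^ Suc n. ?c (Suc k) - ?c k) * ?k^2" by (simp only: sum_distrib_right)
 also have "(\<Sum>k<4 ^ Suc n. ?c (Suc k) - ?c k) = ?c (4 ^ Suc n) - ?c 0" by (rule sum_lessThan_telescope)
 also have "(?c (4 ^ Suc n) - ?c 0) * ?k^2 <= T * ?k^2"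
  using clamp_time_range(2)[OF t(1), of "tm (Suc n) (4 ^ Suc n)"] clamp_time_range(1)[OF t(1), of "tm (Suc n) 0"] t
  by (intro mult_right_mono) auto
 also have "\<dots> = (sqrt T * ?k)^2" using T by (simp add: power_mult_distrib)
 also have "\<dots> <= (K7 * (1 / 2) ^ n)^2"
  using mult_right_mono[OF sqrtT_le, of ?k] T \<kappa> K_nonneg
  by (intro power_mono) (auto simp: K7_def K6_def mult_ac)
 finally have *: "(\<Sum>k<4 ^ Suc n. (?c (Suc k) - ?c k) * (l2 M (dn f n k))^2) <= (K7 * (1 / 2) ^ n)^2" .
 have n0: "0 <= K7 * (1 / 2) ^ n" using K7_nonneg by simp
 show ?g1
  by (rule power2_le_imp_le[OF _ n0])
   (use * simple_increment(4)[OF dn_data[OF f] order_refl t(1), of n] in \<open>simp add: simple_integral_0[OF dn_data[OF f]] del: power_Suc\<close>)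
 show ?g2
  by (rule power2_le_imp_le[OF _ n0])
   (use * cut_simple_integral_sq(2)[OF dn_data[OF f] order_refl t(1), of n] in \<open>simp add: l2_sq del: power_Suc\<close>)
qed

text \<open>The time integral is no martingale, but at all times its norm is at most the sum of all
  coefficient norms weighted by the step. That is the single random variable
  \<open>\<rho> n\<close>, to which Chebyshev's inequality applies.\<close>

lemma clock_small:
 assumes f: "sq_lip \<kappa> f"
 shows "AE w in M. \<exists>n0. \<forall>n\<ge>n0. \<forall>t\<in>{0..T}. norm (simple_integral clock (4 ^ Suc n) (tm (Suc n)) (dn f n) t w) <= (3 / 4) ^ n"
proof -
 define \<rho> where "\<rho> n w = (\<Sum>j<4 ^ Suc n. (T / 4 ^ Suc n) *\<^sub>R norm (dn f n j w))" for n w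
 have nsq: "sq_int M (%w. norm (dn f n j w))" "l2 M (%w. norm (dn f n j w)) = l2 M (dn f n j)" if "j < 4 ^ Suc n" for n j
  using dn_props(1)[OF f, of j n] that by (auto simp: sq_int_def l2_def)
 have rsq: "sq_int M (\<rho> n)" for n unfolding \<rho>_def by (intro sq_int_sum sq_int_scaleR nsq) simp
 have rl: "l2 M (\<rho> n) <= K7 * (1 / 2) ^ n" for n
 proof -
  have "l2 M (\<rho> n) <= (\<Sum>j<4 ^ Suc n. l2 M (%w. (T / 4 ^ Suc n) *\<^sub>R norm (dn f n j w)))"
   unfolding \<rho>_def by (intro l2_sum_le sq_int_scaleR nsq) simp
  also have "\<dots> <= (\<Sum>j<(4::nat) ^ Suc n. T / 4 ^ Suc n * (sqrt \<kappa> * K6 * (1 / 2) ^ n))"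
  proof (rule sum_mono)
   fix j assume "j \<in> {..<4 ^ Suc n :: nat}"
   then have j: "j < 4 ^ Suc n" by simp
   show "l2 M (%w. (T / 4 ^ Suc n) *\<^sub>R norm (dn f n j w)) <= T / 4 ^ Suc n * (sqrt \<kappa> * K6 * (1 / 2) ^ n)"
    unfolding l2_scaleR nsq(2)[OF j] using T dn_props(3)[OF f less_imp_le[OF j]]
    by (simp only: abs_of_pos divide_pos_pos zero_less_power zero_less_numeral) (intro mult_left_mono, auto)
  qed
  also have "\<dots> = T * (sqrt \<kappa> * K6 * (1 / 2) ^ n)" by simp
  also have "\<dots> <= (1 + T) * (sqrt \<kappa> * K6 * (1 / 2) ^ n)"
   using \<kappa> T K_nonneg by (intro mult_right_mono) (auto simp: K6_def)
  finally show ?thesis by (simp add: K7_def mult_ac)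
 qed
 define B where "B n = {w \<in> space M. (3 / 4) ^ n < \<rho> n w}" for n
 have [measurable]: "\<rho> n \<in> borel_measurable M" for n using rsq by (simp add: sq_int_def)
 have BM: "B n \<in> sets M" for n unfolding B_def by measurable
 have Bp: "prob (B n) <= K7^2 * (4 / 9) ^ n" for n
 proof -
  let ?l = "(3 / 4 :: real) ^ n"
  have "?l^2 * prob (B n) = (\<integral>w. indicator (B n) w * ?l^2 \<partial>M)" using BM by simp
  also have "\<dots> <= (\<integral>w. (norm (\<rho> n w))^2 \<partial>M)"
  proof (rule integral_mono)
   show "integrable M (%w. indicator (B n) w * ?l^2)" using BM by (auto simp: less_top[symmetric])
   show "integrable M (%w. (norm (\<rho> n w))^2)" by (rule sq_int_integrable_sq[OF rsq])
   fix w
   have "?l^2 <= (norm (\<rho> n w))^2" if "w \<in> B n" using that by (intro power_mono) (auto simp: B_def)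
   then show "indicator (B n) w * ?l^2 <= (norm (\<rho> n w))^2" by (auto simp: indicator_def)
  qed
  also have "\<dots> <= (K7 * (1 / 2) ^ n)^2" unfolding l2_sq[symmetric] by (intro power_mono rl) simp
  finally have "prob (B n) <= (K7 * (1 / 2) ^ n)^2 / ?l^2" by (simp add: field_simps)
  then show ?thesis by (simp only: geometric_square)
 qed
 show ?thesis
  using eventually_small_AE[OF BM Bp]
 proof eventually_elim
  case (elim w)
  then obtain n0 where n0: "!!n. n \<ge> n0 ==> w \<in> space M - B n" by blast
  have "norm (simple_integral clock (4 ^ Suc n) (tm (Suc n)) (dn f n) t w) <= (3 / 4) ^ n" if n: "n \<ge> n0" for n t
  proof -
   have "norm (simple_integral clock (4 ^ Suc n) (tm (Suc n)) (dn f n) t w) <= \<rho> n w"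
    unfolding simple_integral_def \<rho>_def
   proof (rule order_trans[OF norm_sum sum_mono])
    fix k
    have "\<bar>min t (tm (Suc n) (Suc k)) - min t (tm (Suc n) k)\<bar> <= tm (Suc n) (Suc k) - tm (Suc n) k"
     using tm_mono[of k "Suc k" "Suc n"] by (auto simp: min_def)
    then show "norm ((min t (tm (Suc n) (Suc k)) - min t (tm (Suc n) k)) *\<^sub>R dn f n k w) <= (T / 4 ^ Suc n) *\<^sub>R norm (dn f n k w)"
     unfolding tm_simps(4) norm_scaleR real_scaleR_def by (rule mult_right_mono) simp
   qed
   also have "\<dots> <= (3 / 4) ^ n" using n0[OF n] by (auto simp: B_def not_less)
   finally show ?thesis .
  qed
  then show ?case by blast
 qed
qed

lemma W0_data:
 assumes f: "sq_lip \<kappa> f"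
 shows "mean_field_basis.sq_data M F0 W0 W (4 ^ Suc n) (tm (Suc n)) (dn f n)"
  "mean_field_basis.sq_data M F0 W0 W (4 ^ n) (tm n) (%k w. f (node n k w))"
proof -
 interpret sw: mean_field_basis M F0 W0 W by (rule swap)
 show "sw.sq_data (4 ^ Suc n) (tm (Suc n)) (dn f n)" "sw.sq_data (4 ^ n) (tm n) (%k w. f (node n k w))"
  using dn_data[OF f, of n] node_data[OF f, of n] by (simp_all add: sq_data_def sw.sq_data_def swF)
qed

lemma cut_dn_le_W0:
 assumes f: "sq_lip \<kappa> f" and t: "0 <= t" "t <= T"
 shows "l2 M (simple_integral W0 (4 ^ Suc n) (tm (Suc n)) (dn f n) t) <= K7 * (1 / 2) ^ n"
proof -
 interpret sw: mean_field_basis M F0 W0 W by (rule swap)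
 have "(l2 M (simple_integral W0 (4 ^ Suc n) (tm (Suc n)) (dn f n) t))^2 =
   (l2 M (simple_integral W (4 ^ Suc n) (tm (Suc n)) (dn f n) t))^2"
  using sw.simple_increment(4)[OF W0_data(1)[OF f] order_refl t(1), of n] simple_increment(4)[OF dn_data[OF f] order_refl t(1), of n]
  by (simp add: simple_integral_0[OF dn_data[OF f]] del: power_Suc)
 then show ?thesis using cut_dn_le(1)[OF f t, of n] by (simp add: power2_eq_iff_nonneg)
qed

text \<open>Path conditions under which the three Euler integrals converge uniformly. They hold
  almost surely; on the other paths the limits are set to 0, so that every path of the solution is
  continuous.\<close>

definition good :: "'a => bool" where
 "good w \<longleftrightarrow> continuous_on {0..} (%t. W t w) \<and> continuous_on {0..} (%t. W0 t w) \<and>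
  (\<exists>n0. \<forall>n\<ge>n0. \<forall>t\<in>{0..T}. norm (SI clock fa (Suc n) t w - SI clock fa n t w) <= (3 / 4) ^ n \<and>
   norm (SI W fc (Suc n) t w - SI W fc n t w) <= (3 / 4) ^ n \<and> norm (SI W0 fg (Suc n) t w - SI W0 fg n t w) <= (3 / 4) ^ n)"

lemma good_AE: "AE w in M. good w"
proof -
 interpret sw: mean_field_basis M F0 W0 W by (rule swap)
 have a: "AE w in M. \<exists>n0. \<forall>n\<ge>n0. \<forall>t\<in>{0..T}. norm (simple_integral W (4 ^ Suc n) (tm (Suc n)) (dn fc n) t w) <= (3 / 4) ^ n"
  by (rule simple_integrals_uniformly_small[OF dn_data[OF lip(2)] T cut_dn_le(1)[OF lip(2)]]) (use T in auto)
 have b: "AE w in M. \<exists>n0. \<forall>n\<ge>n0. \<forall>t\<in>{0..T}. norm (simple_integral W0 (4 ^ Suc n) (tm (Suc n)) (dn fg n) t w) <= (3 / 4) ^ n"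
  by (rule sw.simple_integrals_uniformly_small[OF W0_data(1)[OF lip(3)] T cut_dn_le_W0[OF lip(3)]]) (use T in auto)
 show ?thesis
  using a b clock_small[OF lip(1)] W_cont sw.W_cont
 proof eventually_elim
  case (elim w)
  from elim(1) obtain n1 where n1: "!!n t. n \<ge> n1 ==> t \<in> {0..T} ==> norm (SI W fc (Suc n) t w - SI W fc n t w) <= (3 / 4) ^ n"
   unfolding SI_diff by blast
  from elim(2) obtain n2 where n2: "!!n t. n \<ge> n2 ==> t \<in> {0..T} ==> norm (SI W0 fg (Suc n) t w - SI W0 fg n t w) <= (3 / 4) ^ n"
   unfolding SI_diff by blast
  from elim(3) obtain n3 where n3: "!!n t. n \<ge> n3 ==> t \<in> {0..T} ==> norm (SI clock fa (Suc n) t w - SI clock fa n t w) <= (3 / 4) ^ n"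
   unfolding SI_diff by blast
  show ?case unfolding good_def using elim(4,5) n1 n2 n3 by (intro conjI exI[of _ "max n1 (max n2 n3)"]) auto
 qed
qed

definition epath :: "nat => real => 'a => 'b" where
 "epath n t w = x0 w + SI clock fa n t w + SI W fc n t w + SI W0 fg n t w"

lemma SI_node:
 assumes k: "k <= 4 ^ n"
 shows "SI V f n (tm n k) w = (\<Sum>i<k. (V (tm n (Suc i)) w - V (tm n i) w) *\<^sub>R f (node n i w))"
proof -
 let ?g = "%i. (V (min (tm n k) (tm n (Suc i))) w - V (min (tm n k) (tm n i)) w) *\<^sub>R f (node n i w)"
 have "SI V f n (tm n k) w = (\<Sum>i<4 ^ n. ?g i)" by (simp add: SI_def simple_integral_def)
 also have "\<dots> = (\<Sum>i<k. ?g i)"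
 proof (rule sum.mono_neutral_right)
  show "\<forall>i\<in>{..<4 ^ n} - {..<k}. ?g i = 0"
  proof
   fix i assume "i \<in> {..<4 ^ n} - {..<k}"
   then have "tm n k <= tm n i" "tm n k <= tm n (Suc i)" using tm_mono[of k i n] tm_mono[of k "Suc i" n] by auto
   then show "?g i = 0" by (simp add: min_def)
  qed
 qed (use k in auto)
 also have "\<dots> = (\<Sum>i<k. (V (tm n (Suc i)) w - V (tm n i) w) *\<^sub>R f (node n i w))"
 proof (rule sum.cong[OF refl])
  fix i assume "i \<in> {..<k}"
  then have "tm n i <= tm n k" "tm n (Suc i) <= tm n k" using tm_mono[of i k n] tm_mono[of "Suc i" k n] by auto
  then show "?g i = (V (tm n (Suc i)) w - V (tm n i) w) *\<^sub>R f (node n i w)" by (simp add: min_def)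
 qed
 finally show ?thesis .
qed

lemma epath_node:
 assumes k: "k <= 4 ^ n"
 shows "epath n (tm n k) w = node n k w"
proof -
 have "node n k w = x0 w + (\<Sum>i<k. (tm n (Suc i) - tm n i) *\<^sub>R fa (node n i w))
   + (\<Sum>i<k. (W (tm n (Suc i)) w - W (tm n i) w) *\<^sub>R fc (node n i w))
   + (\<Sum>i<k. (W0 (tm n (Suc i)) w - W0 (tm n i) w) *\<^sub>R fg (node n i w))"
  by (induction k) (simp_all add: algebra_simps)
 then show ?thesis by (simp add: epath_def SI_node[OF k])
qed

end

section \<open>Existence of solutions\<close>

lemma simple_integral_clock:
 assumes t: "0 <= t" and \<tau>: "!!k. k < N ==> \<tau> k <= \<tau> (Suc k)" "!!k. k <= N ==> 0 <= \<tau> k"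
 shows "set_integrable lborel {0<..t} (%s. simple_proc N \<tau> \<eta> s w)" (is ?g1)
  "simple_integral (%t _. t) N \<tau> \<eta> t w = (LBINT s:{0<..t}. simple_proc N \<tau> \<eta> s w)" (is ?g2)
proof -
 have e: "indicator {0<..t} s *\<^sub>R simple_proc N \<tau> \<eta> s w =
   (\<Sum>k<N. indicator {min t (\<tau> k)<..min t (\<tau> (Suc k))} s *\<^sub>R \<eta> k w)" for s
  unfolding simple_proc_def scaleR_sum_right scaleR_scaleR
 proof (rule sum.cong[OF refl])
  fix k assume "k \<in> {..<N}"
  then have "0 <= \<tau> k" "\<tau> k <= \<tau> (Suc k)" using \<tau>(1)[of k] \<tau>(2)[of k] by auto
  then have "indicator {0<..t} s * indicator {\<tau> k<..\<tau> (Suc k)} s = (indicator {min t (\<tau> k)<..min t (\<tau> (Suc k))} s :: real)"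
   by (auto simp: indicator_def)
  then show "(indicator {0<..t} s * indicator {\<tau> k<..\<tau> (Suc k)} s) *\<^sub>R \<eta> k w =
    indicator {min t (\<tau> k)<..min t (\<tau> (Suc k))} s *\<^sub>R \<eta> k w" by simp
 qed
 have m: "min t (\<tau> k) <= min t (\<tau> (Suc k))" if "k < N" for k using \<tau>(1)[OF that] by auto
 have i: "integrable lborel (%s. indicator {min t (\<tau> k)<..min t (\<tau> (Suc k))} s *\<^sub>R \<eta> k w)" if "k < N" for k
  by (intro integrable_scaleR_left integrable_real_indicator) (use m[OF that] in auto)
 show ?g1
  unfolding set_integrable_def e by (rule Bochner_Integration.integrable_sum) (use i in auto)
 have "(LBINT s:{0<..t}. simple_proc N \<tau> \<eta> s w) = (\<Sum>k<N. \<integral>s. indicator {min t (\<tau> k)<..min t (\<tau> (Suc k))} s *\<^sub>R \<eta> k w \<partial>lborel)"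
  unfolding set_lebesgue_integral_def e by (rule Bochner_Integration.integral_sum) (use i in auto)
 also have "\<dots> = (\<Sum>k<N. (min t (\<tau> (Suc k)) - min t (\<tau> k)) *\<^sub>R \<eta> k w)"
  using m by (intro sum.cong) (auto simp: less_top[symmetric])
 finally show ?g2
  by (simp add: simple_integral_def)
qed

text \<open>For arbitrary \<open>f\<close> the integrands differ only at time 0, so they are
  measurable together or not at all; in the second case both integrals have the default value
  0.\<close>

lemma set_integral_Icc_Ioc: "(LBINT s:{0..t}. f s) = (LBINT s:{0<..t::real}. (f s :: 'b::euclidean_space))"
proof -
 have "AE s in lborel. indicator {0..t} s *\<^sub>R f s = indicator {0<..t} s *\<^sub>R f s"
  using AE_lborel_singleton[of "0::real"] by eventually_elim (auto simp: indicator_def)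
 note ae = this
 let ?F = "%s. indicator {0..t} s *\<^sub>R f s" and ?G = "%s. indicator {0<..t} s *\<^sub>R f s"
 have G: "?G = (%s. if s = 0 then 0 else ?F s)" and F: "?F = (%s. if s = 0 then indicator {0..t} (0::real) *\<^sub>R f 0 else ?G s)"
  by (auto simp: fun_eq_iff indicator_def)
 have z: "{s \<in> space lborel. s = (0::real)} \<in> sets lborel" by simp
 have "?F \<in> borel_measurable lborel \<longleftrightarrow> ?G \<in> borel_measurable lborel"
 proof
  assume "?F \<in> borel_measurable lborel"
  then show "?G \<in> borel_measurable lborel" by (subst G, intro measurable_If z) simp_all
 next
  assume "?G \<in> borel_measurable lborel"
  then show "?F \<in> borel_measurable lborel" by (subst F, intro measurable_If z) simp_all
 qed
 note iff = this
 show ?thesis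
 proof (cases "?F \<in> borel_measurable lborel")
  case True
  then show ?thesis unfolding set_lebesgue_integral_def using iff ae by (intro integral_cong_AE) auto
 next
  case False
  then have "\<not> integrable lborel ?F" "\<not> integrable lborel ?G"
   using iff borel_measurable_integrable[of lborel ?F] borel_measurable_integrable[of lborel ?G] by blast+
  then show ?thesis
   unfolding set_lebesgue_integral_def
   using not_integrable_integral_eq[of lborel ?F] not_integrable_integral_eq[of lborel ?G] by simp
 qed
qed

text \<open>The process is approximated by its values at dyadic times to the left. On the strip up
  to \<open>t\<close> these use only times not after \<open>t\<close>, countably many at each level,
  and continuity gives the limit.\<close>

lemma progressive_continuous:
 fixes Z :: "real => 'a => 'b::euclidean_space"
 assumes m: "!!s t. 0 <= s ==> s <= t ==> t <= T ==> Z s \<in> borel_measurable (G t)"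
  and c: "!!w t. t \<in> {0..T} ==> w \<in> space (G t) ==> continuous_on {0..T} (%t. Z t w)"
 shows "progressive G T Z"
 unfolding progressive_def
proof
 fix t assume t: "t \<in> {0..T}"
 let ?N = "restrict_space borel {0..t} \<Otimes>\<^sub>M G t"
 define \<sigma> where "\<sigma> n s = real (nat \<lfloor>s * 2 ^ n\<rfloor>) / 2 ^ n" for n :: nat and s :: real
 have \<sigma>: "0 <= \<sigma> n s" "\<sigma> n s <= s" "s - (1 / 2) ^ n <= \<sigma> n s" if "0 <= s" for n s
 proof -
  have "0 <= s * 2 ^ n" using that by simp
  then have f: "real (nat \<lfloor>s * 2 ^ n\<rfloor>) <= s * 2 ^ n" "s * 2 ^ n <= real (nat \<lfloor>s * 2 ^ n\<rfloor>) + 1" by linarith+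
  show "0 <= \<sigma> n s" by (simp add: \<sigma>_def)
  show "\<sigma> n s <= s" using f(1) by (simp add: \<sigma>_def divide_le_eq)
  have "s <= (real (nat \<lfloor>s * 2 ^ n\<rfloor>) + 1) / 2 ^ n" using f(2) by (simp add: le_divide_eq)
  then show "s - (1 / 2) ^ n <= \<sigma> n s" by (simp add: \<sigma>_def add_divide_distrib power_one_over)
 qed
 have lim: "(%n. \<sigma> n s) \<longlonglongrightarrow> s" if "0 <= s" for s
 proof -
  have "(%n. s - (1 / 2 :: real) ^ n) \<longlonglongrightarrow> s - 0" by (intro tendsto_diff tendsto_const LIMSEQ_realpow_zero) auto
  then have low: "(%n. s - (1 / 2 :: real) ^ n) \<longlonglongrightarrow> s" by simp
  show ?thesis by (rule tendsto_sandwich[OF _ _ low tendsto_const]) (simp_all add: \<sigma>[OF that])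
 qed
 show "(%(s, w). Z s w) \<in> borel_measurable ?N"
 proof (rule borel_measurable_LIMSEQ_metric)
  fix n
  have k: "(%x. nat \<lfloor>fst x * 2 ^ n\<rfloor>) \<in> ?N \<rightarrow>\<^sub>M count_space UNIV"
  proof -
   have [measurable]: "fst \<in> borel_measurable ?N"
    by (rule measurable_compose[OF measurable_fst]) (simp add: measurable_restrict_space1)
   show ?thesis by measurable
  qed
  \<comment> \<open>The index \<open>k\<close> runs over all natural numbers here. The default 0
    keeps times beyond \<open>t\<close> measurable for \<open>G t\<close>; it is not attained on the
    strip.\<close>
  have "(%x. if real k / 2 ^ n <= t then Z (real k / 2 ^ n) (snd x) else 0) \<in> borel_measurable ?N" for k :: nat
  proof (cases "real k / 2 ^ n <= t")
   case True
   have "Z (real k / 2 ^ n) \<in> borel_measurable (G t)" by (rule m) (use True t in auto)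
   then show ?thesis using True measurable_compose[OF measurable_snd] by simp
  qed simp
  from measurable_compose_countable[where f = "%k x. if real k / 2 ^ n <= t then Z (real k / 2 ^ n) (snd x) else 0", OF this k]
  have "(%x. if \<sigma> n (fst x) <= t then Z (\<sigma> n (fst x)) (snd x) else 0) \<in> borel_measurable ?N"
   unfolding \<sigma>_def .
  then show "(%x. if \<sigma> n (fst x) <= t then Z (\<sigma> n (fst x)) (snd x) else 0) \<in> borel_measurable ?N" .
 next
  fix x assume "x \<in> space ?N"
  then have x: "0 <= fst x" "fst x <= t" "snd x \<in> space (G t)" by (auto simp: space_pair_measure space_restrict_space)
  have "(%n. Z (\<sigma> n (fst x)) (snd x)) \<longlonglongrightarrow> Z (fst x) (snd x)"
  proof (rule continuous_on_tendsto_compose[OF c[OF t x(3)] lim[OF x(1)]])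
   show "fst x \<in> {0..T}" using x t by auto
   have "\<sigma> n (fst x) \<in> {0..T}" for n using \<sigma>(1,2)[OF x(1), of n] x(2) t by simp
   then show "\<forall>\<^sub>F n in sequentially. \<sigma> n (fst x) \<in> {0..T}" by simp
  qed
  moreover have "\<sigma> n (fst x) <= t" for n using \<sigma>(2)[OF x(1), of n] x(2) by linarith
  ultimately show "(%n. if \<sigma> n (fst x) <= t then Z (\<sigma> n (fst x)) (snd x) else 0) \<longlonglongrightarrow> (case x of (s, w) => Z s w)"
   by (simp add: case_prod_beta')
 qed
qed

context prob_space
begin

lemma energy_cut:
 fixes G :: "real => 'a => 'b::euclidean_space"
 assumes m: "cut 0 T G \<in> borel_measurable (lborel \<Otimes>\<^sub>M M)"
 shows "energy M {0..T} G = (\<integral>\<^sup>+x. ennreal ((norm (cut 0 T G x))^2) \<partial>(lborel \<Otimes>\<^sub>M M))"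
proof -
 interpret P: pair_sigma_finite lborel M by (rule pair_lborel)
 have "(\<integral>\<^sup>+x. ennreal ((norm (cut 0 T G x))^2) \<partial>(lborel \<Otimes>\<^sub>M M)) =
   (\<integral>\<^sup>+w. (\<integral>\<^sup>+r. ennreal ((norm (cut 0 T G (r, w)))^2) \<partial>lborel) \<partial>M)"
  by (rule P.nn_integral_snd[symmetric]) (use m in measurable)
 also have "\<dots> = energy M {0..T} G"
  unfolding energy_def
 proof (rule nn_integral_cong)
  fix w
  show "(\<integral>\<^sup>+r. ennreal ((norm (cut 0 T G (r, w)))^2) \<partial>lborel) = (\<integral>\<^sup>+t\<in>{0..T}. ennreal ((norm (G t w))^2) \<partial>lborel)"
  proof (rule nn_integral_cong_AE)
   show "AE r in lborel. ennreal ((norm (cut 0 T G (r, w)))^2) = ennreal ((norm (G r w))^2) * indicator {0..T} r"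
    using AE_lborel_singleton[of "0::real"] by eventually_elim (auto simp: cut_def indicator_def)
  qed
 qed
 finally show ?thesis ..
qed

lemma energy_l2proc: "l2proc M T G ==> energy M {0..T} G = ennreal ((l2 (lborel \<Otimes>\<^sub>M M) (cut 0 T G))^2)"
 unfolding l2proc_def by (simp add: energy_cut sq_int_def nn_integral_sq_int)

end

context mean_field_basis
begin

lemma simple_integral_diff:
 "simple_integral V N \<tau> (%k w. \<eta> k w - \<eta>' k w) t w = simple_integral V N \<tau> \<eta> t w - simple_integral V N \<tau> \<eta>' t w"
 by (simp add: simple_integral_def scaleR_diff_right sum_subtractf)

lemma simple_proc_diff:
 "simple_proc N \<tau> (%k w. \<eta> k w - \<eta>' k w) s w = simple_proc N \<tau> \<eta> s w - simple_proc N \<tau> \<eta>' s w"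
 by (simp add: simple_proc_def scaleR_diff_right sum_subtractf)

text \<open>Simple processes must be bounded, so the square-integrable approximants are truncated.\<close>

lemma is_ito_integralI:
 fixes Z I :: "real => 'a => 'b::euclidean_space"
 assumes T: "0 < T" and d: "!!n. sq_data (N n) (\<tau> n) (\<eta> n)" and \<tau>T: "!!n. \<tau> n (N n) <= T"
  and Z: "Z \<in> L2_prog M F T" and I: "!!t. t \<in> {0..T} ==> I t \<in> borel_measurable (F t)" "!!t. t \<in> {0..T} ==> sq_int M (I t)"
  and cont: "AE w in M. continuous_on {0..T} (%t. I t w)"
  and li: "!!t. t \<in> {0..T} ==> (%n. l2 M (%w. simple_integral W (N n) (\<tau> n) (\<eta> n) t w - I t w)) \<longlonglongrightarrow> 0"
  and lp: "(%n. l2 (lborel \<Otimes>\<^sub>M M) (%x. cut 0 T (simple_proc (N n) (\<tau> n) (\<eta> n)) x - cut 0 T Z x)) \<longlonglongrightarrow> 0"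
 shows "is_ito_integral M F W T Z I"
proof -
 let ?P = "lborel \<Otimes>\<^sub>M M"
 have sq: "sq_int M (\<eta> n k)" "\<eta> n k \<in> borel_measurable (F (\<tau> n k))" if "k < N n" for n k
  using d that by (auto simp: sq_data_def)
 \<comment> \<open>Each level has finitely many coefficients, so one truncation bound serves them
   all with error \<open>(1 / 2) ^ n\<close>.\<close>
 have "\<exists>R. \<forall>k<N n. l2 M (%w. (if norm (\<eta> n k w) <= real R then \<eta> n k w else 0) - \<eta> n k w) <= (1 / 2) ^ n" for n
 proof -
  have "\<forall>\<^sub>F R in sequentially. \<forall>k\<in>{..<N n}. l2 M (%w. (if norm (\<eta> n k w) <= real R then \<eta> n k w else 0) - \<eta> n k w) <= (1 / 2) ^ n"
  proof (rule eventually_ball_finite, simp, rule ballI)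
   fix k assume "k \<in> {..<N n}"
   then have "(%R. l2 M (%w. (if norm (\<eta> n k w) <= real R then \<eta> n k w else 0) - \<eta> n k w)) \<longlonglongrightarrow> 0"
    by (intro l2_truncate sq) simp
   from order_tendstoD(2)[OF this, of "(1 / 2) ^ n"]
   show "\<forall>\<^sub>F R in sequentially. l2 M (%w. (if norm (\<eta> n k w) <= real R then \<eta> n k w else 0) - \<eta> n k w) <= (1 / 2) ^ n"
    by (auto elim: eventually_mono)
  qed
  then show ?thesis by (auto simp: eventually_sequentially)
 qed
 then obtain R where R: "!!n k. k < N n ==> l2 M (%w. (if norm (\<eta> n k w) <= real (R n) then \<eta> n k w else 0) - \<eta> n k w) <= (1 / 2) ^ n"
  by metis
 define \<theta> where "\<theta> n k w = (if norm (\<eta> n k w) <= real (R n) then \<eta> n k w else 0)" for n k w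
 define \<delta> where "\<delta> n k w = \<theta> n k w - \<eta> n k w" for n k w
 have \<theta>m: "\<theta> n k \<in> borel_measurable (F (\<tau> n k))" if "k < N n" for n k
 proof -
  have [measurable]: "\<eta> n k \<in> borel_measurable (F (\<tau> n k))" by (rule sq[OF that])
  show ?thesis unfolding \<theta>_def by measurable
 qed
 have \<theta>d: "simple_data F T (N n) (\<tau> n) (\<theta> n)" for n
  unfolding simple_data_def
 proof (intro conjI)
  show "0 <= \<tau> n 0" "\<forall>k<N n. \<tau> n k <= \<tau> n (Suc k)" using d[of n] by (auto simp: sq_data_def)
  show "\<exists>c. \<forall>k<N n. \<forall>w\<in>space (F (\<tau> n k)). norm (\<theta> n k w) <= c"
   by (intro exI[of _ "real (R n)"]) (simp add: \<theta>_def)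
 qed (use \<tau>T \<theta>m in auto)
 note \<theta>s = simple_data_sq_data[OF \<theta>d]
 have \<delta>d: "sq_data (N n) (\<tau> n) (\<delta> n)" for n
 proof -
  have "sq_int M (\<delta> n k)" "\<delta> n k \<in> borel_measurable (F (\<tau> n k))" if k: "k < N n" for k
  proof -
   have "sq_int M (\<theta> n k)" using \<theta>s[of n] k by (simp add: sq_data_def)
   from sq_int_diff[OF this sq(1)[OF k]] show "sq_int M (\<delta> n k)" by (simp add: \<delta>_def[abs_def])
   show "\<delta> n k \<in> borel_measurable (F (\<tau> n k))"
    unfolding \<delta>_def using \<theta>m[OF k] sq(2)[OF k] by (rule borel_measurable_diff)
  qed
  then show ?thesis using d[of n] by (simp add: sq_data_def)
 qed
 \<comment> \<open>The isometry sum of the truncation errors, with interval lengths telescoping to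
   at most \<open>T\<close>; it controls the integrals as well as the processes.\<close>
 have sum_le: "(\<Sum>k<N n. (clamp_time 0 t (\<tau> n (Suc k)) - clamp_time 0 t (\<tau> n k)) * (l2 M (\<delta> n k))^2) <= (sqrt T * (1 / 2) ^ n)^2"
  if t: "0 <= t" "t <= T" for n t
 proof -
  let ?c = "%k. clamp_time 0 t (\<tau> n k)"
  have "(\<Sum>k<N n. (?c (Suc k) - ?c k) * (l2 M (\<delta> n k))^2) <= (\<Sum>k<N n. (?c (Suc k) - ?c k) * ((1 / 2) ^ n)^2)"
   using clamp_step(2)[OF \<delta>d order_refl t(1), of _ n] R by (intro sum_mono mult_left_mono power_mono) (auto simp: \<delta>_def[abs_def] \<theta>_def)
  also have "\<dots> = (?c (N n) - ?c 0) * ((1 / 2) ^ n)^2"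
   by (simp only: sum_distrib_right[symmetric] sum_lessThan_telescope[of ?c "N n"])
  also have "\<dots> <= T * ((1 / 2) ^ n)^2"
   using clamp_time_range(2)[OF t(1), of "\<tau> n (N n)"] clamp_time_range(1)[OF t(1), of "\<tau> n 0"] t by (intro mult_right_mono) auto
  finally show ?thesis using T by (simp add: power_mult_distrib)
 qed
 have n0: "0 <= sqrt T * (1 / 2) ^ n" for n using T by simp
 have \<delta>0: "(%n. sqrt T * (1 / 2) ^ n) \<longlonglongrightarrow> 0" by (rule tendsto_mult_right_zero) (rule LIMSEQ_realpow_zero, simp_all)
 have sim: "sq_int M (simple_integral W (N n) (\<tau> n) \<xi> t)" if "sq_data (N n) (\<tau> n) \<xi>" "t \<in> {0..T}" for n \<xi> t
  using simple_integral_props(1)[OF that(1)] that(2) by simp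
 have l1: "(%n. l2 M (%w. simple_integral W (N n) (\<tau> n) (\<theta> n) t w - I t w)) \<longlonglongrightarrow> 0" if t: "t \<in> {0..T}" for t
 proof (rule tendsto_sandwich[OF _ _ tendsto_const])
  show "(%n. sqrt T * (1 / 2) ^ n + l2 M (%w. simple_integral W (N n) (\<tau> n) (\<eta> n) t w - I t w)) \<longlonglongrightarrow> 0"
   using tendsto_add[OF \<delta>0 li[OF t]] by simp
  have "l2 M (%w. simple_integral W (N n) (\<tau> n) (\<theta> n) t w - I t w) <=
    sqrt T * (1 / 2) ^ n + l2 M (%w. simple_integral W (N n) (\<tau> n) (\<eta> n) t w - I t w)" for n
  proof -
   have t': "0 <= t" "t <= T" using t by auto
   have "l2 M (simple_integral W (N n) (\<tau> n) (\<delta> n) t) <= sqrt T * (1 / 2) ^ n"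
    by (rule power2_le_imp_le[OF _ n0])
     (use sum_le[OF t', of n] simple_increment(4)[OF \<delta>d order_refl t'(1), of n] in \<open>simp add: simple_integral_0[OF \<delta>d]\<close>)
   moreover have "simple_integral W (N n) (\<tau> n) (\<delta> n) t =
     (%w. simple_integral W (N n) (\<tau> n) (\<theta> n) t w - simple_integral W (N n) (\<tau> n) (\<eta> n) t w)"
    unfolding \<delta>_def[abs_def] by (rule ext) (rule simple_integral_diff)
   ultimately show ?thesis
    using l2_triangle[OF sim[OF \<theta>s t] sim[OF d t] I(2)[OF t], of n n] by simp
  qed
  then show "\<forall>\<^sub>F n in sequentially. l2 M (%w. simple_integral W (N n) (\<tau> n) (\<theta> n) t w - I t w) <=
    sqrt T * (1 / 2) ^ n + l2 M (%w. simple_integral W (N n) (\<tau> n) (\<eta> n) t w - I t w)" by simp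
 qed simp
 have Zp: "l2proc M T Z" by (rule L2_prog_l2proc[OF Z subalg_F])
 have cs: "sq_int ?P (cut 0 T (simple_proc (N n) (\<tau> n) \<xi>))" if "sq_data (N n) (\<tau> n) \<xi>" for n \<xi>
  by (rule cut_simple_integral_sq(1)[OF that order_refl]) (use T in simp)
 have cZ: "sq_int ?P (cut 0 T Z)" using Zp by (simp add: l2proc_def)
 have l2: "(%n. l2 ?P (%x. cut 0 T (simple_proc (N n) (\<tau> n) (\<theta> n)) x - cut 0 T Z x)) \<longlonglongrightarrow> 0"
 proof (rule tendsto_sandwich[OF _ _ tendsto_const])
  show "(%n. sqrt T * (1 / 2) ^ n + l2 ?P (%x. cut 0 T (simple_proc (N n) (\<tau> n) (\<eta> n)) x - cut 0 T Z x)) \<longlonglongrightarrow> 0"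
   using tendsto_add[OF \<delta>0 lp] by simp
  have "l2 ?P (%x. cut 0 T (simple_proc (N n) (\<tau> n) (\<theta> n)) x - cut 0 T Z x) <=
    sqrt T * (1 / 2) ^ n + l2 ?P (%x. cut 0 T (simple_proc (N n) (\<tau> n) (\<eta> n)) x - cut 0 T Z x)" for n
  proof -
   have "l2 ?P (cut 0 T (simple_proc (N n) (\<tau> n) (\<delta> n))) <= sqrt T * (1 / 2) ^ n"
    by (rule power2_le_imp_le[OF _ n0])
     (use sum_le[OF less_imp_le[OF T] order_refl, of n] cut_simple_integral_sq(2)[OF \<delta>d order_refl less_imp_le[OF T], of n] in \<open>simp add: l2_sq\<close>)
   moreover have "cut 0 T (simple_proc (N n) (\<tau> n) (\<delta> n)) =
     (%x. cut 0 T (simple_proc (N n) (\<tau> n) (\<theta> n)) x - cut 0 T (simple_proc (N n) (\<tau> n) (\<eta> n)) x)"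
   proof -
    have "simple_proc (N n) (\<tau> n) (\<delta> n) s w = simple_proc (N n) (\<tau> n) (\<theta> n) s w - simple_proc (N n) (\<tau> n) (\<eta> n) s w" for s w
     unfolding \<delta>_def[abs_def] by (rule simple_proc_diff)
    then show ?thesis by (simp add: fun_eq_iff cut_def scaleR_diff_right)
   qed
   ultimately have "l2 ?P (%x. cut 0 T (simple_proc (N n) (\<tau> n) (\<theta> n)) x - cut 0 T (simple_proc (N n) (\<tau> n) (\<eta> n)) x) <= sqrt T * (1 / 2) ^ n"
    by simp
   then show ?thesis
    using l2_triangle[OF cs[OF \<theta>s] cs[OF d] cZ, of n n] by simp
  qed
  then show "\<forall>\<^sub>F n in sequentially. l2 ?P (%x. cut 0 T (simple_proc (N n) (\<tau> n) (\<theta> n)) x - cut 0 T Z x) <=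
    sqrt T * (1 / 2) ^ n + l2 ?P (%x. cut 0 T (simple_proc (N n) (\<tau> n) (\<eta> n)) x - cut 0 T Z x)" by simp
 qed simp
 have "(%n. energy M {0..T} (%s w. simple_proc (N n) (\<tau> n) (\<theta> n) s w - Z s w)) \<longlonglongrightarrow> 0"
 proof -
  have e: "energy M {0..T} (%s w. simple_proc (N n) (\<tau> n) (\<theta> n) s w - Z s w) =
    ennreal ((l2 ?P (%x. cut 0 T (simple_proc (N n) (\<tau> n) (\<theta> n)) x - cut 0 T Z x))^2)" for n
   using energy_l2proc[OF l2proc_diff[OF _ Zp], of "simple_proc (N n) (\<tau> n) (\<theta> n)"] cs[OF \<theta>s, of n]
   by (simp add: l2proc_def cut_diff)
  have "(%n. ennreal ((l2 ?P (%x. cut 0 T (simple_proc (N n) (\<tau> n) (\<theta> n)) x - cut 0 T Z x))^2)) \<longlonglongrightarrow> ennreal 0"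
   using l2 by (intro tendsto_ennrealI) (simp add: tendsto_0_power2_iff)
  then show ?thesis by (simp add: e)
 qed
 moreover have "(%n. \<integral>\<^sup>+w. ennreal ((norm (simple_integral W (N n) (\<tau> n) (\<theta> n) t w - I t w))^2) \<partial>M) \<longlonglongrightarrow> 0"
  if t: "t \<in> {0..T}" for t
  using l1[OF t] l2_tendsto_0_iff_nn[of M "%n w. simple_integral W (N n) (\<tau> n) (\<theta> n) t w - I t w"]
   sq_int_diff[OF sim[OF \<theta>s t] I(2)[OF t]] by blast
 ultimately show ?thesis
  unfolding is_ito_integral_def using Z I(1) cont \<theta>d by blast
qed

end

section \<open>The limit of the scheme as a solution of the equation\<close>

context euler_scheme
begin

definition lim_SI :: "(real => 'a => real) => ('b => 'b) => real => 'a => 'b" where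
 "lim_SI V f t w = (if good w then lim (%n. SI V f n t w) else 0)"

definition sol :: "real => 'a => 'b" where
 "sol t w = (if good w then x0 w + lim_SI clock fa t w + lim_SI W fc t w + lim_SI W0 fg t w else 0)"

lemma SI_cont:
 assumes "continuous_on {0..} (%t. V t w)"
 shows "continuous_on {0..T} (%t. SI V f n t w)"
 unfolding SI_def
 by (rule continuous_on_subset[OF continuous_on_simple_integral[where V = V, OF assms tm_nonneg]]) auto

lemma good_uniform:
 assumes "good w"
 shows "uniform_limit {0..T} (%n t. SI clock fa n t w) (%t. lim_SI clock fa t w) sequentially" (is ?g1)
  "uniform_limit {0..T} (%n t. SI W fc n t w) (%t. lim_SI W fc t w) sequentially" (is ?g2)
  "uniform_limit {0..T} (%n t. SI W0 fg n t w) (%t. lim_SI W0 fg t w) sequentially" (is ?g3)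
  "uniform_limit {0..T} (%n t. epath n t w) (%t. sol t w) sequentially" (is ?g4)
proof -
 obtain n0 where n0: "!!n t. n0 <= n ==> t \<in> {0..T} ==> norm (SI clock fa (Suc n) t w - SI clock fa n t w) <= (3 / 4) ^ n \<and>
   norm (SI W fc (Suc n) t w - SI W fc n t w) <= (3 / 4) ^ n \<and> norm (SI W0 fg (Suc n) t w - SI W0 fg n t w) <= (3 / 4) ^ n"
  using assms unfolding good_def by blast
 show a: ?g1
  using uniform_limit_geometric[of n0 "{0..T}" "%n t. SI clock fa n t w"] n0 assms by (simp add: lim_SI_def)
 show b: ?g2
  using uniform_limit_geometric[of n0 "{0..T}" "%n t. SI W fc n t w"] n0 assms by (simp add: lim_SI_def)
 show c: ?g3
  using uniform_limit_geometric[of n0 "{0..T}" "%n t. SI W0 fg n t w"] n0 assms by (simp add: lim_SI_def)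
 show ?g4
  using uniform_limit_add[OF uniform_limit_add[OF uniform_limit_add[OF uniform_limit_const[where c = "%_. x0 w"] a] b] c] assms
  by (simp add: epath_def sol_def)
qed

lemma lim_SI_cont: "continuous_on {0..T} (%t. lim_SI W fc t w)" "continuous_on {0..T} (%t. lim_SI W0 fg t w)"
 and sol_cont: "continuous_on {0..T} (%t. sol t w)"
proof -
 have "continuous_on {0..T} (%t. lim_SI clock fa t w) \<and> continuous_on {0..T} (%t. lim_SI W fc t w) \<and> continuous_on {0..T} (%t. lim_SI W0 fg t w)"
 proof (cases "good w")
  case True
  then have c: "continuous_on {0..} (%t. W t w)" "continuous_on {0..} (%t. W0 t w)" by (auto simp: good_def)
  note u = good_uniform[OF True]
  show ?thesis
   by (intro conjI uniform_limit_theorem[OF always_eventually u(1)] uniform_limit_theorem[OF always_eventually u(2)]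
     uniform_limit_theorem[OF always_eventually u(3)] allI SI_cont c continuous_on_id) simp_all
 qed (simp add: lim_SI_def)
 then show "continuous_on {0..T} (%t. lim_SI W fc t w)" "continuous_on {0..T} (%t. lim_SI W0 fg t w)"
  "continuous_on {0..T} (%t. sol t w)"
  by (cases "good w"; auto simp: sol_def intro!: continuous_intros)+
qed

lemma good_lim:
 assumes "good w" "t \<in> {0..T}"
 shows "(%n. SI clock fa n t w) \<longlonglongrightarrow> lim_SI clock fa t w" "(%n. SI W fc n t w) \<longlonglongrightarrow> lim_SI W fc t w"
  "(%n. SI W0 fg n t w) \<longlonglongrightarrow> lim_SI W0 fg t w" "(%n. epath n t w) \<longlonglongrightarrow> sol t w"
 using good_uniform[OF assms(1)] assms(2) by (auto intro: tendsto_uniform_limitI)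

lemma W0_swap_data: "sq_lip \<kappa> f ==> sq_int M (SI W0 f n t) \<and> SI W0 f n t \<in> borel_measurable (F t)" if "0 <= t"
proof -
 interpret sw: mean_field_basis M F0 W0 W by (rule swap)
 assume f: "sq_lip \<kappa> f"
 show "sq_int M (SI W0 f n t) \<and> SI W0 f n t \<in> borel_measurable (F t)"
  using sw.simple_integral_props[OF W0_data(2)[OF f] that, unfolded swF] by (simp add: SI_def)
qed

lemma SI_props:
 assumes f: "sq_lip \<kappa> f" and t: "0 <= t"
 shows "sq_int M (SI W f n t)" "SI W f n t \<in> borel_measurable (F t)"
  "sq_int M (SI W0 f n t)" "SI W0 f n t \<in> borel_measurable (F t)"
  "sq_int M (SI clock f n t)" (is ?g5) "SI clock f n t \<in> borel_measurable (F t)" (is ?g6)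
proof -
 show "sq_int M (SI W f n t)" "SI W f n t \<in> borel_measurable (F t)"
  using simple_integral_props[OF node_data[OF f] t] by (simp_all add: SI_def)
 show "sq_int M (SI W0 f n t)" "SI W0 f n t \<in> borel_measurable (F t)"
  using W0_swap_data[OF t f] by auto
 show ?g5
  unfolding SI_def simple_integral_def by (intro sq_int_sum sq_int_scaleR sq_lip_sq_int(1)[OF f \<kappa>] node_sq)
 have "(%w. (min t (tm n (Suc k)) - min t (tm n k)) *\<^sub>R f (node n k w)) \<in> borel_measurable (F t)" for k
 proof (cases "tm n k <= t")
  case True
  then show ?thesis using sq_lip_meas[OF f \<kappa> meas_F_mono[OF node_F True]] by measurable
 next
  case False
  then have "min t (tm n (Suc k)) - min t (tm n k) = 0" using tm_mono[of k "Suc k" n] by auto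
  then show ?thesis by simp
 qed
 then show ?g6
  unfolding SI_def simple_integral_def by (intro borel_measurable_sum)
qed

lemma epath_props:
 assumes t: "0 <= t"
 shows "sq_int M (epath n t)" (is ?g1) "epath n t \<in> borel_measurable (F t)" (is ?g2)
proof -
 have x0t: "x0 \<in> borel_measurable (F t)" by (rule meas_F_mono[OF x0(2) t])
 note p = SI_props[OF lip(1) t] SI_props[OF lip(2) t] SI_props[OF lip(3) t]
 show ?g1 unfolding epath_def by (intro sq_int_add x0(1) p)
 show ?g2 unfolding epath_def by (intro borel_measurable_add x0t p)
qed

text \<open>\<open>good\<close> refers to the whole interval \<open>{0..T}\<close> and is not
  visibly known at time \<open>t\<close>. It fails only on a null set, though, and these belong to
  the filtration, so almost sure limits of adapted approximants are adapted.\<close>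

lemma lim_SI_F:
 assumes t: "t \<in> {0..T}"
 shows "lim_SI W fc t \<in> borel_measurable (F t)" (is ?g1) "lim_SI W0 fg t \<in> borel_measurable (F t)" (is ?g2) "sol t \<in> borel_measurable (F t)" (is ?g3)
proof -
 have t0: "0 <= t" using t by simp
 show ?g1
  by (rule measurable_AE_limit_complete[OF complete subalg_F null_le_F SI_props(2)[OF lip(2) t0]])
   (use good_AE in eventually_elim, rule good_lim(2)[OF _ t])
 show ?g2
  by (rule measurable_AE_limit_complete[OF complete subalg_F null_le_F SI_props(4)[OF lip(3) t0]])
   (use good_AE in eventually_elim, rule good_lim(3)[OF _ t])
 show ?g3
  by (rule measurable_AE_limit_complete[OF complete subalg_F null_le_F epath_props(2)[OF t0]])
   (use good_AE in eventually_elim, rule good_lim(4)[OF _ t])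
qed

lemma clock_dn_le:
 assumes f: "sq_lip \<kappa> f" and t: "t \<in> {0..T}"
 shows "l2 M (simple_integral clock (4 ^ Suc n) (tm (Suc n)) (dn f n) t) <= K7 * (1 / 2) ^ n"
proof -
 let ?c = "%k. min t (tm (Suc n) k)"
 have c: "0 <= ?c (Suc k) - ?c k" for k using tm_mono[of k "Suc k" "Suc n"] by auto
 have s: "sq_int M (dn f n k)" if "k < 4 ^ Suc n" for k using dn_props(1)[OF f, of k n] that by simp
 have "l2 M (simple_integral clock (4 ^ Suc n) (tm (Suc n)) (dn f n) t) <=
   (\<Sum>k<4 ^ Suc n. l2 M (%w. (?c (Suc k) - ?c k) *\<^sub>R dn f n k w))"
  unfolding simple_integral_def by (intro l2_sum_le sq_int_scaleR s) simp
 also have "\<dots> <= (\<Sum>k<4 ^ Suc n. (?c (Suc k) - ?c k) * (sqrt \<kappa> * K6 * (1 / 2) ^ n))"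
  unfolding l2_scaleR using c dn_props(3)[OF f, of _ n]
  by (intro sum_mono) (simp only: abs_of_nonneg mult_left_mono lessThan_iff less_imp_le)
 also have "\<dots> = (?c (4 ^ Suc n) - ?c 0) * (sqrt \<kappa> * K6 * (1 / 2) ^ n)"
  by (simp only: sum_distrib_right[symmetric] sum_lessThan_telescope[of ?c "4 ^ Suc n"])
 also have "\<dots> <= (1 + T) * (sqrt \<kappa> * K6 * (1 / 2) ^ n)"
  using t T \<kappa> K_nonneg tm_simps(2)[of "Suc n"] by (intro mult_right_mono) (auto simp: tm_simps(1) K6_def)
 finally show ?thesis by (simp add: K7_def mult_ac)
qed

text \<open>Pathwise limits meet the geometric \<open>l2\<close>-rate in
  \<open>l2_geometric_limit\<close>; for \<open>epath\<close> the rates of the drift and of the two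
  noise integrals add to \<open>3 * K7\<close>.\<close>

lemma SI_limits:
 assumes t: "t \<in> {0..T}"
 shows "sq_int M (lim_SI W fc t)" "(%n. l2 M (%w. SI W fc n t w - lim_SI W fc t w)) \<longlonglongrightarrow> 0"
  "sq_int M (lim_SI W0 fg t)" "(%n. l2 M (%w. SI W0 fg n t w - lim_SI W0 fg t w)) \<longlonglongrightarrow> 0"
  "sq_int M (sol t)" "(%n. l2 M (%w. epath n t w - sol t w)) \<longlonglongrightarrow> 0"
proof -
 have t': "0 <= t" "t <= T" using t by auto
 have lw: "l2 M (%w. SI W fc (Suc n) t w - SI W fc n t w) <= K7 * (1 / 2) ^ n" for n
  unfolding SI_diff by (rule cut_dn_le(1)[OF lip(2) t'])
 have lw0: "l2 M (%w. SI W0 fg (Suc n) t w - SI W0 fg n t w) <= K7 * (1 / 2) ^ n" for n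
  unfolding SI_diff by (rule cut_dn_le_W0[OF lip(3) t'])
 have lc: "l2 M (%w. SI clock fa (Suc n) t w - SI clock fa n t w) <= K7 * (1 / 2) ^ n" for n
  unfolding SI_diff by (rule clock_dn_le[OF lip(1) t])
 note p = SI_props[OF lip(1) t'(1)] SI_props[OF lip(2) t'(1)] SI_props[OF lip(3) t'(1)]
 have le: "l2 M (%w. epath (Suc n) t w - epath n t w) <= (3 * K7) * (1 / 2) ^ n" for n
 proof -
  have "epath (Suc n) t w - epath n t w = (SI clock fa (Suc n) t w - SI clock fa n t w) +
    (SI W fc (Suc n) t w - SI W fc n t w) + (SI W0 fg (Suc n) t w - SI W0 fg n t w)" for w
   by (simp add: epath_def)
  then show ?thesis
   using l2_add_le[OF sq_int_add[OF sq_int_diff[OF p(5) p(5), of "Suc n" n] sq_int_diff[OF p(7) p(7), of "Suc n" n]] sq_int_diff[OF p(15) p(15), of "Suc n" n]]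
    l2_add_le[OF sq_int_diff[OF p(5) p(5), of "Suc n" n] sq_int_diff[OF p(7) p(7), of "Suc n" n]] lw[of n] lw0[of n] lc[of n]
   by simp
 qed
 have ae: "AE w in M. (%n. SI W fc n t w) \<longlonglongrightarrow> lim_SI W fc t w" "AE w in M. (%n. SI W0 fg n t w) \<longlonglongrightarrow> lim_SI W0 fg t w"
  "AE w in M. (%n. epath n t w) \<longlonglongrightarrow> sol t w"
  using good_AE good_lim[OF _ t] by (auto elim: eventually_mono)
 have m: "lim_SI W fc t \<in> borel_measurable M" "lim_SI W0 fg t \<in> borel_measurable M" "sol t \<in> borel_measurable M"
  using lim_SI_F[OF t] by (auto intro: meas_F_M)
 have K3': "0 <= 3 * K7" using K7_nonneg by simp
 show "sq_int M (lim_SI W fc t)" "(%n. l2 M (%w. SI W fc n t w - lim_SI W fc t w)) \<longlonglongrightarrow> 0"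
  using l2_geometric_limit[OF p(7) m(1) ae(1) lw K7_nonneg] by blast+
 show "sq_int M (lim_SI W0 fg t)" "(%n. l2 M (%w. SI W0 fg n t w - lim_SI W0 fg t w)) \<longlonglongrightarrow> 0"
  using l2_geometric_limit[OF p(15) m(2) ae(2) lw0 K7_nonneg] by blast+
 show "sq_int M (sol t)" "(%n. l2 M (%w. epath n t w - sol t w)) \<longlonglongrightarrow> 0"
  using l2_geometric_limit[OF epath_props(1)[OF t'(1)] m(3) ae(3) le K3'] by blast+
qed

lemma simple_proc_node:
 assumes s: "s \<in> {0<..T}"
 obtains k where "k < 4 ^ n" "tm n k <= s" "s - tm n k <= T / 4 ^ n"
  "!!f w. simple_proc (4 ^ n) (tm n) (%k w. f (node n k w)) s w = (f (epath n (tm n k) w) :: 'b)"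
proof -
 \<comment> \<open>The intervals of a simple process are open on the left, so \<open>s\<close>
   belongs to the one that ends at the first node not before \<open>s\<close>; its index is the
   predecessor of \<open>m\<close>.\<close>
 define m where "m = (LEAST m. s <= tm n m)"
 have ex: "s <= tm n (4 ^ n)" using s by (simp add: tm_simps)
 have m1: "s <= tm n m" unfolding m_def using ex by (rule LeastI)
 have m2: "m <= 4 ^ n" unfolding m_def using ex by (rule Least_le)
 have "m \<noteq> 0"
 proof
  assume "m = 0"
  with m1 s show False by (simp add: tm_simps)
 qed
 then obtain k where k: "m = Suc k" using not0_implies_Suc by blast
 have k1: "tm n k < s" using not_less_Least[of k "%m. s <= tm n m"] k unfolding m_def by (metis lessI not_le)
 have kl: "k < 4 ^ n" using m2 k by simp
 have ind: "indicator {tm n i<..tm n (Suc i)} s = (if i = k then 1 else (0::real))" for i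
 proof (cases "i < k")
  case True
  then show ?thesis using tm_mono[of "Suc i" k n] k1 by (auto simp: indicator_def)
 next
  case False
  then show ?thesis using tm_mono[of "Suc k" i n] k1 m1 k by (cases "i = k") (auto simp: indicator_def)
 qed
 have "simple_proc (4 ^ n) (tm n) (%k w. f (node n k w)) s w = (f (epath n (tm n k) w) :: 'b)" for f w
 proof -
  have "simple_proc (4 ^ n) (tm n) (%k w. f (node n k w)) s w = (\<Sum>i<4 ^ n. if i = k then f (node n i w) else 0)"
   unfolding simple_proc_def ind by (intro sum.cong) auto
  then show ?thesis using kl by (simp add: epath_node[OF less_imp_le[OF kl]])
 qed
 moreover have "s - tm n k <= T / 4 ^ n" using m1 k tm_simps(4)[of n k] by simp
 ultimately show ?thesis using that kl k1 by (meson less_imp_le)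
qed

text \<open>At \<open>s\<close> the step process is \<open>f\<close> of the interpolation at a node
  just left of \<open>s\<close>. Uniform convergence of the interpolations and uniform continuity of
  the limit path contribute \<open>d\<close> each, and \<open>d\<close> is fitted to the Lipschitz
  constant.\<close>

lemma step_uniform:
 assumes f: "sq_lip \<kappa> f" and g: "good w"
 shows "uniform_limit {0<..T} (%n s. simple_proc (4 ^ n) (tm n) (%k w. f (node n k w)) s w) (%s. f (sol s w)) sequentially"
proof (rule uniform_limitI)
 fix e :: real assume e: "0 < e"
 define c where "c = sqrt \<kappa> + 1"
 have c: "0 < c" "!!x y. norm (f x - f y) <= c * norm (x - y)"
 proof -
  show "0 < c" using real_sqrt_ge_zero[OF \<kappa>] unfolding c_def by linarith
  fix x y show "norm (f x - f y) <= c * norm (x - y)"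
   using sq_lip_norm[OF f \<kappa>, of x y] by (simp add: c_def distrib_right add_increasing2)
 qed
 define d where "d = e / (2 * c)"
 have d: "0 < d" using e c by (simp add: d_def)
 have "uniformly_continuous_on {0..T} (%t. sol t w)" by (rule compact_uniformly_continuous[OF sol_cont]) simp
 then obtain \<delta> where \<delta>: "0 < \<delta>" "!!x y. x \<in> {0..T} ==> y \<in> {0..T} ==> dist y x < \<delta> ==> dist (sol y w) (sol x w) < d"
  using d unfolding uniformly_continuous_on_def by metis
 have "(%n. T * (1 / 4 :: real) ^ n) \<longlonglongrightarrow> 0" by (rule tendsto_mult_right_zero) (rule LIMSEQ_realpow_zero, simp_all)
 then have h: "\<forall>\<^sub>F n in sequentially. T / 4 ^ n < \<delta>"
  using order_tendstoD(2)[of "%n. T * (1 / 4 :: real) ^ n" 0 sequentially \<delta>] \<delta>(1) by (simp add: power_one_over)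
 have u: "\<forall>\<^sub>F n in sequentially. \<forall>t\<in>{0..T}. dist (epath n t w) (sol t w) < d"
  by (rule uniform_limitD[OF good_uniform(4)[OF g] d])
 show "\<forall>\<^sub>F n in sequentially. \<forall>s\<in>{0<..T}. dist (simple_proc (4 ^ n) (tm n) (%k w. f (node n k w)) s w) (f (sol s w)) < e"
  using h u
 proof eventually_elim
  case (elim n)
  show ?case
  proof
   fix s assume s: "s \<in> {0<..T}"
   obtain k where k: "k < 4 ^ n" "tm n k <= s" "s - tm n k <= T / 4 ^ n"
    "!!f w. simple_proc (4 ^ n) (tm n) (%k w. f (node n k w)) s w = (f (epath n (tm n k) w) :: 'b)"
    using simple_proc_node[OF s, of n] by metis
   have tk: "tm n k \<in> {0..T}" using tm_nonneg[of n k] k(2) s by simp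
   have "dist (epath n (tm n k) w) (sol (tm n k) w) < d" using elim(2) tk by blast
   moreover have "dist (sol (tm n k) w) (sol s w) < d"
    using \<delta>(2)[of s "tm n k"] tk s k(2,3) elim(1) by (simp add: dist_real_def)
   ultimately have "norm (epath n (tm n k) w - sol s w) < 2 * d"
    using dist_triangle[of "epath n (tm n k) w" "sol s w" "sol (tm n k) w"] by (simp add: dist_norm)
   then have "c * norm (epath n (tm n k) w - sol s w) < c * (2 * d)" using c(1) by simp
   also have "c * (2 * d) = e" using c(1) by (simp add: d_def)
   finally show "dist (simple_proc (4 ^ n) (tm n) (%k w. f (node n k w)) s w) (f (sol s w)) < e"
    using c(2)[of "epath n (tm n k) w" "sol s w"] by (simp add: k(4) dist_norm)
  qed
 qed
qed

lemma sol_progressive: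
 assumes f: "sq_lip \<kappa> f"
 shows "progressive F T (%t w. f (sol t w))"
proof (rule progressive_continuous)
 fix s t :: real assume st: "0 <= s" "s <= t" "t <= T"
 show "(%w. f (sol s w)) \<in> borel_measurable (F t)"
  by (rule sq_lip_meas[OF f \<kappa> meas_F_mono[OF lim_SI_F(3) st(2)]]) (use st in auto)
next
 fix w
 show "continuous_on {0..T} (%t. f (sol t w))"
  by (rule continuous_on_compose2[OF sq_lip_continuous[OF f \<kappa>, of UNIV] sol_cont]) simp
qed

lemma AE_pair_snd:
 assumes "AE w in M. Q w"
 shows "AE x in (lborel :: real measure) \<Otimes>\<^sub>M M. Q (snd x)"
proof -
 obtain N where N: "!!w. w \<in> space M - N ==> Q w" "N \<in> null_sets M" using AE_E3[OF assms] by metis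
 have "emeasure (lborel \<Otimes>\<^sub>M M) ((UNIV :: real set) \<times> N) = emeasure (lborel :: real measure) UNIV * emeasure M N"
  by (rule sigma_finite_measure.emeasure_pair_measure_Times[OF sigma_finite_measure_axioms]) (use N(2) in auto)
 then have "(UNIV :: real set) \<times> N \<in> null_sets (lborel \<Otimes>\<^sub>M M)" using N(2) by (auto simp: null_sets_def)
 then show ?thesis
  by (rule AE_I') (use N(1) in \<open>fastforce simp: space_pair_measure\<close>)
qed

lemma step_l2:
 assumes f: "sq_lip \<kappa> f"
 shows "l2proc M T (%t w. f (sol t w))" (is ?g1)
  "(%n. l2 (lborel \<Otimes>\<^sub>M M) (%x. cut 0 T (simple_proc (4 ^ n) (tm n) (%k w. f (node n k w))) x - cut 0 T (%t w. f (sol t w)) x)) \<longlonglongrightarrow> 0"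
  "(%t w. f (sol t w)) \<in> L2_prog M F T" (is ?g3)
proof -
 let ?P = "lborel \<Otimes>\<^sub>M M"
 let ?g = "%n. cut 0 T (simple_proc (4 ^ n) (tm n) (%k w. f (node n k w)))"
 have T0: "0 <= T" using T by simp
 have gs: "sq_int ?P (?g n)" for n by (rule cut_simple_integral_sq(1)[OF node_data[OF f] order_refl T0])
 have m: "cut 0 T (%t w. f (sol t w)) \<in> borel_measurable ?P"
  by (rule progressive_cut[OF sol_progressive[OF f] subalg_F]) auto
 have ae: "AE x in ?P. (%n. ?g n x) \<longlonglongrightarrow> cut 0 T (%t w. f (sol t w)) x"
  using AE_pair_snd[OF good_AE]
 proof eventually_elim
  case (elim x)
  show ?case
  proof (cases "fst x \<in> {0<..T}")
   case True
   from tendsto_uniform_limitI[OF step_uniform[OF f elim] True] True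
   show ?thesis by (simp add: cut_def case_prod_beta')
  qed (simp add: cut_def case_prod_beta')
 qed
 have l: "l2 ?P (%x. ?g (Suc n) x - ?g n x) <= K7 * (1 / 2) ^ n" for n
 proof -
  \<comment> \<open>A simple process evaluated at \<open>s\<close> is a simple integral against the
    unit jump at \<open>s\<close>; in this way \<open>SI_diff\<close> also compares the processes of
    two levels.\<close>
  have "simple_proc (4 ^ m) (tm m) \<eta> s w = simple_integral (%t _. indicator {s..} t) (4 ^ m) (tm m) \<eta> T w" for m s w and \<eta> :: "nat => 'a => 'b"
   unfolding simple_proc_def simple_integral_def
  proof (rule sum.cong[OF refl])
   fix k assume "k \<in> {..<4 ^ m :: nat}"
   then have "tm m k <= T" "tm m (Suc k) <= T" "tm m k <= tm m (Suc k)"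
    using tm_le[of k m] tm_le[of "Suc k" m] tm_mono[of k "Suc k" m] by auto
   then have "(indicator {tm m k<..tm m (Suc k)} s :: real) = indicator {s..} (min T (tm m (Suc k))) - indicator {s..} (min T (tm m k))"
    by (auto simp: indicator_def min_def)
   then show "indicator {tm m k<..tm m (Suc k)} s *\<^sub>R \<eta> k w =
     (indicator {s..} (min T (tm m (Suc k))) - indicator {s..} (min T (tm m k))) *\<^sub>R \<eta> k w" by simp
  qed
  note eq = this
  have "simple_proc (4 ^ Suc n) (tm (Suc n)) (%k w. f (node (Suc n) k w)) s w - simple_proc (4 ^ n) (tm n) (%k w. f (node n k w)) s w =
    simple_proc (4 ^ Suc n) (tm (Suc n)) (dn f n) s w" for s w
   unfolding eq using SI_diff[of "%t _. indicator {s..} t" f n T w] by (simp add: SI_def)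
  then have "(%x. ?g (Suc n) x - ?g n x) = cut 0 T (simple_proc (4 ^ Suc n) (tm (Suc n)) (dn f n))"
   unfolding cut_diff by simp
  then show ?thesis using cut_dn_le(2)[OF f T0 order_refl, of n] by simp
 qed
 note lim = l2_geometric_limit[OF gs m ae l K7_nonneg]
 show p: ?g1 using lim(1) by (simp add: l2proc_def)
 show "(%n. l2 ?P (%x. ?g n x - cut 0 T (%t w. f (sol t w)) x)) \<longlonglongrightarrow> 0" by (rule lim(3))
 show ?g3
  using sol_progressive[OF f] energy_l2proc[OF p] by (simp add: L2_prog_def)
qed

text \<open>Only the drift has to be identified: on a good path the step processes converge
  uniformly, so the limit moves inside the time integral.\<close>

lemma sol_dynamics:
 assumes g: "good w" and t: "t \<in> {0..T}"
 shows "sol t w = x0 w + (LBINT s:{0..t}. fa (sol s w)) + lim_SI W fc t w + lim_SI W0 fg t w"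
proof -
 let ?p = "%n s. simple_proc (4 ^ n) (tm n) (%k w. fa (node n k w)) s w"
 have t0: "0 <= t" using t by simp
 have clk: "SI clock fa n t w = (LBINT s:{0<..t}. ?p n s)" and ip: "set_integrable lborel {0<..t} (?p n)" for n
  using simple_integral_clock[OF t0, of "4 ^ n" "tm n" "%k w. fa (node n k w)" w] tm_mono tm_nonneg by (simp_all add: SI_def)
 have "continuous_on {0..t} (%s. fa (sol s w))"
  by (rule continuous_on_compose2[OF sq_lip_continuous[OF lip(1) \<kappa>, of UNIV] continuous_on_subset[OF sol_cont]]) (use t in auto)
 then have "set_integrable lborel {0..t} (%s. fa (sol s w))" by (rule borel_integrable_atLeastAtMost')
 then have ia: "set_integrable lborel {0<..t} (%s. fa (sol s w))" by (rule set_integrable_subset) auto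
 have "(%n. SI clock fa n t w) \<longlonglongrightarrow> (LBINT s:{0<..t}. fa (sol s w))"
 proof (rule LIMSEQ_I)
  fix r :: real assume r: "0 < r"
  define e where "e = r / (T + 1)"
  have e: "0 < e" using r T by (simp add: e_def)
  from uniform_limitD[OF step_uniform[OF lip(1) g] e]
  obtain n0 where n0: "!!n s. n0 <= n ==> s \<in> {0<..T} ==> dist (?p n s) (fa (sol s w)) < e"
   unfolding eventually_sequentially by blast
  have "norm (SI clock fa n t w - (LBINT s:{0<..t}. fa (sol s w))) < r" if n: "n0 <= n" for n
  proof -
   have "norm (SI clock fa n t w - (LBINT s:{0<..t}. fa (sol s w))) = norm (LBINT s:{0<..t}. ?p n s - fa (sol s w))"
    unfolding clk using set_integral_diff(2)[OF ip ia] by simp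
   also have "\<dots> <= (\<integral>s. norm (indicator {0<..t} s *\<^sub>R (?p n s - fa (sol s w))) \<partial>lborel)"
    unfolding set_lebesgue_integral_def by (rule integral_norm_bound)
   also have "\<dots> <= (LBINT s:{0<..t}. e)"
    unfolding set_lebesgue_integral_def
   proof (rule integral_mono)
    show "integrable lborel (%s. norm (indicator {0<..t} s *\<^sub>R (?p n s - fa (sol s w))))"
     using set_integral_diff(1)[OF ip ia] by (simp only: set_integrable_def integrable_norm)
    show "integrable lborel (%s. indicator {0<..t} s *\<^sub>R e)"
     using set_integrable_const_Ioc[of 0 t e] by (simp add: set_integrable_def)
    fix s show "norm (indicator {0<..t} s *\<^sub>R (?p n s - fa (sol s w))) <= indicator {0<..t} s *\<^sub>R e"
     using n0[OF n, of s] t by (auto simp: indicator_def dist_norm)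
   qed
   also have "\<dots> = t * e" using t0 by (simp add: set_integral_const_Ioc)
   also have "\<dots> <= T * e" using t e by (intro mult_right_mono) auto
   also have "\<dots> < r" using r T by (simp add: e_def field_simps)
   finally show ?thesis .
  qed
  then show "\<exists>n0. \<forall>n\<ge>n0. norm (SI clock fa n t w - (LBINT s:{0<..t}. fa (sol s w))) < r" by blast
 qed
 then have "lim_SI clock fa t w = (LBINT s:{0<..t}. fa (sol s w))"
  using good_lim(1)[OF g t] LIMSEQ_unique by blast
 then show ?thesis using g by (simp add: sol_def set_integral_Icc_Ioc)
qed

text \<open>That \<open>q\<close> of the state is the conditional mean of \<open>p\<close> of the
  state is preserved by the drift and by the \<open>W0\<close>-coefficient; the
  \<open>W\<close>-coefficient has no \<open>q\<close>-part, in accordance with the zero conditional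
  mean of its term. The relation thus passes along the nodes and finally to the limit.\<close>

lemma sol_cm:
 fixes p q :: "'b => 'c::euclidean_space"
 assumes lin: "bounded_linear p" "bounded_linear q"
  and cm0: "is_cm M (H 0) (%w. p (x0 w)) (%w. q (x0 w))"
  and cma: "!!s u. is_cm M (H s) (%w. p (u w)) (%w. q (u w)) ==> is_cm M (H s) (%w. p (fa (u w))) (%w. q (fa (u w)))"
  and cmg: "!!s u. is_cm M (H s) (%w. p (u w)) (%w. q (u w)) ==> is_cm M (H s) (%w. p (fg (u w))) (%w. q (fg (u w)))"
  and qc: "!!x. q (fc x) = 0"
  and t: "t \<in> {0..T}"
 shows "is_cm M (H t) (%w. p (sol t w)) (%w. q (sol t w))"
proof -
 interpret p: bounded_linear p by (rule lin(1))
 interpret q: bounded_linear q by (rule lin(2))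
 have pm: "(%w. p (u w)) \<in> borel_measurable G" if "u \<in> borel_measurable G" for u and G :: "'a measure"
  using measurable_compose[OF that borel_measurable_continuous_onI[OF linear_continuous_on[OF lin(1)]]] .
 \<comment> \<open>Only nodes strictly before \<open>t\<close> enter, as all other summands vanish;
   this permits strong induction along the nodes.\<close>
 have S: "is_cm M (H t) (%w. p (epath n t w)) (%w. q (epath n t w))"
  if t: "0 <= t" and hyp: "!!i. i < 4 ^ n ==> tm n i < t ==> is_cm M (H (tm n i)) (%w. p (node n i w)) (%w. q (node n i w))" for n t
 proof -
  have sum_form: "p (SI V f n t w) = (\<Sum>k<4 ^ n. (V (min t (tm n (Suc k))) w - V (min t (tm n k)) w) *\<^sub>R p (f (node n k w)))"
   "q (SI V f n t w) = (\<Sum>k<4 ^ n. (V (min t (tm n (Suc k))) w - V (min t (tm n k)) w) *\<^sub>R q (f (node n k w)))" for V f w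
   by (simp_all add: SI_def simple_integral_def p.sum q.sum p.scaleR q.scaleR)
  have zero: "V (min t (tm n (Suc k))) w - V (min t (tm n k)) w = 0" if "\<not> tm n k < t" for V :: "real => 'a => real" and k w
   using that tm_mono[of k "Suc k" n] by (auto simp: min_def)
  have trivial: "is_cm M (H t) (%_. 0 :: 'c) (%_. 0)" by (rule is_cm_self) simp_all
  have nF: "(%w. p (f (node n k w))) \<in> borel_measurable (F (tm n k))" if "sq_lip \<kappa> f" for f k
   by (rule pm[OF sq_lip_meas[OF that \<kappa> node_F]])
  have nS: "sq_int M (%w. p (f (node n k w)))" if "sq_lip \<kappa> f" for f k
   by (rule sq_int_linear[OF sq_lip_sq_int(1)[OF that \<kappa> node_sq] lin(1)])
  have mr: "tm n k <= min t (tm n (Suc k))" "min t (tm n k) = tm n k" if "tm n k < t" for k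
   using that tm_mono[of k "Suc k" n] by auto
  have a: "is_cm M (H t) (%w. p (SI clock fa n t w)) (%w. q (SI clock fa n t w))"
   unfolding sum_form
  proof (rule is_cm_sum[OF _ subalg_H])
   fix k assume k: "k \<in> {..<4 ^ n :: nat}"
   show "is_cm M (H t) (%w. (min t (tm n (Suc k)) - min t (tm n k)) *\<^sub>R p (fa (node n k w)))
     (%w. (min t (tm n (Suc k)) - min t (tm n k)) *\<^sub>R q (fa (node n k w)))"
   proof (cases "tm n k < t")
    case True
    have "is_cm M (H t) (%w. p (fa (node n k w))) (%w. q (fa (node n k w)))"
     by (rule is_cm_H_mono[OF tm_nonneg less_imp_le[OF True] cma[OF hyp[OF _ True]] nF[OF lip(1)]]) (use k in simp)
    from is_cm_linear[OF this bounded_linear_scaleR_right subalg_H] show ?thesis .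
   next
    case False
    then show ?thesis using zero[of k "%t _. t"] trivial by simp
   qed
  qed
  have g: "is_cm M (H t) (%w. p (SI W0 fg n t w)) (%w. q (SI W0 fg n t w))"
   unfolding sum_form
  proof (rule is_cm_sum[OF _ subalg_H])
   fix k assume k: "k \<in> {..<4 ^ n :: nat}"
   show "is_cm M (H t) (%w. (W0 (min t (tm n (Suc k))) w - W0 (min t (tm n k)) w) *\<^sub>R p (fg (node n k w)))
     (%w. (W0 (min t (tm n (Suc k))) w - W0 (min t (tm n k)) w) *\<^sub>R q (fg (node n k w)))"
   proof (cases "tm n k < t")
    case True
    show ?thesis
     unfolding mr(2)[OF True]
     by (rule is_cm_increment_W0[OF tm_nonneg mr(1)[OF True] min.cobounded1 cmg[OF hyp[OF _ True]] nF[OF lip(3)]]) (use k in simp)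
   next
    case False
    then show ?thesis using zero[of k W0] trivial by simp
   qed
  qed
  have c: "is_cm M (H t) (%w. p (SI W fc n t w)) (%w. q (SI W fc n t w))"
   unfolding sum_form
  proof (rule is_cm_sum[OF _ subalg_H])
   fix k assume k: "k \<in> {..<4 ^ n :: nat}"
   show "is_cm M (H t) (%w. (W (min t (tm n (Suc k))) w - W (min t (tm n k)) w) *\<^sub>R p (fc (node n k w)))
     (%w. (W (min t (tm n (Suc k))) w - W (min t (tm n k)) w) *\<^sub>R q (fc (node n k w)))"
   proof (cases "tm n k < t")
    case True
    show ?thesis
     unfolding mr(2)[OF True] qc scaleR_zero_right
     by (rule is_cm_increment_0[OF tm_nonneg mr(1)[OF True] nS[OF lip(2)] nF[OF lip(2)]])
   next
    case False
    then show ?thesis using zero[of k W] trivial by simp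
   qed
  qed
  have x: "is_cm M (H t) (%w. p (x0 w)) (%w. q (x0 w))"
   by (rule is_cm_H_mono[OF order_refl t cm0 pm[OF x0(2)]])
  show ?thesis
   unfolding epath_def p.add q.add by (intro is_cm_add x a c g subalg_H)
 qed
 have node_cm: "is_cm M (H (tm n k)) (%w. p (node n k w)) (%w. q (node n k w))" if "k <= 4 ^ n" for n k
  using that
 proof (induction k rule: less_induct)
  case (less k)
  have "is_cm M (H (tm n k)) (%w. p (epath n (tm n k) w)) (%w. q (epath n (tm n k) w))"
  proof (rule S[OF tm_nonneg])
   fix i assume i: "i < (4::nat) ^ n" "tm n i < tm n k"
   have "i < k"
   proof (rule ccontr)
    assume "\<not> i < k"
    then show False using tm_mono[of k i n] i(2) by simp
   qed
   then show "is_cm M (H (tm n i)) (%w. p (node n i w)) (%w. q (node n i w))" using less i(1) by auto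
  qed
  then show ?case by (simp add: epath_node[OF less.prems])
 qed
 have t0: "0 <= t" using t by simp
 have e: "is_cm M (H t) (%w. p (epath n t w)) (%w. q (epath n t w))" for n
  by (rule S[OF t0]) (simp add: node_cm)
 have limL: "(%n. l2 M (%w. L (epath n t w) - L (sol t w))) \<longlonglongrightarrow> 0" if "bounded_linear L" for L :: "'b => 'c"
 proof -
  interpret L: bounded_linear L by fact
  obtain K where K: "0 <= K" "!!x. norm (L x) <= norm x * K" using L.nonneg_bounded by auto
  have d: "sq_int M (%w. epath n t w - sol t w)" for n by (intro sq_int_diff epath_props t0 SI_limits t)
  have b: "l2 M (%w. L (epath n t w) - L (sol t w)) <= K * l2 M (%w. epath n t w - sol t w)" for n
   using l2_linear_le(2)[OF d, of L K n] K sq_int_linear[OF d that, of n] by (simp add: L.diff mult.commute sq_int_def)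
  have u: "(%n. K * l2 M (%w. epath n t w - sol t w)) \<longlonglongrightarrow> 0" by (rule tendsto_mult_right_zero[OF SI_limits(6)[OF t]])
  show ?thesis by (rule tendsto_sandwich[OF _ _ tendsto_const u]) (simp_all add: b)
 qed
 have qH: "(%w. q (sol t w)) \<in> borel_measurable (H t)"
 proof (rule measurable_AE_limit_complete[OF complete subalg_H null_le_H])
  show "(%w. q (epath n t w)) \<in> borel_measurable (H t)" for n using e by (simp add: is_cm_def)
  show "AE w in M. (%n. q (epath n t w)) \<longlonglongrightarrow> q (sol t w)"
   using good_AE by eventually_elim (rule q.tendsto, rule good_lim(4)[OF _ t])
 qed
 show ?thesis
  by (rule is_cm_limit[OF e subalg_H sq_int_linear[OF SI_limits(5)[OF t] lin(1)] sq_int_linear[OF SI_limits(5)[OF t] lin(2)] qH limL[OF lin(1)] limL[OF lin(2)]])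
qed

end

section \<open>Algebra of the stationary equations\<close>

lemma transpose_inner: "(transpose N *v x) \<bullet> y = x \<bullet> (N *v y)" for N :: "real^'n^'m"
 by (simp add: dot_lmul_matrix)

lemma inner_lmul_matrix: "x \<bullet> (y v* N) = (N *v x) \<bullet> y" for N :: "real^'n^'m"
 by (metis dot_lmul_matrix inner_commute)

lemma symmetric_mat_inner: "symmetric_mat N ==> (N *v x) \<bullet> y = (N *v y) \<bullet> x"
 using transpose_inner[of N x y] by (simp add: symmetric_mat_def inner_commute)

lemma pos_def_mat_nonneg: "pos_def_mat N ==> 0 <= (N *v x) \<bullet> x"
 by (cases "x = 0") (auto simp: pos_def_mat_def intro: less_imp_le)

lemma pos_def_mat_inv:
 assumes "pos_def_mat N"
 shows "N *v (matrix_inv N *v x) = x" "(matrix_inv N *v x) \<bullet> y = (matrix_inv N *v y) \<bullet> x" (is ?g2)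
proof -
 have "N *v x = 0 ==> x = 0" for x using assms by (force simp: pos_def_mat_def)
 then have "\<exists>L. L ** N = mat 1" using matrix_left_invertible_ker by blast
 then have "invertible N" using invertible_left_inverse by blast
 then have e: "N ** matrix_inv N = mat 1" unfolding invertible_def matrix_inv_def by (metis (mono_tags, lifting) someI_ex)
 show i: "N *v (matrix_inv N *v x) = x" for x by (simp add: matrix_vector_mul_assoc e)
 have "(matrix_inv N *v x) \<bullet> y = (N *v (matrix_inv N *v y)) \<bullet> (matrix_inv N *v x)" by (simp add: i inner_commute)
 also have "\<dots> = (N *v (matrix_inv N *v x)) \<bullet> (matrix_inv N *v y)"
  by (rule symmetric_mat_inner) (use assms in \<open>simp add: pos_def_mat_def\<close>)
 finally show ?g2 by (simp add: i inner_commute)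
qed

text \<open>\<open>\<delta>\<close> is the minimum of the form on the unit sphere, attained by
  compactness; homogeneity extends the bound to all vectors.\<close>

lemma pos_def_mat_coercive:
 fixes N :: "real^'n^'n"
 assumes "pos_def_mat N"
 obtains \<delta> where "0 < \<delta>" "!!x. \<delta> * (norm x)^2 <= (N *v x) \<bullet> x"
proof -
 have c: "continuous_on (sphere 0 1) (%x. (N *v x) \<bullet> x)"
  by (intro continuous_intros linear_continuous_on matrix_vector_mul_bounded_linear)
 obtain e :: "real^'n" where "norm e = 1" using vector_choose_size[of 1] by auto
 then have "sphere (0 :: real^'n) 1 \<noteq> {}" by (auto simp: sphere_def dist_norm intro: exI[of _ e])
 then obtain m where m: "m \<in> sphere 0 1" "!!x. x \<in> sphere 0 1 ==> (N *v m) \<bullet> m <= (N *v x) \<bullet> x"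
  using continuous_attains_inf[OF _ _ c] by auto
 show ?thesis
 proof (rule that)
  have "m \<noteq> 0" using m(1) by auto
  then show "0 < (N *v m) \<bullet> m" using assms by (simp add: pos_def_mat_def)
  fix x :: "real^'n"
  show "(N *v m) \<bullet> m * (norm x)^2 <= (N *v x) \<bullet> x"
  proof (cases "x = 0")
   case False
   define y where "y = x /\<^sub>R norm x"
   have xy: "x = norm x *\<^sub>R y" using False by (simp add: y_def)
   have y: "(N *v m) \<bullet> m <= (N *v y) \<bullet> y" by (rule m(2)) (use False in \<open>simp add: y_def\<close>)
   have "(N *v x) \<bullet> x = (N *v y) \<bullet> y * (norm x)^2"
    by (subst (1 2) xy) (simp add: matrix_vector_mult_scaleR power2_eq_square)
   then show ?thesis using mult_right_mono[OF y, of "(norm x)^2"] by simp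
  qed simp
 qed
qed

lemma mat_form_le:
 fixes N :: "real^'n^'n"
 obtains \<kappa> where "0 < \<kappa>" "!!x. (N *v x) \<bullet> x <= \<kappa> * (norm x)^2"
proof -
 obtain \<kappa> where k: "0 < \<kappa>" "!!x. norm (N *v x) <= norm x * \<kappa>"
  using bounded_linear.pos_bounded[OF matrix_vector_mul_bounded_linear[of N]] by blast
 have "(N *v x) \<bullet> x <= \<kappa> * (norm x)^2" for x
 proof -
  have "(N *v x) \<bullet> x <= norm (N *v x) * norm x" by (rule norm_cauchy_schwarz)
  also have "\<dots> <= norm x * \<kappa> * norm x" by (intro mult_right_mono k) simp
  finally show ?thesis by (simp add: power2_eq_square algebra_simps)
 qed
 then show ?thesis using that k(1) by blast
qed

text \<open>The squared norm of \<open>\<delta> *\<^sub>R y + c *\<^sub>R l\<close>, divided by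
  \<open>\<delta>\<close>, is nonnegative; \<open>c = 1\<close> and \<open>c = -1\<close> give the
  two sides.\<close>

lemma two_inner_ge:
 fixes l y :: "'b::real_inner"
 assumes "0 < \<delta>"
 shows "- (\<delta> * (norm y)^2) - (norm l)^2 / \<delta> <= 2 * (l \<bullet> y)" "2 * (l \<bullet> y) <= \<delta> * (norm y)^2 + (norm l)^2 / \<delta>"
proof -
 have "(norm (\<delta> *\<^sub>R y + c *\<^sub>R l))^2 = \<delta>^2 * (norm y)^2 + 2 * \<delta> * c * (l \<bullet> y) + c^2 * (norm l)^2" for c
  by (simp only: power2_norm_eq_inner) (simp add: inner_add_left inner_add_right inner_commute power2_eq_square algebra_simps)
 then have "\<delta> * (norm y)^2 + 2 * c * (l \<bullet> y) + c^2 * (norm l)^2 / \<delta> = (norm (\<delta> *\<^sub>R y + c *\<^sub>R l))^2 / \<delta>" for c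
  using assms by (simp only:) (simp add: field_simps power2_eq_square)
 then have "0 <= \<delta> * (norm y)^2 + 2 * c * (l \<bullet> y) + c^2 * (norm l)^2 / \<delta>" for c
  using assms by simp
 from this[of 1] this[of "-1"] show "- (\<delta> * (norm y)^2) - (norm l)^2 / \<delta> <= 2 * (l \<bullet> y)" "2 * (l \<bullet> y) <= \<delta> * (norm y)^2 + (norm l)^2 / \<delta>"
  by simp_all
qed

section \<open>Completing the square with the stationary equations\<close>

locale stationary =
 fixes K :: "('n::finite, 'm::finite) mf_coeffs" and P \<Lambda> :: "real^'n^'n" and p :: "real^'n"
 assumes sym: "symmetric_coeffs K" and R: "pos_def_mat (cR K)"
  and Q: "pos_def_mat (cQ K - transpose (cS K) ** matrix_inv (cR K) ** cS K)"
  and Qb: "pos_def_mat (cQ K + cQb K - transpose (cS K) ** matrix_inv (cR K) ** cS K)"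
  and stat: "stationary_solution K P \<Lambda> p"
begin

abbreviation Rm :: "real^'m^'m" where "Rm \<equiv> op_R K P"
abbreviation Th :: "real^'n^'m" where "Th \<equiv> gain K P"
abbreviation Tm :: "real^'n^'m" where "Tm \<equiv> gain_mean K P \<Lambda>"
abbreviation th :: "real^'m" where "th \<equiv> offset K P p"

lemma P: "pos_def_mat P" and \<Lambda>: "pos_def_mat \<Lambda>"
 using stat by (auto simp: stationary_solution_def)

lemma syms: "(P *v x) \<bullet> y = (P *v y) \<bullet> x" "(\<Lambda> *v x) \<bullet> y = (\<Lambda> *v y) \<bullet> x" "(cQ K *v x) \<bullet> y = (cQ K *v y) \<bullet> x"
  "(cQb K *v x) \<bullet> y = (cQb K *v y) \<bullet> x" "(cR K *v v) \<bullet> v' = (cR K *v v') \<bullet> v"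
 using P \<Lambda> sym by (auto intro!: symmetric_mat_inner simp: pos_def_mat_def symmetric_coeffs_def)

lemmas mult_distribs = matrix_vector_mult_add_rdistrib matrix_vector_mult_diff_rdistrib matrix_vector_right_distrib
 matrix_vector_mult_diff_distrib matrix_vector_mul_assoc[symmetric] inner_add_left inner_add_right
 inner_diff_left inner_diff_right dot_lmul_matrix inner_lmul_matrix

lemma Rm_form: "(Rm *v v) \<bullet> v' = (cR K *v v) \<bullet> v' + (P *v (cD K *v v)) \<bullet> (cD K *v v')"
 by (simp add: op_R_def mult_distribs)

lemma Rm_sym: "(Rm *v v) \<bullet> v' = (Rm *v v') \<bullet> v"
 unfolding Rm_form using syms(1)[of "cD K *v v" "cD K *v v'"] syms(5)[of v v'] by simp

lemma Rm: "pos_def_mat Rm"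
 unfolding pos_def_mat_def
proof (intro conjI allI impI)
 have "x \<bullet> (transpose Rm *v y) = x \<bullet> (Rm *v y)" for x y
  using Rm_sym[of x y] by (simp add: inner_lmul_matrix inner_commute)
 then have "transpose Rm *v y = Rm *v y" for y by (metis vector_eq_rdot inner_commute)
 then show "symmetric_mat Rm" by (simp add: symmetric_mat_def matrix_eq)
 fix v :: "real^'m" assume "v \<noteq> 0"
 then show "0 < (Rm *v v) \<bullet> v"
  unfolding Rm_form using R pos_def_mat_nonneg[OF P, of "cD K *v v"] by (auto simp: pos_def_mat_def add_pos_nonneg)
qed

lemma matrix_vector_uminus: "(- N) *v x = - (N *v x)" for N :: "real^'k^'l"
 using matrix_vector_mult_diff_rdistrib[of 0 N x] by simp

lemma gains: "Rm *v (Th *v z) = - (op_S K P *v z)" "Rm *v (Tm *v y) = - (op_Sh K P \<Lambda> *v y)"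
  "Rm *v th = - (transpose (cB K) *v p + transpose (cD K) *v (P *v csig K) + cr K)"
proof -
 have m: "Rm *v (- w) = - (Rm *v w)" for w using matrix_vector_mult_diff_distrib[of Rm 0 w] by simp
 show "Rm *v (Th *v z) = - (op_S K P *v z)" "Rm *v (Tm *v y) = - (op_Sh K P \<Lambda> *v y)"
  "Rm *v th = - (transpose (cB K) *v p + transpose (cD K) *v (P *v csig K) + cr K)"
  by (simp_all add: gain_def gain_mean_def offset_def matrix_vector_uminus m matrix_vector_mul_assoc[symmetric] pos_def_mat_inv(1)[OF Rm])
qed

text \<open>The definitions of the gains with the inverse of \<open>Rm\<close> cleared and the
  coefficient matrices moved onto the test vector. In this form they cancel the mixed terms of the
  cost.\<close>

lemma gain_forms:
 "(Rm *v (Th *v z)) \<bullet> v = - ((P *v z) \<bullet> (cB K *v v) + (P *v (cC K *v z)) \<bullet> (cD K *v v) + (cS K *v z) \<bullet> v)"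
 "(Rm *v (Tm *v y)) \<bullet> v = - ((\<Lambda> *v y) \<bullet> (cB K *v v) + (P *v (hC K *v y)) \<bullet> (cD K *v v) + (cS K *v y) \<bullet> v)"
 "(Rm *v th) \<bullet> v = - (p \<bullet> (cB K *v v) + (P *v csig K) \<bullet> (cD K *v v) + cr K \<bullet> v)"
 unfolding gains by (simp_all add: op_S_def op_Sh_def mult_distribs)

text \<open>The matrix equations evaluated as quadratic forms; the quadratic correction with the
  inverse of \<open>Rm\<close> becomes the form of \<open>Rm\<close> at the gain.\<close>

lemma riccati:
 "2 * ((P *v z) \<bullet> (cA K *v z)) + (P *v (cC K *v z)) \<bullet> (cC K *v z) + (P *v (cG K *v z)) \<bullet> (cG K *v z) + (cQ K *v z) \<bullet> z
  = (Rm *v (Th *v z)) \<bullet> (Th *v z)" (is ?g1)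
 "2 * ((\<Lambda> *v y) \<bullet> (hA K *v y)) + (P *v (hC K *v y)) \<bullet> (hC K *v y) + (\<Lambda> *v (hG K *v y)) \<bullet> (hG K *v y) + (hQ K *v y) \<bullet> y
  = (Rm *v (Tm *v y)) \<bullet> (Tm *v y)" (is ?g2)
proof -
 have "op_Q K P *v z = transpose (op_S K P) *v (matrix_inv Rm *v (op_S K P *v z))"
  using stat by (simp add: stationary_solution_def matrix_vector_mul_assoc matrix_mul_assoc)
 then have "(op_Q K P *v z) \<bullet> z = (matrix_inv Rm *v (op_S K P *v z)) \<bullet> (op_S K P *v z)" by (simp add: dot_lmul_matrix)
 also have "\<dots> = (Rm *v (Th *v z)) \<bullet> (Th *v z)"
  unfolding gains by (simp add: gain_def matrix_vector_uminus matrix_vector_mul_assoc[symmetric] inner_commute)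
 finally show ?g1
  using syms(1)[of "cA K *v z" z] by (simp add: op_Q_def mult_distribs)
 have "op_Qh K P \<Lambda> *v y = transpose (op_Sh K P \<Lambda>) *v (matrix_inv Rm *v (op_Sh K P \<Lambda> *v y))"
  using stat by (simp add: stationary_solution_def matrix_vector_mul_assoc matrix_mul_assoc)
 then have "(op_Qh K P \<Lambda> *v y) \<bullet> y = (matrix_inv Rm *v (op_Sh K P \<Lambda> *v y)) \<bullet> (op_Sh K P \<Lambda> *v y)" by (simp add: dot_lmul_matrix)
 also have "\<dots> = (Rm *v (Tm *v y)) \<bullet> (Tm *v y)"
  unfolding gains by (simp add: gain_mean_def matrix_vector_uminus matrix_vector_mul_assoc[symmetric] inner_commute)
 finally show ?g2
  using syms(2)[of "hA K *v y" y] by (simp add: op_Qh_def mult_distribs)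
qed

lemma linear_equation:
 "p \<bullet> (hA K *v y) + (P *v csig K) \<bullet> (hC K *v y) + (\<Lambda> *v cb K) \<bullet> y + (\<Lambda> *v cgam K) \<bullet> (hG K *v y) + cq K \<bullet> y
  = (Rm *v th) \<bullet> (Tm *v y)"
proof -
 have "(transpose (hA K + cB K ** Tm) *v p + transpose (hC K + cD K ** Tm) *v (P *v csig K) + transpose Tm *v cr K
    + \<Lambda> *v cb K + transpose (hG K) *v (\<Lambda> *v cgam K) + cq K) \<bullet> y = 0"
  using stat by (simp add: stationary_solution_def)
 then show ?thesis unfolding gain_forms(3) by (simp add: mult_distribs)
qed

definition hform :: "real^'n => real^'n => real" where
 "hform y z = (P *v z) \<bullet> z + (\<Lambda> *v y) \<bullet> y + 2 * (p \<bullet> y)"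

text \<open>Rate of change of the expected potential for a process with coefficients
  \<open>a\<close>, \<open>c\<close>, \<open>g\<close>. In expectation the \<open>P\<close>-form of
  \<open>X - Y\<close> is that of \<open>X\<close> minus that of \<open>Y\<close>, which is why
  \<open>P\<close> acts on the data of \<open>X\<close> and \<open>\<Lambda> - P\<close> on those of
  \<open>Y\<close>.\<close>

definition gform :: "real^'n => real^'n => real^'n => real^'n => real^'n => real^'n => real" where
 "gform x y a c g gh = 2 * ((P *v x) \<bullet> a) + (P *v c) \<bullet> c + (P *v g) \<bullet> g
   + (2 * (((\<Lambda> - P) *v y) \<bullet> a) + ((\<Lambda> - P) *v gh) \<bullet> gh) + 2 * (p \<bullet> a)"

definition dev :: "real^'n => real^'n => real^'m => real^'m" where
 "dev x y u = u - Th *v (x - y) - Tm *v y - th"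

lemma hform_lower: obtains C where "!!y z. - C <= hform y z"
proof -
 obtain \<delta> where d: "0 < \<delta>" "!!x. \<delta> * (norm x)^2 <= (\<Lambda> *v x) \<bullet> x" using pos_def_mat_coercive[OF \<Lambda>] by blast
 have "- ((norm p)^2 / \<delta>) <= hform y z" for y z
  using pos_def_mat_nonneg[OF P, of z] d(2)[of y] two_inner_ge(1)[OF d(1), of y p] unfolding hform_def by linarith
 then show ?thesis by (rule that)
qed

lemma hform_upper: obtains C where "0 < C" "!!y z. hform y z <= C * ((norm z)^2 + (norm y)^2 + 1)"
proof -
 obtain k k' where k: "0 < k" "!!x. (P *v x) \<bullet> x <= k * (norm x)^2" "0 < k'" "!!x. (\<Lambda> *v x) \<bullet> x <= k' * (norm x)^2"
  using mat_form_le by metis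
 have "hform y z <= (k + k' + 1 + (norm p)^2) * ((norm z)^2 + (norm y)^2 + 1)" for y z
 proof -
  have "hform y z <= k * (norm z)^2 + k' * (norm y)^2 + ((norm y)^2 + (norm p)^2)"
   using k(2)[of z] k(4)[of y] two_inner_ge(2)[of 1 p y] unfolding hform_def by simp
  moreover have "0 <= (norm z)^2" "0 <= k * ((norm y)^2 + 1)" "0 <= k' * ((norm z)^2 + 1)" "0 <= (norm p)^2 * ((norm z)^2 + (norm y)^2)"
   using k(1,3) by simp_all
  ultimately show ?thesis unfolding distrib_left distrib_right mult_1_right mult_1_left by linarith
 qed
 moreover have "0 < k + k' + 1 + (norm p)^2" using k(1,3) by (simp add: add_pos_nonneg)
 ultimately show ?thesis by (rule that[rotated])
qed

lemma bounded_linear_mult: "bounded_linear L ==> bounded_linear (%y. (N :: real^'k^'l) *v L y)"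
 by (rule bounded_linear_compose[OF matrix_vector_mul_bounded_linear])

text \<open>The last summand pairs the deviation from the conditional mean with a function of the conditional mean,
 so it vanishes in expectation.\<close>

lemma cost_identity:
 obtains L k where "bounded_linear L"
  "!!y z u. gform (y + z) y (cA K *v z + hA K *v y + cB K *v u + cb K) (cC K *v z + hC K *v y + cD K *v u + csig K)
    (cG K *v z + (hG K *v y + cgam K)) (hG K *v y + cgam K) + running_cost K (y + z) y u
   = ergodic_const K P \<Lambda> p + (Rm *v dev (y + z) y u) \<bullet> dev (y + z) y u + z \<bullet> (L y + k)"
proof -
 \<comment> \<open>\<open>L\<close> and \<open>k\<close> collect the terms linear in
   \<open>z\<close>: in each of them the deviation meets a function of \<open>y\<close>
   only.\<close>
 define L where "L y = 2 *\<^sub>R (P *v (hA K *v y) + transpose (cA K) *v (\<Lambda> *v y) + transpose (cC K) *v (P *v (hC K *v y))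
   + transpose (cG K) *v (P *v (hG K *v y)) + cQ K *v y - transpose Th *v (Rm *v (Tm *v y)))" for y
 define k where "k = 2 *\<^sub>R (P *v cb K + transpose (cA K) *v p + transpose (cC K) *v (P *v csig K)
   + transpose (cG K) *v (P *v cgam K) + cq K - transpose Th *v (Rm *v th))"
 have L: "bounded_linear L"
  unfolding L_def[abs_def]
  by (intro bounded_linear_const_scaleR bounded_linear_add bounded_linear_sub bounded_linear_mult bounded_linear_ident)
 \<comment> \<open>Opaque names for the symmetric forms; once symmetry and additivity have been
   applied, the claim is polynomial arithmetic in their values.\<close>
 define bP where "bP x y = (P *v x) \<bullet> y" for x y
 define bL where "bL x y = (\<Lambda> *v x) \<bullet> y" for x y
 define bR where "bR x y = (Rm *v x) \<bullet> y" for x y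
 define bQ where "bQ x y = (cQ K *v x) \<bullet> y" for x y
 have comm: "bP x y = bP y x" "bL x y = bL y x" "bQ x y = bQ y x" "bR v v' = bR v' v" for x y v v'
  unfolding bP_def bL_def bR_def bQ_def using syms Rm_sym by blast+
 have bil: "bP (x + x') y = bP x y + bP x' y" "bP x (y + y') = bP x y + bP x y'"
  "bL (x + x') y = bL x y + bL x' y" "bL x (y + y') = bL x y + bL x y'"
  "bQ (x + x') y = bQ x y + bQ x' y" "bQ x (y + y') = bQ x y + bQ x y'"
  "bR (v - v') u = bR v u - bR v' u" "bR v (u - u') = bR v u - bR v u'" for x x' y y' v v' u u'
  by (simp_all add: bP_def bL_def bR_def bQ_def mult_distribs)
 show ?thesis
 proof (rule that[OF L])
  fix y z u
  define a where "a = cA K *v z + hA K *v y + cB K *v u + cb K"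
  define c where "c = cC K *v z + hC K *v y + cD K *v u + csig K"
  define gh where "gh = hG K *v y + cgam K"
  have cross: "z \<bullet> (L y + k) = 2 * (bP z (hA K *v y) + bL y (cA K *v z) + bP (cC K *v z) (hC K *v y) + bP (cG K *v z) (hG K *v y)
    + bQ z y - bR (Th *v z) (Tm *v y)) + 2 * (bP z (cb K) + p \<bullet> (cA K *v z) + bP (cC K *v z) (csig K)
    + bP (cG K *v z) (cgam K) + cq K \<bullet> z - bR (Th *v z) th)"
   unfolding L_def k_def using comm unfolding bP_def bL_def bR_def bQ_def
   by (simp add: mult_distribs inner_commute[of z] inner_commute[of "_ *v z"] algebra_simps) (simp add: inner_commute)
  have g: "gform (y + z) y a c (cG K *v z + gh) gh = 2 * bP z a + bP c c + bP (cG K *v z) (cG K *v z) + 2 * bP (cG K *v z) gh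
    + 2 * bL y a + bL gh gh + 2 * (p \<bullet> a)"
   unfolding gform_def using comm(1)[of "cG K *v z" gh] unfolding bP_def bL_def by (simp add: mult_distribs algebra_simps)
  have r: "running_cost K (y + z) y u = bQ z z + 2 * bQ z y + (hQ K *v y) \<bullet> y + 2 * ((cS K *v z) \<bullet> u) + 2 * ((cS K *v y) \<bullet> u)
    + (cR K *v u) \<bullet> u + 2 * (cq K \<bullet> z) + 2 * (cq K \<bullet> y) + 2 * (cr K \<bullet> u)"
   unfolding running_cost_def hQ_def using comm(3)[of z y] unfolding bQ_def by (simp add: mult_distribs)
  have d: "(Rm *v dev (y + z) y u) \<bullet> dev (y + z) y u = bR u u + bR (Th *v z) (Th *v z) + bR (Tm *v y) (Tm *v y) + bR th th
    - 2 * bR (Th *v z) u - 2 * bR (Tm *v y) u - 2 * bR th u + 2 * bR (Th *v z) (Tm *v y) + 2 * bR (Th *v z) th + 2 * bR th (Tm *v y)"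
   unfolding dev_def bR_def[symmetric] using comm(4) by (simp add: bil)
  have e: "ergodic_const K P \<Lambda> p = 2 * (p \<bullet> cb K) + bP (csig K) (csig K) + bL (cgam K) (cgam K) - bR th th"
   by (simp add: ergodic_const_def bP_def bL_def bR_def inner_commute)
  have aa: "bP z a = bP z (cA K *v z) + bP z (hA K *v y) + bP z (cB K *v u) + bP z (cb K)"
   "bL y a = bL y (cA K *v z) + bL y (hA K *v y) + bL y (cB K *v u) + bL y (cb K)"
   "p \<bullet> a = p \<bullet> (cA K *v z) + p \<bullet> (hA K *v y) + p \<bullet> (cB K *v u) + p \<bullet> cb K"
   by (simp_all add: a_def bil inner_add_right)
  have cc: "bP c c = bP (cC K *v z) (cC K *v z) + bP (hC K *v y) (hC K *v y) + bP (cD K *v u) (cD K *v u) + bP (csig K) (csig K)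
    + 2 * bP (cC K *v z) (hC K *v y) + 2 * bP (cC K *v z) (cD K *v u) + 2 * bP (cC K *v z) (csig K)
    + 2 * bP (hC K *v y) (cD K *v u) + 2 * bP (csig K) (hC K *v y) + 2 * bP (csig K) (cD K *v u)"
   unfolding c_def using comm(1) by (simp add: bil)
  have gg: "bP (cG K *v z) gh = bP (cG K *v z) (hG K *v y) + bP (cG K *v z) (cgam K)"
   "bL gh gh = bL (hG K *v y) (hG K *v y) + 2 * bL (cgam K) (hG K *v y) + bL (cgam K) (cgam K)"
   unfolding gh_def using comm(2) by (simp_all add: bil)
  have yb: "bL y (cb K) = bL (cb K) y" by (rule comm)
  note facts = gain_forms(1)[of z u] gain_forms(2)[of y u] gain_forms(3)[of u] riccati(1)[of z, symmetric]
   riccati(2)[of y, symmetric] linear_equation[of y, symmetric] Rm_form[of u u]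
  show "gform (y + z) y (cA K *v z + hA K *v y + cB K *v u + cb K) (cC K *v z + hC K *v y + cD K *v u + csig K)
    (cG K *v z + (hG K *v y + cgam K)) (hG K *v y + cgam K) + running_cost K (y + z) y u
   = ergodic_const K P \<Lambda> p + (Rm *v dev (y + z) y u) \<bullet> dev (y + z) y u + z \<bullet> (L y + k)"
   unfolding a_def[symmetric] c_def[symmetric] gh_def[symmetric] g r d e cross aa cc gg yb
    facts[folded bP_def bL_def bR_def bQ_def]
   by (simp add: algebra_simps)
 qed
qed

text \<open>Completing the square in \<open>u\<close> leaves the two matrices assumed positive
  definite, one acting on the deviation \<open>z\<close> and the other on the mean \<open>y\<close>.
  \<open>hform_upper\<close> converts their coercivity into a multiple of the potential, and the
  mixed terms are linear in \<open>z\<close>.\<close>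

lemma running_cost_lower:
 obtains \<delta> C L k where "0 < \<delta>" "bounded_linear L"
  "!!y z u. \<delta> * hform y z - C + z \<bullet> (L y + k) <= running_cost K (y + z) y u"
proof -
 let ?Ri = "matrix_inv (cR K)"
 let ?Q = "cQ K - transpose (cS K) ** ?Ri ** cS K" and ?q = "cq K - transpose (cS K) *v (?Ri *v cr K)"
 obtain d1 d2 where d: "0 < d1" "!!x. d1 * (norm x)^2 <= (?Q *v x) \<bullet> x"
   "0 < d2" "!!x. d2 * (norm x)^2 <= ((cQ K + cQb K - transpose (cS K) ** ?Ri ** cS K) *v x) \<bullet> x"
  using pos_def_mat_coercive[OF Q] pos_def_mat_coercive[OF Qb] by metis
 obtain C where C: "0 < C" "!!y z. hform y z <= C * ((norm z)^2 + (norm y)^2 + 1)" using hform_upper by blast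
 \<comment> \<open>Half of the coercivity in \<open>y\<close> absorbs the linear term
   \<open>?q\<close>, the other half is kept for \<open>hform\<close>.\<close>
 define e where "e = min d1 (d2 / 2)"
 have e: "0 < e" "e <= d1" "2 * e <= d2" using d by (auto simp: e_def)
 \<comment> \<open>In this order: the completed square of \<open>cr K\<close>, the remainder of
   Young's inequality, and the contribution of the summand 1 in \<open>hform_upper\<close>.\<close>
 define c where "c = (?Ri *v cr K) \<bullet> cr K + (norm ?q)^2 / e + e"
 show ?thesis
 proof (rule that[of "e / C" "%y. 2 *\<^sub>R (?Q *v y)" c "2 *\<^sub>R ?q"])
  show "0 < e / C" using e C by simp
  show "bounded_linear (%y. 2 *\<^sub>R (?Q *v y))"
   by (intro bounded_linear_const_scaleR bounded_linear_mult bounded_linear_ident)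
  fix y z :: "real^'n" and u :: "real^'m"
  define x where "x = y + z"
  define s where "s = cS K *v x + cr K"
  have "0 <= (cR K *v (u + ?Ri *v s)) \<bullet> (u + ?Ri *v s)" by (rule pos_def_mat_nonneg[OF R])
  also have "\<dots> = (cR K *v u) \<bullet> u + 2 * (s \<bullet> u) + (?Ri *v s) \<bullet> s"
   using syms(5)[of u "?Ri *v s"] pos_def_mat_inv(1)[OF R, of s]
   by (simp add: matrix_vector_right_distrib inner_add_left inner_add_right inner_commute)
  finally have 1: "- ((?Ri *v s) \<bullet> s) <= (cR K *v u) \<bullet> u + 2 * (s \<bullet> u)" by simp
  have 2: "(?Ri *v s) \<bullet> s = (?Ri *v (cS K *v x)) \<bullet> (cS K *v x) + 2 * ((?Ri *v cr K) \<bullet> (cS K *v x)) + (?Ri *v cr K) \<bullet> cr K"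
   unfolding s_def using pos_def_mat_inv(2)[OF R, of "cS K *v x" "cr K"] by (simp add: mult_distribs)
  have 3: "running_cost K x y u = (cQ K *v x) \<bullet> x + ((cR K *v u) \<bullet> u + 2 * (s \<bullet> u)) + 2 * (cq K \<bullet> x) + (cQb K *v y) \<bullet> y"
   unfolding running_cost_def s_def by (simp add: inner_add_left)
  have 4: "(?Q *v x) \<bullet> x = (cQ K *v x) \<bullet> x - (?Ri *v (cS K *v x)) \<bullet> (cS K *v x)"
   "?q \<bullet> x = cq K \<bullet> x - (?Ri *v cr K) \<bullet> (cS K *v x)" by (simp_all add: mult_distribs)
  have Qs: "(?Q *v y) \<bullet> z = (?Q *v z) \<bullet> y" by (rule symmetric_mat_inner) (use Q in \<open>simp add: pos_def_mat_def\<close>)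
  have 5: "(?Q *v x) \<bullet> x = (?Q *v z) \<bullet> z + (?Q *v y) \<bullet> y + 2 * (z \<bullet> (?Q *v y))" "?q \<bullet> x = ?q \<bullet> y + z \<bullet> ?q"
   unfolding x_def using Qs by (simp_all add: matrix_vector_right_distrib inner_add_left inner_add_right inner_commute)
  have 6: "d2 * (norm y)^2 <= (?Q *v y) \<bullet> y + (cQb K *v y) \<bullet> y"
   using d(4)[of y] by (simp add: mult_distribs algebra_simps)
  have 7: "e * (norm z)^2 <= (?Q *v z) \<bullet> z" using d(2)[of z] mult_right_mono[OF e(2), of "(norm z)^2"] by simp
  have 8: "2 * e * (norm y)^2 <= d2 * (norm y)^2" by (intro mult_right_mono e) simp
  have "e / C * hform y z <= e / C * (C * ((norm z)^2 + (norm y)^2 + 1))"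
   by (intro mult_left_mono C) (use e C in simp)
  then have 9: "e / C * hform y z <= e * (norm z)^2 + e * (norm y)^2 + e" using C(1) by (simp add: algebra_simps)
  have z: "z \<bullet> (2 *\<^sub>R (?Q *v y) + 2 *\<^sub>R ?q) = 2 * (z \<bullet> (?Q *v y)) + 2 * (z \<bullet> ?q)" by (simp add: inner_add_right)
  have "e / C * hform y z - c + z \<bullet> (2 *\<^sub>R (?Q *v y) + 2 *\<^sub>R ?q) <= running_cost K x y u"
   unfolding z c_def using 1 2 3 4 5 6 7 8 9 two_inner_ge(1)[OF e(1), of y ?q] by linarith
  then show "e / C * hform y z - c + z \<bullet> (2 *\<^sub>R (?Q *v y) + 2 *\<^sub>R ?q) <= running_cost K (y + z) y u" by (simp add: x_def)
 qed
qed

end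

section \<open>Quadratic functionals of Ito processes\<close>

context prob_space
begin

text \<open>Formed on the product space so that both orders of integration are available: the cost
  is an expectation of time integrals, the moment identities are time integrals of
  expectations.\<close>

definition tint :: "real => real => (real => 'a => real) => real" where
 "tint s t k = (\<integral>x. cut s t k x \<partial>(lborel \<Otimes>\<^sub>M M))"

definition l1proc :: "real => (real => 'a => real) => bool" where
 "l1proc T k \<longleftrightarrow> integrable (lborel \<Otimes>\<^sub>M M) (cut 0 T k)"

lemma cut_l1:
 assumes "l1proc T k" "0 <= s" "t <= T"
 shows "integrable (lborel \<Otimes>\<^sub>M M) (cut s t k)"
proof -
 have "{s<..t} \<times> space M \<in> sets (lborel \<Otimes>\<^sub>M M)" by measurable
 from integrable_mult_indicator[OF this assms(1)[unfolded l1proc_def]]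
 show ?thesis
  by (rule Bochner_Integration.integrable_cong[THEN iffD1, OF refl, rotated])
   (use assms in \<open>auto simp: cut_def indicator_def space_pair_measure\<close>)
qed

lemma l1proc_inner:
 assumes "l2proc M T U" "l2proc M T V"
 shows "l1proc T (%r w. U r w \<bullet> V r w)"
proof -
 have "cut 0 T (%r w. U r w \<bullet> V r w) = (%x. cut 0 T U x \<bullet> cut 0 T V x)"
  by (auto simp: cut_def fun_eq_iff indicator_def)
 then show ?thesis using sq_int_inner[OF assms[unfolded l2proc_def]] by (simp add: l1proc_def)
qed

lemma l1proc_add: "l1proc T k ==> l1proc T k' ==> l1proc T (%r w. k r w + k' r w)"
 and l1proc_diff: "l1proc T k ==> l1proc T k' ==> l1proc T (%r w. k r w - k' r w)"
 and l1proc_cmult: "l1proc T k ==> l1proc T (%r w. c * k r w)"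
proof -
 have e: "cut 0 T (%r w. k r w + k' r w) = (%x. cut 0 T k x + cut 0 T k' x)" "cut 0 T (%r w. k r w - k' r w) = (%x. cut 0 T k x - cut 0 T k' x)"
  "cut 0 T (%r w. c * k r w) = (%x. c * cut 0 T k x)"
  by (auto simp: cut_def fun_eq_iff algebra_simps)
 show "l1proc T k ==> l1proc T k' ==> l1proc T (%r w. k r w + k' r w)" "l1proc T k ==> l1proc T k' ==> l1proc T (%r w. k r w - k' r w)"
  "l1proc T k ==> l1proc T (%r w. c * k r w)" by (simp_all add: l1proc_def e)
qed

lemma l1proc_const: "0 <= T ==> l1proc T (%_ _. c)"
 unfolding l1proc_def
 by (rule cut_integrable[OF l2proc_const[OF sq_int_const[OF finite_measure_axioms]]]) auto

lemma tint_add: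
 assumes "l1proc T k" "l1proc T k'" "0 <= s" "t <= T"
 shows "tint s t (%r w. k r w + k' r w) = tint s t k + tint s t k'" "tint s t (%r w. k r w - k' r w) = tint s t k - tint s t k'"
proof -
 have e: "cut s t (%r w. k r w + k' r w) = (%x. cut s t k x + cut s t k' x)" "cut s t (%r w. k r w - k' r w) = (%x. cut s t k x - cut s t k' x)"
  by (auto simp: cut_def fun_eq_iff algebra_simps)
 show "tint s t (%r w. k r w + k' r w) = tint s t k + tint s t k'" "tint s t (%r w. k r w - k' r w) = tint s t k - tint s t k'"
  unfolding tint_def e using cut_l1[OF assms(1,3,4)] cut_l1[OF assms(2-4)] by simp_all
qed

lemma tint_cmult: "tint s t (%r w. c * k r w) = c * tint s t k"
proof -
 have "cut s t (%r w. c * k r w) = (%x. c * cut s t k x)" by (auto simp: cut_def fun_eq_iff)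
 then show ?thesis by (simp add: tint_def)
qed

lemma tint_mono:
 assumes "l1proc T k" "l1proc T k'" "0 <= s" "t <= T" "!!r w. k r w <= k' r w"
 shows "tint s t k <= tint s t k'"
 unfolding tint_def
 by (rule integral_mono[OF cut_l1[OF assms(1,3,4)] cut_l1[OF assms(2-4)]]) (auto simp: cut_def intro!: mult_left_mono assms(5))

lemma tint_eq:
 assumes "l1proc T k" "0 <= s" "t <= T"
 shows "set_integrable lborel {s<..t} (%r. \<integral>w. k r w \<partial>M)" (is ?g1) "tint s t k = (LBINT r:{s<..t}. \<integral>w. k r w \<partial>M)" (is ?g2)
  "tint s t k = (\<integral>w. (LBINT r:{s<..t}. k r w) \<partial>M)" (is ?g3)
proof -
 interpret P: pair_sigma_finite lborel M by (rule pair_lborel)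
 have i: "integrable (lborel \<Otimes>\<^sub>M M) (%(r, w). indicator {s<..t} r *\<^sub>R k r w)"
  using cut_l1[OF assms] by (simp add: cut_def)
 have e: "(\<integral>w. indicator {s<..t} r *\<^sub>R k r w \<partial>M) = indicator {s<..t} r *\<^sub>R (\<integral>w. k r w \<partial>M)" for r by simp
 show ?g1
  using P.integrable_fst[OF i] unfolding e set_integrable_def .
 show ?g2
  using P.integral_fst[OF i] unfolding e set_lebesgue_integral_def tint_def cut_def by simp
 show ?g3
  using P.integral_snd[OF i] unfolding set_lebesgue_integral_def tint_def cut_def by simp
qed

lemma tint_split:
 assumes "l1proc T k" "0 <= s" "s <= t" "t <= T"
 shows "tint 0 t k = tint 0 s k + tint s t k"
 using set_integral_Ioc_split[OF tint_eq(1)[OF assms(1) order_refl assms(4)] assms(2,3)] assms tint_eq(2)[OF assms(1)] by simp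

lemma l2_tendsto_linear:
 assumes "bounded_linear L" "!!j::nat. sq_int N (U j)" "(%j. l2 N (U j)) \<longlonglongrightarrow> 0"
 shows "(%j. l2 N (%w. L (U j w))) \<longlonglongrightarrow> 0"
proof -
 obtain C where C: "0 <= C" "!!x. norm (L x) <= norm x * C" using bounded_linear.nonneg_bounded[OF assms(1)] by auto
 have b: "l2 N (%w. L (U j w)) <= C * l2 N (U j)" for j
  by (rule l2_linear_le(2)[OF assms(2)]) (use C sq_int_linear[OF assms(2,1)] in \<open>auto simp: mult.commute sq_int_def\<close>)
 have u: "(%j. C * l2 N (U j)) \<longlonglongrightarrow> 0" by (rule tendsto_mult_right_zero[OF assms(3)])
 show ?thesis by (rule tendsto_sandwich[OF _ _ tendsto_const u]) (simp_all add: b)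
qed

end

context mean_field_basis
begin

lemma linear_image:
 assumes "bounded_linear L"
 shows "simple_integral V N \<tau> (%k w. L (\<eta> k w)) t w = L (simple_integral V N \<tau> \<eta> t w)" (is ?g1)
  "cut s t (simple_proc N \<tau> (%k w. L (\<eta> k w))) x = L (cut s t (simple_proc N \<tau> \<eta>) x)"
  "cut s t (%r w. L (Z r w)) x = L (cut s t Z x)"
  "sq_data N \<tau> \<eta> ==> sq_data N \<tau> (%k w. L (\<eta> k w))"
proof -
 interpret L: bounded_linear L by fact
 show ?g1
  by (simp add: simple_integral_def L.sum L.scaleR)
 show "cut s t (simple_proc N \<tau> (%k w. L (\<eta> k w))) x = L (cut s t (simple_proc N \<tau> \<eta>) x)" "cut s t (%r w. L (Z r w)) x = L (cut s t Z x)"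
  by (simp_all add: cut_def simple_proc_def case_prod_beta' L.sum L.scaleR)
 have m: "(%w. L (\<eta> k w)) \<in> borel_measurable G" if "\<eta> k \<in> borel_measurable G" for k and G :: "'a measure"
  using measurable_compose[OF that borel_measurable_continuous_onI[OF linear_continuous_on[OF assms]]] .
 show "sq_data N \<tau> \<eta> ==> sq_data N \<tau> (%k w. L (\<eta> k w))"
  by (auto simp: sq_data_def intro: sq_int_linear[OF _ assms] m)
qed

lemma ito_approx_linear:
 assumes a: "ito_approx V T Z I N \<tau> \<eta>" and L: "bounded_linear L"
 shows "ito_approx V T (%t w. L (Z t w)) (%t w. L (I t w)) N \<tau> (%j k w. L (\<eta> j k w))"
proof -
 interpret L: bounded_linear L by fact
 have d: "l2proc M T Z" "sq_data (N j) (\<tau> j) (\<eta> j)" for j using a by (auto simp: ito_approx_def)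
 have 1: "(%j. l2 M (%w. L (simple_integral V (N j) (\<tau> j) (\<eta> j) t w - I t w))) \<longlonglongrightarrow> 0" if t: "t \<in> {0..T}" for t
  by (rule l2_tendsto_linear[OF L]) (use a t in \<open>auto simp: ito_approx_def intro: sq_int_diff\<close>)
 have 2: "(%j. l2 (lborel \<Otimes>\<^sub>M M) (%x. L (cut s t (simple_proc (N j) (\<tau> j) (\<eta> j)) x - cut s t Z x))) \<longlonglongrightarrow> 0"
  if st: "0 <= s" "t <= T" for s t
 proof (cases "s <= t")
  case True
  show ?thesis
   by (rule l2_tendsto_linear[OF L])
    (use a st cut_simple_integral_sq(1)[OF d(2) st(1) True] cut_sq_int[OF d(1) st] in \<open>auto simp: ito_approx_def intro: sq_int_diff\<close>)
 next
  case False
  then show ?thesis by (simp add: cut_def case_prod_beta' l2_def L.zero)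
 qed
 show ?thesis
  using a 1 2 unfolding ito_approx_def linear_image[OF L] L.diff
  by (auto simp: linear_image[OF L] intro: l2proc_linear[OF _ L] sq_int_linear[OF _ L])
qed

end

context ito_sys
begin

text \<open>Because the class is closed under affine maps, the identity for squared norms is enough
  for all quadratic functionals.\<close>

lemma affine:
 assumes L: "bounded_linear L"
 shows "ito_sys M F0 W W0 T (%t w. L (X t w) + v) (%t w. L (a t w)) (%t w. L (c t w)) (%t w. L (g t w))
  (%t w. L (I t w)) (%t w. L (I0 t w))"
proof -
 interpret L: bounded_linear L by fact
 have k: "sq_int M (%_. v)" by (rule sq_int_const[OF finite_measure_axioms])
 show ?thesis
 proof
  show "0 <= T" by (rule T)
  show "l2proc M T (%t w. L (a t w))" by (rule l2proc_linear[OF aP L])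
  show "l2proc M T (%t w. L (X t w) + v)" by (intro l2proc_add l2proc_linear[OF XP L] l2proc_const k T)
  show "sq_int M (%w. L (X t w) + v)" if "t \<in> {0..T}" for t by (intro sq_int_add sq_int_linear[OF X(1)[OF that] L] k)
  show "(%w. L (X t w) + v) \<in> borel_measurable (F t)" if "t \<in> {0..T}" for t
   using measurable_compose[OF X(2)[OF that] borel_measurable_continuous_onI[OF linear_continuous_on[OF L]]] by measurable
  show "\<exists>N \<tau> \<eta>. ito_approx W T (%t w. L (c t w)) (%t w. L (I t w)) N \<tau> \<eta>"
   "\<exists>N \<tau> \<eta>. ito_approx W0 T (%t w. L (g t w)) (%t w. L (I0 t w)) N \<tau> \<eta>"
   using I I0 ito_approx_linear[OF _ L] by blast+
  fix s t assume st: "0 <= s" "s <= t" "t <= T"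
  show "AE w in M. L (X t w) + v - (L (X s w) + v) = drift (%t w. L (a t w)) s t w + (L (I t w) - L (I s w) + (L (I0 t w) - L (I0 s w)))"
   using dyn[OF st] drift_AE_integrable[OF aP st]
  proof eventually_elim
   case (elim w)
   have "L (X t w) + v - (L (X s w) + v) = L (X t w - X s w)" by (simp add: L.diff)
   also have "\<dots> = L (drift a s t w) + (L (I t w) - L (I s w) + (L (I0 t w) - L (I0 s w)))"
    unfolding elim(1) by (simp add: L.diff L.add)
   also have "L (drift a s t w) = drift (%t w. L (a t w)) s t w"
    using integral_bounded_linear[OF L elim(2)[unfolded set_integrable_def]]
    by (simp add: drift_def set_lebesgue_integral_def L.scaleR)
   finally show ?case .
  qed
 qed
qed

lemma X_tint:
 assumes t: "t \<in> {0..T}"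
 shows "l1proc T (%r w. 2 * (X r w \<bullet> a r w) + (c r w \<bullet> c r w + g r w \<bullet> g r w))" (is ?g1)
  "msq X t - msq X 0 = tint 0 t (%r w. 2 * (X r w \<bullet> a r w) + (c r w \<bullet> c r w + g r w \<bullet> g r w))" (is ?g2)
proof -
 have tT: "0 <= t" "t <= T" using t by auto
 note l = l1proc_inner[OF XP aP] l1proc_inner[OF cP cP] l1proc_inner[OF gP gP]
 show ?g1 by (intro l1proc_add l1proc_cmult l)
 have "msq X t - msq X 0 = 2 * tint 0 t (%r w. X r w \<bullet> a r w) + (tint 0 t (%r w. c r w \<bullet> c r w) + tint 0 t (%r w. g r w \<bullet> g r w))"
  unfolding X_identity[OF t] tint_eq(2)[OF l(1) order_refl tT(2)] tint_eq(2)[OF l(2) order_refl tT(2)] tint_eq(2)[OF l(3) order_refl tT(2)]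
  using tint_eq(1)[OF l(1) order_refl tT(2)] tint_eq(1)[OF l(2) order_refl tT(2)] tint_eq(1)[OF l(3) order_refl tT(2)]
  by (simp add: power2_norm_eq_inner set_integral_add)
 also have "\<dots> = tint 0 t (%r w. 2 * (X r w \<bullet> a r w) + (c r w \<bullet> c r w + g r w \<bullet> g r w))"
  using tT by (simp add: tint_add[where T = T] l l1proc_cmult l1proc_add tint_cmult)
 finally show ?g2 .
qed

text \<open>Polarization: the quadratic form of a self-adjoint \<open>N\<close> is a difference of squared norms of affine images.\<close>

lemma X_form:
 assumes N: "bounded_linear N" "!!x y. N x \<bullet> y = N y \<bullet> x" and t: "t \<in> {0..T}"
 shows "(\<integral>w. N (X t w) \<bullet> X t w + 2 * (q \<bullet> X t w) \<partial>M) - (\<integral>w. N (X 0 w) \<bullet> X 0 w + 2 * (q \<bullet> X 0 w) \<partial>M)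
  = tint 0 t (%r w. 2 * (N (X r w) \<bullet> a r w) + N (c r w) \<bullet> c r w + N (g r w) \<bullet> g r w + 2 * (q \<bullet> a r w))"
proof -
 have L: "bounded_linear (%x. x + N x)" "bounded_linear (%x. x - N x)"
  by (intro bounded_linear_add bounded_linear_sub bounded_linear_ident N)+
 interpret p: ito_sys M F0 W W0 T "%t w. (X t w + N (X t w)) + 2 *\<^sub>R q" "%t w. a t w + N (a t w)" "%t w. c t w + N (c t w)"
  "%t w. g t w + N (g t w)" "%t w. I t w + N (I t w)" "%t w. I0 t w + N (I0 t w)" by (rule affine[OF L(1)])
 interpret m: ito_sys M F0 W W0 T "%t w. (X t w - N (X t w)) + - 2 *\<^sub>R q" "%t w. a t w - N (a t w)" "%t w. c t w - N (c t w)"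
  "%t w. g t w - N (g t w)" "%t w. I t w - N (I t w)" "%t w. I0 t w - N (I0 t w)" by (rule affine[OF L(2)])
 \<comment> \<open>The difference of the squared norms of \<open>x + v\<close> and
   \<open>x - v\<close> is \<open>4 * (x \<bullet> v)\<close>, here with
   \<open>v = N x + 2 *\<^sub>R q\<close>.\<close>
 have pt: "(norm (x + N x + 2 *\<^sub>R q))^2 - (norm (x - N x + - 2 *\<^sub>R q))^2 = 4 * (N x \<bullet> x + 2 * (q \<bullet> x))" for x
  unfolding power2_norm_eq_inner using N(2)[of x x] by (simp add: inner_simps inner_commute algebra_simps)
 have E: "msq (%t w. X t w + N (X t w) + 2 *\<^sub>R q) s - msq (%t w. X t w - N (X t w) + - 2 *\<^sub>R q) s
   = 4 * (\<integral>w. N (X s w) \<bullet> X s w + 2 * (q \<bullet> X s w) \<partial>M)" if s: "s \<in> {0..T}" for s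
  using Bochner_Integration.integral_diff[OF sq_int_integrable_sq[OF p.X(1)[OF s]] sq_int_integrable_sq[OF m.X(1)[OF s]]]
  by (simp only: pt integral_mult_right_zero)
 have pw: "(2 * ((x + N x + 2 *\<^sub>R q) \<bullet> (b + N b)) + ((c + N c) \<bullet> (c + N c) + (g + N g) \<bullet> (g + N g)))
   - (2 * ((x - N x + - 2 *\<^sub>R q) \<bullet> (b - N b)) + ((c - N c) \<bullet> (c - N c) + (g - N g) \<bullet> (g - N g)))
   = 4 * (2 * (N x \<bullet> b) + N c \<bullet> c + N g \<bullet> g + 2 * (q \<bullet> b))" for x b c g
  using N(2)[of b x] by (simp add: inner_simps inner_commute algebra_simps)
 have tT: "t <= T" "0 \<in> {0..T}" using t T by auto
 show ?thesis
  using E[OF t] E[OF tT(2)] p.X_tint(2)[OF t] m.X_tint(2)[OF t]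
   tint_add(2)[OF p.X_tint(1)[OF t] m.X_tint(1)[OF t] order_refl tT(1)]
  unfolding pw tint_cmult by linarith
qed

end

context cm_sys
begin

lemma affine_cm:
 assumes L: "bounded_linear L"
 obtains C' where "cm_sys M F0 W W0 T (%t w. L (X t w)) (%t w. L (a t w)) (%t w. L (c t w)) (%t w. L (g t w))
  (%t w. L (I t w)) (%t w. L (I0 t w)) (%t w. L (Y t w)) (%t w. L (gh t w)) C'"
proof -
 interpret L: bounded_linear L by fact
 interpret s: ito_sys M F0 W W0 T "%t w. L (X t w)" "%t w. L (a t w)" "%t w. L (c t w)" "%t w. L (g t w)"
  "%t w. L (I t w)" "%t w. L (I0 t w)" using affine[OF L, of 0] by simp
 obtain B where B: "0 < B" "!!x. norm (L x) <= norm x * B" using L.pos_bounded by blast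
 have l: "l2 M (%w. L (U w)) <= B * l2 M U" if "sq_int M U" for U
  by (rule l2_linear_le(2)[OF that]) (use B sq_int_linear[OF that L] in \<open>auto simp: mult.commute sq_int_def\<close>)
 have gs: "sq_int M (g t)" if "t \<in> {0..T}" for t using gh[OF that] by (simp add: is_cm_def)
 show ?thesis
 proof (rule that, unfold_locales)
  show "is_cm M (H t) (%w. L (X t w)) (%w. L (Y t w))" "is_cm M (H t) (%w. L (g t w)) (%w. L (gh t w))"
   if "t \<in> {0..T}" for t using Y[OF that] gh[OF that] is_cm_linear[OF _ L subalg_H] by blast+
  show "l2proc M T (%t w. L (Y t w))" "l2proc M T (%t w. L (gh t w))" using YP ghP by (auto intro: l2proc_linear[OF _ L])
  show "(%w. L (g t w)) \<in> borel_measurable (F t)" if "t \<in> {0..T}" for t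
   using measurable_compose[OF gF[OF that] borel_measurable_continuous_onI[OF linear_continuous_on[OF L]]] .
  show "l2 M (%w. L (gh t w)) <= B * C" if "t \<in> {0..T}" for t
  proof -
   have "l2 M (%w. L (gh t w)) <= B * l2 M (gh t)" by (rule l) (use gh[OF that] in \<open>simp add: is_cm_def\<close>)
   also have "\<dots> <= B * C" using B g_bound[OF that] by (intro mult_left_mono) auto
   finally show ?thesis .
  qed
  fix \<epsilon> :: real assume "0 < \<epsilon>"
  then have "0 < \<epsilon> / B" using B by simp
  from g_modulus[OF this] obtain d where d: "0 < d"
   "!!s t. 0 <= s ==> s <= t ==> t <= T ==> t - s < d ==> l2 M (%w. g t w - g s w) <= \<epsilon> / B" by blast
  show "\<exists>d>0. \<forall>s t. 0 <= s --> s <= t --> t <= T --> t - s < d --> l2 M (%w. L (g t w) - L (g s w)) <= \<epsilon>"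
  proof (intro exI[of _ d] conjI allI impI d(1))
   fix s t assume st: "0 <= s" "s <= t" "t <= T" "t - s < d"
   have "l2 M (%w. L (g t w - g s w)) <= B * l2 M (%w. g t w - g s w)"
    by (rule l) (use st gs in \<open>auto intro: sq_int_diff\<close>)
   also have "\<dots> <= B * (\<epsilon> / B)" using d(2)[OF st] B by (intro mult_left_mono) auto
   finally show "l2 M (%w. L (g t w) - L (g s w)) <= \<epsilon>" using B by (simp add: L.diff)
  qed
 qed
qed

lemma Y_tint:
 assumes t: "t \<in> {0..T}"
 shows "l1proc T (%r w. 2 * (Y r w \<bullet> a r w) + gh r w \<bullet> gh r w)" (is ?g1)
  "msq Y t - msq Y 0 = tint 0 t (%r w. 2 * (Y r w \<bullet> a r w) + gh r w \<bullet> gh r w)" (is ?g2)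
proof -
 have tT: "t <= T" using t by auto
 note l = l1proc_inner[OF YP aP] l1proc_inner[OF ghP ghP]
 show ?g1 by (intro l1proc_add l1proc_cmult l)
 have "msq Y t - msq Y 0 = 2 * tint 0 t (%r w. Y r w \<bullet> a r w) + tint 0 t (%r w. gh r w \<bullet> gh r w)"
  unfolding Y_identity[OF t] tint_eq(2)[OF l(1) order_refl tT] tint_eq(2)[OF l(2) order_refl tT]
  using tint_eq(1)[OF l(1) order_refl tT] tint_eq(1)[OF l(2) order_refl tT]
  by (simp add: power2_norm_eq_inner set_integral_add)
 also have "\<dots> = tint 0 t (%r w. 2 * (Y r w \<bullet> a r w) + gh r w \<bullet> gh r w)"
  using tT by (simp add: tint_add[where T = T] l l1proc_cmult l1proc_add tint_cmult)
 finally show ?g2 .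
qed

text \<open>Polarization again, now without a linear term: \<open>p \<bullet> X\<close> and
  \<open>p \<bullet> Y\<close> have the same expectation, so the linear part of the potential is
  carried by \<open>X_form\<close>.\<close>

lemma Y_form:
 assumes N: "bounded_linear N" "!!x y. N x \<bullet> y = N y \<bullet> x" and t: "t \<in> {0..T}"
 shows "(\<integral>w. N (Y t w) \<bullet> Y t w \<partial>M) - (\<integral>w. N (Y 0 w) \<bullet> Y 0 w \<partial>M)
  = tint 0 t (%r w. 2 * (N (Y r w) \<bullet> a r w) + N (gh r w) \<bullet> gh r w)"
proof -
 have L: "bounded_linear (%x. x + N x)" "bounded_linear (%x. x - N x)"
  by (intro bounded_linear_add bounded_linear_sub bounded_linear_ident N)+
 obtain C1 where "cm_sys M F0 W W0 T (%t w. X t w + N (X t w)) (%t w. a t w + N (a t w)) (%t w. c t w + N (c t w))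
  (%t w. g t w + N (g t w)) (%t w. I t w + N (I t w)) (%t w. I0 t w + N (I0 t w)) (%t w. Y t w + N (Y t w)) (%t w. gh t w + N (gh t w)) C1"
  by (rule affine_cm[OF L(1)])
 then interpret p: cm_sys M F0 W W0 T "%t w. X t w + N (X t w)" "%t w. a t w + N (a t w)" "%t w. c t w + N (c t w)"
  "%t w. g t w + N (g t w)" "%t w. I t w + N (I t w)" "%t w. I0 t w + N (I0 t w)" "%t w. Y t w + N (Y t w)" "%t w. gh t w + N (gh t w)" C1 .
 obtain C2 where "cm_sys M F0 W W0 T (%t w. X t w - N (X t w)) (%t w. a t w - N (a t w)) (%t w. c t w - N (c t w))
  (%t w. g t w - N (g t w)) (%t w. I t w - N (I t w)) (%t w. I0 t w - N (I0 t w)) (%t w. Y t w - N (Y t w)) (%t w. gh t w - N (gh t w)) C2"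
  by (rule affine_cm[OF L(2)])
 then interpret m: cm_sys M F0 W W0 T "%t w. X t w - N (X t w)" "%t w. a t w - N (a t w)" "%t w. c t w - N (c t w)"
  "%t w. g t w - N (g t w)" "%t w. I t w - N (I t w)" "%t w. I0 t w - N (I0 t w)" "%t w. Y t w - N (Y t w)" "%t w. gh t w - N (gh t w)" C2 .
 have pt: "(norm (x + N x))^2 - (norm (x - N x))^2 = 4 * (N x \<bullet> x)" for x
  unfolding power2_norm_eq_inner by (simp add: inner_simps inner_commute algebra_simps)
 have E: "msq (%t w. Y t w + N (Y t w)) s - msq (%t w. Y t w - N (Y t w)) s = 4 * (\<integral>w. N (Y s w) \<bullet> Y s w \<partial>M)"
  if s: "s \<in> {0..T}" for s
 proof -
  have "sq_int M (%w. Y s w + N (Y s w))" "sq_int M (%w. Y s w - N (Y s w))"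
   using p.Y[OF s] m.Y[OF s] by (simp_all add: is_cm_def)
  from Bochner_Integration.integral_diff[OF this[THEN sq_int_integrable_sq]]
  show ?thesis by (simp only: pt integral_mult_right_zero)
 qed
 have pw: "(2 * ((y + N y) \<bullet> (b + N b)) + (g + N g) \<bullet> (g + N g)) - (2 * ((y - N y) \<bullet> (b - N b)) + (g - N g) \<bullet> (g - N g))
   = 4 * (2 * (N y \<bullet> b) + N g \<bullet> g)" for y b g
  using N(2)[of b y] by (simp add: inner_simps inner_commute algebra_simps)
 have tT: "t <= T" "0 \<in> {0..T}" using t T by auto
 show ?thesis
  using E[OF t] E[OF tT(2)] p.Y_tint(2)[OF t] m.Y_tint(2)[OF t]
   tint_add(2)[OF p.Y_tint(1)[OF t] m.Y_tint(1)[OF t] order_refl tT(1)]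
  unfolding pw tint_cmult by linarith
qed

end

section \<open>The cost along a solution of the state equation\<close>

context mean_field_basis
begin

lemma progressive_section:
 assumes "progressive G T Z" "t \<in> {0..T}"
 shows "Z t \<in> borel_measurable (G t)"
proof -
 have m: "(%(s, w). Z s w) \<in> borel_measurable (restrict_space borel {0..t} \<Otimes>\<^sub>M G t)" using assms by (simp add: progressive_def)
 have "t \<in> space (restrict_space borel {0..t})" using assms(2) by (simp add: space_restrict_space)
 from measurable_compose[OF measurable_Pair1'[OF this] m] show ?thesis by simp
qed

text \<open>Square-integrability over time follows from the contraction at each single time and
  Tonelli's theorem; joint measurability comes from progressivity.\<close>

lemma cond_mean_process_props:
 fixes X Y :: "real => 'a => real^'n"
 assumes c: "cond_mean_process M W0 T X Y" and X: "!!t. t \<in> {0..T} ==> sq_int M (X t)" "l2proc M T X"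
 shows "!!t. t \<in> {0..T} ==> is_cm M (H t) (X t) (Y t)" "l2proc M T Y"
proof -
 have p: "progressive H T Y" using c by (simp add: cond_mean_process_def)
 show cm: "is_cm M (H t) (X t) (Y t)" if t: "t \<in> {0..T}" for t
 proof (rule is_cmI_real_cond_exp[OF X(1)[OF t] progressive_section[OF p t] subalg_H])
  fix b :: "real^'n" assume "b \<in> Basis"
  then obtain i where b: "b = axis i 1" by (auto simp: Basis_vec_def)
  have "AE w in M. Y t w = (\<chi> i. real_cond_exp M (H t) (%w'. X t w' $ i) w)"
   using c t by (auto simp: cond_mean_process_def)
  then show "AE w in M. Y t w \<bullet> b = real_cond_exp M (H t) (%w. X t w \<bullet> b) w"
   by eventually_elim (simp add: b inner_axis)
 qed
 show "l2proc M T Y"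
  unfolding l2proc_def
 proof (rule sq_intI_nn)
  show m: "cut 0 T Y \<in> borel_measurable (lborel \<Otimes>\<^sub>M M)" by (rule progressive_cut[OF p subalg_H]) auto
  have mX: "cut 0 T X \<in> borel_measurable (lborel \<Otimes>\<^sub>M M)" using X(2) by (simp add: l2proc_def sq_int_def)
  have "(\<integral>\<^sup>+x. ennreal ((norm (cut 0 T Y x))^2) \<partial>(lborel \<Otimes>\<^sub>M M)) = (\<integral>\<^sup>+r. \<integral>\<^sup>+w. ennreal ((norm (cut 0 T Y (r, w)))^2) \<partial>M \<partial>lborel)"
   by (rule nn_integral_fst[symmetric]) (use m in measurable)
  also have "\<dots> <= (\<integral>\<^sup>+r. \<integral>\<^sup>+w. ennreal ((norm (cut 0 T X (r, w)))^2) \<partial>M \<partial>lborel)"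
  proof (rule nn_integral_mono)
   fix r :: real
   show "(\<integral>\<^sup>+w. ennreal ((norm (cut 0 T Y (r, w)))^2) \<partial>M) <= (\<integral>\<^sup>+w. ennreal ((norm (cut 0 T X (r, w)))^2) \<partial>M)"
   proof (cases "r \<in> {0<..T}")
    case True
    then have r: "is_cm M (H r) (X r) (Y r)" using cm by simp
    then have s: "sq_int M (X r)" "sq_int M (Y r)" by (auto simp: is_cm_def)
    show ?thesis using True is_cm_l2_le[OF r subalg_H]
     by (simp add: cut_def nn_integral_sq_int s power_mono)
   qed (simp add: cut_def)
  qed
  also have "\<dots> = (\<integral>\<^sup>+x. ennreal ((norm (cut 0 T X x))^2) \<partial>(lborel \<Otimes>\<^sub>M M))"
   by (rule nn_integral_fst) (use mX in measurable)
  also have "\<dots> < \<infinity>" using nn_integral_sq_int[OF X(2)[unfolded l2proc_def]] by simp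
  finally show "(\<integral>\<^sup>+x. ennreal ((norm (cut 0 T Y x))^2) \<partial>(lborel \<Otimes>\<^sub>M M)) < \<infinity>" .
 qed
qed

text \<open>The two integrals are fixed only as \<open>l2\<close>-limits, so they vanish at time 0
  almost surely; this is why the initial value is recovered up to a null set.\<close>

lemma ito_process_sys:
 assumes T: "0 < T" and \<xi>: "sq_int M \<xi>" and p: "ito_process M F0 W W0 T \<xi> a c g X"
 obtains I I0 where "ito_sys M F0 W W0 T X a c g I I0" "AE w in M. X 0 w = \<xi> w"
proof -
 interpret sw: mean_field_basis M F0 W0 W by (rule swap)
 obtain I I0 where i: "is_ito_integral M F W T c I" "is_ito_integral M F W0 T g I0"
  and eq: "AE w in M. \<forall>t\<in>{0..T}. X t w = \<xi> w + (LBINT s:{0..t}. a s w) + I t w + I0 t w"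
  and L: "X \<in> L2_prog M F T" "a \<in> L2_prog M F T" using p unfolding ito_process_def by blast
 obtain N \<tau> \<eta> where ap: "ito_approx W T c I N \<tau> \<eta>" using ito_integral_approx[OF i(1)] .
 have "is_ito_integral M (full_filt M F0 W0 W) W0 T g I0" using i(2) by (simp only: swF)
 then obtain N' \<tau>' \<eta>' where "sw.ito_approx W0 T g I0 N' \<tau>' \<eta>'" using sw.ito_integral_approx by metis
 then have ap0: "ito_approx W0 T g I0 N' \<tau>' \<eta>'" by (simp add: ito_approx_def sw.ito_approx_def sq_data_def sw.sq_data_def swF)
 have P: "l2proc M T X" "l2proc M T a" using L by (auto intro: L2_prog_l2proc[OF _ subalg_F])
 have XF: "X t \<in> borel_measurable (F t)" if "t \<in> {0..T}" for t
  by (rule progressive_section[OF _ that]) (use L in \<open>simp add: L2_prog_def\<close>)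
 have Xt: "AE w in M. X t w = \<xi> w + drift a 0 t w + I t w + I0 t w" if "t \<in> {0..T}" for t
  using eq by eventually_elim (use that in \<open>simp add: drift_def set_integral_Icc_Ioc\<close>)
 have sys: "ito_sys M F0 W W0 T X a c g I I0"
 proof
  show "0 <= T" using T by simp
  show "l2proc M T a" "l2proc M T X" by (rule P)+
  fix t assume t: "t \<in> {0..T}"
  show "X t \<in> borel_measurable (F t)" by (rule XF[OF t])
  show "sq_int M (X t)"
  proof (rule sq_int_cong_AE(1)[OF _ meas_F_M[OF XF[OF t]] Xt[OF t]])
   show "sq_int M (%w. \<xi> w + drift a 0 t w + I t w + I0 t w)"
    using t ap ap0 by (intro sq_int_add \<xi> drift_props(1)[OF P(2)]) (auto simp: ito_approx_def)
  qed
 next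
  show "\<exists>N \<tau> \<eta>. ito_approx W T c I N \<tau> \<eta>" "\<exists>N \<tau> \<eta>. ito_approx W0 T g I0 N \<tau> \<eta>" using ap ap0 by blast+
  fix s t assume st: "0 <= s" "s <= t" "t <= T"
  have t: "0 <= t" "t \<in> {0..T}" "s \<in> {0..T}" using st by auto
  show "AE w in M. X t w - X s w = drift a s t w + (I t w - I s w + (I0 t w - I0 s w))"
   using Xt[OF t(2)] Xt[OF t(3)] drift_AE_integrable[OF P(2) order_refl t(1) st(3)]
  proof eventually_elim
   case (elim w)
   have "drift a 0 t w = drift a 0 s w + drift a s t w"
    unfolding drift_def by (rule set_integral_Ioc_split[OF elim(3) st(1,2)])
   with elim(1,2) show ?case by (simp add: algebra_simps)
  qed
 qed
 have "AE w in M. I 0 w = 0" "AE w in M. I0 0 w = 0"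
  using ito_zero[OF ap] sw.ito_zero[OF \<open>sw.ito_approx W0 T g I0 N' \<tau>' \<eta>'\<close>] T by auto
 moreover have "AE w in M. X 0 w = \<xi> w + drift a 0 0 w + I 0 w + I0 0 w" by (rule Xt) (use T in simp)
 ultimately have "AE w in M. X 0 w = \<xi> w"
  by eventually_elim (simp add: drift_def set_lebesgue_integral_def)
 with sys show ?thesis by (rule that)
qed

text \<open>What has to be supplied beyond \<open>ito_sys\<close> concerns \<open>g\<close>. Its
  \<open>l2\<close>-modulus comes from that of \<open>X\<close> and, by contraction, of
  \<open>Y\<close>; its bound comes from the second moment of \<open>X\<close>, which is continuous
  on a compact interval by the moment identity.\<close>

lemma mf_state_sys:
 fixes K :: "('n::finite, 'm::finite) mf_coeffs"
 assumes T: "0 < T" and \<xi>: "sq_int M \<xi>" and m: "mf_state K M F0 W W0 T \<xi> u X Y"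
 obtains I I0 C where "cm_sys M F0 W W0 T X (%t w. cA K *v X t w + cAb K *v Y t w + cB K *v u t w + cb K)
    (%t w. cC K *v X t w + cCb K *v Y t w + cD K *v u t w + csig K)
    (%t w. cG K *v X t w + cGb K *v Y t w + cgam K) I I0 Y (%t w. hG K *v Y t w + cgam K) C"
   "AE w in M. X 0 w = \<xi> w"
proof -
 let ?g = "%t w. cG K *v X t w + cGb K *v Y t w + cgam K"
 obtain I I0 where s: "ito_sys M F0 W W0 T X (%t w. cA K *v X t w + cAb K *v Y t w + cB K *v u t w + cb K)
    (%t w. cC K *v X t w + cCb K *v Y t w + cD K *v u t w + csig K) ?g I I0"
  and X0: "AE w in M. X 0 w = \<xi> w"
  using ito_process_sys[OF T \<xi>] m unfolding mf_state_def by blast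
 interpret s: ito_sys M F0 W W0 T X "%t w. cA K *v X t w + cAb K *v Y t w + cB K *v u t w + cb K"
  "%t w. cC K *v X t w + cCb K *v Y t w + cD K *v u t w + csig K" ?g I I0 by (rule s)
 have cmp: "cond_mean_process M W0 T X Y" using m by (simp add: mf_state_def)
 have Y: "is_cm M (H t) (X t) (Y t)" if "t \<in> {0..T}" for t by (rule cond_mean_process_props(1)[OF cmp s.X(1) s.XP that])
 have YP: "l2proc M T Y" by (rule cond_mean_process_props(2)[OF cmp s.X(1) s.XP])
 have lin: "bounded_linear (%x. N *v x)" for N :: "real^'n^'n" by (rule matrix_vector_mul_bounded_linear)
 have k: "sq_int M (%_. cgam K)" by (rule sq_int_const[OF finite_measure_axioms])
 have sq: "sq_int M (X t)" "sq_int M (Y t)" if "t \<in> {0..T}" for t using Y[OF that] by (auto simp: is_cm_def)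
 have bd: "\<exists>B>0. \<forall>U. sq_int M U --> l2 M (%w. N *v U w) <= B * l2 M U" for N :: "real^'n^'n"
 proof -
  obtain B where B: "0 < B" "!!x. norm (N *v x) <= norm x * B" using bounded_linear.pos_bounded[OF lin[of N]] by blast
  show ?thesis
   by (intro exI[of _ B] conjI allI impI B l2_linear_le(2)) (use B sq_int_linear[OF _ lin[of N]] in \<open>auto simp: mult.commute sq_int_def\<close>)
 qed
 obtain B B1 B2 where B: "0 < B" "!!U. sq_int M U ==> l2 M (%w. hG K *v U w) <= B * l2 M U"
  "0 < B1" "!!U. sq_int M U ==> l2 M (%w. cG K *v U w) <= B1 * l2 M U"
  "0 < B2" "!!U. sq_int M U ==> l2 M (%w. cGb K *v U w) <= B2 * l2 M U"
  using bd[of "hG K"] bd[of "cG K"] bd[of "cGb K"] by metis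
 have cI: "continuous_on {0..T} (%t. s.msq X 0 + tint 0 t (%r w. 2 * (X r w \<bullet> (cA K *v X r w + cAb K *v Y r w + cB K *v u r w + cb K)) +
   ((cC K *v X r w + cCb K *v Y r w + cD K *v u r w + csig K) \<bullet> (cC K *v X r w + cCb K *v Y r w + cD K *v u r w + csig K) + ?g r w \<bullet> ?g r w)))"
  (is "continuous_on _ (%t. _ + tint 0 t ?k)")
 proof -
  have l: "l1proc T ?k" by (rule s.X_tint(1)[of T]) (use T in simp)
  have "continuous_on {0..T} (%t. tint 0 t ?k)"
   by (rule continuous_on_eq[OF continuous_on_set_integral_Ioc[OF tint_eq(1)[OF l order_refl order_refl]]])
    (rule tint_eq(2)[OF l, symmetric], auto)
  then show ?thesis by (intro continuous_on_add continuous_on_const)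
 qed
 obtain C0 where C0: "!!t. t \<in> {0..T} ==> s.msq X t <= C0"
 proof -
  obtain z where "!!t. t \<in> {0..T} ==> s.msq X 0 + tint 0 t ?k <= z"
   using continuous_attains_sup[OF _ _ cI] T by fastforce
  then have "s.msq X t <= z" if "t \<in> {0..T}" for t using s.X_tint(2)[OF that] that by fastforce
  then show ?thesis by (rule that)
 qed
 have Xb: "l2 M (X t) <= sqrt C0" if "t \<in> {0..T}" for t using C0[OF that] by (simp add: l2_def)
 show ?thesis
 proof (rule that[OF _ X0], unfold_locales)
  show "l2proc M T Y" by (rule YP)
  show "l2proc M T (%t w. hG K *v Y t w + cgam K)"
   using T by (intro l2proc_add l2proc_linear[OF YP lin] l2proc_const k) simp
  fix t assume t: "t \<in> {0..T}"
  show "is_cm M (H t) (X t) (Y t)" by (rule Y[OF t])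
  have YF: "Y t \<in> borel_measurable (H t)" using Y[OF t] by (simp add: is_cm_def)
  show "?g t \<in> borel_measurable (F t)"
   using measurable_compose[OF s.X(2)[OF t] borel_measurable_continuous_onI[OF linear_continuous_on[OF lin[of "cG K"]]]]
    measurable_compose[OF meas_H_F[OF YF] borel_measurable_continuous_onI[OF linear_continuous_on[OF lin[of "cGb K"]]]] by measurable
  have "is_cm M (H t) (?g t) (%w. cG K *v Y t w + cGb K *v Y t w + cgam K)"
   by (intro is_cm_add subalg_H is_cm_linear[OF Y[OF t] lin] is_cm_linear[OF is_cm_self[OF sq(2)[OF t] YF] lin] is_cm_self[OF k]) simp
  then show "is_cm M (H t) (?g t) (%w. hG K *v Y t w + cgam K)" by (simp add: hG_def matrix_vector_mult_add_rdistrib)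
  have "l2 M (%w. hG K *v Y t w + cgam K) <= l2 M (%w. hG K *v Y t w) + l2 M (%_. cgam K)"
   by (rule l2_add_le[OF sq_int_linear[OF sq(2)[OF t] lin] k])
  also have "\<dots> <= B * sqrt C0 + l2 M (%_. cgam K)"
   using B(2)[OF sq(2)[OF t]] mult_left_mono[OF order_trans[OF is_cm_l2_le[OF Y[OF t] subalg_H] Xb[OF t]] less_imp_le[OF B(1)]] by simp
  finally show "l2 M (%w. hG K *v Y t w + cgam K) <= B * sqrt C0 + l2 M (%_. cgam K)" .
 next
  fix \<epsilon> :: real assume e: "0 < \<epsilon>"
  define e where "e = \<epsilon> / (B1 + B2)"
  have e0: "0 < e" using e B by (simp add: e_def)
  obtain d where d: "0 < d" "!!s t. 0 <= s ==> s <= t ==> t <= T ==> t - s < d ==> l2 M (%w. X t w - X s w) <= e"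
   using s.modulus[OF e0] by blast
  show "\<exists>d>0. \<forall>s t. 0 <= s --> s <= t --> t <= T --> t - s < d --> l2 M (%w. ?g t w - ?g s w) <= \<epsilon>"
  proof (intro exI[of _ d] conjI allI impI d(1))
   fix s t assume st: "0 <= s" "s <= t" "t <= T" "t - s < d"
   have t: "s \<in> {0..T}" "t \<in> {0..T}" using st by auto
   note dX = sq_int_diff[OF sq(1)[OF t(2)] sq(1)[OF t(1)]] and dY = sq_int_diff[OF sq(2)[OF t(2)] sq(2)[OF t(1)]]
   have "is_cm M (H t) (%w. X t w - X s w) (%w. Y t w - Y s w)"
    by (rule is_cm_diff[OF Y[OF t(2)] is_cm_H_mono[OF st(1,2) Y[OF t(1)] s.X(2)[OF t(1)]] subalg_H])
   then have l: "l2 M (%w. Y t w - Y s w) <= e" "l2 M (%w. X t w - X s w) <= e"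
    using is_cm_l2_le[OF _ subalg_H] d(2)[OF st] order_trans by blast+
   have "l2 M (%w. ?g t w - ?g s w) = l2 M (%w. cG K *v (X t w - X s w) + cGb K *v (Y t w - Y s w))"
    by (simp add: matrix_vector_mult_diff_distrib algebra_simps)
   also have "\<dots> <= l2 M (%w. cG K *v (X t w - X s w)) + l2 M (%w. cGb K *v (Y t w - Y s w))"
    by (rule l2_add_le[OF sq_int_linear[OF dX lin] sq_int_linear[OF dY lin]])
   also have "\<dots> <= B1 * e + B2 * e"
    using B(4)[OF dX] B(6)[OF dY] mult_left_mono[OF l(2) less_imp_le[OF B(3)]] mult_left_mono[OF l(1) less_imp_le[OF B(5)]] by linarith
   also have "\<dots> = (B1 + B2) * e" by (simp add: distrib_right)
   also have "\<dots> = \<epsilon>" using B(3,5) by (simp add: e_def)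
   finally show "l2 M (%w. ?g t w - ?g s w) <= \<epsilon>" .
  qed
 qed
qed

end

section \<open>Potential and cost of one given solution\<close>

locale mf_solution = stationary K P \<Lambda> p + cm_sys M F0 W W0 T X a c g I I0 Y gh C
 for K :: "('n::finite, 'm::finite) mf_coeffs" and P \<Lambda> p and M F0 :: "'a measure" and W W0 T
  and X a c g I I0 Y gh :: "real => 'a => real^'n" and C +
 fixes u :: "real => 'a => real^'m"
 assumes uP: "l2proc M T u"
  and a_eq: "a = (%t w. cA K *v X t w + cAb K *v Y t w + cB K *v u t w + cb K)"
  and c_eq: "c = (%t w. cC K *v X t w + cCb K *v Y t w + cD K *v u t w + csig K)"
  and g_eq: "g = (%t w. cG K *v X t w + cGb K *v Y t w + cgam K)"
  and gh_eq: "gh = (%t w. hG K *v Y t w + cgam K)"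
begin

lemma sq_XY: "t \<in> {0..T} ==> sq_int M (X t)" "t \<in> {0..T} ==> sq_int M (Y t)"
 using Y[of t] by (auto simp: is_cm_def)

lemma lin: "bounded_linear (%x. (N :: real^'k^'l) *v x)"
 by (rule matrix_vector_mul_bounded_linear)

lemma l2proc_const_vec: "l2proc M T (%_ _. v)"
 by (rule l2proc_const[OF sq_int_const[OF finite_measure_axioms] T])

text \<open>The second factor is a function of \<open>Y t\<close> and hence
  \<open>H t\<close>-measurable, and against such functions \<open>X t\<close> and
  \<open>Y t\<close> have the same pairing.\<close>

lemma cross_zero:
 assumes "bounded_linear L" "t \<in> {0..T}"
 shows "integrable M (%w. (X t w - Y t w) \<bullet> (L (Y t w) + k))" (is ?g1) "(\<integral>w. (X t w - Y t w) \<bullet> (L (Y t w) + k) \<partial>M) = 0" (is ?g2)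
proof -
 have k: "sq_int M (%_. k)" by (rule sq_int_const[OF finite_measure_axioms])
 note s = sq_XY[OF assms(2)]
 have e: "(x - y) \<bullet> z = z \<bullet> x - z \<bullet> y" for x y z :: "real^'n" by (metis inner_commute inner_diff_right)
 have z: "sq_int M (%w. L (Y t w) + k)" by (intro sq_int_add sq_int_linear[OF s(2) assms(1)] k)
 have m: "(%w. L (Y t w) + k) \<in> borel_measurable (H t)"
  using measurable_compose[OF _ borel_measurable_continuous_onI[OF linear_continuous_on[OF assms(1)]], of "Y t" "H t"] Y[OF assms(2)]
  by (simp add: is_cm_def)
 show ?g1 by (rule sq_int_inner[OF sq_int_diff[OF s] z])
 show ?g2
  using is_cm_inner[OF Y[OF assms(2)] subalg_H z m] sq_int_inner[OF z s(1)] sq_int_inner[OF z s(2)]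
  unfolding e by simp
qed

lemma cross_tint:
 assumes "bounded_linear L" "0 <= s" "t <= T"
 shows "l1proc T (%r w. (X r w - Y r w) \<bullet> (L (Y r w) + k))" (is ?g1) "tint s t (%r w. (X r w - Y r w) \<bullet> (L (Y r w) + k)) = 0" (is ?g2)
proof -
 show l: ?g1
  by (intro l1proc_inner l2proc_diff l2proc_add XP YP l2proc_linear[OF YP assms(1)] l2proc_const_vec)
 have z: "indicator {s<..t} r *\<^sub>R (\<integral>w. (X r w - Y r w) \<bullet> (L (Y r w) + k) \<partial>M) = 0" for r
  using cross_zero(2)[OF assms(1), of r k] assms by (auto simp: indicator_def)
 show ?g2
  by (simp only: tint_eq(2)[OF l assms(2,3)] set_lebesgue_integral_def z integral_zero)
qed

abbreviation cost :: "real => 'a => real" where "cost r w \<equiv> running_cost K (X r w) (Y r w) (u r w)"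
abbreviation dv :: "real => 'a => real^'m" where "dv r w \<equiv> dev (X r w) (Y r w) (u r w)"
abbreviation pot :: "real => real" where "pot t \<equiv> \<integral>w. hform (Y t w) (X t w - Y t w) \<partial>M"

lemma l2proc_mult: "l2proc M T U ==> l2proc M T (%r w. (N :: real^'k^'l) *v U r w)"
 by (rule l2proc_linear[OF _ lin])

lemma cost_l1: "l1proc T cost"
 unfolding running_cost_def
 by (intro l1proc_add l1proc_cmult l1proc_inner l2proc_mult XP YP uP l2proc_const_vec)

lemma dev_l1: "l1proc T (%r w. (Rm *v dv r w) \<bullet> dv r w)"
 unfolding dev_def by (intro l1proc_inner l2proc_mult l2proc_diff XP YP uP l2proc_const_vec)

lemma hform_l1: "l1proc T (%r w. hform (Y r w) (X r w - Y r w))"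
 unfolding hform_def by (intro l1proc_add l1proc_cmult l1proc_inner l2proc_mult l2proc_diff XP YP l2proc_const_vec)

lemma gform_l1: "l1proc T (%r w. gform (X r w) (Y r w) (a r w) (c r w) (g r w) (gh r w))"
 unfolding gform_def by (intro l1proc_add l1proc_cmult l1proc_inner l2proc_mult XP YP aP cP gP ghP l2proc_const_vec)

lemma form_integrable: "sq_int M U ==> integrable M (%w. ((N :: real^'n^'n) *v U w) \<bullet> U w)"
 by (rule sq_int_inner[OF sq_int_linear[OF _ lin]])

lemma hform_integrable: "t \<in> {0..T} ==> integrable M (%w. hform (Y t w) (X t w - Y t w))"
 unfolding hform_def
 by (intro Bochner_Integration.integrable_add integrable_mult_right form_integrable sq_int_diff sq_XY sq_int_inner[OF sq_int_const[OF finite_measure_axioms]])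

text \<open>The potential is rewritten as a form in \<open>X\<close> plus a form in
  \<open>Y\<close>, since identities are at hand for each separately; the difference is a pairing of
  \<open>X - Y\<close> with a function of \<open>Y\<close> and has expectation zero.\<close>

lemma pot_identity:
 assumes t: "t \<in> {0..T}"
 shows "pot t - pot 0 = tint 0 t (%r w. gform (X r w) (Y r w) (a r w) (c r w) (g r w) (gh r w))"
proof -
 let ?k1 = "%r w. 2 * ((P *v X r w) \<bullet> a r w) + (P *v c r w) \<bullet> c r w + (P *v g r w) \<bullet> g r w + 2 * (p \<bullet> a r w)"
 let ?k2 = "%r w. 2 * (((\<Lambda> - P) *v Y r w) \<bullet> a r w) + ((\<Lambda> - P) *v gh r w) \<bullet> gh r w"
 have tT: "t <= T" "0 \<in> {0..T}" using t T by auto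
 have l: "l1proc T ?k1" "l1proc T ?k2"
  by (intro l1proc_add l1proc_cmult l1proc_inner l2proc_mult XP YP aP cP gP ghP l2proc_const_vec)+
 have s2: "((\<Lambda> - P) *v x) \<bullet> y = ((\<Lambda> - P) *v y) \<bullet> x" for x y
  using syms(1,2)[of x y] by (simp add: matrix_vector_mult_diff_rdistrib inner_diff_left)
 have pot: "pot s = (\<integral>w. (P *v X s w) \<bullet> X s w + 2 * (p \<bullet> X s w) \<partial>M) + (\<integral>w. ((\<Lambda> - P) *v Y s w) \<bullet> Y s w \<partial>M)"
  if s: "s \<in> {0..T}" for s
 proof -
  have L: "bounded_linear (%y. 2 *\<^sub>R (P *v y))" by (intro bounded_linear_const_scaleR lin)
  have e: "(P *v x) \<bullet> x + 2 * (p \<bullet> x) + ((\<Lambda> - P) *v y) \<bullet> y = hform y (x - y) + (x - y) \<bullet> (2 *\<^sub>R (P *v y) + 2 *\<^sub>R p)" for x y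
   unfolding hform_def using syms(1)[of x y]
   by (simp add: mult_distribs inner_commute[of _ p] inner_commute[of x "P *v y"] inner_commute[of y "P *v y"] algebra_simps)
  have "(\<integral>w. (P *v X s w) \<bullet> X s w + 2 * (p \<bullet> X s w) \<partial>M) + (\<integral>w. ((\<Lambda> - P) *v Y s w) \<bullet> Y s w \<partial>M)
    = (\<integral>w. (P *v X s w) \<bullet> X s w + 2 * (p \<bullet> X s w) + ((\<Lambda> - P) *v Y s w) \<bullet> Y s w \<partial>M)"
   by (rule Bochner_Integration.integral_add[symmetric])
    (intro Bochner_Integration.integrable_add integrable_mult_right form_integrable sq_XY s sq_int_inner[OF sq_int_const[OF finite_measure_axioms]])+
  also have "\<dots> = pot s"
   unfolding e using hform_integrable[OF s] cross_zero[OF L s, of "2 *\<^sub>R p"] by simp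
  finally show ?thesis by simp
 qed
 have "pot t - pot 0 = tint 0 t ?k1 + tint 0 t ?k2"
  using X_form[OF lin syms(1) t, of p] Y_form[OF lin s2 t] pot[OF t] pot[OF tT(2)] by linarith
 also have "\<dots> = tint 0 t (%r w. ?k1 r w + ?k2 r w)" by (rule tint_add(1)[OF l order_refl tT(1), symmetric])
 also have "(%r w. ?k1 r w + ?k2 r w) = (%r w. gform (X r w) (Y r w) (a r w) (c r w) (g r w) (gh r w))"
  by (simp add: gform_def fun_eq_iff)
 finally show ?thesis .
qed

lemma pot_continuous: "continuous_on {0..T} pot"
proof -
 have "continuous_on {0..T} (%t. pot 0 + (LBINT r:{0<..t}. \<integral>w. gform (X r w) (Y r w) (a r w) (c r w) (g r w) (gh r w) \<partial>M))"
  by (intro continuous_on_add continuous_on_const continuous_on_set_integral_Ioc tint_eq(1)[OF gform_l1]) auto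
 then show ?thesis
  by (rule continuous_on_eq) (use pot_identity tint_eq(2)[OF gform_l1 order_refl] in fastforce)
qed

lemma tint_const: "0 <= s ==> s <= t ==> t <= T ==> tint s t (%_ _. k) = (t - s) * k"
 using tint_eq(2)[OF l1proc_const[OF T], of s t k] by (simp add: prob_space set_integral_const_Ioc)

lemma cost_formula:
 assumes t: "t \<in> {0..T}"
 shows "tint 0 t cost = ergodic_const K P \<Lambda> p * t + pot 0 - pot t + tint 0 t (%r w. (Rm *v dv r w) \<bullet> dv r w)"
proof -
 obtain L k where L: "bounded_linear L" and
  id: "!!y z u. gform (y + z) y (cA K *v z + hA K *v y + cB K *v u + cb K) (cC K *v z + hC K *v y + cD K *v u + csig K)
    (cG K *v z + (hG K *v y + cgam K)) (hG K *v y + cgam K) + running_cost K (y + z) y u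
   = ergodic_const K P \<Lambda> p + (Rm *v dev (y + z) y u) \<bullet> dev (y + z) y u + z \<bullet> (L y + k)"
  using cost_identity by blast
 have tT: "0 <= t" "t <= T" using t by auto
 have pw: "gform (X r w) (Y r w) (a r w) (c r w) (g r w) (gh r w) + cost r w =
   (ergodic_const K P \<Lambda> p + (Rm *v dv r w) \<bullet> dv r w) + (X r w - Y r w) \<bullet> (L (Y r w) + k)" for r w
 proof -
  have e: "a r w = cA K *v (X r w - Y r w) + hA K *v Y r w + cB K *v u r w + cb K"
   "c r w = cC K *v (X r w - Y r w) + hC K *v Y r w + cD K *v u r w + csig K"
   "g r w = cG K *v (X r w - Y r w) + (hG K *v Y r w + cgam K)"
   by (simp_all add: a_eq c_eq g_eq hA_def hC_def hG_def mult_distribs)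
  show ?thesis unfolding e gh_eq using id[of "Y r w" "X r w - Y r w" "u r w"] by simp
 qed
 note l = l1proc_const[OF T, of "ergodic_const K P \<Lambda> p"]
 have "pot t - pot 0 + tint 0 t cost = tint 0 t (%r w. gform (X r w) (Y r w) (a r w) (c r w) (g r w) (gh r w) + cost r w)"
  unfolding pot_identity[OF t] by (rule tint_add(1)[OF gform_l1 cost_l1 order_refl tT(2), symmetric])
 also have "\<dots> = tint 0 t (%r w. ergodic_const K P \<Lambda> p + (Rm *v dv r w) \<bullet> dv r w)"
  unfolding pw tint_add(1)[OF l1proc_add[OF l dev_l1] cross_tint(1)[OF L order_refl tT(2)] order_refl tT(2)]
  by (simp add: cross_tint(2)[OF L order_refl tT(2)])
 also have "\<dots> = t * ergodic_const K P \<Lambda> p + tint 0 t (%r w. (Rm *v dv r w) \<bullet> dv r w)"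
  unfolding tint_add(1)[OF l dev_l1 order_refl tT(2)] using tT by (simp add: tint_const)
 finally show ?thesis by (simp add: mult.commute)
qed

lemma total_cost_eq: "total_cost K M T X Y u = tint 0 T cost"
 by (simp add: total_cost_def set_integral_Icc_Ioc tint_eq(3)[OF cost_l1])

lemma dev_nonneg: "t <= T ==> 0 <= tint 0 t (%r w. (Rm *v dv r w) \<bullet> dv r w)"
 unfolding tint_def by (rule integral_nonneg_AE, rule AE_I2) (auto simp: cut_def intro!: mult_nonneg_nonneg pos_def_mat_nonneg[OF Rm])

lemma pot_lower: "(!!y z. - k <= hform y z) ==> t \<in> {0..T} ==> - k <= pot t"
 using integral_ge_const[of "%w. hform (Y t w) (X t w - Y t w)" "- k"] hform_integrable[of t] by simp

text \<open>After the last time at which the potential is at most \<open>b\<close>, the expected running cost exceeds the ergodic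
 constant; before that time the cost formula applies.\<close>

lemma total_cost_lower:
 assumes h: "!!y z. - k <= hform y z" and \<delta>: "0 < \<delta>" and L: "bounded_linear L"
  and f: "!!y z u. \<delta> * hform y z - k' + z \<bullet> (L y + v) <= running_cost K (y + z) y u"
  and b: "b = (ergodic_const K P \<Lambda> p + k') / \<delta>"
 shows "ergodic_const K P \<Lambda> p * T - (\<bar>k\<bar> + \<bar>b\<bar>) <= total_cost K M T X Y u"
proof -
 let ?c = "ergodic_const K P \<Lambda> p"
 \<comment> \<open>\<open>b\<close> is chosen such that \<open>\<delta> * b - k'\<close> is the
   ergodic constant; the cross term of \<open>f\<close> integrates to zero.\<close>
 have late: "(T - s) * ?c <= tint s T cost" if s: "0 <= s" "s <= T" "!!r. r \<in> {s<..T} ==> b <= pot r" for s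
 proof -
  have pw: "\<delta> * hform (Y r w) (X r w - Y r w) - k' + (X r w - Y r w) \<bullet> (L (Y r w) + v) <= cost r w" for r w
   using f[of "Y r w" "X r w - Y r w" "u r w"] by simp
  note hl = l1proc_cmult[OF hform_l1, of \<delta>] l1proc_const[OF T, of k']
  have "(T - s) * b = (LBINT r:{s<..T}. b)" using s by (simp add: set_integral_const_Ioc)
  also have "\<dots> <= (LBINT r:{s<..T}. pot r)"
   by (rule set_integral_mono[OF set_integrable_const_Ioc tint_eq(1)[OF hform_l1 s(1) order_refl] s(3)])
  also have "\<dots> = tint s T (%r w. hform (Y r w) (X r w - Y r w))" by (rule tint_eq(2)[OF hform_l1 s(1) order_refl, symmetric])
  finally have "\<delta> * ((T - s) * b) <= \<delta> * tint s T (%r w. hform (Y r w) (X r w - Y r w))" using \<delta> by simp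
  moreover have "\<delta> * ((T - s) * b) = (T - s) * ?c + (T - s) * k'" using \<delta> unfolding b by (simp add: field_simps)
  ultimately have "(T - s) * ?c <= tint s T (%r w. \<delta> * hform (Y r w) (X r w - Y r w) - k' + (X r w - Y r w) \<bullet> (L (Y r w) + v))"
   unfolding tint_add(1)[OF l1proc_diff[OF hl] cross_tint(1)[OF L s(1) order_refl] s(1) order_refl] tint_add(2)[OF hl s(1) order_refl]
    tint_cmult tint_const[OF s(1,2) order_refl] cross_tint(2)[OF L s(1) order_refl] by simp
  also have "\<dots> <= tint s T cost"
   by (rule tint_mono[OF l1proc_add[OF l1proc_diff[OF hl] cross_tint(1)[OF L s(1) order_refl]] cost_l1 s(1) order_refl pw])
  finally show ?thesis .
 qed
 define S where "S = {t \<in> {0..T}. pot t <= b}"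
 show ?thesis
 proof (cases "S = {}")
  case True
  \<comment> \<open>If the potential never gets that low, the late estimate covers the whole
    interval.\<close>
  then have "T * ?c <= tint 0 T cost" using late[of 0] T by (force simp: S_def)
  then show ?thesis unfolding total_cost_eq by (simp add: mult.commute)
 next
  case False
  \<comment> \<open>Continuity of the potential makes \<open>S\<close> compact, so a last such time
    exists.\<close>
  have "S = {0..T} \<inter> pot -` {..b}" by (auto simp: S_def)
  then have "closed S" using continuous_closed_preimage[OF pot_continuous, of "{..b}"] by simp
  moreover have "bounded S" by (rule bounded_subset[OF bounded_closed_interval[of 0 T]]) (auto simp: S_def)
  ultimately have "compact S" by (simp add: compact_eq_bounded_closed)
  then obtain s where s: "s \<in> S" "!!t. t \<in> S ==> t <= s" using compact_attains_sup[OF _ False] by blast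
  then have sT: "0 <= s" "s <= T" "s \<in> {0..T}" and ps: "pot s <= b" by (auto simp: S_def)
  have "b <= pot r" if "r \<in> {s<..T}" for r
  proof (rule ccontr)
   assume "\<not> b <= pot r"
   then have "r \<in> S" using that sT by (simp add: S_def)
   then show False using s(2)[of r] that by simp
  qed
  then have "(T - s) * ?c <= tint s T cost" by (rule late[OF sT(1,2)])
  then show ?thesis
   unfolding total_cost_eq tint_split[OF cost_l1 sT(1,2) order_refl] cost_formula[OF sT(3)]
   \<comment> \<open>Up to \<open>s\<close> the deviation term is nonnegative, and
     \<open>pot 0 - pot s\<close> is at least \<open>- k - b\<close>.\<close>
   using dev_nonneg[OF sT(2)] pot_lower[OF h, of 0] T ps by (simp add: algebra_simps)
 qed
qed

text \<open>Without deviation only the initial and the terminal potential remain. The factor 5 is 2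
  for \<open>X\<close> plus 3 for \<open>Y\<close>, from splitting the square of
  \<open>X - Y\<close>; contraction then replaces \<open>Y\<close> by \<open>X\<close>.\<close>

lemma total_cost_upper:
 assumes h: "!!y z. - k <= hform y z" and h': "!!y z. hform y z <= k' * ((norm z)^2 + (norm y)^2 + 1)" "0 <= k'"
  and d: "!!t w. 0 <= t ==> w \<in> space M ==> dv t w = 0"
 shows "total_cost K M T X Y u <= ergodic_const K P \<Lambda> p * T + (k' * (5 * msq X 0 + 1) + k)"
proof -
 have T0: "0 \<in> {0..T}" "T \<in> {0..T}" using T by auto
 have z: "tint 0 T (%r w. (Rm *v dv r w) \<bullet> dv r w) = 0"
  unfolding tint_def by (rule integral_eq_zero_AE, rule AE_I2) (auto simp: cut_def indicator_def space_pair_measure d)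
 have n: "hform y (x - y) <= k' * (2 * (norm x)^2 + 3 * (norm y)^2 + 1)" for x y
 proof -
  have "0 <= (norm (x + y))^2" by simp
  then have "(norm (x - y))^2 <= 2 * (norm x)^2 + 2 * (norm y)^2"
   unfolding power2_norm_eq_inner by (simp add: inner_simps inner_commute)
  then have "k' * ((norm (x - y))^2 + (norm y)^2 + 1) <= k' * (2 * (norm x)^2 + 3 * (norm y)^2 + 1)"
   by (intro mult_left_mono h'(2)) simp
  then show ?thesis using h'(1)[of y "x - y"] by simp
 qed
 have i: "integrable M (%w. (norm (X 0 w))^2)" "integrable M (%w. (norm (Y 0 w))^2)"
  using sq_XY[OF T0(1)] by (auto simp: sq_int_def)
 have "pot 0 <= (\<integral>w. k' * (2 * (norm (X 0 w))^2 + 3 * (norm (Y 0 w))^2 + 1) \<partial>M)"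
  by (rule integral_mono[OF hform_integrable[OF T0(1)]]) (use i n in auto)
 also have "\<dots> = k' * (2 * msq X 0 + 3 * msq Y 0 + 1)" using i by (simp add: prob_space)
 also have "\<dots> <= k' * (5 * msq X 0 + 1)"
  using power_mono[OF is_cm_l2_le[OF Y[OF T0(1)] subalg_H] l2_nonneg, of 2] h'(2) by (intro mult_left_mono) (simp_all add: l2_sq)
 finally have "pot 0 <= k' * (5 * msq X 0 + 1)" .
 then show ?thesis
  unfolding total_cost_eq cost_formula[OF T0(2)] z using pot_lower[OF h T0(2)] by simp
qed

end

section \<open>Bounds uniform in the horizon and in the control\<close>

locale mf_problem = stationary K P \<Lambda> p + mean_field_basis M F0 W W0
 for K :: "('n::finite, 'm::finite) mf_coeffs" and P \<Lambda> p and M F0 :: "'a measure" and W W0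
begin

lemma mf_solutionI:
 assumes T: "0 < T" and \<xi>: "sq_int M \<xi>" and u: "u \<in> L2_prog M F T" and m: "mf_state K M F0 W W0 T \<xi> u X Y"
 obtains a c g I I0 gh C where "mf_solution K P \<Lambda> p M F0 W W0 T X a c g I I0 Y gh C u" "AE w in M. X 0 w = \<xi> w"
proof -
 obtain I I0 C where s: "cm_sys M F0 W W0 T X (%t w. cA K *v X t w + cAb K *v Y t w + cB K *v u t w + cb K)
    (%t w. cC K *v X t w + cCb K *v Y t w + cD K *v u t w + csig K)
    (%t w. cG K *v X t w + cGb K *v Y t w + cgam K) I I0 Y (%t w. hG K *v Y t w + cgam K) C"
   and x: "AE w in M. X 0 w = \<xi> w" using mf_state_sys[OF T \<xi> m] by blast
 show ?thesis
  by (rule that[OF _ x], rule mf_solution.intro[OF stationary_axioms s], unfold_locales)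
   (use L2_prog_l2proc[OF u subalg_F] in auto)
qed

text \<open>One \<open>C\<close> is possible because its ingredients, the bounds on
  \<open>hform\<close> and the coercivity of the running cost, depend on the stationary data alone.
  The initial state enters through its second moment only.\<close>

lemma cost_bounds:
 obtains C where "!!T \<xi> u X Y. 0 < T ==> sq_int M \<xi> ==> u \<in> L2_prog M F T ==> mf_state K M F0 W W0 T \<xi> u X Y ==>
   ergodic_const K P \<Lambda> p * T - C <= total_cost K M T X Y u"
  "!!T \<xi> u X Y. 0 < T ==> sq_int M \<xi> ==> u \<in> L2_prog M F T ==> mf_state K M F0 W W0 T \<xi> u X Y ==>
   (!!t w. 0 <= t ==> w \<in> space M ==> dev (X t w) (Y t w) (u t w) = 0) ==>
   total_cost K M T X Y u <= ergodic_const K P \<Lambda> p * T + C * ((\<integral>w. (norm (\<xi> w))^2 \<partial>M) + 1)"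
proof -
 obtain k where k: "!!y z. - k <= hform y z" using hform_lower by blast
 obtain k' where k': "0 < k'" "!!y z. hform y z <= k' * ((norm z)^2 + (norm y)^2 + 1)" using hform_upper by blast
 obtain \<delta> k'' L v where f: "0 < \<delta>" "bounded_linear L"
  "!!y z u. \<delta> * hform y z - k'' + z \<bullet> (L y + v) <= running_cost K (y + z) y u"
  using running_cost_lower by metis
 define b where "b = (ergodic_const K P \<Lambda> p + k'') / \<delta>"
 define C where "C = \<bar>k\<bar> + \<bar>b\<bar> + 5 * k'"
 show ?thesis
 proof (rule that[of C])
  fix T \<xi> u X Y assume A: "0 < T" "sq_int M \<xi>" "u \<in> L2_prog M F T" "mf_state K M F0 W W0 T \<xi> u X Y"
  obtain a c g I I0 gh C1 where s: "mf_solution K P \<Lambda> p M F0 W W0 T X a c g I I0 Y gh C1 u"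
   and x: "AE w in M. X 0 w = \<xi> w" using mf_solutionI[OF A] by blast
  interpret s: mf_solution K P \<Lambda> p M F0 W W0 T X a c g I I0 Y gh C1 u by (rule s)
  show "ergodic_const K P \<Lambda> p * T - C <= total_cost K M T X Y u"
   using s.total_cost_lower[OF k f b_def] k'(1) by (simp add: C_def)
  assume d: "!!t w. 0 <= t ==> w \<in> space M ==> dev (X t w) (Y t w) (u t w) = 0"
  have "s.msq X 0 = (\<integral>w. (norm (\<xi> w))^2 \<partial>M)"
   by (rule integral_cong_AE) (use x A(2) s.X(1)[of 0] A(1) in \<open>auto simp: sq_int_def\<close>)
  then have "total_cost K M T X Y u <= ergodic_const K P \<Lambda> p * T + (k' * (5 * (\<integral>w. (norm (\<xi> w))^2 \<partial>M) + 1) + k)"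
   using s.total_cost_upper[OF k k'(2) _ d] k'(1) by simp
  moreover have "k' * (5 * e + 1) + k <= C * (e + 1)" if "0 <= e" for e
  proof -
   have "0 <= (\<bar>k\<bar> + \<bar>b\<bar>) * e" using that by simp
   then show ?thesis using k'(1) unfolding C_def by (simp add: algebra_simps)
  qed
  moreover have "0 <= (\<integral>w. (norm (\<xi> w))^2 \<partial>M)" by simp
  ultimately show "total_cost K M T X Y u <= ergodic_const K P \<Lambda> p * T + C * ((\<integral>w. (norm (\<xi> w))^2 \<partial>M) + 1)"
   by (meson add_left_mono order_trans)
 qed
qed

end

section \<open>Existence of a closed-loop solution\<close>

text \<open>The bound is asserted for all larger constants so that drift and both noise coefficients
  can share one.\<close>

lemma affine_sq_lip:
 fixes L :: "'b::euclidean_space => 'b"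
 assumes "bounded_linear L"
 obtains \<kappa> where "1 <= \<kappa>" "!!\<kappa>'. \<kappa> <= \<kappa>' ==> sq_lip \<kappa>' (%z. L z + v)"
proof -
 interpret L: bounded_linear L by fact
 obtain B where B: "!!x. norm (L x) <= norm x * B" using L.bounded by blast
 have b: "(norm (L x))^2 <= B^2 * (norm x)^2" for x
  using power_mono[OF B[of x], of 2] by (simp add: power_mult_distrib mult.commute)
 have s: "(norm (x + y))^2 <= 2 * (norm x)^2 + 2 * (norm y)^2" for x y :: 'b
 proof -
  have "0 <= (norm (x - y))^2" by simp
  then show ?thesis unfolding power2_norm_eq_inner by (simp add: inner_simps inner_commute)
 qed
 show ?thesis
 proof (rule that[of "1 + 2 * B^2 + 2 * (norm v)^2"])
  fix \<kappa> assume k: "1 + 2 * B^2 + 2 * (norm v)^2 <= \<kappa>"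
  have m: "c * e <= \<kappa> * e" if "c <= 2 * B^2 + 2 * (norm v)^2" "0 <= e" for c e
   using k that by (intro mult_right_mono) auto
  show "sq_lip \<kappa> (%z. L z + v)"
   unfolding sq_lip_def
  proof (intro conjI allI)
   fix x y
   have "(norm (L x + v - (L y + v)))^2 <= B^2 * (norm (x - y))^2" using b[of "x - y"] by (simp add: L.diff)
   also have "\<dots> <= \<kappa> * (norm (x - y))^2" by (intro m) auto
   finally show "(norm (L x + v - (L y + v)))^2 <= \<kappa> * (norm (x - y))^2" .
   have "(norm (L x + v))^2 <= 2 * B^2 * (norm x)^2 + 2 * (norm v)^2 * 1" using s[of "L x" v] b[of x] by simp
   also have "\<dots> <= \<kappa> * (norm x)^2 + \<kappa> * 1" by (intro add_mono m) auto
   finally show "(norm (L x + v))^2 <= \<kappa> * (1 + (norm x)^2)" by (simp add: distrib_left add.commute)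
  qed
 qed simp
qed

context mean_field_basis
begin

lemma L2_prog_affine:
 assumes Z: "Z \<in> L2_prog M F T" and L: "bounded_linear L" and T: "0 <= T"
 shows "(%t w. L (Z t w) + v) \<in> L2_prog M F T"
proof -
 have "progressive F T (%t w. L (Z t w) + v)"
  unfolding progressive_def
 proof
  fix t assume "t \<in> {0..T}"
  then have "(%x. Z (fst x) (snd x)) \<in> borel_measurable (restrict_space borel {0..t} \<Otimes>\<^sub>M F t)"
   using Z by (simp add: L2_prog_def progressive_def case_prod_beta')
  from measurable_compose[OF this borel_measurable_continuous_onI[OF linear_continuous_on[OF L]]]
  show "(%(s, w). L (Z s w) + v) \<in> borel_measurable (restrict_space borel {0..t} \<Otimes>\<^sub>M F t)"
   unfolding case_prod_beta' by measurable
 qed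
 moreover have "l2proc M T (%t w. L (Z t w) + v)"
  by (intro l2proc_add l2proc_linear[OF L2_prog_l2proc[OF Z subalg_F] L] l2proc_const[OF sq_int_const[OF finite_measure_axioms] T])
 ultimately show ?thesis by (simp add: L2_prog_def energy_l2proc)
qed

lemma L2_prog_linear: "Z \<in> L2_prog M F T ==> bounded_linear L ==> 0 <= T ==> (%t w. L (Z t w)) \<in> L2_prog M F T"
 using L2_prog_affine[of Z T L 0] by simp

end

context euler_scheme
begin

lemma sol_ito:
 assumes L: "bounded_linear L"
 shows "is_ito_integral M F W T (%t w. L (fc (sol t w))) (%t w. L (lim_SI W fc t w))" (is ?g1)
  "is_ito_integral M F W0 T (%t w. L (fg (sol t w))) (%t w. L (lim_SI W0 fg t w))" (is ?g2)
proof -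
 interpret sw: mean_field_basis M F0 W0 W by (rule swap)
 interpret L: bounded_linear L by fact
 have T0: "0 <= T" using T by simp
 have m: "(%w. L (U w)) \<in> borel_measurable G" if "U \<in> borel_measurable G" for U and G :: "'a measure"
  using measurable_compose[OF that borel_measurable_continuous_onI[OF linear_continuous_on[OF L]]] .
 have c: "continuous_on {0..T} (%t. L (lim_SI V f t w))" if "continuous_on {0..T} (%t. lim_SI V f t w)" for V f w
  by (rule L.continuous_on[OF that])
 have li: "(%n. l2 M (%w. simple_integral V (4 ^ n) (tm n) (%k w. L (f (node n k w))) t w - L (lim_SI V f t w))) \<longlonglongrightarrow> 0"
  if "!!n. sq_int M (SI V f n t)" "sq_int M (lim_SI V f t)" "(%n. l2 M (%w. SI V f n t w - lim_SI V f t w)) \<longlonglongrightarrow> 0" for V f t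
  using l2_tendsto_linear[OF L sq_int_diff[OF that(1,2)] that(3)] by (simp add: linear_image(1)[OF L] L.diff SI_def)
 have lp: "(%n. l2 (lborel \<Otimes>\<^sub>M M) (%x. cut 0 T (simple_proc (4 ^ n) (tm n) (%k w. L (f (node n k w)))) x - cut 0 T (%t w. L (f (sol t w))) x)) \<longlonglongrightarrow> 0"
  if f: "sq_lip \<kappa> f" for f
 proof -
  have "sq_int (lborel \<Otimes>\<^sub>M M) (%x. cut 0 T (simple_proc (4 ^ n) (tm n) (%k w. f (node n k w))) x - cut 0 T (%t w. f (sol t w)) x)" for n
   by (rule sq_int_diff[OF cut_simple_integral_sq(1)[OF node_data[OF f] order_refl T0] step_l2(1)[OF f, unfolded l2proc_def]])
  from l2_tendsto_linear[OF L this step_l2(2)[OF f]] show ?thesis by (simp add: linear_image(2,3)[OF L] L.diff)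
 qed
 have e: "sq_int M (SI W fc n t)" "sq_int M (SI W0 fg n t)" if "t \<in> {0..T}" for n t
  using SI_props[OF lip(2), of t] SI_props[OF lip(3), of t] that by auto
 show ?g1
  by (rule is_ito_integralI[OF T linear_image(4)[OF L node_data[OF lip(2)]] _ L2_prog_linear[OF step_l2(3)[OF lip(2)] L T0]
    m[OF lim_SI_F(1)] sq_int_linear[OF SI_limits(1) L] _ li[OF e(1) SI_limits(1,2)] lp[OF lip(2)]])
   (auto simp: tm_simps intro!: c lim_SI_cont)
 show ?g2
  by (rule sw.is_ito_integralI[OF T sw.linear_image(4)[OF L W0_data(2)[OF lip(3)]] _ _ _ sq_int_linear[OF SI_limits(3) L] _
    li[OF e(2) SI_limits(3,4)] lp[OF lip(3)], unfolded swF])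
   (auto simp: tm_simps intro!: c lim_SI_cont m[OF lim_SI_F(2)] L2_prog_linear[OF step_l2(3)[OF lip(3)] L T0])
qed

end

context mf_problem
begin

text \<open>The state equation contains its own conditional mean. Under the feedback this mean
  should satisfy a closed equation driven by \<open>W0\<close> alone, so the pair is solved as one
  equation in twice the dimension, and \<open>sol_cm\<close> then identifies the second component as
  the conditional mean.\<close>

lemma closed_loop_exists:
 assumes T: "0 < T" and \<xi>: "sq_int M \<xi>" "\<xi> \<in> borel_measurable F0"
 obtains u X Y where "u \<in> L2_prog M F T" "mf_state K M F0 W W0 T \<xi> u X Y" "!!t w. dev (X t w) (Y t w) (u t w) = 0"
proof -
 define y0 where "y0 w = (\<chi> i. real_cond_exp M (H 0) (%w. \<xi> w $ i) w)" for w
 define x0 where "x0 w = (\<xi> w, y0 w)" for w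
 \<comment> \<open>The second component is the first with the state replaced by its mean: the
   deviation disappears, and the plain and barred matrices merge into \<open>hA\<close>.\<close>
 define La where "La z = (cA K *v fst z + cAb K *v snd z + cB K *v (Th *v (fst z - snd z) + Tm *v snd z),
   hA K *v snd z + cB K *v (Tm *v snd z))" for z :: "(real^'n) \<times> (real^'n)"
 \<comment> \<open>The mean receives no \<open>W\<close>-noise, hence 0 in the second
   component.\<close>
 define Lc where "Lc z = (cC K *v fst z + cCb K *v snd z + cD K *v (Th *v (fst z - snd z) + Tm *v snd z), 0 :: real^'n)"
  for z :: "(real^'n) \<times> (real^'n)"
 define Lg where "Lg z = (cG K *v fst z + cGb K *v snd z, hG K *v snd z)" for z :: "(real^'n) \<times> (real^'n)"
 define va where "va = (cB K *v th + cb K, cB K *v th + cb K)"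
 define vc where "vc = (cD K *v th + csig K, 0 :: real^'n)"
 define vg where "vg = (cgam K, cgam K)"
 have L: "bounded_linear La" "bounded_linear Lc" "bounded_linear Lg"
  unfolding La_def[abs_def] Lc_def[abs_def] Lg_def[abs_def]
  by (intro bounded_linear_Pair bounded_linear_add bounded_linear_mult bounded_linear_sub bounded_linear_fst bounded_linear_snd bounded_linear_zero)+
 obtain \<kappa> where k: "1 <= \<kappa>" "sq_lip \<kappa> (%z. La z + va)" "sq_lip \<kappa> (%z. Lc z + vc)" "sq_lip \<kappa> (%z. Lg z + vg)"
 proof -
  obtain k1 k2 k3 where "1 <= k1" "!!\<kappa>'. k1 <= \<kappa>' ==> sq_lip \<kappa>' (%z. La z + va)" "1 <= k2" "!!\<kappa>'. k2 <= \<kappa>' ==> sq_lip \<kappa>' (%z. Lc z + vc)"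
   "1 <= k3" "!!\<kappa>'. k3 <= \<kappa>' ==> sq_lip \<kappa>' (%z. Lg z + vg)"
   using affine_sq_lip[OF L(1), of va] affine_sq_lip[OF L(2), of vc] affine_sq_lip[OF L(3), of vg] by metis
  then show ?thesis by (intro that[of "k1 + k2 + k3"]) auto
 qed
 have y0H: "y0 \<in> borel_measurable (H 0)"
  unfolding borel_measurable_euclidean_space[of y0]
  by (auto simp: y0_def[abs_def] Basis_vec_def inner_axis borel_measurable_cond_exp)
 have cm0: "is_cm M (H 0) \<xi> y0"
  by (rule is_cmI_real_cond_exp[OF \<xi>(1) y0H subalg_H]) (auto simp: y0_def Basis_vec_def inner_axis)
 have \<xi>F: "\<xi> \<in> borel_measurable (F 0)" using \<xi>(2) F0_le_F[of 0] subF0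
  by (intro measurable_from_subalg[OF _ \<xi>(2)]) (auto simp: subalgebra_def)
 have x0: "sq_int M x0" "x0 \<in> borel_measurable (F 0)"
 proof -
  have "sq_int M (%w. (\<xi> w, 0) + (0, y0 w))"
   using cm0 by (intro sq_int_add sq_int_linear[where L = "%x. (x, 0)"] sq_int_linear[where L = "%y. (0, y)"]
    bounded_linear_Pair bounded_linear_ident bounded_linear_zero) (auto simp: is_cm_def)
  then show "sq_int M x0" by (simp add: x0_def[abs_def])
  show "x0 \<in> borel_measurable (F 0)" unfolding x0_def[abs_def] by (intro borel_measurable_Pair \<xi>F meas_H_F[OF y0H])
 qed
 interpret e: euler_scheme M F0 W W0 T \<kappa> "%z. La z + va" "%z. Lc z + vc" "%z. Lg z + vg" x0
  by unfold_locales (rule T k x0)+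
 define X where "X t w = fst (e.sol t w)" for t w
 define Y where "Y t w = snd (e.sol t w)" for t w
 define u where "u t w = (Th *v (X t w - Y t w) + Tm *v Y t w) + th" for t w
 have T0: "0 <= T" using T by simp
 \<comment> \<open>With \<open>\<kappa>\<close> at least 1 the identity is admissible as well, and
   \<open>step_l2\<close> then gives square-integrability of the solution itself.\<close>
 have "sq_lip \<kappa> (%z :: (real^'n) \<times> (real^'n). z)"
  unfolding sq_lip_def
 proof (intro conjI allI)
  fix x y :: "(real^'n) \<times> (real^'n)"
  show "(norm (x - y))^2 <= \<kappa> * (norm (x - y))^2" using mult_right_mono[OF k(1), of "(norm (x - y))^2"] by simp
  show "(norm x)^2 <= \<kappa> * (1 + (norm x)^2)" using mult_right_mono[OF k(1), of "1 + (norm x)^2"] by simp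
 qed
 then have solL: "e.sol \<in> L2_prog M F T" using e.step_l2(3)[of "%z. z"] by simp
 have cm: "is_cm M (H t) (X t) (Y t)" if t: "t \<in> {0..T}" for t
  unfolding X_def Y_def
 proof (rule e.sol_cm[OF bounded_linear_fst bounded_linear_snd _ _ _ _ t])
  show "is_cm M (H 0) (%w. fst (x0 w)) (%w. snd (x0 w))" using cm0 by (simp add: x0_def)
  show "snd (Lc x + vc) = 0" for x by (simp add: Lc_def vc_def)
  fix s and z :: "'a => (real^'n) \<times> (real^'n)"
  assume c: "is_cm M (H s) (%w. fst (z w)) (%w. snd (z w))"
  have c': "is_cm M (H s) (%w. snd (z w)) (%w. snd (z w))" by (rule is_cm_self) (use c in \<open>auto simp: is_cm_def\<close>)
  have k': "is_cm M (H s) (%_. v) (%_. v)" for v :: "real^'n" by (rule is_cm_self[OF sq_int_const[OF finite_measure_axioms]]) simp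
  have m: "is_cm M (H s) (%w. N *v U w) (%w. N *v V w)" if "is_cm M (H s) U V" for N :: "real^'k^'l" and U V
   by (rule is_cm_linear[OF that matrix_vector_mul_bounded_linear subalg_H])
  have "is_cm M (H s) (%w. cA K *v fst (z w) + cAb K *v snd (z w) + cB K *v (Th *v (fst (z w) - snd (z w)) + Tm *v snd (z w)) + fst va)
   (%w. cA K *v snd (z w) + cAb K *v snd (z w) + cB K *v (Th *v (snd (z w) - snd (z w)) + Tm *v snd (z w)) + fst va)"
   by (intro is_cm_add is_cm_diff m c c' k' subalg_H)
  then show "is_cm M (H s) (%w. fst (La (z w) + va)) (%w. snd (La (z w) + va))"
   by (simp add: La_def va_def hA_def matrix_vector_mult_add_rdistrib)
  have "is_cm M (H s) (%w. cG K *v fst (z w) + cGb K *v snd (z w) + cgam K) (%w. cG K *v snd (z w) + cGb K *v snd (z w) + cgam K)"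
   by (intro is_cm_add m c c' k' subalg_H)
  then show "is_cm M (H s) (%w. fst (Lg (z w) + vg)) (%w. snd (Lg (z w) + vg))"
   by (simp add: Lg_def vg_def hG_def matrix_vector_mult_add_rdistrib)
 qed
 have "cond_mean_process M W0 T X Y"
  unfolding cond_mean_process_def
 proof (intro conjI ballI)
  show "progressive H T Y"
  proof (rule progressive_continuous)
   show "Y s \<in> borel_measurable (H t)" if "0 <= s" "s <= t" "t <= T" for s t
    by (rule meas_H_mono[OF _ that(2)]) (use cm[of s] that in \<open>simp add: is_cm_def\<close>)
   show "continuous_on {0..T} (%t. Y t w)" for w unfolding Y_def by (intro continuous_on_snd e.sol_cont)
  qed
  fix t assume t: "t \<in> {0..T}"
  have "AE w in M. Y t w $ i = real_cond_exp M (H t) (%w'. X t w' $ i) w" for i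
   using is_cm_AE_real_cond_exp[OF cm[OF t] subalg_H, of "axis i 1"] by eventually_elim (simp add: inner_axis)
  then have "AE w in M. \<forall>i. Y t w $ i = real_cond_exp M (H t) (%w'. X t w' $ i) w" by (simp add: AE_all_countable)
  then show "AE w in M. Y t w = (\<chi> i. real_cond_exp M (H t) (%w'. X t w' $ i) w)"
   by eventually_elim (simp add: vec_eq_iff)
 qed
 moreover have "ito_process M F0 W W0 T \<xi> (%t w. cA K *v X t w + cAb K *v Y t w + cB K *v u t w + cb K)
    (%t w. cC K *v X t w + cCb K *v Y t w + cD K *v u t w + csig K) (%t w. cG K *v X t w + cGb K *v Y t w + cgam K) X"
 proof -
  have eqs: "cA K *v X t w + cAb K *v Y t w + cB K *v u t w + cb K = fst (La (e.sol t w) + va)"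
   "cC K *v X t w + cCb K *v Y t w + cD K *v u t w + csig K = fst (Lc (e.sol t w) + vc)"
   "cG K *v X t w + cGb K *v Y t w + cgam K = fst (Lg (e.sol t w) + vg)" for t w
   by (simp_all add: La_def va_def Lc_def vc_def Lg_def vg_def X_def Y_def u_def matrix_vector_right_distrib)
  have "AE w in M. \<forall>t\<in>{0..T}. X t w = \<xi> w + (LBINT s:{0..t}. fst (La (e.sol s w) + va)) + fst (e.lim_SI W (%z. Lc z + vc) t w)
    + fst (e.lim_SI W0 (%z. Lg z + vg) t w)"
   using e.good_AE
  proof eventually_elim
   case (elim w)
   show ?case
   proof
    fix t assume t: "t \<in> {0..T}"
    have "continuous_on {0..t} (%s. La (e.sol s w) + va)"
     by (intro continuous_on_add continuous_on_const bounded_linear.continuous_on[OF L(1)] continuous_on_subset[OF e.sol_cont]) (use t in auto)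
    then have "set_integrable lborel {0..t} (%s. La (e.sol s w) + va)" by (rule borel_integrable_atLeastAtMost')
    from integral_bounded_linear[OF bounded_linear_fst this[unfolded set_integrable_def]]
    have "fst (LBINT s:{0..t}. La (e.sol s w) + va) = (LBINT s:{0..t}. fst (La (e.sol s w) + va))"
     by (simp add: set_lebesgue_integral_def)
    then show "X t w = \<xi> w + (LBINT s:{0..t}. fst (La (e.sol s w) + va)) + fst (e.lim_SI W (%z. Lc z + vc) t w)
     + fst (e.lim_SI W0 (%z. Lg z + vg) t w)"
     unfolding X_def e.sol_dynamics[OF elim t] by (simp add: x0_def)
   qed
  qed
  moreover have "X \<in> L2_prog M F T" unfolding X_def[abs_def] by (rule L2_prog_linear[OF solL bounded_linear_fst T0])
  moreover have "(%t w. fst (La (e.sol t w) + va)) \<in> L2_prog M F T"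
   by (rule L2_prog_linear[OF L2_prog_affine[OF solL L(1) T0] bounded_linear_fst T0])
  ultimately show ?thesis
   unfolding ito_process_def eqs using e.sol_ito[OF bounded_linear_fst] by blast
 qed
 ultimately have "mf_state K M F0 W W0 T \<xi> u X Y" by (simp add: mf_state_def)
 moreover have "u \<in> L2_prog M F T"
  unfolding u_def[abs_def] X_def Y_def
  by (rule L2_prog_affine[OF solL _ T0, where L = "%z. Th *v (fst z - snd z) + Tm *v snd z"])
   (intro bounded_linear_add bounded_linear_mult bounded_linear_sub bounded_linear_fst bounded_linear_snd)
 moreover have "dev (X t w) (Y t w) (u t w) = 0" for t w by (simp add: dev_def u_def)
 ultimately show ?thesis using that by blast
qed

text \<open>\<open>ergodic_optimal_pair\<close> prescribes the control only for nonnegative times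
  and points of the space. Admissibility is derived from the processes \<open>X\<close> and
  \<open>Y\<close>, the latter being progressive even for the smaller filtration.\<close>

lemma feedback_L2_prog:
 assumes T: "0 < T" and \<xi>: "sq_int M \<xi>" and m: "mf_state K M F0 W W0 T \<xi> u X Y"
  and u: "!!t w. 0 <= t ==> w \<in> space M ==> u t w = Th *v (X t w - Y t w) + Tm *v Y t w + th"
 shows "u \<in> L2_prog M F T"
proof -
 obtain I I0 C where s: "cm_sys M F0 W W0 T X (%t w. cA K *v X t w + cAb K *v Y t w + cB K *v u t w + cb K)
    (%t w. cC K *v X t w + cCb K *v Y t w + cD K *v u t w + csig K)
    (%t w. cG K *v X t w + cGb K *v Y t w + cgam K) I I0 Y (%t w. hG K *v Y t w + cgam K) C"
  using mf_state_sys[OF T \<xi> m] by blast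
 interpret s: cm_sys M F0 W W0 T X "%t w. cA K *v X t w + cAb K *v Y t w + cB K *v u t w + cb K"
  "%t w. cC K *v X t w + cCb K *v Y t w + cD K *v u t w + csig K" "%t w. cG K *v X t w + cGb K *v Y t w + cgam K" I I0 Y
  "%t w. hG K *v Y t w + cgam K" C by (rule s)
 let ?v = "%t w. Th *v (X t w - Y t w) + Tm *v Y t w + th"
 have lin: "bounded_linear (%x. N *v x)" for N :: "real^'k^'l" by (rule matrix_vector_mul_bounded_linear)
 have "l2proc M T ?v"
  by (intro l2proc_add l2proc_linear[OF _ lin] l2proc_diff s.XP s.YP l2proc_const[OF sq_int_const[OF finite_measure_axioms]] less_imp_le[OF T])
 then have "energy M {0..T} ?v < \<infinity>" by (simp add: energy_l2proc)
 moreover have "energy M {0..T} u = energy M {0..T} ?v"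
  unfolding energy_def by (intro nn_integral_cong) (auto simp: u indicator_def)
 moreover have "progressive F T u"
  unfolding progressive_def
 proof
  fix t assume t: "t \<in> {0..T}"
  let ?R = "restrict_space borel {0..t} :: real measure"
  have "progressive F T X" "progressive H T Y" using m by (auto simp: mf_state_def ito_process_def L2_prog_def cond_mean_process_def)
  then have mX: "(%x. X (fst x) (snd x)) \<in> borel_measurable (?R \<Otimes>\<^sub>M F t)" and mY: "(%x. Y (fst x) (snd x)) \<in> borel_measurable (?R \<Otimes>\<^sub>M H t)"
   using t by (auto simp: progressive_def case_prod_beta')
  have "(%x. (fst x, snd x)) \<in> measurable (?R \<Otimes>\<^sub>M F t) (?R \<Otimes>\<^sub>M H t)"
   by (intro measurable_Pair measurable_fst measurable_compose[OF measurable_snd measurable_from_subalg[OF subalgebra_F_H measurable_ident_sets]] refl)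
  from measurable_compose[OF this mY] have mY: "(%x. Y (fst x) (snd x)) \<in> borel_measurable (?R \<Otimes>\<^sub>M F t)" by simp
  have mv: "(%x. (N :: real^'n^'m) *v U x) \<in> borel_measurable G" if "U \<in> borel_measurable G" for N U and G :: "(real \<times> 'a) measure"
   using measurable_compose[OF that borel_measurable_continuous_onI[OF linear_continuous_on[OF lin]]] .
  have "(%x. ?v (fst x) (snd x)) \<in> borel_measurable (?R \<Otimes>\<^sub>M F t)"
   by (intro borel_measurable_add mv borel_measurable_diff mX mY borel_measurable_const)
  then show "(%(s, w). u s w) \<in> borel_measurable (?R \<Otimes>\<^sub>M F t)"
   by (rule measurable_cong[THEN iffD1, rotated]) (auto simp: space_pair_measure space_restrict_space u)
 qed
 ultimately show ?thesis by (simp add: L2_prog_def)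
qed

end

section \<open>Turnpike estimate and ergodic constant\<close>

theorem corollary6p4:
  fixes M F0 :: "'a measure" and W W0 :: "real \<Rightarrow> 'a \<Rightarrow> real"
    and K :: "('n::finite, 'm::finite) mf_coeffs"
    and P \<Lambda> :: "real^'n^'n" and p :: "real^'n"
  assumes "mf_basis M F0 W W0"
    and "symmetric_coeffs K"
    and "pos_def_mat (cR K)"
    and "pos_def_mat (cQ K - transpose (cS K) ** matrix_inv (cR K) ** cS K)"
    and "pos_def_mat (cQ K + cQb K - transpose (cS K) ** matrix_inv (cR K) ** cS K)"
    and "L2_stabilizable_mean M F0 W W0 (cA K + cAb K) (cG K + cGb K) (cB K)"
    and "L2_stabilizable M F0 W W0 (cA K) (cC K) (cG K) (cB K) (cD K)"
    and "stationary_solution K P \<Lambda> p"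
  shows "\<forall>\<mu>0 \<in> P4. \<forall>\<xi> \<in> L4 M F0. distr M borel \<xi> = \<mu>0 \<longrightarrow>
      (\<forall>X Y u. ergodic_optimal_pair K M F0 W W0 P \<Lambda> p \<xi> X Y u \<longrightarrow>
         (\<forall>T>0. 0 \<le> total_cost K M T X Y u - value_fn K M F0 W W0 \<xi> T) \<and>
         (\<lambda>T. total_cost K M T X Y u - value_fn K M F0 W W0 \<xi> T) \<in> O[at_top](\<lambda>_. 1)) \<and>
      ((\<lambda>T. 1 / T * value_fn K M F0 W W0 \<xi> T) \<longlongrightarrow> ergodic_const K P \<Lambda> p) at_top"
proof (intro ballI impI)
 fix \<xi> :: "'a => real^'n" assume xi: "\<xi> \<in> L4 M F0"
 interpret mean_field_basis M F0 W W0 by unfold_locales (rule assms)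
 interpret mf_problem K P \<Lambda> p M F0 W W0 by unfold_locales (rule assms)+
 have \<xi>F: "\<xi> \<in> borel_measurable F0" using xi by (simp add: L4_def)
 have \<xi>: "sq_int M \<xi>"
 proof (rule sq_intI_nn)
  show m: "\<xi> \<in> borel_measurable M" by (rule measurable_from_subalg[OF subF0 \<xi>F])
  have "(\<integral>\<^sup>+w. ennreal ((norm (\<xi> w))^2) \<partial>M) <= (\<integral>\<^sup>+w. 1 + ennreal (norm (\<xi> w) ^ 4) \<partial>M)"
  proof (rule nn_integral_mono)
   fix w
   \<comment> \<open>Compares the second moment with the fourth: expanding gives twice the square at
     most 1 plus the fourth power.\<close>
   have "0 <= ((norm (\<xi> w))^2 - 1)^2" by simp
   then have "(norm (\<xi> w))^2 <= 1 + norm (\<xi> w) ^ 4"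
    by (simp add: power2_eq_square algebra_simps power4_eq_xxxx) (smt (verit) zero_le_mult_iff)
   then have "ennreal ((norm (\<xi> w))^2) <= ennreal (1 + norm (\<xi> w) ^ 4)" by (rule ennreal_leI)
   then show "ennreal ((norm (\<xi> w))^2) <= 1 + ennreal (norm (\<xi> w) ^ 4)" by simp
  qed
  also have "\<dots> = 1 + (\<integral>\<^sup>+w. ennreal (norm (\<xi> w) ^ 4) \<partial>M)"
   using m by (subst nn_integral_add) (auto simp: emeasure_space_1)
  also have "\<dots> < \<infinity>" using xi by (auto simp: L4_def)
  finally show "(\<integral>\<^sup>+w. ennreal ((norm (\<xi> w))^2) \<partial>M) < \<infinity>" .
 qed
 let ?c = "ergodic_const K P \<Lambda> p"
 let ?S = "%T. {total_cost K M T X Y u | X Y u. u \<in> L2_prog M F T \<and> mf_state K M F0 W W0 T \<xi> u X Y}"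
 let ?U = "value_fn K M F0 W W0 \<xi>"
 obtain C where lo: "!!T u X Y. 0 < T ==> u \<in> L2_prog M F T ==> mf_state K M F0 W W0 T \<xi> u X Y ==>
   ?c * T - C <= total_cost K M T X Y u"
  and up: "!!T u X Y. 0 < T ==> u \<in> L2_prog M F T ==> mf_state K M F0 W W0 T \<xi> u X Y ==>
   (!!t w. 0 <= t ==> w \<in> space M ==> dev (X t w) (Y t w) (u t w) = 0) ==>
   total_cost K M T X Y u <= ?c * T + C * ((\<integral>w. (norm (\<xi> w))^2 \<partial>M) + 1)"
  using cost_bounds \<xi> by metis
 define D where "D = C * ((\<integral>w. (norm (\<xi> w))^2 \<partial>M) + 1)"
 have bdd: "bdd_below (?S T)" if "0 < T" for T
  by (rule bdd_belowI[of _ "?c * T - C"]) (use lo[OF that] in auto)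
 have le: "?U T <= total_cost K M T X Y u" if "0 < T" "u \<in> L2_prog M F T" "mf_state K M F0 W W0 T \<xi> u X Y" for T X Y u
  unfolding value_fn_def by (rule cInf_lower[OF _ bdd[OF that(1)]]) (use that in blast)
 \<comment> \<open>The infimum of an empty set of reals carries no information. The closed-loop pair
   on \<open>{0..T}\<close> makes the set nonempty and at the same time supplies the upper
   bound.\<close>
 have U: "?c * T - C <= ?U T" "?U T <= ?c * T + D" if T: "0 < T" for T
 proof -
  obtain u X Y where s: "u \<in> L2_prog M F T" "mf_state K M F0 W W0 T \<xi> u X Y" "!!t w. dev (X t w) (Y t w) (u t w) = 0"
   using closed_loop_exists[OF T \<xi> \<xi>F] by blast
  show "?c * T - C <= ?U T"
   unfolding value_fn_def by (rule cInf_greatest) (use s lo[OF T] in blast)+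
  show "?U T <= ?c * T + D" unfolding D_def by (rule order_trans[OF le[OF T s(1,2)] up[OF T s]])
 qed
 show "(\<forall>X Y u. ergodic_optimal_pair K M F0 W W0 P \<Lambda> p \<xi> X Y u -->
     (\<forall>T>0. 0 <= total_cost K M T X Y u - ?U T) \<and>
     (%T. total_cost K M T X Y u - ?U T) \<in> O[at_top](%_. 1)) \<and>
   ((%T. 1 / T * ?U T) \<longlongrightarrow> ?c) at_top"
 proof (intro conjI allI impI)
  fix X Y u assume e: "ergodic_optimal_pair K M F0 W W0 P \<Lambda> p \<xi> X Y u"
  have m: "mf_state K M F0 W W0 T \<xi> u X Y" if "0 < T" for T using e that by (simp add: ergodic_optimal_pair_def)
  have f: "u t w = Th *v (X t w - Y t w) + Tm *v Y t w + th" if "0 <= t" "w \<in> space M" for t w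
   using e that by (simp add: ergodic_optimal_pair_def)
  have uL: "u \<in> L2_prog M F T" if "0 < T" for T by (rule feedback_L2_prog[OF that \<xi> m[OF that] f])
  show n: "0 <= total_cost K M T X Y u - ?U T" if "0 < T" for T using le[OF that uL[OF that] m[OF that]] by simp
  \<comment> \<open>Cost and value both lie within constants of \<open>?c * T\<close>, so the linear
    growth cancels in the difference.\<close>
  have "total_cost K M T X Y u - ?U T <= C + D" if "0 < T" for T
  proof -
   have "total_cost K M T X Y u <= ?c * T + D"
    unfolding D_def by (rule up[OF that uL[OF that] m[OF that]]) (simp add: dev_def f)
   then show ?thesis using U(1)[OF that] by simp
  qed
  then show "(%T. total_cost K M T X Y u - ?U T) \<in> O[at_top](%_. 1)"
   using n by (intro bigoI[where c = "C + D"] eventually_mono[OF eventually_gt_at_top[of 0]]) auto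
 next
  have l: "((%T. ?c + k / T) \<longlongrightarrow> ?c) at_top" for k
   using tendsto_add[OF tendsto_const tendsto_divide_0[OF tendsto_const filterlim_at_top_imp_at_infinity[OF filterlim_ident]], of ?c k] by simp
  show "((%T. 1 / T * ?U T) \<longlongrightarrow> ?c) at_top"
  proof (rule tendsto_sandwich[OF _ _ l[of "- C"] l[of D]])
   have b: "?c + - C / T <= 1 / T * ?U T" "1 / T * ?U T <= ?c + D / T" if "0 < T" for T
    using divide_right_mono[OF U(1)[OF that], of T] divide_right_mono[OF U(2)[OF that], of T] that
    by (simp_all add: add_divide_distrib diff_divide_distrib)
   show "\<forall>\<^sub>F T in at_top. ?c + - C / T <= 1 / T * ?U T" "\<forall>\<^sub>F T in at_top. 1 / T * ?U T <= ?c + D / T"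
    by (rule eventually_mono[OF eventually_gt_at_top[of 0]], rule b, assumption)+
  qed
 qed
qed

end
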